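(* There is a polynomial-time randomized algorithm for the Unsplittable Flow on a Path with Bags problem (bagUFP) whose output is always feasible and has expected weight at least $\Omega\!\left(\frac{\log\log n}{\log n}\right)$ times the optimum; i.e., an expected $O\!\left(\frac{\log n}{\log\log n}\right)$-approximation, where $n$ is the number of tasks.
   Context: bagUFP: we are given a path graph with vertices $0,1,\dots,m$ and edges $e=(j,j+1)$ with positive integer capacities $u_e$, and a set $T$ of $n$ tasks; task $i$ has a weight $w_i\in\mathbb{N}^+$, a demand $d_i\in\mathbb{N}^+$, and a subpath $P_i$ between nodes $s_i<t_i$. The tasks are partitioned into bags $\mathcal{B}_1,\dots,\mathcal{B}_h$. A feasible solution is a set $T'\subseteq T$ containing at most one task from each bag such that for every edge $e$, $\sum_{i\in T':\,e\in P_i}d_i\le u_e$. The goal is to maximize $\sum_{i\in T'}w_i$. *)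

theory Defs
  imports
    "HOL-Probability.Probability"
    "HOL-Computational_Algebra.Polynomial"
    "HOL-Library.Log_Nat"
    "HOL-Library.Landau_Symbols"
begin

section \<open>Unsplittable flow on a path with bags\<close>

text \<open>
  The path has the vertices \<open>0, \<dots>, m\<close> with \<open>m = length (capacities I)\<close>, and edge \<open>e < m\<close> joins
  \<open>e\<close> and \<open>e + 1\<close>.  Tasks are identified with their positions in the task list and bags with the
  numbers below \<open>num_bags I\<close>.
\<close>

record task =
  weight :: nat
  demand :: nat
  source :: nat
  sink :: nat
  bag :: nat

record bagufp =
  capacities :: "nat list"
  tasks :: "task list"
  num_bags :: nat

definition num_edges :: "bagufp \<Rightarrow> nat" where
  "num_edges I = length (capacities I)"

definition num_tasks :: "bagufp \<Rightarrow> nat" where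
  "num_tasks I = length (tasks I)"

definition path_edges :: "task \<Rightarrow> nat set" where
  "path_edges t = {source t..<sink t}"

definition bag_tasks :: "bagufp \<Rightarrow> nat \<Rightarrow> nat set" where
  "bag_tasks I b = {i. i < num_tasks I \<and> bag (tasks I ! i) = b}"

definition valid_bagufp :: "bagufp \<Rightarrow> bool" where
  "valid_bagufp I \<longleftrightarrow>
     (\<forall>u \<in> set (capacities I). 0 < u) \<and>
     (\<forall>t \<in> set (tasks I). 0 < weight t \<and> 0 < demand t \<and>
        source t < sink t \<and> sink t \<le> num_edges I \<and> bag t < num_bags I) \<and>
     (\<forall>b < num_bags I. bag_tasks I b \<noteq> {})"

definition feasible :: "bagufp \<Rightarrow> nat set \<Rightarrow> bool" where
  "feasible I S \<longleftrightarrow>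
     S \<subseteq> {..<num_tasks I} \<and>
     (\<forall>b < num_bags I. card (S \<inter> bag_tasks I b) \<le> 1) \<and>
     (\<forall>e < num_edges I.
        (\<Sum>i \<in> {i \<in> S. e \<in> path_edges (tasks I ! i)}. demand (tasks I ! i)) \<le> capacities I ! e)"

definition total_weight :: "bagufp \<Rightarrow> nat set \<Rightarrow> nat" where
  "total_weight I S = (\<Sum>i \<in> S. weight (tasks I ! i))"

definition optimum :: "bagufp \<Rightarrow> nat" where
  "optimum I = Max (total_weight I ` {S. feasible I S})"

lemma finite_feasible: "finite {S. feasible I S}"
  by (rule finite_subset[of _ "Pow {..<num_tasks I}"]) (auto simp: feasible_def)

lemma feasible_empty: "feasible I {}"
  by (simp add: feasible_def)

lemma optimum_attained: "\<exists>S. feasible I S \<and> total_weight I S = optimum I"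
proof -
  have "optimum I \<in> total_weight I ` {S. feasible I S}"
    unfolding optimum_def using finite_feasible feasible_empty by (intro Max_in) auto
  then show ?thesis by auto
qed

lemma total_weight_le_optimum: "feasible I S \<Longrightarrow> total_weight I S \<le> optimum I"
  unfolding optimum_def using finite_feasible by (intro Max_ge) auto


section \<open>Randomized random access machines with logarithmic cost\<close>

text \<open>
  Programs are while programs over finitely many unbounded arrays of natural numbers, with
  indirect addressing and fair coin tosses.  Every operation is charged the bit lengths of all
  numbers and addresses it handles.  Under this cost measure no number can become longer than the
  time spent on producing it, so that polynomial running time coincides with polynomial time on
  (probabilistic) Turing machines, in spite of the multiplication and division instructions.
\<close>

definition bits :: "nat \<Rightarrow> nat" where
  "bits k = Suc (floorlog 2 k)"

type_synonym memory = "nat \<Rightarrow> nat \<Rightarrow> nat"  \<comment> \<open>array name, index\<close>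

datatype aexp =
    Const nat
  | Get nat aexp
  | Add aexp aexp
  | Sub aexp aexp
  | Mul aexp aexp
  | Div aexp aexp

text \<open>Subtraction is truncated at 0, and division is integer division with \<open>k div 0 = 0\<close>.\<close>

primrec aval :: "aexp \<Rightarrow> memory \<Rightarrow> nat" where
  "aval (Const k) s = k"
| "aval (Get a e) s = s a (aval e s)"
| "aval (Add e1 e2) s = aval e1 s + aval e2 s"
| "aval (Sub e1 e2) s = aval e1 s - aval e2 s"
| "aval (Mul e1 e2) s = aval e1 s * aval e2 s"
| "aval (Div e1 e2) s = aval e1 s div aval e2 s"

text \<open>The operands of an operation have already been charged as the values of subexpressions.\<close>

primrec acost :: "aexp \<Rightarrow> memory \<Rightarrow> nat" where
  "acost (Const k) s = bits k"
| "acost (Get a e) s = acost e s + bits (aval (Get a e) s)"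
| "acost (Add e1 e2) s = acost e1 s + acost e2 s + bits (aval (Add e1 e2) s)"
| "acost (Sub e1 e2) s = acost e1 s + acost e2 s + bits (aval (Sub e1 e2) s)"
| "acost (Mul e1 e2) s = acost e1 s + acost e2 s + bits (aval (Mul e1 e2) s)"
| "acost (Div e1 e2) s = acost e1 s + acost e2 s + bits (aval (Div e1 e2) s)"

lemma bits_aval_le_acost: "bits (aval e s) \<le> acost e s"
  by (cases e) auto

text \<open>
  \<open>Put a e1 e2\<close> stores the value of \<open>e2\<close> in cell \<open>e1\<close> of array \<open>a\<close>, and \<open>Flip a e\<close> stores a fair
  random bit in cell \<open>e\<close> of array \<open>a\<close>.  Conditions hold if their value is nonzero.
\<close>

datatype com =
    Skip
  | Put nat aexp aexp
  | Flip nat aexp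
  | Seq com com
  | If aexp com com
  | While aexp com

definition store :: "nat \<Rightarrow> nat \<Rightarrow> nat \<Rightarrow> memory \<Rightarrow> memory" where
  "store a i v s = s(a := (s a)(i := v))"

definition delay :: "nat \<Rightarrow> (memory \<times> nat) pmf \<Rightarrow> (memory \<times> nat) pmf" where
  "delay k D = map_pmf (\<lambda>(s, l). (s, k + l)) D"

definition chain ::
    "(memory \<times> nat) pmf \<Rightarrow> (memory \<times> nat \<Rightarrow> (memory \<times> nat) pmf) \<Rightarrow> (memory \<times> nat) pmf" where
  "chain D F = bind_pmf D (\<lambda>x. delay (snd x) (F x))"

text \<open>
  \<open>exec c s D\<close>: started in memory \<open>s\<close>, the program \<open>c\<close> terminates for every outcome of its coin
  tosses, and \<open>D\<close> is the joint distribution of the final memory and the running time.  In the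
  rules for \<open>Seq\<close> and \<open>While\<close>, \<open>F x\<close> is the distribution produced by the continuation from
  the intermediate result \<open>x\<close>.
\<close>

inductive exec :: "com \<Rightarrow> memory \<Rightarrow> (memory \<times> nat) pmf \<Rightarrow> bool" where
  exec_Skip: "exec Skip s (return_pmf (s, 1))"
| exec_Put: "exec (Put a e1 e2) s
    (return_pmf (store a (aval e1 s) (aval e2 s) s, 1 + acost e1 s + acost e2 s))"
| exec_Flip: "exec (Flip a e) s
    (map_pmf (\<lambda>r. (store a (aval e s) (of_bool r) s, 1 + acost e s)) (bernoulli_pmf (1/2)))"
| exec_Seq: "\<lbrakk>exec c1 s D; \<And>x. x \<in> set_pmf D \<Longrightarrow> exec c2 (fst x) (F x)\<rbrakk>
    \<Longrightarrow> exec (Seq c1 c2) s (chain D F)"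
| exec_IfTrue: "\<lbrakk>aval e s \<noteq> 0; exec c1 s D\<rbrakk>
    \<Longrightarrow> exec (If e c1 c2) s (delay (1 + acost e s) D)"
| exec_IfFalse: "\<lbrakk>aval e s = 0; exec c2 s D\<rbrakk>
    \<Longrightarrow> exec (If e c1 c2) s (delay (1 + acost e s) D)"
| exec_WhileFalse: "aval e s = 0
    \<Longrightarrow> exec (While e c) s (return_pmf (s, 1 + acost e s))"
| exec_WhileTrue: "\<lbrakk>aval e s \<noteq> 0; exec c s D;
      \<And>x. x \<in> set_pmf D \<Longrightarrow> exec (While e c) (fst x) (F x)\<rbrakk>
    \<Longrightarrow> exec (While e c) s (delay (1 + acost e s) (chain D F))"

inductive_cases exec_SkipE: "exec Skip s D"
inductive_cases exec_PutE: "exec (Put a e1 e2) s D"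
inductive_cases exec_FlipE: "exec (Flip a e) s D"
inductive_cases exec_SeqE: "exec (Seq c1 c2) s D"
inductive_cases exec_IfE: "exec (If e c1 c2) s D"
inductive_cases exec_WhileE: "exec (While e c) s D"

lemma chain_cong: "(\<And>x. x \<in> set_pmf D \<Longrightarrow> F x = G x) \<Longrightarrow> chain D F = chain D G"
  unfolding chain_def by (intro bind_pmf_cong) auto

lemma exec_deterministic: "exec c s D \<Longrightarrow> exec c s D' \<Longrightarrow> D = D'"
proof (induction arbitrary: D' rule: exec.induct)
  case (exec_Skip s)
  then show ?case by (elim exec_SkipE) simp
next
  case (exec_Put a e1 e2 s)
  then show ?case by (elim exec_PutE) simp
next
  case (exec_Flip a e s)
  then show ?case by (elim exec_FlipE) simp
next
  case (exec_Seq c1 s D c2 F)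
  from exec_Seq.prems show ?case
  proof (rule exec_SeqE)
    fix E G
    assume E: "D' = chain E G" "exec c1 s E"
      "\<And>x. x \<in> set_pmf E \<Longrightarrow> exec c2 (fst x) (G x)"
    have "D = E" using exec_Seq.IH(1) E(2) .
    have "chain D F = chain D G"
      by (rule chain_cong, rule exec_Seq.IH(2)) (simp_all add: E(3) \<open>D = E\<close>)
    then show ?case by (simp only: E(1) \<open>D = E\<close>)
  qed
next
  case (exec_IfTrue e s c1 D c2)
  from exec_IfTrue.prems show ?case
    by (rule exec_IfE) (use exec_IfTrue.hyps in \<open>auto dest: exec_IfTrue.IH\<close>)
next
  case (exec_IfFalse e s c2 D c1)
  from exec_IfFalse.prems show ?case
    by (rule exec_IfE) (use exec_IfFalse.hyps in \<open>auto dest: exec_IfFalse.IH\<close>)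
next
  case (exec_WhileFalse e s c)
  from exec_WhileFalse.prems show ?case
    by (rule exec_WhileE) (use exec_WhileFalse.hyps in simp_all)
next
  case (exec_WhileTrue e s c D F)
  from exec_WhileTrue.prems show ?case
  proof (rule exec_WhileE)
    fix E G
    assume E: "D' = delay (Suc (acost e s)) (chain E G)" "exec c s E"
      "\<And>x. x \<in> set_pmf E \<Longrightarrow> exec (While e c) (fst x) (G x)"
    have "D = E" using exec_WhileTrue.IH(1) E(2) .
    have "chain D F = chain D G"
      by (rule chain_cong, rule exec_WhileTrue.IH(2)) (simp_all add: E(3) \<open>D = E\<close>)
    then show ?case by (simp add: E(1) \<open>D = E\<close>)
  qed (use exec_WhileTrue.hyps in simp_all)
qed

lemma exec_finite_support: "exec c s D \<Longrightarrow> finite (set_pmf D)"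
  by (induction rule: exec.induct) (auto simp: chain_def delay_def)


section \<open>Input and output\<close>

definition input_size :: "bagufp \<Rightarrow> nat" where
  "input_size I =
     bits (num_edges I) + bits (num_tasks I) + bits (num_bags I) +
     (\<Sum>u \<leftarrow> capacities I. bits u) +
     (\<Sum>t \<leftarrow> tasks I. bits (weight t) + bits (demand t) + bits (source t) + bits (sink t) + bits (bag t))"

definition array_of :: "nat list \<Rightarrow> nat \<Rightarrow> nat" where
  "array_of xs i = (if i < length xs then xs ! i else 0)"

definition input_memory :: "bagufp \<Rightarrow> memory" where
  "input_memory I = (\<lambda>_ _. 0)
     (0 := array_of [num_edges I, num_tasks I, num_bags I],
      1 := array_of (capacities I),
      2 := array_of (map weight (tasks I)),
      3 := array_of (map demand (tasks I)),
      4 := array_of (map source (tasks I)),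
      5 := array_of (map sink (tasks I)),
      6 := array_of (map bag (tasks I)))"

text \<open>The selected tasks are read off array 7 as a characteristic vector.\<close>

definition output_set :: "bagufp \<Rightarrow> memory \<Rightarrow> nat set" where
  "output_set I s = {i. i < num_tasks I \<and> s 7 i \<noteq> 0}"

definition poly_time_on_bagufp :: "com \<Rightarrow> bool" where
  "poly_time_on_bagufp c \<longleftrightarrow>
     (\<exists>p :: nat poly. \<forall>I. valid_bagufp I \<longrightarrow>
        (\<exists>D. exec c (input_memory I) D \<and> (\<forall>(s, k) \<in> set_pmf D. k \<le> poly p (input_size I))))"

definition output_dist :: "com \<Rightarrow> bagufp \<Rightarrow> nat set pmf" where
  "output_dist c I = map_pmf (\<lambda>(s, k). output_set I s) (THE D. exec c (input_memory I) D)"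

lemma output_dist_eq:
  "exec c (input_memory I) D \<Longrightarrow> output_dist c I = map_pmf (\<lambda>(s, k). output_set I s) D"
  unfolding output_dist_def by (subst the_equality[of _ D]) (auto intro: exec_deterministic)

definition expected_weight :: "com \<Rightarrow> bagufp \<Rightarrow> real" where
  "expected_weight c I =
     measure_pmf.expectation (output_dist c I) (\<lambda>S. real (total_weight I S))"

end

theory Submission
  imports Defs "HOL-Real_Asymp.Real_Asymp"
begin

text \<open>
  The algorithm is deterministic.  Call a task small if its demand is at most a quarter of the largest
  power of two below its bottleneck capacity.  Small tasks whose bottlenecks agree up to a factor of two
  may be treated as living on their own path of uniform capacity, since the capacities of these paths
  sum up geometrically; the bags then tie together several uniform instances, for which the local ratio
  technique gives a constant factor.

  A large task is drawn as the rectangle over its path that hangs down from its bottleneck capacity.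
  Disjoint rectangles are feasible together, and every feasible set of large tasks splits into 47 sets of
  disjoint rectangles.  Multiplicative weights yield a fractional packing of the rectangles that respects
  all points and all bags up to a constant factor.  Sampling it, and dropping every sampled rectangle for
  which another one lies in the same bag or contains one of its two lower corners, costs another constant
  factor.  The remaining intersections are crossings, which form a partial order whose chains share a
  point.  The sampled depth of every point is O(log n / log log n), so the survivors fall into that many
  layers of disjoint rectangles.  Sampling is derandomized by the method of conditional expectations: the
  potential is affine in every single probability.
\<close>

section \<open>Total correctness with step bounds for deterministic programs\<close>

text \<open>Origin of log n / log log n: a constraint with k sampled tasks is penalised by
  \<open>base ^ k\<close> with \<open>base = lg + 2\<close>, and the final potential leaves room
  only for penalties below \<open>threshold\<close>, a polynomial in n;
  \<open>base ^ k < threshold\<close> forces k = O(log n / log log n). The probabilities make this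
  affordable: the weights phase ends with every constraint used fewer than \<open>depth\<close> =
  O(log n) times, yet with total weight at least \<open>lg + 1\<close> times the best packing, so
  dividing by \<open>denom = 6 * depth\<close> leaves expected usage below 1/6 and a constant
  fraction of the weight. The final factor is 36 + 47 * 120 * K for K layers: 36 from local ratio,
  47 colour classes, 120 from rounding. The machine shapes the rest: it knows only naturals and
  charges bit lengths. Hence weights are scaled by \<open>2 * n\<close> in local ratio,
  probabilities by \<open>denom\<close>, expectations by its powers; differences are compared by
  moving terms across; sorting is replaced by a scan of all possible sort keys; and every stored
  number is shown to have O(size^2) bits.\<close>

definition run :: "com \<Rightarrow> memory \<Rightarrow> memory \<Rightarrow> nat \<Rightarrow> bool" where
  "run c s s' k \<longleftrightarrow> exec c s (return_pmf (s', k))"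

lemma delay_return: "delay k (return_pmf (s, l)) = return_pmf (s, k + l)"
  by (simp add: delay_def)

lemma chain_return: "chain (return_pmf (s, k)) (\<lambda>_. return_pmf (s', l)) = return_pmf (s', k + l)"
  by (simp add: chain_def delay_return bind_return_pmf)

lemma run_Put: "run (Put a e1 e2) s (store a (aval e1 s) (aval e2 s) s) (1 + acost e1 s + acost e2 s)"
  unfolding run_def by (rule exec_Put)

lemma run_Seq: "run c1 s s1 k1 \<Longrightarrow> run c2 s1 s2 k2 \<Longrightarrow> run (Seq c1 c2) s s2 (k1 + k2)"
  unfolding run_def
  using exec_Seq[of c1 s "return_pmf (s1, k1)" c2 "\<lambda>_. return_pmf (s2, k2)"]
  by (simp add: chain_return)

lemma run_If:
  "run (if aval e s \<noteq> 0 then c1 else c2) s s' k \<Longrightarrow> run (If e c1 c2) s s' (1 + acost e s + k)"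
  unfolding run_def
  using exec_IfTrue[of e s c1 "return_pmf (s', k)" c2] exec_IfFalse[of e s c2 "return_pmf (s', k)" c1]
  by (auto simp: delay_return split: if_splits)

lemma run_WhileFalse: "aval e s = 0 \<Longrightarrow> run (While e c) s s (1 + acost e s)"
  unfolding run_def by (rule exec_WhileFalse)

lemma run_WhileTrue:
  assumes "aval e s \<noteq> 0" "run c s s1 k1" "run (While e c) s1 s2 k2"
  shows "run (While e c) s s2 (1 + acost e s + (k1 + k2))"
  using exec_WhileTrue[of e s c "return_pmf (s1, k1)" "\<lambda>_. return_pmf (s2, k2)"] assms
  unfolding run_def by (simp add: delay_return chain_return)

text \<open>
  Constants are charged in unary: an expression of size \<open>k\<close> over cells below \<open>2 ^ v\<close> then has a
  value below \<open>2 ^ (v * k)\<close>.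
\<close>

primrec esize :: "aexp \<Rightarrow> nat" where
  "esize (Const k) = Suc k"
| "esize (Get a e) = Suc (esize e)"
| "esize (Add e1 e2) = Suc (esize e1 + esize e2)"
| "esize (Sub e1 e2) = Suc (esize e1 + esize e2)"
| "esize (Mul e1 e2) = Suc (esize e1 + esize e2)"
| "esize (Div e1 e2) = Suc (esize e1 + esize e2)"

definition bounded_memory :: "nat \<Rightarrow> memory \<Rightarrow> bool" where
  "bounded_memory v s \<longleftrightarrow> (\<forall>a i. s a i \<le> 2 ^ v)"

lemma bits_mono: "k \<le> l \<Longrightarrow> bits k \<le> bits l"
  by (simp add: bits_def floorlog_mono)

lemma bits_power2: "bits (2 ^ k) = k + 2"
proof -
  have "floorlog 2 (2 ^ k) = Suc k"
    unfolding floorlog_def by (simp add: log_nat_power)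
  then show ?thesis by (simp add: bits_def)
qed

lemma less_power2_bits: "k < 2 ^ bits k"
proof -
  have "k < 2 ^ floorlog 2 k"
    using floorlog_bounds[of k 2] by (cases "k = 0") auto
  also have "\<dots> \<le> 2 ^ bits k" by (simp add: bits_def)
  finally show ?thesis .
qed

text \<open>Multiplication adds exponents, and a sum at most doubles a common bound of its operands;
  the \<open>Suc\<close> in \<open>esize\<close> pays for this extra bit because
  \<open>v \<ge> 1\<close>. Subtraction and division only shrink.\<close>

lemma aval_le:
  assumes "bounded_memory v s" "v \<ge> 1"
  shows "aval e s \<le> 2 ^ (v * esize e)"
proof (induction e)
  case (Const k)
  have "k \<le> 2 ^ k" by (simp add: less_imp_le)
  also have "(2::nat) ^ k \<le> 2 ^ (v * Suc k)"
    using assms(2) by (intro power_increasing) (cases v, auto)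
  finally show ?case by simp
next
  case (Get a e)
  have "s a (aval e s) \<le> 2 ^ v" using assms(1) by (simp add: bounded_memory_def)
  also have "(2::nat) ^ v \<le> 2 ^ (v * Suc (esize e))" by (intro power_increasing) auto
  finally show ?case by simp
next
  case (Add e1 e2)
  have "aval e1 s + aval e2 s \<le> 2 ^ (v * (esize e1 + esize e2)) + 2 ^ (v * (esize e1 + esize e2))"
    by (intro add_mono order.trans[OF Add.IH(1)] order.trans[OF Add.IH(2)] power_increasing) auto
  also have "\<dots> \<le> 2 ^ (Suc (v * (esize e1 + esize e2)))" by simp
  also have "\<dots> \<le> 2 ^ (v * esize (Add e1 e2))"
    using assms(2) by (intro power_increasing) (auto simp: algebra_simps)
  finally show ?case by simp
next
  case (Sub e1 e2)
  have "aval e1 s - aval e2 s \<le> aval e1 s" by simp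
  also have "\<dots> \<le> 2 ^ (v * esize (Sub e1 e2))"
    by (intro order.trans[OF Sub.IH(1)] power_increasing) (auto simp: algebra_simps)
  finally show ?case by simp
next
  case (Mul e1 e2)
  have "aval e1 s * aval e2 s \<le> 2 ^ (v * esize e1) * 2 ^ (v * esize e2)"
    using Mul.IH by (intro mult_mono) auto
  also have "\<dots> = 2 ^ (v * esize e1 + v * esize e2)" by (simp add: power_add)
  also have "\<dots> \<le> 2 ^ (v * esize (Mul e1 e2))"
    by (intro power_increasing) (auto simp: algebra_simps)
  finally show ?case by simp
next
  case (Div e1 e2)
  have "aval e1 s div aval e2 s \<le> aval e1 s" by (rule div_le_dividend)
  also have "\<dots> \<le> 2 ^ (v * esize (Div e1 e2))"
    by (intro order.trans[OF Div.IH(1)] power_increasing) (auto simp: algebra_simps)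
  finally show ?case by simp
qed

lemma bits_aval_le:
  assumes "bounded_memory v s" "v \<ge> 1" "esize e \<le> k"
  shows "bits (aval e s) \<le> v * k + 2"
proof -
  have "bits (aval e s) \<le> bits (2 ^ (v * esize e))"
    by (rule bits_mono, rule aval_le[OF assms(1,2)])
  also have "\<dots> \<le> v * k + 2" using assms(3) by (simp add: bits_power2)
  finally show ?thesis .
qed

lemma acost_le:
  assumes "bounded_memory v s" "v \<ge> 1" "esize e \<le> k"
  shows "acost e s \<le> esize e * (v * k + 2)"
  using assms(3)
proof (induction e)
  case (Const x)
  then show ?case using bits_aval_le[OF assms(1,2) Const] by simp
next
  case (Get a e)
  then show ?case using bits_aval_le[OF assms(1,2) Get.prems] by simp
next
  case (Add e1 e2)
  then show ?case using bits_aval_le[OF assms(1,2) Add.prems] by (simp add: add_mult_distrib)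
next
  case (Sub e1 e2)
  then show ?case using bits_aval_le[OF assms(1,2) Sub.prems] by (simp add: add_mult_distrib)
next
  case (Mul e1 e2)
  then show ?case using bits_aval_le[OF assms(1,2) Mul.prems] by (simp add: add_mult_distrib)
next
  case (Div e1 e2)
  then show ?case using bits_aval_le[OF assms(1,2) Div.prems] by (simp add: add_mult_distrib)
qed

text \<open>A generous bound on the size of every expression of the program. The largest sizes stem
  from the constant 1024 in \<open>ThresholdE\<close>, which is counted in unary.\<close>

definition max_esize :: nat where
  "max_esize = 5000"

text \<open>The factor 2 stands for the two expressions that a \<open>Put\<close> evaluates; a test
  evaluates only one.\<close>

definition step_cost :: "nat \<Rightarrow> nat" where
  "step_cost v = 1 + 2 * (max_esize * (v * max_esize + 2))"

lemma acost_le_step_cost: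
  assumes "bounded_memory v s" "v \<ge> 1" "esize e \<le> max_esize"
  shows "acost e s \<le> max_esize * (v * max_esize + 2)"
  using acost_le[OF assms] mult_le_mono1[OF assms(3), of "v * max_esize + 2"] by linarith

text \<open>
  \<open>wp v c s T Q\<close>: from a memory \<open>s\<close> with cells bounded by \<open>2 ^ v\<close>, the program \<open>c\<close> deterministically
  reaches a memory satisfying \<open>Q\<close> and the same bound, with at most \<open>T\<close> assignments and tests.
\<close>

definition wp :: "nat \<Rightarrow> com \<Rightarrow> memory \<Rightarrow> nat \<Rightarrow> (memory \<Rightarrow> bool) \<Rightarrow> bool" where
  "wp v c s T Q \<longleftrightarrow> (v \<ge> 1 \<and> bounded_memory v s \<longrightarrow>
     (\<exists>s' k. run c s s' k \<and> k \<le> T * step_cost v \<and> bounded_memory v s' \<and> Q s'))"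

lemma wp_mono: "wp v c s T P \<Longrightarrow> T \<le> T' \<Longrightarrow> (\<And>s'. P s' \<Longrightarrow> Q s') \<Longrightarrow> wp v c s T' Q"
  unfolding wp_def by (meson mult_le_mono1 order.trans)

lemma store_same: "store a i x s a j = (if j = i then x else s a j)"
  by (simp add: store_def)

lemma store_other: "b \<noteq> a \<Longrightarrow> store a i x s b = s b"
  by (simp add: store_def)

lemma store_apply: "store a i x s b j = (if b = a \<and> j = i then x else s b j)"
  by (simp add: store_def)

text \<open>Only the stored value has to fit into \<open>2 ^ v\<close>. Intermediate values may be
  longer, since their cost is controlled by the size of the expression alone.\<close>

lemma wp_Put:
  assumes "esize e1 \<le> max_esize" "esize e2 \<le> max_esize" "aval e2 s \<le> 2 ^ v"
    "Q (store a (aval e1 s) (aval e2 s) s)"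
  shows "wp v (Put a e1 e2) s 1 Q"
  unfolding wp_def
proof (intro impI exI conjI)
  assume b: "v \<ge> 1 \<and> bounded_memory v s"
  show "run (Put a e1 e2) s (store a (aval e1 s) (aval e2 s) s) (1 + acost e1 s + acost e2 s)"
    by (rule run_Put)
  show "1 + acost e1 s + acost e2 s \<le> 1 * step_cost v"
    using acost_le_step_cost[of v s e1] acost_le_step_cost[of v s e2] b assms(1,2)
    by (simp add: step_cost_def)
  show "bounded_memory v (store a (aval e1 s) (aval e2 s) s)"
    using b assms(3) by (auto simp: bounded_memory_def store_apply)
qed (rule assms(4))

lemma wp_Seq:
  assumes "wp v c1 s T1 P" "\<And>s'. P s' \<Longrightarrow> wp v c2 s' T2 Q"
  shows "wp v (Seq c1 c2) s (T1 + T2) Q"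
  unfolding wp_def
proof
  assume b: "v \<ge> 1 \<and> bounded_memory v s"
  then obtain s1 k1 where 1: "run c1 s s1 k1" "k1 \<le> T1 * step_cost v" "bounded_memory v s1" "P s1"
    using assms(1) by (auto simp: wp_def)
  then obtain s2 k2 where 2: "run c2 s1 s2 k2" "k2 \<le> T2 * step_cost v" "bounded_memory v s2" "Q s2"
    using assms(2)[of s1] b by (auto simp: wp_def)
  show "\<exists>s' k. run (Seq c1 c2) s s' k \<and> k \<le> (T1 + T2) * step_cost v \<and> bounded_memory v s' \<and> Q s'"
    using run_Seq[OF 1(1) 2(1)] 1(2) 2 by (intro exI[of _ s2] exI[of _ "k1 + k2"])
      (simp add: add_mult_distrib)
qed

lemma wp_If:
  assumes "esize e \<le> max_esize"
    "aval e s \<noteq> 0 \<Longrightarrow> wp v c1 s T Q" "aval e s = 0 \<Longrightarrow> wp v c2 s T Q"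
  shows "wp v (If e c1 c2) s (T + 1) Q"
  unfolding wp_def
proof
  assume b: "v \<ge> 1 \<and> bounded_memory v s"
  have "wp v (if aval e s \<noteq> 0 then c1 else c2) s T Q"
    using assms(2,3) by auto
  then obtain s1 k1 where 1: "run (if aval e s \<noteq> 0 then c1 else c2) s s1 k1"
    "k1 \<le> T * step_cost v" "bounded_memory v s1" "Q s1"
    using b by (auto simp: wp_def)
  have "1 + acost e s \<le> step_cost v"
    using acost_le_step_cost[of v s e] b assms(1) by (simp add: step_cost_def)
  then show "\<exists>s' k. run (If e c1 c2) s s' k \<and> k \<le> (T + 1) * step_cost v \<and> bounded_memory v s' \<and> Q s'"
    using run_If[OF 1(1)] 1 by (intro exI[of _ s1] exI[of _ "1 + acost e s + k1"]) simp
qed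

lemma wp_Skip: "Q s \<Longrightarrow> wp v Skip s 1 Q"
  unfolding wp_def run_def
  by (intro impI exI[of _ s] exI[of _ 1] conjI exec_Skip) (auto simp: step_cost_def)

text \<open>Well-founded induction on the variant: every round costs its body and one test, and the
  final \<open>+ 1\<close> is the failing test.\<close>

lemma wp_While:
  fixes measure :: "memory \<Rightarrow> nat"
  assumes "esize e \<le> max_esize" "I s"
    "\<And>s'. I s' \<Longrightarrow> aval e s' \<noteq> 0 \<Longrightarrow> wp v c s' T (\<lambda>s''. I s'' \<and> measure s'' < measure s')"
    "\<And>s'. I s' \<Longrightarrow> aval e s' = 0 \<Longrightarrow> Q s'"
  shows "wp v (While e c) s (measure s * (T + 1) + 1) Q"
  using assms(2)
proof (induction "measure s" arbitrary: s rule: less_induct)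
  case less
  show ?case unfolding wp_def
  proof
    assume b: "v \<ge> 1 \<and> bounded_memory v s"
    have c: "1 + acost e s \<le> step_cost v"
      using acost_le_step_cost[of v s e] b assms(1) by (simp add: step_cost_def)
    show "\<exists>s' k. run (While e c) s s' k \<and> k \<le> (measure s * (T + 1) + 1) * step_cost v \<and>
      bounded_memory v s' \<and> Q s'"
    proof (cases "aval e s = 0")
      case True
      then show ?thesis
        using run_WhileFalse[OF True] b c assms(4) less.prems
        by (intro exI[of _ s] exI[of _ "1 + acost e s"]) auto
    next
      case False
      then obtain s1 k1 where 1: "run c s s1 k1" "k1 \<le> T * step_cost v" "bounded_memory v s1"
        "I s1" "measure s1 < measure s"
        using assms(3)[OF less.prems] b by (auto simp: wp_def)
      then obtain s2 k2 where 2: "run (While e c) s1 s2 k2"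
        "k2 \<le> (measure s1 * (T + 1) + 1) * step_cost v" "bounded_memory v s2" "Q s2"
        using less.hyps[of s1] b by (auto simp: wp_def)
      have "Suc (measure s1) * (T + 1) \<le> measure s * (T + 1)"
        using 1(5) by (intro mult_le_mono1) auto
      then have "(measure s1 * (T + 1) + (T + 1) + 1) * step_cost v
        \<le> (measure s * (T + 1) + 1) * step_cost v"
        by (intro mult_le_mono1) simp
      then have "1 + acost e s + (k1 + k2) \<le> (measure s * (T + 1) + 1) * step_cost v"
        using c 1(2) 2(2) by (simp add: add_mult_distrib)
      then show ?thesis using run_WhileTrue[OF False 1(1) 2(1)] 2 by blast
    qed
  qed
qed

section \<open>Counting loops and accumulations\<close>

abbreviation Var :: "nat \<Rightarrow> aexp" where
  "Var a \<equiv> Get a (Const 0)"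

definition For :: "nat \<Rightarrow> aexp \<Rightarrow> com \<Rightarrow> com" where
  "For x e c = Seq (Put x (Const 0) (Const 0))
     (While (Sub e (Var x)) (Seq c (Put x (Const 0) (Add (Var x) (Const 1)))))"

text \<open>The invariant is indexed by the number of finished rounds and must survive any
  overwriting of the counter cell (\<open>indep\<close>), so that initialising and incrementing the
  counter never disturb it. Each round adds a test and an increment to \<open>T\<close>.\<close>

lemma wp_For:
  assumes sz: "esize e + 3 \<le> max_esize" and N: "N \<le> 2 ^ v"
    and I0: "I 0 s"
    and indep: "\<And>k s' z. I k s' \<Longrightarrow> I k (store x 0 z s')"
    and e: "\<And>k s'. I k s' \<Longrightarrow> aval e s' = N"
    and body: "\<And>k s'. k < N \<Longrightarrow> I k s' \<Longrightarrow> s' x 0 = k \<Longrightarrow>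
      wp v c s' T (\<lambda>s''. I (Suc k) s'' \<and> s'' x 0 = k)"
  shows "wp v (For x e c) s (N * (T + 2) + 2) (I N)"
proof -
  let ?m = "\<lambda>s'. N - s' x 0"
  let ?J = "\<lambda>s'. s' x 0 \<le> N \<and> I (s' x 0) s'"
  have ms: "5 \<le> max_esize" by (simp add: max_esize_def)
  have "wp v (For x e c) s (1 + (N * (T + 1 + 1) + 1)) (I N)"
    unfolding For_def
  proof (rule wp_Seq[where P = "\<lambda>s'. ?J s' \<and> s' x 0 = 0"])
    show "wp v (Put x (Const 0) (Const 0)) s 1 (\<lambda>s'. ?J s' \<and> s' x 0 = 0)"
      by (rule wp_Put) (use ms indep[OF I0] in \<open>auto simp: store_apply\<close>)
    fix s' assume s': "?J s' \<and> s' x 0 = 0"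
    have "wp v (While (Sub e (Var x)) (Seq c (Put x (Const 0) (Add (Var x) (Const 1))))) s'
        (?m s' * (T + 1 + 1) + 1) (I N)"
    proof (rule wp_While[where I = ?J])
      show "?J s'" using s' by auto
      show "esize (Sub e (Var x)) \<le> max_esize" using sz by simp
    next
      fix s1 assume s1: "?J s1" "aval (Sub e (Var x)) s1 \<noteq> 0"
      then have lt: "s1 x 0 < N" using e by fastforce
      show "wp v (Seq c (Put x (Const 0) (Add (Var x) (Const 1)))) s1 (T + 1)
        (\<lambda>s''. ?J s'' \<and> ?m s'' < ?m s1)"
      proof (rule wp_Seq)
        show "wp v c s1 T (\<lambda>s''. I (Suc (s1 x 0)) s'' \<and> s'' x 0 = s1 x 0)"
          using body lt s1(1) by blast
        fix s2 assume s2: "I (Suc (s1 x 0)) s2 \<and> s2 x 0 = s1 x 0"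
        show "wp v (Put x (Const 0) (Add (Var x) (Const 1))) s2 1 (\<lambda>s''. ?J s'' \<and> ?m s'' < ?m s1)"
          by (rule wp_Put) (use ms lt N s2 indep[of "Suc (s1 x 0)" s2] in \<open>auto simp: store_apply\<close>)
      qed
    next
      fix s1 assume s1: "?J s1" "aval (Sub e (Var x)) s1 = 0"
      then have "s1 x 0 = N" using e by fastforce
      then show "I N s1" using s1 by auto
    qed
    then show "wp v (While (Sub e (Var x)) (Seq c (Put x (Const 0) (Add (Var x) (Const 1))))) s'
        (N * (T + 1 + 1) + 1) (I N)"
      using s' by simp
  qed
  then show ?thesis by simp
qed

definition agree :: "nat set \<Rightarrow> memory \<Rightarrow> memory \<Rightarrow> bool" where
  "agree A s s' \<longleftrightarrow> (\<forall>a. a \<notin> A \<longrightarrow> s' a = s a)"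

lemma agreeD: "agree A s s' \<Longrightarrow> a \<notin> A \<Longrightarrow> s' a = s a"
  by (simp add: agree_def)

lemma agree_refl: "agree A s s"
  by (simp add: agree_def)

lemma agree_trans: "agree A s s' \<Longrightarrow> agree B s' s'' \<Longrightarrow> A \<subseteq> C \<Longrightarrow> B \<subseteq> C \<Longrightarrow> agree C s s''"
  unfolding agree_def by (metis subsetD)

lemma agree_store: "agree A s s' \<Longrightarrow> a \<in> A \<Longrightarrow> agree A s (store a i x s')"
  by (auto simp: agree_def store_def)

definition Fold :: "nat \<Rightarrow> nat \<Rightarrow> aexp \<Rightarrow> aexp \<Rightarrow> aexp \<Rightarrow> com" where
  "Fold r x e e0 step = Seq (Put r (Const 0) e0) (For x e (Put r (Const 0) step))"

text \<open>\<open>F k\<close> is the accumulator after k rounds. Bounding all partial results, and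
  not only the last one, is what keeps the memory bounded throughout.\<close>

lemma wp_Fold:
  assumes sz: "esize e + 3 \<le> max_esize" "esize e0 \<le> max_esize" "esize step \<le> max_esize"
    and rx: "r \<noteq> x" and N: "N \<le> 2 ^ v"
    and e: "\<And>s'. agree {r, x} s s' \<Longrightarrow> aval e s' = N"
    and F0: "aval e0 s = F 0"
    and FS: "\<And>k s'. k < N \<Longrightarrow> agree {r, x} s s' \<Longrightarrow> s' x 0 = k \<Longrightarrow> s' r 0 = F k \<Longrightarrow>
      aval step s' = F (Suc k)"
    and F: "\<And>k. k \<le> N \<Longrightarrow> F k \<le> 2 ^ v"
  shows "wp v (Fold r x e e0 step) s (3 * N + 3) (\<lambda>s'. s' r 0 = F N \<and> agree {r, x} s s')"
proof -
  have ms: "5 \<le> max_esize" by (simp add: max_esize_def)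
  let ?I = "\<lambda>k s'. s' r 0 = F k \<and> agree {r, x} s s'"
  have "wp v (Fold r x e e0 step) s (1 + (N * (1 + 2) + 2)) (?I N)"
    unfolding Fold_def
  proof (rule wp_Seq)
    show "wp v (Put r (Const 0) e0) s 1 (?I 0)"
      by (rule wp_Put) (use ms sz F[of 0] F0 in \<open>auto simp: store_same store_other intro: agree_store agree_refl\<close>)
    fix s1 assume s1: "?I 0 s1"
    show "wp v (For x e (Put r (Const 0) step)) s1 (N * (1 + 2) + 2) (?I N)"
    proof (rule wp_For)
      fix k s2 assume a: "k < N" "?I k s2" "s2 x 0 = k"
      have st: "aval step s2 = F (Suc k)" using FS[of k s2] a by blast
      show "wp v (Put r (Const 0) step) s2 1 (\<lambda>s''. ?I (Suc k) s'' \<and> s'' x 0 = k)"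
        by (rule wp_Put) (use ms sz F[of "Suc k"] st a rx in \<open>auto simp: store_same store_other intro: agree_store\<close>)
    qed (use sz N e s1 rx in \<open>auto simp: store_same store_other intro: agree_store\<close>)
  qed
  then show ?thesis by (rule wp_mono) auto
qed

section \<open>Tasks of small relative demand\<close>

locale bagufp_instance =
  fixes I :: bagufp
  assumes valid: "valid_bagufp I"
begin

abbreviation n :: nat where "n \<equiv> num_tasks I"
abbreviation m :: nat where "m \<equiv> num_edges I"
definition cap :: "nat \<Rightarrow> nat" where "cap e = capacities I ! e"
definition wt :: "nat \<Rightarrow> nat" where "wt i = weight (tasks I ! i)"
definition dem :: "nat \<Rightarrow> nat" where "dem i = demand (tasks I ! i)"
definition src :: "nat \<Rightarrow> nat" where "src i = source (tasks I ! i)"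
definition snk :: "nat \<Rightarrow> nat" where "snk i = sink (tasks I ! i)"
definition bg :: "nat \<Rightarrow> nat" where "bg i = bag (tasks I ! i)"

lemmas task_defs = wt_def dem_def src_def snk_def bg_def

definition bottleneck :: "nat \<Rightarrow> nat" where
  "bottleneck i = Min (cap ` {src i..<snk i})"

definition level :: "nat \<Rightarrow> nat" where
  "level i = floorlog 2 (bottleneck i) - 1"

definition scale :: "nat \<Rightarrow> nat" where
  "scale i = 2 ^ level i"

lemma task_valid:
  assumes "i < n"
  shows "0 < wt i" "0 < dem i" "src i < snk i" "snk i \<le> m" "bg i < num_bags I"
  using valid assms nth_mem[of i "tasks I"]
  by (auto simp: valid_bagufp_def num_tasks_def task_defs)

lemma cap_pos: "e < m \<Longrightarrow> 0 < cap e"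
  using valid nth_mem[of e "capacities I"]
  by (auto simp: valid_bagufp_def num_edges_def cap_def)

lemma bottleneck_le: "src i \<le> e \<Longrightarrow> e < snk i \<Longrightarrow> bottleneck i \<le> cap e"
  by (auto simp: bottleneck_def)

lemma bottleneck_attained:
  assumes "i < n"
  obtains e where "src i \<le> e" "e < snk i" "cap e = bottleneck i"
proof -
  have "bottleneck i \<in> cap ` {src i..<snk i}"
    unfolding bottleneck_def using task_valid[OF assms] by (intro Min_in) auto
  with that show ?thesis by auto
qed

lemma bottleneck_eqI:
  assumes "i < n" "src i \<le> e" "e < snk i" "\<And>e'. src i \<le> e' \<Longrightarrow> e' < snk i \<Longrightarrow> cap e \<le> cap e'"
  shows "bottleneck i = cap e"
proof (rule antisym)
  show "bottleneck i \<le> cap e" using bottleneck_le assms by blast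
  show "cap e \<le> bottleneck i" using bottleneck_attained[OF assms(1)] assms(4) by metis
qed

lemma bottleneck_pos: "i < n \<Longrightarrow> 0 < bottleneck i"
  using bottleneck_attained[of i] cap_pos task_valid(4)[of i]
  by (metis order_less_le_trans)

lemma scale_bounds:
  assumes "i < n"
  shows "scale i \<le> bottleneck i" "bottleneck i < 2 * scale i" "0 < scale i"
proof -
  have "2 ^ (floorlog 2 (bottleneck i) - 1) \<le> bottleneck i \<and>
    bottleneck i < 2 ^ floorlog 2 (bottleneck i)"
    using floorlog_bounds[of "bottleneck i" 2] bottleneck_pos[OF assms] by auto
  moreover have "floorlog 2 (bottleneck i) > 0"
    using bottleneck_pos[OF assms] by (simp add: floorlog_def)
  ultimately show "scale i \<le> bottleneck i" "bottleneck i < 2 * scale i"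
    by (auto simp: scale_def level_def simp flip: power_Suc)
qed (simp add: scale_def)

lemma scale_eqI:
  assumes "i < n" "2 ^ k \<le> bottleneck i" "bottleneck i < 2 * 2 ^ k"
  shows "scale i = 2 ^ k"
proof -
  have "(2::nat) ^ k < 2 ^ Suc (level i)" "(2::nat) ^ level i < 2 ^ Suc k"
    using scale_bounds[OF assms(1)] assms by (auto simp: scale_def)
  then have "k < Suc (level i)" "level i < Suc k"
    by (auto intro: power_less_imp_less_exp[of "2::nat", rotated] simp del: power_Suc)
  then show ?thesis by (simp add: scale_def)
qed

definition bneck_edge :: "nat \<Rightarrow> nat" where
  "bneck_edge i = (SOME e. src i \<le> e \<and> e < snk i \<and> cap e = bottleneck i)"

lemma bneck_edge:
  assumes "i < n"
  shows "src i \<le> bneck_edge i" "bneck_edge i < snk i" "cap (bneck_edge i) = bottleneck i"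
    "bneck_edge i < m"
proof -
  have "\<exists>e. src i \<le> e \<and> e < snk i \<and> cap e = bottleneck i"
    using bottleneck_attained[OF assms] by blast
  from someI_ex[OF this]
  show "src i \<le> bneck_edge i" "bneck_edge i < snk i" "cap (bneck_edge i) = bottleneck i"
    by (auto simp: bneck_edge_def)
  then show "bneck_edge i < m" using task_valid(4)[OF assms] by linarith
qed

lemma feasible_iff:
  "feasible I S \<longleftrightarrow> S \<subseteq> {..<n} \<and> inj_on bg S \<and>
     (\<forall>e < m. (\<Sum>i \<in> {i \<in> S. src i \<le> e \<and> e < snk i}. dem i) \<le> cap e)"
proof -
  have "(\<forall>b < num_bags I. card (S \<inter> bag_tasks I b) \<le> 1) \<longleftrightarrow> inj_on bg S" if S: "S \<subseteq> {..<n}"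
  proof
    assume *: "\<forall>b < num_bags I. card (S \<inter> bag_tasks I b) \<le> 1"
    show "inj_on bg S"
    proof (rule inj_onI)
      fix i j assume ij: "i \<in> S" "j \<in> S" "bg i = bg j"
      then have "i < n" "j < n" using S by auto
      then have "{i, j} \<subseteq> S \<inter> bag_tasks I (bg i)"
        using ij by (auto simp: bag_tasks_def bg_def)
      moreover have "finite (S \<inter> bag_tasks I (bg i))"
        using S finite_subset by blast
      ultimately have "card {i, j} \<le> card (S \<inter> bag_tasks I (bg i))"
        by (rule card_mono[rotated])
      also have "\<dots> \<le> 1" using * task_valid(5)[OF \<open>i < n\<close>] by auto
      finally show "i = j" by (cases "i = j") auto
    qed
  next
    assume *: "inj_on bg S"
    show "\<forall>b < num_bags I. card (S \<inter> bag_tasks I b) \<le> 1"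
    proof (intro allI impI)
      fix b
      have "i = j" if "i \<in> S \<inter> bag_tasks I b" "j \<in> S \<inter> bag_tasks I b" for i j
        using that inj_onD[OF *, of i j] by (auto simp: bag_tasks_def bg_def)
      then show "card (S \<inter> bag_tasks I b) \<le> 1"
        by (metis card_le_Suc0_iff_eq One_nat_def card.infinite le0)
    qed
  qed
  then show ?thesis
    by (auto simp: feasible_def path_edges_def src_def snk_def dem_def cap_def)
qed

definition load :: "nat set \<Rightarrow> nat \<Rightarrow> nat" where
  "load S e = (\<Sum>i \<in> {i \<in> S. src i \<le> e \<and> e < snk i}. dem i)"

lemma feasible_load: "feasible I S \<Longrightarrow> e < m \<Longrightarrow> load S e \<le> cap e"
  by (auto simp: feasible_iff load_def)

lemma load_mono_sum:
  assumes "finite S" "A \<subseteq> S" "\<And>i. i \<in> A \<Longrightarrow> src i \<le> e \<and> e < snk i"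
  shows "(\<Sum>i\<in>A. dem i) \<le> load S e"
  unfolding load_def using assms by (intro sum_mono2) auto

lemma feasible_finite: "feasible I S \<Longrightarrow> finite S"
  using finite_subset[of S "{..<n}"] by (auto simp: feasible_iff)

lemma feasible_sum_le:
  assumes "feasible I S" "A \<subseteq> S" "e < m" "\<And>i. i \<in> A \<Longrightarrow> src i \<le> e \<and> e < snk i"
  shows "(\<Sum>i\<in>A. dem i) \<le> cap e"
  using load_mono_sum[OF feasible_finite[OF assms(1)] assms(2,4)] feasible_load[OF assms(1,3)]
  by (meson order.trans)

lemma total_weight_eq: "total_weight I S = (\<Sum>i\<in>S. wt i)"
  by (simp add: total_weight_def wt_def)

section \<open>Load of a scale class and the local ratio algorithm\<close>

definition small :: "nat \<Rightarrow> bool" where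
  "small i \<longleftrightarrow> 4 * dem i \<le> scale i"

text \<open>
  Of the tasks of one scale class through \<open>e\<close>, those with a bottleneck to the left of \<open>e\<close> all use
  the rightmost of these bottlenecks, and symmetrically on the other side.
\<close>

lemma scale_class_load:
  assumes Z: "feasible I Z" and A: "A \<subseteq> Z"
    and thru: "\<And>i. i \<in> A \<Longrightarrow> src i \<le> e \<and> e < snk i \<and> scale i = B"
  shows "(\<Sum>i\<in>A. dem i) \<le> 4 * B"
proof -
  have fin: "finite A" using A feasible_finite[OF Z] finite_subset by blast
  have lt: "i < n" if "i \<in> A" for i using that A Z by (auto simp: feasible_iff)
  \<comment> \<open>If one member's bottleneck edge lies on all paths of the subfamily, the whole
    subfamily fits under that capacity, which is below twice the scale.\<close>
  have half: "(\<Sum>i\<in>A'. dem i) \<le> 2 * B" if sub: "A' \<subseteq> A"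
    and ex: "A' \<noteq> {} \<Longrightarrow> \<exists>i0\<in>A'. \<forall>i\<in>A'. src i \<le> bneck_edge i0 \<and> bneck_edge i0 < snk i" for A'
  proof (cases "A' = {}")
    case False
    then obtain i0 where i0: "i0 \<in> A'" "\<forall>i\<in>A'. src i \<le> bneck_edge i0 \<and> bneck_edge i0 < snk i"
      using ex by blast
    have n: "i0 < n" using i0 sub lt by auto
    have "(\<Sum>i\<in>A'. dem i) \<le> cap (bneck_edge i0)"
      using feasible_sum_le[OF Z, of A' "bneck_edge i0"] i0(2) sub A bneck_edge[OF n] by auto
    also have "\<dots> \<le> 2 * B"
      using bneck_edge(3)[OF n] scale_bounds(2)[OF n] thru[of i0] i0(1) sub by auto
    finally show ?thesis .
  qed auto
  define L where "L = {i \<in> A. bneck_edge i \<le> e}"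
  define R where "R = {i \<in> A. e < bneck_edge i}"
  have "(\<Sum>i\<in>L. dem i) \<le> 2 * B"
  proof (rule half)
    assume ne: "L \<noteq> {}"
    have finL: "finite L" using fin by (auto simp: L_def)
    have "Max (bneck_edge ` L) \<in> bneck_edge ` L" using ne finL by (intro Max_in) auto
    then obtain i0 where i0: "i0 \<in> L" "bneck_edge i0 = Max (bneck_edge ` L)" by auto
    have "\<forall>i\<in>L. src i \<le> bneck_edge i0 \<and> bneck_edge i0 < snk i"
    proof
      fix i assume i: "i \<in> L"
      then have "bneck_edge i \<le> bneck_edge i0" using i0 finL by auto
      moreover have "src i \<le> bneck_edge i" using bneck_edge(1) lt i by (auto simp: L_def)
      moreover have "bneck_edge i0 \<le> e" "e < snk i" using i0 i thru by (auto simp: L_def)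
      ultimately show "src i \<le> bneck_edge i0 \<and> bneck_edge i0 < snk i" by linarith
    qed
    then show "\<exists>i0\<in>L. \<forall>i\<in>L. src i \<le> bneck_edge i0 \<and> bneck_edge i0 < snk i" using i0 by blast
  qed (auto simp: L_def)
  moreover have "(\<Sum>i\<in>R. dem i) \<le> 2 * B"
  proof (rule half)
    assume ne: "R \<noteq> {}"
    have finR: "finite R" using fin by (auto simp: R_def)
    have "Min (bneck_edge ` R) \<in> bneck_edge ` R" using ne finR by (intro Min_in) auto
    then obtain i0 where i0: "i0 \<in> R" "bneck_edge i0 = Min (bneck_edge ` R)" by auto
    have "\<forall>i\<in>R. src i \<le> bneck_edge i0 \<and> bneck_edge i0 < snk i"
    proof
      fix i assume i: "i \<in> R"
      then have "bneck_edge i0 \<le> bneck_edge i" using i0 finR by auto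
      moreover have "bneck_edge i < snk i" using bneck_edge(2) lt i by (auto simp: R_def)
      moreover have "e < bneck_edge i0" "src i \<le> e" using i0 i thru by (auto simp: R_def)
      ultimately show "src i \<le> bneck_edge i0 \<and> bneck_edge i0 < snk i" by linarith
    qed
    then show "\<exists>i0\<in>R. \<forall>i\<in>R. src i \<le> bneck_edge i0 \<and> bneck_edge i0 < snk i" using i0 by blast
  qed (auto simp: R_def)
  moreover have "(\<Sum>i\<in>A. dem i) = (\<Sum>i\<in>L. dem i) + (\<Sum>i\<in>R. dem i)"
    using fin by (subst sum.union_disjoint[symmetric]) (auto simp: L_def R_def intro!: sum.cong)
  ultimately show ?thesis by linarith
qed

text \<open>Order by right end with the index as tie-breaker, packed into one number: quotient and
  remainder by \<open>n\<close> recover both components, so a program can enumerate the order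
  without sorting.\<close>

definition time :: "nat \<Rightarrow> nat" where
  "time i = snk i * n + i"

lemma time_inj: "i < n \<Longrightarrow> j < n \<Longrightarrow> time i = time j \<Longrightarrow> i = j"
proof -
  assume *: "i < n" "j < n" "time i = time j"
  have "time i mod n = i" "time j mod n = j" using *(1,2) by (auto simp: time_def)
  then show ?thesis using *(3) by metis
qed

lemma time_less_snk:
  assumes "i < n" "j < n" "time i < time j"
  shows "snk i \<le> snk j"
proof -
  have "time i div n = snk i" "time j div n = snk j" using assms by (auto simp: time_def)
  moreover have "time i div n \<le> time j div n" using assms(3) by (intro div_le_mono) simp
  ultimately show ?thesis by simp
qed

text \<open>
  The share of the residual weight \<open>r j\<close> of an earlier task \<open>j\<close> that the local ratio step for \<open>j\<close>
  subtracts from the weight of \<open>i\<close>; it is rounded up.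
\<close>

definition charge :: "(nat \<Rightarrow> nat) \<Rightarrow> nat \<Rightarrow> nat \<Rightarrow> nat" where
  "charge r j i = (if bg j = bg i then r j
     else if scale j = scale i \<and> src i < snk j then (r j * 4 * dem i + (scale i - 1)) div scale i
     else 0)"

text \<open>A recursion along \<open>time\<close>, stated as an equation so that an array can be
  checked against it. The scaling by \<open>2 * n\<close> makes rounding harmless: rounding up costs
  at most one unit per pair of tasks, hence at most half of the scaled weight of any solution.
  Truncated subtraction replaces negative residuals by 0.\<close>

definition residual :: "(nat \<Rightarrow> nat) \<Rightarrow> bool" where
  "residual r \<longleftrightarrow> (\<forall>i < n. r i = (if small i
     then 2 * n * wt i - (\<Sum>j | j < n \<and> time j < time i. charge r j i) else 0))"

text \<open>The unwinding phase of local ratio: tasks are decided from late to early. A class may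
  use only half of its scale, so that the classes together, whose scales are distinct powers of two,
  stay below the capacity.\<close>

definition accepted :: "(nat \<Rightarrow> nat) \<Rightarrow> (nat \<Rightarrow> bool) \<Rightarrow> bool" where
  "accepted r acc \<longleftrightarrow> (\<forall>i < n. acc i \<longleftrightarrow> r i > 0 \<and>
     (\<forall>j < n. time i < time j \<and> acc j \<longrightarrow> bg j \<noteq> bg i) \<and>
     2 * ((\<Sum>j | j < n \<and> time i < time j \<and> acc j \<and> scale j = scale i \<and> src j < snk i. dem j) + dem i)
       \<le> scale i)"

lemma residual_small:
  "residual r \<Longrightarrow> i < n \<Longrightarrow> small i \<Longrightarrow>
    r i = 2 * n * wt i - (\<Sum>j | j < n \<and> time j < time i. charge r j i)"
  unfolding residual_def by presburger

lemma residual_not_small: "residual r \<Longrightarrow> i < n \<Longrightarrow> \<not> small i \<Longrightarrow> r i = 0"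
  unfolding residual_def by presburger

lemma acceptedD:
  assumes "accepted r acc" "i < n" "acc i"
  shows "r i > 0" "\<And>j. j < n \<Longrightarrow> time i < time j \<Longrightarrow> acc j \<Longrightarrow> bg j \<noteq> bg i"
    "2 * ((\<Sum>j | j < n \<and> time i < time j \<and> acc j \<and> scale j = scale i \<and> src j < snk i. dem j) + dem i)
       \<le> scale i"
  using assms unfolding accepted_def by blast+

lemma not_acceptedD:
  assumes "accepted r acc" "i < n" "\<not> acc i" "r i > 0"
  shows "(\<exists>j<n. time i < time j \<and> acc j \<and> bg j = bg i) \<or>
    scale i < 2 * ((\<Sum>j | j < n \<and> time i < time j \<and> acc j \<and> scale j = scale i \<and> src j < snk i. dem j) + dem i)"
  using assms unfolding accepted_def by (meson not_le_imp_less)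

lemma ceil_div_ge: "0 < (b::nat) \<Longrightarrow> a \<le> b * ((a + (b - 1)) div b)"
  using mult_div_mod_eq[of b "a + (b - 1)"] mod_less_divisor[of b "a + (b - 1)"] by linarith

lemma ceil_div_le: "0 < (b::nat) \<Longrightarrow> b * ((a + (b - 1)) div b) \<le> a + b"
  using mult_div_mod_eq[of b "a + (b - 1)"] by linarith

text \<open>Fix an edge \<open>e\<close> and a level. The earliest accepted task of this level
  through \<open>e\<close> passed its test against all the others, which are later and start before
  its end; so the level has at most half of its power of two. Levels at \<open>e\<close> are below
  \<open>floorlog 2 (cap e)\<close>, and the geometric sum of the halves is at most
  \<open>cap e\<close>.\<close>

lemma accepted_feasible:
  assumes r: "residual r" and acc: "accepted r acc"
  shows "feasible I {i. i < n \<and> acc i}"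
proof -
  let ?A = "{i. i < n \<and> acc i}"
  have inj: "inj_on bg ?A"
  proof (rule inj_onI)
    fix i j assume ij: "i \<in> ?A" "j \<in> ?A" "bg i = bg j"
    show "i = j"
    proof (rule ccontr)
      assume "i \<noteq> j"
      then have "time i \<noteq> time j" using ij time_inj[of i j] by blast
      then consider "time i < time j" | "time j < time i" by linarith
      then show False
        using ij acceptedD(2)[OF acc, of i j] acceptedD(2)[OF acc, of j i] by cases auto
    qed
  qed
  have "(\<Sum>i \<in> {i \<in> ?A. src i \<le> e \<and> e < snk i}. dem i) \<le> cap e" if e: "e < m" for e
  proof -
    let ?E = "{i \<in> ?A. src i \<le> e \<and> e < snk i}"
    have finE: "finite ?E" by auto
    have class_load: "2 * (\<Sum>i\<in>{i\<in>?E. level i = k}. dem i) \<le> 2 ^ k" for k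
    proof (cases "{i\<in>?E. level i = k} = {}")
      case False
      let ?C = "{i\<in>?E. level i = k}"
      have "Min (time ` ?C) \<in> time ` ?C" using False finE by (intro Min_in) auto
      then obtain i where i: "i \<in> ?C" "time i = Min (time ` ?C)" by auto
      have split: "(\<Sum>j\<in>?C. dem j) = (\<Sum>j\<in>?C - {i}. dem j) + dem i"
        using i(1) finE by (subst sum.remove[of _ i]) auto
      have later: "(\<Sum>j\<in>?C - {i}. dem j) \<le>
        (\<Sum>j | j < n \<and> time i < time j \<and> acc j \<and> scale j = scale i \<and> src j < snk i. dem j)"
      proof (rule sum_mono2)
        show "?C - {i} \<subseteq> {j. j < n \<and> time i < time j \<and> acc j \<and> scale j = scale i \<and> src j < snk i}"
        proof
          fix j assume j: "j \<in> ?C - {i}"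
          have "time i \<le> time j" unfolding i(2) using j finE by (intro Min_le) auto
          moreover have "time i \<noteq> time j" using time_inj[of i j] i j by auto
          ultimately have "time i < time j" by linarith
          then show "j \<in> {j. j < n \<and> time i < time j \<and> acc j \<and> scale j = scale i \<and> src j < snk i}"
            using i(1) j by (auto simp: scale_def)
        qed
      qed auto
      have "(\<Sum>j\<in>?C. dem j) \<le>
        (\<Sum>j | j < n \<and> time i < time j \<and> acc j \<and> scale j = scale i \<and> src j < snk i. dem j) + dem i"
        unfolding split by (rule add_right_mono[OF later])
      then have "2 * (\<Sum>j\<in>?C. dem j) \<le> 2 *
        ((\<Sum>j | j < n \<and> time i < time j \<and> acc j \<and> scale j = scale i \<and> src j < snk i. dem j) + dem i)"
        by (rule mult_le_mono2)
      also have "\<dots> \<le> scale i" using i(1) by (intro acceptedD(3)[OF acc]) auto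
      finally have "2 * (\<Sum>j\<in>?C. dem j) \<le> scale i" .
      then show ?thesis using i(1) by (simp add: scale_def)
    next
      case True
      show ?thesis by (subst True) simp
    qed
    define K where "K = floorlog 2 (cap e)"
    have K: "2 ^ (K - 1) \<le> cap e" "cap e < 2 ^ K" "K > 0"
      using floorlog_bounds[of "cap e" 2] cap_pos[OF e] by (auto simp: K_def floorlog_def)
    have lev: "level i \<in> {..<K}" if "i \<in> ?E" for i
    proof -
      have "2 ^ level i \<le> cap e"
        using scale_bounds(1)[of i] bottleneck_le[of i e] that by (auto simp: scale_def)
      then have "(2::nat) ^ level i < 2 ^ K" using K(2) by linarith
      then show ?thesis by simp
    qed
    have "level ` ?E \<subseteq> {..<K}" using lev by blast
    then have "(\<Sum>i\<in>?E. dem i) = (\<Sum>k<K. \<Sum>i\<in>{i\<in>?E. level i = k}. dem i)"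
      by (rule sum.group[OF finE finite_lessThan, symmetric])
    then have "2 * (\<Sum>i\<in>?E. dem i) = (\<Sum>k<K. 2 * (\<Sum>i\<in>{i\<in>?E. level i = k}. dem i))"
      by (simp only: sum_distrib_left)
    also have "\<dots> \<le> (\<Sum>k<K. 2 ^ k)" by (intro sum_mono class_load)
    also have "\<dots> \<le> 2 ^ K"
      by (simp add: lessThan_atLeast0 sum_power2)
    also have "\<dots> \<le> 2 * cap e" using K by (cases K) auto
    finally show ?thesis by simp
  qed
  then show ?thesis using inj by (auto simp: feasible_iff)
qed

text \<open>A positive residual \<open>r i\<close> that is rejected is covered by charges to later
  accepted tasks: in full by a bag mate, or else by the load that made the capacity test fail. The
  charges received by an accepted \<open>j\<close> together with \<open>r j\<close> amount to
  exactly \<open>2 * n * wt j\<close>, because \<open>r j > 0\<close> excludes truncation.\<close>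

lemma residual_le_accepted:
  assumes r: "residual r" and acc: "accepted r acc"
  shows "(\<Sum>i<n. r i) \<le> 2 * n * (\<Sum>i | i < n \<and> acc i. wt i)"
proof -
  let ?A = "{i. i < n \<and> acc i}"
  have "r i \<le> (if acc i then r i else 0) + (\<Sum>j | j \<in> ?A \<and> time i < time j. charge r i j)"
    if i: "i < n" for i
  proof (cases "acc i \<or> r i = 0")
    case False
    then have "small i" using residual_not_small[OF r i] by auto
    have *: "(\<exists>j<n. time i < time j \<and> acc j \<and> bg j = bg i) \<or>
      scale i < 2 * ((\<Sum>j | j < n \<and> time i < time j \<and> acc j \<and> scale j = scale i \<and> src j < snk i. dem j) + dem i)"
      using not_acceptedD[OF acc i] False by blast
    have "r i \<le> (\<Sum>j | j \<in> ?A \<and> time i < time j. charge r i j)"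
    proof (cases "\<exists>j<n. time i < time j \<and> acc j \<and> bg j = bg i")
      case True
      then obtain j where j: "j < n" "time i < time j" "acc j" "bg j = bg i" by blast
      have "charge r i j \<le> (\<Sum>j | j \<in> ?A \<and> time i < time j. charge r i j)"
        using j by (intro member_le_sum) auto
      then show ?thesis using j by (simp add: charge_def)
    next
      case nobag: False
      let ?L = "{j. j < n \<and> time i < time j \<and> acc j \<and> scale j = scale i \<and> src j < snk i}"
      have B: "0 < scale i" using scale_bounds(3)[OF i] .
      \<comment> \<open>Smallness is used here: as \<open>4 * dem i \<le> scale i\<close>, a failed
        test means that the later load alone is at least a quarter of the scale, matching the factor
        4 in \<open>charge\<close>.\<close>
      have arith: "b < 2 * (x + d) \<Longrightarrow> 4 * d \<le> b \<Longrightarrow> b \<le> 4 * x" for b x d :: nat by presburger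
      have "scale i < 2 * ((\<Sum>j\<in>?L. dem j) + dem i)" using * nobag by blast
      then have "scale i \<le> 4 * (\<Sum>j\<in>?L. dem j)"
        by (rule arith) (use \<open>small i\<close> in \<open>simp add: small_def\<close>)
      then have "r i * scale i \<le> r i * (4 * (\<Sum>j\<in>?L. dem j))" by (rule mult_le_mono2)
      also have "\<dots> = (\<Sum>j\<in>?L. r i * 4 * dem j)" by (simp add: sum_distrib_left mult.assoc)
      also have "\<dots> \<le> (\<Sum>j\<in>?L. scale i * charge r i j)"
      proof (rule sum_mono)
        fix j assume j: "j \<in> ?L"
        then have "bg i \<noteq> bg j" using nobag by auto
        then have "charge r i j = (r i * 4 * dem j + (scale i - 1)) div scale i"
          using j by (auto simp: charge_def)
        then show "r i * 4 * dem j \<le> scale i * charge r i j"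
          using ceil_div_ge[OF B, of "r i * 4 * dem j"] by simp
      qed
      also have "\<dots> = scale i * (\<Sum>j\<in>?L. charge r i j)" by (simp add: sum_distrib_left)
      also have "\<dots> \<le> scale i * (\<Sum>j | j \<in> ?A \<and> time i < time j. charge r i j)"
        by (intro mult_le_mono2 sum_mono2) auto
      finally show ?thesis using B by (simp add: mult.commute)
    qed
    then show ?thesis by simp
  qed auto
  then have "(\<Sum>i<n. r i) \<le> (\<Sum>i<n. (if acc i then r i else 0) +
      (\<Sum>j | j \<in> ?A \<and> time i < time j. charge r i j))"
    by (intro sum_mono) auto
  also have "\<dots> = (\<Sum>i<n. if acc i then r i else 0) +
      (\<Sum>i<n. \<Sum>j\<in>?A. if time i < time j then charge r i j else 0)"
    by (simp add: sum.distrib sum.inter_filter[symmetric])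
  also have "(\<Sum>i<n. if acc i then r i else 0) = (\<Sum>j\<in>?A. r j)"
    by (subst sum.inter_filter[symmetric]) (auto intro!: sum.cong)
  also have "(\<Sum>i<n. \<Sum>j\<in>?A. if time i < time j then charge r i j else 0) =
      (\<Sum>j\<in>?A. \<Sum>i | i < n \<and> time i < time j. charge r i j)"
    by (subst sum.swap) (auto intro!: sum.cong simp: sum.inter_filter[symmetric])
  also have "(\<Sum>j\<in>?A. r j) + \<dots> = (\<Sum>j\<in>?A. r j + (\<Sum>i | i < n \<and> time i < time j. charge r i j))"
    by (simp add: sum.distrib)
  also have "\<dots> \<le> (\<Sum>j\<in>?A. 2 * n * wt j)"
  proof (rule sum_mono)
    fix j assume j: "j \<in> ?A"
    then have "r j > 0" using acceptedD(1)[OF acc] by blast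
    moreover from this have "small j" using residual_not_small[OF r, of j] j by auto
    ultimately show "r j + (\<Sum>i | i < n \<and> time i < time j. charge r i j) \<le> 2 * n * wt j"
      using residual_small[OF r, of j] j by auto
  qed
  finally show ?thesis by (simp add: sum_distrib_left)
qed

text \<open>The bag of \<open>i\<close> meets \<open>Z\<close> at most once, which costs
  \<open>r i\<close>. Members of \<open>Z\<close> that end later and start before
  \<open>snk i\<close> use the last edge of \<open>i\<close>; by \<open>scale_class_load\<close>
  their demand is at most \<open>4 * scale i\<close>, and the factor 4 in \<open>charge\<close>
  turns this into \<open>16 * r i\<close>. The term \<open>card Z\<close> pays for rounding
  up.\<close>

lemma charges_le:
  assumes Z: "feasible I Z" and i: "i < n"
  shows "(\<Sum>j | j \<in> Z \<and> time i < time j. charge r i j) \<le> 17 * r i + card Z"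
proof -
  have On: "Z \<subseteq> {..<n}" and inj: "inj_on bg Z" using Z by (auto simp: feasible_iff)
  have finO: "finite Z" using feasible_finite[OF Z] .
  let ?S = "{j \<in> Z. time i < time j}"
  let ?X = "{j \<in> ?S. bg i = bg j}"
  let ?Y = "{j \<in> ?S. bg i \<noteq> bg j \<and> scale i = scale j \<and> src j < snk i}"
  have B: "0 < scale i" using scale_bounds(3)[OF i] .
  have "(\<Sum>j\<in>?S. charge r i j) = (\<Sum>j\<in>?X \<union> ?Y. charge r i j)"
    using finO by (intro sum.mono_neutral_right) (auto simp: charge_def)
  also have "\<dots> = (\<Sum>j\<in>?X. charge r i j) + (\<Sum>j\<in>?Y. charge r i j)"
    using finO by (intro sum.union_disjoint) auto
  also have "(\<Sum>j\<in>?X. charge r i j) \<le> r i"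
  proof -
    have "card ?X \<le> Suc 0"
      using finO inj by (subst card_le_Suc0_iff_eq) (auto dest: inj_onD)
    then have "card ?X * r i \<le> 1 * r i" by (intro mult_le_mono1) simp
    then show ?thesis by (simp add: charge_def)
  qed
  also have "(\<Sum>j\<in>?Y. charge r i j) \<le> 16 * r i + card Z"
  proof -
    have "scale i * (\<Sum>j\<in>?Y. charge r i j) = (\<Sum>j\<in>?Y. scale i * charge r i j)"
      by (simp add: sum_distrib_left)
    also have "\<dots> \<le> (\<Sum>j\<in>?Y. r i * 4 * dem j + scale i)"
    proof (rule sum_mono)
      fix j assume j: "j \<in> ?Y"
      then show "scale i * charge r i j \<le> r i * 4 * dem j + scale i"
        using ceil_div_le[OF B, of "r i * 4 * dem j"] by (auto simp: charge_def)
    qed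
    also have "\<dots> = r i * 4 * (\<Sum>j\<in>?Y. dem j) + card ?Y * scale i"
      by (simp add: sum.distrib sum_distrib_left del: mem_Collect_eq)
    also have "(\<Sum>j\<in>?Y. dem j) \<le> 4 * scale i"
    proof (rule scale_class_load[OF Z, of _ "snk i - 1"])
      fix j assume j: "j \<in> ?Y"
      then have "snk i \<le> snk j" using time_less_snk[OF i, of j] On by auto
      then show "src j \<le> snk i - 1 \<and> snk i - 1 < snk j \<and> scale j = scale i"
        using j task_valid(3)[OF i] by auto
    qed auto
    also have "card ?Y \<le> card Z" using card_mono[of Z ?Y] finO by auto
    finally have "scale i * (\<Sum>j\<in>?Y. charge r i j) \<le> scale i * (16 * r i + card Z)"
      by (simp add: algebra_simps)
    then show ?thesis using B by simp
  qed
  finally show ?thesis by simp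
qed

text \<open>The weights of \<open>Z\<close> decompose into residuals and charges, at most 18 times
  all residuals plus \<open>n * card Z\<close> for rounding. As weights are positive, the rounding
  term eats half of \<open>2 * n\<close> times the weight of \<open>Z\<close>; comparing with
  \<open>residual_le_accepted\<close> gives 2 * 18 = 36.\<close>

lemma small_ratio:
  assumes r: "residual r" and acc: "accepted r acc"
    and Z: "feasible I Z" and small: "\<And>j. j \<in> Z \<Longrightarrow> small j"
  shows "total_weight I Z \<le> 36 * total_weight I {i. i < n \<and> acc i}"
proof (cases "n = 0")
  case True
  then have "Z = {}" using Z by (auto simp: feasible_iff)
  then show ?thesis by (simp add: total_weight_def)
next
  case False
  have On: "Z \<subseteq> {..<n}" using Z by (auto simp: feasible_iff)
  have finO: "finite Z" using feasible_finite[OF Z] .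
  have "2 * n * (\<Sum>j\<in>Z. wt j) \<le> (\<Sum>j\<in>Z. r j + (\<Sum>i | i < n \<and> time i < time j. charge r i j))"
    unfolding sum_distrib_left
  proof (rule sum_mono)
    fix j assume "j \<in> Z"
    then show "2 * n * wt j \<le> r j + (\<Sum>i | i < n \<and> time i < time j. charge r i j)"
      using residual_small[OF r, of j] small[of j] On by auto
  qed
  also have "(\<Sum>j\<in>Z. r j + (\<Sum>i | i < n \<and> time i < time j. charge r i j)) =
    (\<Sum>j\<in>Z. r j) + (\<Sum>j\<in>Z. \<Sum>i | i < n \<and> time i < time j. charge r i j)"
    by (simp add: sum.distrib)
  also have "(\<Sum>j\<in>Z. r j) \<le> (\<Sum>i<n. r i)" using On by (intro sum_mono2) auto
  also have "(\<Sum>j\<in>Z. \<Sum>i | i < n \<and> time i < time j. charge r i j) =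
      (\<Sum>j\<in>Z. \<Sum>i<n. if time i < time j then charge r i j else 0)"
    by (auto intro!: sum.cong simp: sum.inter_filter[symmetric])
  also have "\<dots> = (\<Sum>i<n. \<Sum>j | j \<in> Z \<and> time i < time j. charge r i j)"
    by (subst sum.swap) (use finO in \<open>auto intro!: sum.cong simp: sum.inter_filter[symmetric]\<close>)
  also have "\<dots> \<le> (\<Sum>i<n. 17 * r i) + n * card Z"
    using sum_mono[of "{..<n}" "\<lambda>i. \<Sum>j | j \<in> Z \<and> time i < time j. charge r i j" "\<lambda>i. 17 * r i + card Z"]
      charges_le[OF Z] by (simp add: sum.distrib)
  also have "n * card Z \<le> n * (\<Sum>j\<in>Z. wt j)"
  proof -
    have "(\<Sum>j\<in>Z. 1) \<le> (\<Sum>j\<in>Z. wt j)"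
      using task_valid(1) On by (intro sum_mono) (auto simp: Suc_le_eq)
    then show ?thesis by simp
  qed
  finally have "n * (\<Sum>j\<in>Z. wt j) \<le> 18 * (\<Sum>i<n. r i)"
    by (simp add: sum_distrib_left[symmetric])
  also have "\<dots> \<le> n * (36 * (\<Sum>i | i < n \<and> acc i. wt i))"
    using residual_le_accepted[OF r acc] by simp
  finally show ?thesis using False by (simp add: total_weight_eq)
qed

end

section \<open>Tasks of large relative demand as rectangles\<close>

text \<open>In-degrees and out-degrees have the same sum, so some vertex has in-degree at most
  \<open>D\<close> and thus at most \<open>2 * D\<close> neighbours. It is removed, the rest is
  coloured by induction, and one of the \<open>2 * D + 1\<close> colours remains for it.\<close>

lemma coloring_of_bounded_outdegree:
  fixes N :: "'a \<Rightarrow> 'a \<Rightarrow> bool"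
  assumes "finite V" "\<And>v. v \<in> V \<Longrightarrow> card {u \<in> V. N v u} \<le> D"
  shows "\<exists>f :: 'a \<Rightarrow> nat. (\<forall>v\<in>V. f v \<le> 2 * D) \<and>
    (\<forall>u\<in>V. \<forall>v\<in>V. u \<noteq> v \<and> (N u v \<or> N v u) \<longrightarrow> f u \<noteq> f v)"
  using assms
proof (induction "card V" arbitrary: V rule: less_induct)
  case less
  show ?case
  proof (cases "V = {}")
    case False
    have "\<exists>v\<in>V. card {u \<in> V. N u v} \<le> D"
    proof (rule ccontr)
      assume "\<not> ?thesis"
      then have "(\<Sum>v\<in>V. Suc D) \<le> (\<Sum>v\<in>V. card {u \<in> V. N u v})"
        by (intro sum_mono) (simp add: not_le Suc_le_eq)
      also have "\<dots> = (\<Sum>v\<in>V. \<Sum>u\<in>V. of_bool (N u v))"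
        using less.prems(1) by (simp add: Int_def)
      also have "\<dots> = (\<Sum>u\<in>V. \<Sum>v\<in>V. of_bool (N u v))" by (rule sum.swap)
      also have "\<dots> = (\<Sum>u\<in>V. card {v \<in> V. N u v})"
        using less.prems(1) by (simp add: Int_def)
      also have "\<dots> \<le> (\<Sum>v\<in>V. D)" using less.prems(2) by (intro sum_mono)
      finally have "card V * Suc D \<le> card V * D" by simp
      then show False using False less.prems(1) by (simp add: card_eq_0_iff)
    qed
    then obtain v where v: "v \<in> V" "card {u \<in> V. N u v} \<le> D" by blast
    let ?V = "V - {v}"
    have "\<exists>f :: 'a \<Rightarrow> nat. (\<forall>v\<in>?V. f v \<le> 2 * D) \<and>
      (\<forall>u\<in>?V. \<forall>v\<in>?V. u \<noteq> v \<and> (N u v \<or> N v u) \<longrightarrow> f u \<noteq> f v)"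
    proof (rule less.hyps)
      show "card ?V < card V" using v less.prems(1) by (meson card_Diff1_less)
      fix u assume "u \<in> ?V"
      then have "card {u' \<in> V. N u u'} \<le> D" using less.prems(2) by blast
      moreover have "card {u' \<in> ?V. N u u'} \<le> card {u' \<in> V. N u u'}"
        using less.prems(1) by (intro card_mono) auto
      ultimately show "card {u' \<in> ?V. N u u'} \<le> D" by linarith
    qed (use less.prems(1) in auto)
    then obtain f :: "'a \<Rightarrow> nat" where "(\<forall>v\<in>?V. f v \<le> 2 * D) \<and>
      (\<forall>u\<in>?V. \<forall>v\<in>?V. u \<noteq> v \<and> (N u v \<or> N v u) \<longrightarrow> f u \<noteq> f v)" ..
    then have f: "\<And>u. u \<in> ?V \<Longrightarrow> f u \<le> 2 * D"
      "\<And>u u'. u \<in> ?V \<Longrightarrow> u' \<in> ?V \<Longrightarrow> u \<noteq> u' \<Longrightarrow> N u u' \<or> N u' u \<Longrightarrow> f u \<noteq> f u'"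
      by simp_all
    let ?B = "{u \<in> V. N v u} \<union> {u \<in> V. N u v}"
    have "card (f ` ?B) \<le> card ?B" using less.prems(1) by (intro card_image_le) auto
    also have "\<dots> \<le> card {u \<in> V. N v u} + card {u \<in> V. N u v}" by (rule card_Un_le)
    also have "\<dots> \<le> 2 * D" using v less.prems(2)[of v] by linarith
    also have "2 * D < card {..2 * D}" by simp
    finally have lt: "card (f ` ?B) < card {..2 * D}" .
    have "finite (f ` ?B)" using less.prems(1) by simp
    then have "\<not> {..2 * D} \<subseteq> f ` ?B" using card_mono lt by (metis leD)
    then obtain k where k: "k \<le> 2 * D" "k \<notin> f ` ?B" by auto
    have "(\<forall>u\<in>V. (f(v := k)) u \<le> 2 * D) \<and>
      (\<forall>u\<in>V. \<forall>u'\<in>V. u \<noteq> u' \<and> (N u u' \<or> N u' u) \<longrightarrow> (f(v := k)) u \<noteq> (f(v := k)) u')"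
    proof (intro conjI ballI impI)
      fix u assume "u \<in> V"
      then show "(f(v := k)) u \<le> 2 * D" using f(1) k by auto
    next
      fix u u' assume u: "u \<in> V" "u' \<in> V" "u \<noteq> u' \<and> (N u u' \<or> N u' u)"
      show "(f(v := k)) u \<noteq> (f(v := k)) u'"
      proof (cases "u = v \<or> u' = v")
        case True
        then show ?thesis using u k(2) by auto
      next
        case False
        then show ?thesis using f(2)[of u u'] u by simp
      qed
    qed
    then show ?thesis by (intro exI[of _ "f(v := k)"])
  qed auto
qed

section \<open>Rectangles of large tasks and their conflicts\<close>

context bagufp_instance
begin

definition bot :: "nat \<Rightarrow> nat" where
  "bot i = bottleneck i - dem i"

text \<open>The first conjunct discards tasks that do not fit even alone; the second negates
  \<open>small\<close> and implies \<open>bottleneck i < 8 * dem i\<close>, so a large rectangle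
  fills a constant fraction of the height below its top.\<close>

definition large :: "nat \<Rightarrow> bool" where
  "large i \<longleftrightarrow> dem i \<le> bottleneck i \<and> scale i < 4 * dem i"

text \<open>Intersection of the half-open rectangles with horizontal range from \<open>src\<close>
  to \<open>snk\<close> and vertical range from \<open>bot\<close> to
  \<open>bottleneck\<close>.\<close>

definition conflict :: "nat \<Rightarrow> nat \<Rightarrow> bool" where
  "conflict i j \<longleftrightarrow> src i < snk j \<and> src j < snk i \<and> bot i < bottleneck j \<and> bot j < bottleneck i"

definition packed :: "nat set \<Rightarrow> bool" where
  "packed S \<longleftrightarrow> S \<subseteq> {i. i < n \<and> large i} \<and> inj_on bg S \<and>
     (\<forall>i\<in>S. \<forall>j\<in>S. i \<noteq> j \<longrightarrow> \<not> conflict i j)"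

lemma packed_finite: "packed S \<Longrightarrow> finite S"
  by (rule finite_subset[of _ "{..<n}"]) (auto simp: packed_def)

text \<open>Above any edge the vertical intervals of the rectangles are disjoint, have the demands
  as lengths, and lie below the capacity since a bottleneck is at most every capacity on the
  path.\<close>

lemma packed_feasible:
  assumes "packed S"
  shows "feasible I S"
proof -
  have "(\<Sum>i \<in> {i \<in> S. src i \<le> e \<and> e < snk i}. dem i) \<le> cap e" if "e < m" for e
  proof -
    let ?E = "{i \<in> S. src i \<le> e \<and> e < snk i}"
    have "(\<Sum>i\<in>?E. dem i) = (\<Sum>i\<in>?E. card {bot i..<bottleneck i})"
      using assms by (intro sum.cong) (auto simp: packed_def large_def bot_def)
    also have "\<dots> = card (\<Union>i\<in>?E. {bot i..<bottleneck i})"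
    proof (rule card_UN_disjoint[symmetric])
      show "\<forall>i\<in>?E. \<forall>j\<in>?E. i \<noteq> j \<longrightarrow> {bot i..<bottleneck i} \<inter> {bot j..<bottleneck j} = {}"
      proof (intro ballI impI)
        fix i j assume ij: "i \<in> ?E" "j \<in> ?E" "i \<noteq> j"
        then have "\<not> conflict i j" using assms by (auto simp: packed_def)
        then have "bottleneck j \<le> bot i \<or> bottleneck i \<le> bot j"
          using ij by (auto simp: conflict_def)
        then show "{bot i..<bottleneck i} \<inter> {bot j..<bottleneck j} = {}" by auto
      qed
    qed (use packed_finite[OF assms] in auto)
    also have "\<dots> \<le> card {..<cap e}"
    proof (rule card_mono)
      show "(\<Union>i\<in>?E. {bot i..<bottleneck i}) \<subseteq> {..<cap e}"
      proof
        fix x assume "x \<in> (\<Union>i\<in>?E. {bot i..<bottleneck i})"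
        then obtain i where "i \<in> ?E" "x < bottleneck i" by auto
        then show "x \<in> {..<cap e}" using bottleneck_le[of i e] by auto
      qed
    qed auto
    finally show ?thesis by simp
  qed
  then show ?thesis using assms by (auto simp: feasible_iff packed_def)
qed

lemma large_bottleneck: "i < n \<Longrightarrow> large i \<Longrightarrow> bottleneck i < 8 * dem i"
  using scale_bounds(2)[of i] by (simp add: large_def)

lemma bot_less: "i < n \<Longrightarrow> bot i < bottleneck i"
  using task_valid(2)[of i] bottleneck_pos[of i] by (simp add: bot_def)

text \<open>
  At the bottleneck of \<open>j\<close> the other tasks have total demand at most \<open>bot j\<close>, but each of those
  whose own bottleneck exceeds \<open>bot j\<close> takes more than an eighth of that.
\<close>

lemma few_at_bottleneck:
  assumes Z: "feasible I Z" and large: "\<And>i. i \<in> Z \<Longrightarrow> large i" and j: "j \<in> Z"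
    and A: "A \<subseteq> Z - {j}"
    and thru: "\<And>i. i \<in> A \<Longrightarrow> src i \<le> bneck_edge j \<and> bneck_edge j < snk i \<and> bot j < bottleneck i"
  shows "card A \<le> 7"
proof -
  have Zn: "Z \<subseteq> {..<n}" using Z by (auto simp: feasible_iff)
  have jn: "j < n" using j Zn by auto
  have finA: "finite A" using A feasible_finite[OF Z] by (meson finite_Diff finite_subset)
  have "(\<Sum>i\<in>insert j A. dem i) \<le> cap (bneck_edge j)"
    using A j thru bneck_edge[OF jn] by (intro feasible_sum_le[OF Z]) auto
  then have "dem j + (\<Sum>i\<in>A. dem i) \<le> bottleneck j"
    using A finA bneck_edge(3)[OF jn] by (subst (asm) sum.insert) auto
  then have le: "(\<Sum>i\<in>A. dem i) \<le> bot j" by (simp add: bot_def)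
  have "(\<Sum>i\<in>A. Suc (bot j)) \<le> (\<Sum>i\<in>A. 8 * dem i)"
  proof (rule sum_mono)
    fix i assume i: "i \<in> A"
    then have "i \<in> Z" using A by auto
    then have "bottleneck i < 8 * dem i" using large_bottleneck[of i] large Zn by auto
    then show "Suc (bot j) \<le> 8 * dem i" using thru[OF i] by linarith
  qed
  then have "card A * Suc (bot j) \<le> 8 * (\<Sum>i\<in>A. dem i)" by (simp add: sum_distrib_left)
  also have "\<dots> \<le> 8 * bot j" using le by simp
  also have "\<dots> < 8 * Suc (bot j)" by simp
  finally have "card A < 8" by (rule mult_less_cancel2[THEN iffD1, THEN conjunct2])
  then show ?thesis by simp
qed

text \<open>The three relations \<open>near\<close>, \<open>right_above\<close> and
  \<open>left_above\<close> orient the conflicts so that every out-degree in a feasible set is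
  bounded; a conflict as such gives no bound on the degree.\<close>

definition near :: "nat \<Rightarrow> nat \<Rightarrow> bool" where
  "near j i \<longleftrightarrow> i \<noteq> j \<and> src i \<le> bneck_edge j \<and> bneck_edge j < snk i \<and> bot j < bottleneck i"

definition right_above :: "nat \<Rightarrow> nat \<Rightarrow> bool" where
  "right_above i j \<longleftrightarrow> i \<noteq> j \<and> src j < snk i \<and> snk i \<le> bneck_edge j \<and>
     bottleneck i \<le> bottleneck j \<and> bot j < bottleneck i"

definition left_above :: "nat \<Rightarrow> nat \<Rightarrow> bool" where
  "left_above i j \<longleftrightarrow> i \<noteq> j \<and> src i < snk j \<and> bneck_edge j < src i \<and>
     bottleneck i \<le> bottleneck j \<and> bot j < bottleneck i"

text \<open>The task \<open>j\<close> with the higher top decides: its bottleneck edge lies on the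
  path of \<open>i\<close>, to the right of it, or to the left of it.\<close>

lemma conflict_cases:
  assumes "i < n" "j < n" "i \<noteq> j" "conflict i j" "bottleneck i \<le> bottleneck j"
  shows "near i j \<or> near j i \<or> right_above i j \<or> left_above i j"
  using bneck_edge[OF assms(1)] bneck_edge[OF assms(2)] assms
  unfolding conflict_def near_def right_above_def left_above_def by linarith

text \<open>Each such \<open>j\<close> starts before the end of \<open>i\<close> and reaches its own
  bottleneck edge to the right of it, so all of them use the leftmost of these bottleneck edges.
  There \<open>few_at_bottleneck\<close> leaves at most 7 besides the owner of that edge.\<close>

lemma card_right_above:
  assumes Z: "feasible I Z" and large: "\<And>i. i \<in> Z \<Longrightarrow> large i" and i: "i \<in> Z"
  shows "card {j \<in> Z. right_above i j} \<le> 8"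
proof (cases "{j \<in> Z. right_above i j} = {}")
  case False
  let ?R = "{j \<in> Z. right_above i j}"
  have fin: "finite ?R" using feasible_finite[OF Z] by auto
  have Zn: "Z \<subseteq> {..<n}" using Z by (auto simp: feasible_iff)
  have "Min (bneck_edge ` ?R) \<in> bneck_edge ` ?R" using False fin by (intro Min_in) auto
  then obtain j where j: "j \<in> ?R" "bneck_edge j = Min (bneck_edge ` ?R)" by auto
  have "card (?R - {j}) \<le> 7"
  proof (rule few_at_bottleneck[OF Z large])
    fix k assume k: "k \<in> ?R - {j}"
    then have "bneck_edge j \<le> bneck_edge k" unfolding j(2) using fin by (intro Min_le) auto
    then show "src k \<le> bneck_edge j \<and> bneck_edge j < snk k \<and> bot j < bottleneck k"
      using j(1) k bneck_edge[of k] Zn by (auto simp: right_above_def)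
  qed (use j in auto)
  then show ?thesis using j(1) fin by (auto simp: card_Diff_singleton)
next
  case True
  show ?thesis by (subst True) simp
qed

lemma card_left_above:
  assumes Z: "feasible I Z" and large: "\<And>i. i \<in> Z \<Longrightarrow> large i" and i: "i \<in> Z"
  shows "card {j \<in> Z. left_above i j} \<le> 8"
proof (cases "{j \<in> Z. left_above i j} = {}")
  case False
  let ?R = "{j \<in> Z. left_above i j}"
  have fin: "finite ?R" using feasible_finite[OF Z] by auto
  have Zn: "Z \<subseteq> {..<n}" using Z by (auto simp: feasible_iff)
  have "Max (bneck_edge ` ?R) \<in> bneck_edge ` ?R" using False fin by (intro Max_in) auto
  then obtain j where j: "j \<in> ?R" "bneck_edge j = Max (bneck_edge ` ?R)" by auto
  have "card (?R - {j}) \<le> 7"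
  proof (rule few_at_bottleneck[OF Z large])
    fix k assume k: "k \<in> ?R - {j}"
    then have "bneck_edge k \<le> bneck_edge j" unfolding j(2) using fin by (intro Max_ge) auto
    then show "src k \<le> bneck_edge j \<and> bneck_edge j < snk k \<and> bot j < bottleneck k"
      using j(1) k bneck_edge[of k] Zn by (auto simp: left_above_def)
  qed (use j in auto)
  then show ?thesis using j(1) fin by (auto simp: card_Diff_singleton)
next
  case True
  show ?thesis by (subst True) simp
qed

text \<open>The out-degree is at most 7 + 8 + 8 = 23 by \<open>near\<close>,
  \<open>right_above\<close> and \<open>left_above\<close>, hence 2 * 23 + 1 = 47 colours suffice;
  every colour class is packed, and one of them carries the average weight.\<close>

lemma large_feasible_packed:
  assumes Z: "feasible I Z" and large: "\<And>i. i \<in> Z \<Longrightarrow> large i"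
  obtains S where "packed S" "total_weight I Z \<le> 47 * total_weight I S"
proof -
  have Zn: "Z \<subseteq> {..<n}" using Z by (auto simp: feasible_iff)
  have finZ: "finite Z" using feasible_finite[OF Z] .
  let ?N = "\<lambda>i j. near i j \<or> right_above i j \<or> left_above i j"
  have out: "card {j \<in> Z. ?N i j} \<le> 23" if i: "i \<in> Z" for i
  proof -
    have "{j \<in> Z. ?N i j} = {j \<in> Z. near i j} \<union> ({j \<in> Z. right_above i j} \<union> {j \<in> Z. left_above i j})"
      by auto
    then have "card {j \<in> Z. ?N i j} \<le>
      card {j \<in> Z. near i j} + (card {j \<in> Z. right_above i j} + card {j \<in> Z. left_above i j})"
      by (metis (no_types, lifting) card_Un_le add_left_mono order.trans)
    moreover have "card {j \<in> Z. near i j} \<le> 7"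
      by (rule few_at_bottleneck[OF Z large i]) (auto simp: near_def)
    ultimately show ?thesis
      using card_right_above[OF Z large i] card_left_above[OF Z large i] by linarith
  qed
  have "\<exists>f :: nat \<Rightarrow> nat. (\<forall>i\<in>Z. f i \<le> 2 * 23) \<and>
    (\<forall>i\<in>Z. \<forall>j\<in>Z. i \<noteq> j \<and> (?N i j \<or> ?N j i) \<longrightarrow> f i \<noteq> f j)"
    by (rule coloring_of_bounded_outdegree[OF finZ out])
  then obtain f :: "nat \<Rightarrow> nat" where "(\<forall>i\<in>Z. f i \<le> 2 * 23) \<and>
    (\<forall>i\<in>Z. \<forall>j\<in>Z. i \<noteq> j \<and> (?N i j \<or> ?N j i) \<longrightarrow> f i \<noteq> f j)" ..
  then have f: "\<And>i. i \<in> Z \<Longrightarrow> f i \<le> 46"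
    "\<And>i j. i \<in> Z \<Longrightarrow> j \<in> Z \<Longrightarrow> i \<noteq> j \<Longrightarrow> ?N i j \<or> ?N j i \<Longrightarrow> f i \<noteq> f j"
    by simp_all
  have packed: "packed {i \<in> Z. f i = k}" for k
    unfolding packed_def
  proof (intro conjI ballI impI)
    show "inj_on bg {i \<in> Z. f i = k}" using Z by (auto simp: feasible_iff inj_on_def)
    show "{i \<in> Z. f i = k} \<subseteq> {i. i < n \<and> large i}" using Zn large by auto
    fix i j assume ij: "i \<in> {i \<in> Z. f i = k}" "j \<in> {i \<in> Z. f i = k}" "i \<noteq> j"
    show "\<not> conflict i j"
    proof
      assume c: "conflict i j"
      then have "conflict j i" by (auto simp: conflict_def)
      then have "?N i j \<or> ?N j i"
        using conflict_cases[of i j] conflict_cases[of j i] c ij Zn by (metis (no_types, lifting)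
            lessThan_iff linear mem_Collect_eq subsetD)
      then show False using f(2)[of i j] ij by auto
    qed
  qed
  have "\<exists>k\<le>46. total_weight I Z \<le> 47 * total_weight I {i \<in> Z. f i = k}"
  proof (rule ccontr)
    assume neg: "\<not> ?thesis"
    have "f ` Z \<subseteq> {..46}" using f(1) by auto
    then have "total_weight I Z = (\<Sum>k\<le>46. total_weight I {i \<in> Z. f i = k})"
      unfolding total_weight_eq by (rule sum.group[OF finZ finite_atMost, symmetric])
    then have "47 * total_weight I Z = (\<Sum>k\<le>46. 47 * total_weight I {i \<in> Z. f i = k})"
      by (simp only: sum_distrib_left)
    also have "\<dots> < (\<Sum>k\<le>(46::nat). total_weight I Z)"
      using neg by (intro sum_strict_mono) auto
    finally show False by simp
  qed
  then show ?thesis using packed that by blast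
qed

end

section \<open>Multiplicative weights and derandomized rounding\<close>

lemma affine_on_segment:
  fixes a b q z :: real
  assumes "0 \<le> z" "z \<le> q"
  shows "a + b * z \<le> max a (a + b * q)"
proof (cases "b \<ge> 0")
  case True
  then show ?thesis using assms mult_left_mono[of z q b] by linarith
next
  case False
  then show ?thesis using assms mult_nonpos_nonneg[of b z] by linarith
qed

text \<open>The coefficients may depend on all other coordinates of \<open>P\<close>. This is
  multilinearity one variable at a time, which is what conditional expectations of independent
  choices satisfy.\<close>

definition affine_in :: "nat \<Rightarrow> ((nat \<Rightarrow> nat) \<Rightarrow> real) \<Rightarrow> bool" where
  "affine_in i F \<longleftrightarrow> (\<forall>P. \<exists>a b. \<forall>z. F (P(i := z)) = a + b * real z)"

definition constant_in :: "nat \<Rightarrow> ((nat \<Rightarrow> nat) \<Rightarrow> real) \<Rightarrow> bool" where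
  "constant_in i F \<longleftrightarrow> (\<forall>P z. F (P(i := z)) = F P)"

lemma affine_inI: "(\<And>P z. F (P(i := z)) = a P + b P * real z) \<Longrightarrow> affine_in i F"
  unfolding affine_in_def by metis

lemma affine_inD: "affine_in i F \<Longrightarrow> \<exists>a b. \<forall>z. F (P(i := z)) = a + b * real z"
  by (simp add: affine_in_def)

lemma affine_in_coord: "affine_in i (\<lambda>P. real (P j))"
  by (rule affine_inI[of _ _ "\<lambda>P. if i = j then 0 else real (P j)" "\<lambda>P. if i = j then 1 else 0"]) auto

lemma constant_in_coord: "i \<noteq> j \<Longrightarrow> constant_in i (\<lambda>P. real (P j))"
  by (simp add: constant_in_def)

lemma constant_in_const: "constant_in i (\<lambda>P. c)"
  by (simp add: constant_in_def)

lemma affine_in_const: "affine_in i (\<lambda>P. c)"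
  by (rule affine_inI[of _ _ "\<lambda>_. c" "\<lambda>_. 0"]) simp

lemma affine_in_mult:
  assumes F: "constant_in i F" and G: "affine_in i G"
  shows "affine_in i (\<lambda>P. F P * G P)"
  unfolding affine_in_def
proof
  fix P
  obtain a b where "\<forall>z. G (P(i := z)) = a + b * real z" using affine_inD[OF G] by blast
  then have "\<forall>z. F (P(i := z)) * G (P(i := z)) = F P * a + (F P * b) * real z"
    using F by (simp add: constant_in_def algebra_simps)
  then show "\<exists>a b. \<forall>z. F (P(i := z)) * G (P(i := z)) = a + b * real z" by blast
qed

lemma affine_in_add:
  assumes F: "affine_in i F" and G: "affine_in i G"
  shows "affine_in i (\<lambda>P. F P + G P)"
  unfolding affine_in_def
proof
  fix P
  obtain a b where "\<forall>z. F (P(i := z)) = a + b * real z" using affine_inD[OF F] by blast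
  moreover obtain c d where "\<forall>z. G (P(i := z)) = c + d * real z" using affine_inD[OF G] by blast
  ultimately have "\<forall>z. F (P(i := z)) + G (P(i := z)) = (a + c) + (b + d) * real z"
    by (simp add: algebra_simps)
  then show "\<exists>a b. \<forall>z. F (P(i := z)) + G (P(i := z)) = a + b * real z" by blast
qed

lemma affine_in_cmult: "affine_in i F \<Longrightarrow> affine_in i (\<lambda>P. c * F P)"
  by (rule affine_in_mult[OF constant_in_const])

lemma affine_in_diff:
  assumes F: "affine_in i F" and G: "affine_in i G"
  shows "affine_in i (\<lambda>P. F P - G P)"
  using affine_in_add[OF F affine_in_cmult[OF G, of "-1"]] by simp

lemma affine_in_sum:
  assumes "\<And>k. k \<in> A \<Longrightarrow> affine_in i (F k)"
  shows "affine_in i (\<lambda>P. \<Sum>k\<in>A. F k P)"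
  using assms
proof (induction A rule: infinite_finite_induct)
  case (insert x A)
  then show ?case using affine_in_add[of i "F x" "\<lambda>P. \<Sum>k\<in>A. F k P"] by simp
qed (simp_all add: affine_in_const)

text \<open>At most one factor may move with coordinate \<open>i\<close>; the product of the others
  is a constant coefficient.\<close>

lemma affine_in_prod:
  assumes "finite A" "\<And>k. k \<in> A \<Longrightarrow> k \<noteq> i \<Longrightarrow> constant_in i (F k)" "affine_in i (F i)"
  shows "affine_in i (\<lambda>P. \<Prod>k\<in>A. F k P)"
proof -
  have const: "constant_in i (\<lambda>P. \<Prod>k\<in>A - {i}. F k P)"
    using assms(2) by (auto simp: constant_in_def)
  show ?thesis
  proof (cases "i \<in> A")
    case True
    then have "(\<lambda>P. \<Prod>k\<in>A. F k P) = (\<lambda>P. (\<Prod>k\<in>A - {i}. F k P) * F i P)"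
      using assms(1) by (auto simp: prod.remove[of A i] mult.commute)
    then show ?thesis using affine_in_mult[OF const assms(3)] by simp
  next
    case False
    then show ?thesis using affine_in_mult[OF const affine_in_const[of i 1]] by simp
  qed
qed

section \<open>Fractional packing of rectangles by multiplicative weights\<close>

context bagufp_instance
begin

definition covers :: "nat \<Rightarrow> nat \<Rightarrow> nat \<Rightarrow> bool" where
  "covers j x y \<longleftrightarrow> src j \<le> x \<and> x < snk j \<and> bot j \<le> y \<and> y < bottleneck j"

text \<open>The columns of the lower corners of all rectangles: left ends for \<open>p < n\<close>,
  last edges for the next \<open>n\<close> indices. They contain every point that is tested in
  \<open>blocks\<close>, and also the common point of a chain of piercing rectangles.\<close>

definition xcoord :: "nat \<Rightarrow> nat" where
  "xcoord p = (if p < n then src p else snk (p - n) - 1)"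

text \<open>
  Constraint \<open>p * n + q\<close> says that the point with horizontal coordinate \<open>xcoord p\<close> at height \<open>bot q\<close>
  is covered at most once if \<open>p < 2 * n\<close>, and that the bag of \<open>q\<close> is used at most once if \<open>p = 2 * n\<close>.
\<close>

definition num_constraints :: nat where
  "num_constraints = (2 * n + 1) * n"

definition incident :: "nat \<Rightarrow> nat \<Rightarrow> bool" where
  "incident i c \<longleftrightarrow> large i \<and>
     (if c div n < 2 * n then covers i (xcoord (c div n)) (bot (c mod n)) else bg i = bg (c mod n))"

text \<open>Deliberately asymmetric: only the lower corners of \<open>i\<close> are tested. A
  rectangle may contain many others, so charging every intersection would lose too much, whereas
  three constraints capture all blockers of \<open>i\<close>.\<close>

definition blocks :: "nat \<Rightarrow> nat \<Rightarrow> bool" where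
  "blocks j i \<longleftrightarrow> i \<noteq> j \<and> large j \<and>
     (bg i = bg j \<or> covers j (src i) (bot i) \<or> covers j (snk i - 1) (bot i))"

text \<open>A packed set is an integral solution of the constraint system: rectangles that cover a
  common point are in conflict.\<close>

lemma packed_incident:
  assumes "packed S" "i \<in> S" "j \<in> S" "incident i c" "incident j c"
  shows "i = j"
proof (rule ccontr)
  assume ne: "i \<noteq> j"
  then have "\<not> conflict i j" "bg i \<noteq> bg j" using assms(1-3) by (auto simp: packed_def inj_on_def)
  then show False
    using assms(4,5) by (auto simp: incident_def covers_def conflict_def split: if_splits)
qed

definition usage :: "(nat \<Rightarrow> nat) \<Rightarrow> nat \<Rightarrow> nat" where
  "usage x c = (\<Sum>i | i < n \<and> incident i c. x i)"

text \<open>Exponential prices with base 2, so that raising a multiplicity by one doubles the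
  incident prices and all quantities remain integers.\<close>

definition price :: "(nat \<Rightarrow> nat) \<Rightarrow> nat \<Rightarrow> nat" where
  "price x c = 2 ^ usage x c"

definition volume :: "(nat \<Rightarrow> nat) \<Rightarrow> nat" where
  "volume x = (\<Sum>c < num_constraints. price x c)"

definition length_of :: "(nat \<Rightarrow> nat) \<Rightarrow> nat \<Rightarrow> nat" where
  "length_of x i = (\<Sum>c | c < num_constraints \<and> incident i c. price x c)"

lemma usage_bump:
  assumes "k < n"
  shows "usage (x(k := x k + 1)) c = usage x c + of_bool (incident k c)"
proof -
  let ?A = "{i. i < n \<and> incident i c}"
  have "usage (x(k := x k + 1)) c = (\<Sum>i\<in>?A. x i + of_bool (i = k))"
    unfolding usage_def by (intro sum.cong) auto
  also have "\<dots> = usage x c + (\<Sum>i\<in>?A. of_bool (i = k))"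
    by (simp add: usage_def sum.distrib)
  also have "(\<Sum>i\<in>?A. of_bool (i = k)) = (of_bool (incident k c) :: nat)"
    using assms by (auto simp: of_bool_def sum.delta)
  finally show ?thesis .
qed

lemma price_bump:
  assumes "k < n"
  shows "price (x(k := x k + 1)) c = (if incident k c then 2 * price x c else price x c)"
  unfolding price_def usage_bump[OF assms] by auto

lemma volume_bump:
  assumes "k < n"
  shows "volume (x(k := x k + 1)) = volume x + length_of x k"
proof -
  have "volume (x(k := x k + 1)) = (\<Sum>c < num_constraints. price x c + (if incident k c then price x c else 0))"
    unfolding volume_def price_bump[OF assms] by (intro sum.cong) auto
  then show ?thesis
    by (simp add: sum.distrib volume_def length_of_def sum.inter_filter[symmetric] lessThan_def)
qed

lemma length_of_le_volume: "length_of x i \<le> volume x"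
  unfolding length_of_def volume_def by (intro sum_mono2) auto

text \<open>The three constraints that belong to \<open>i\<close>: its bag, its lower left corner
  and its lower right corner. Every blocker of \<open>i\<close> is incident to one of them.\<close>

lemma own_constraints:
  assumes "i < n" "large i"
  shows "2 * n * n + i < num_constraints" "incident j (2 * n * n + i) \<longleftrightarrow> large j \<and> bg j = bg i"
    "i * n + i < num_constraints" "incident j (i * n + i) \<longleftrightarrow> large j \<and> covers j (src i) (bot i)"
    "(n + i) * n + i < num_constraints"
    "incident j ((n + i) * n + i) \<longleftrightarrow> large j \<and> covers j (snk i - 1) (bot i)"
proof -
  have "i * n + i < (i + 1) * n" "(n + i) * n + i < (n + i + 1) * n" "2 * n * n + i < (2 * n + 1) * n"
    using assms(1) by auto
  moreover have "(i + 1) * n \<le> (2 * n + 1) * n" "(n + i + 1) * n \<le> (2 * n + 1) * n"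
    using assms(1) by (intro mult_le_mono1; simp)+
  ultimately show "2 * n * n + i < num_constraints" "i * n + i < num_constraints"
    "(n + i) * n + i < num_constraints"
    unfolding num_constraints_def by linarith+
  have d: "(q * n + i) div n = q" "(q * n + i) mod n = i" for q using assms(1) by auto
  show "incident j (2 * n * n + i) \<longleftrightarrow> large j \<and> bg j = bg i"
    unfolding incident_def d by simp
  show "incident j (i * n + i) \<longleftrightarrow> large j \<and> covers j (src i) (bot i)"
    unfolding incident_def d using assms(1) by (simp add: xcoord_def)
  show "incident j ((n + i) * n + i) \<longleftrightarrow> large j \<and> covers j (snk i - 1) (bot i)"
    unfolding incident_def d using assms(1) by (simp add: xcoord_def)
qed

lemma length_of_pos: "i < n \<Longrightarrow> large i \<Longrightarrow> 0 < length_of x i"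
  unfolding length_of_def using own_constraints(1,2)[of i]
  by (intro sum_pos2[of _ "2 * n * n + i"]) (auto simp: price_def)

text \<open>The usual potential bound of multiplicative weights. It is stated for every packed
  \<open>S\<close> at once, so the algorithm never has to know the best packing or guess its
  weight.\<close>

definition mw_invariant :: "(nat \<Rightarrow> nat) \<Rightarrow> bool" where
  "mw_invariant x \<longleftrightarrow> (\<forall>i < n. \<not> large i \<longrightarrow> x i = 0) \<and>
     (\<forall>S. packed S \<and> total_weight I S > 0 \<longrightarrow>
        real (volume x) \<le> real num_constraints * exp ((\<Sum>i<n. real (wt i * x i)) / real (total_weight I S)))"

lemma mw_invariant_init: "mw_invariant (\<lambda>_. 0)"
  by (simp add: mw_invariant_def volume_def price_def usage_def)

text \<open>Every constraint meets \<open>S\<close> at most once, so the lengths of the members of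
  \<open>S\<close> sum to at most the volume. The task of least length per weight therefore has
  length at most \<open>volume x * wt k / W\<close>, with \<open>W\<close> the weight of
  \<open>S\<close>, and the volume grows by at most the factor 1 + wt k / W, which is below the
  exponential.\<close>

lemma mw_invariant_step:
  assumes x: "mw_invariant x" and k: "k < n" "large k"
    and min: "\<And>i. i < n \<Longrightarrow> large i \<Longrightarrow> length_of x k * wt i \<le> length_of x i * wt k"
  shows "mw_invariant (x(k := x k + 1))"
proof -
  have "real (volume (x(k := x k + 1))) \<le>
      real num_constraints * exp ((\<Sum>i<n. real (wt i * (x(k := x k + 1)) i)) / real (total_weight I S))"
    if S: "packed S" "total_weight I S > 0" for S
  proof -
    let ?W = "total_weight I S"
    have "length_of x k * ?W = (\<Sum>i\<in>S. length_of x k * wt i)"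
      by (simp add: total_weight_eq sum_distrib_left)
    also have "\<dots> \<le> (\<Sum>i\<in>S. length_of x i * wt k)"
      using S(1) min by (intro sum_mono) (auto simp: packed_def)
    also have "\<dots> = wt k * (\<Sum>i\<in>S. \<Sum>c<num_constraints. if incident i c then price x c else 0)"
      by (simp add: sum_distrib_left length_of_def mult.commute sum.inter_filter[symmetric] lessThan_def)
    also have "(\<Sum>i\<in>S. \<Sum>c<num_constraints. if incident i c then price x c else 0) =
        (\<Sum>c<num_constraints. \<Sum>i\<in>S. if incident i c then price x c else 0)"
      by (rule sum.swap)
    also have "\<dots> \<le> volume x"
      unfolding volume_def
    proof (rule sum_mono)
      fix c
      have "(\<Sum>i\<in>S. if incident i c then price x c else 0) = card {i\<in>S. incident i c} * price x c"
        using packed_finite[OF S(1)] by (simp add: sum.inter_filter[symmetric])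
      also have "card {i\<in>S. incident i c} \<le> Suc 0"
        using packed_finite[OF S(1)] packed_incident[OF S(1)] by (subst card_le_Suc0_iff_eq) auto
      finally show "(\<Sum>i\<in>S. if incident i c then price x c else 0) \<le> price x c" by simp
    qed
    finally have "length_of x k * ?W \<le> wt k * volume x" by simp
    then have "real (length_of x k) * real ?W \<le> real (wt k) * real (volume x)"
      by (simp only: of_nat_mult[symmetric] of_nat_le_iff)
    then have "real (length_of x k) \<le> real (volume x) * (real (wt k) / real ?W)"
      using S(2) by (simp add: field_simps)
    then have "real (volume (x(k := x k + 1))) \<le> real (volume x) * (1 + real (wt k) / real ?W)"
      unfolding volume_bump[OF k(1)] by (simp add: algebra_simps)
    also have "\<dots> \<le> real (volume x) * exp (real (wt k) / real ?W)"
      by (intro mult_left_mono exp_ge_add_one_self) auto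
    also have "\<dots> \<le> real num_constraints * exp ((\<Sum>i<n. real (wt i * x i)) / real ?W) *
        exp (real (wt k) / real ?W)"
      using x S by (intro mult_right_mono) (auto simp: mw_invariant_def)
    also have "\<dots> = real num_constraints * exp (((\<Sum>i<n. real (wt i * x i)) + real (wt k)) / real ?W)"
      by (simp add: add_divide_distrib exp_add)
    also have "(\<Sum>i<n. real (wt i * x i)) + real (wt k) = (\<Sum>i<n. real (wt i * (x(k := x k + 1)) i))"
    proof -
      have "(\<Sum>i<n. real (wt i * (x(k := x k + 1)) i)) =
          (\<Sum>i<n. real (wt i * x i) + (if i = k then real (wt k) else 0))"
        by (intro sum.cong) (auto simp: algebra_simps)
      then show ?thesis using k(1) by (simp add: sum.distrib)
    qed
    finally show ?thesis .
  qed
  then show ?thesis using x k by (auto simp: mw_invariant_def)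
qed

definition lg :: nat where
  "lg = (LEAST l. n \<le> 2 ^ l)"

lemma le_lg: "n \<le> 2 ^ lg"
  unfolding lg_def by (rule LeastI[of _ n]) (simp add: less_imp_le)

lemma lg_least: "n \<le> 2 ^ l \<Longrightarrow> lg \<le> l"
  unfolding lg_def by (rule Least_le)

lemma power_lg_le: "2 ^ lg \<le> 2 * n + 1"
proof (cases lg)
  case (Suc l)
  then have "\<not> n \<le> 2 ^ l" using lg_least[of l] by auto
  then show ?thesis using Suc by simp
qed simp

text \<open>The constants fit together as follows. \<open>limit\<close> exceeds the bound on
  \<open>num_constraints\<close> by the factor \<open>4 ^ (lg + 1)\<close>, forcing total weight
  \<open>lg + 1\<close> times the best packing. \<open>depth\<close> is the binary logarithm of
  \<open>2 * limit\<close> and thus bounds every usage. With \<open>denom = 6 * depth\<close> the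
  expected number of sampled blockers is at most 1/2. \<open>base\<close> grows like log n, and
  \<open>threshold\<close> makes the initial penalty at most 1/128 of the scale on which the weight
  is measured.\<close>

definition limit :: nat where "limit = 16 * (2 ^ lg) ^ 4"
definition depth :: nat where "depth = 4 * lg + 5"
definition denom :: nat where "denom = 6 * depth"
definition base :: nat where "base = lg + 2"
definition threshold :: nat where "threshold = 1024 * (2 ^ lg) ^ 4"

lemma denom_pos: "0 < denom" by (simp add: denom_def depth_def)

lemma num_constraints_le: "num_constraints \<le> 4 * (2 ^ lg) ^ 2"
proof (cases "n = 0")
  case False
  then have "num_constraints \<le> (3 * n) * n" unfolding num_constraints_def by (intro mult_le_mono1) simp
  also have "\<dots> \<le> 4 * (n * n)" by simp
  also have "\<dots> \<le> 4 * (2 ^ lg * 2 ^ lg)" by (intro mult_le_mono le_lg order.refl)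
  finally show ?thesis by (simp add: power2_eq_square)
qed (simp add: num_constraints_def)

lemma limit_eq: "limit = 2 ^ (4 * lg + 4)"
  unfolding limit_def by (simp add: power_add power_mult mult.commute)

lemma threshold_eq: "threshold = 2 ^ (4 * lg + 10)"
  unfolding threshold_def by (simp add: power_add power_mult mult.commute)

lemma usage_less_depth:
  assumes "volume x < 2 * limit" "c < num_constraints"
  shows "usage x c < depth"
proof -
  have "price x c \<le> volume x" unfolding volume_def using assms(2) by (intro member_le_sum) auto
  then have "(2::nat) ^ usage x c < 2 ^ depth"
    using assms(1) by (simp add: price_def limit_eq depth_def numeral_eq_Suc)
  then show ?thesis by simp
qed

text \<open>Dividing \<open>limit\<close> by the bound on the number of constraints leaves
  \<open>4 ^ (lg + 1)\<close>, so the exponential in the invariant is at least this large, and in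
  particular at least the exponential of \<open>lg + 1\<close>.\<close>

lemma mw_result:
  assumes x: "mw_invariant x" and v: "limit \<le> volume x" and S: "packed S"
  shows "real ((lg + 1) * total_weight I S) \<le> (\<Sum>i<n. real (wt i * x i))"
proof (cases "total_weight I S = 0")
  case False
  define z where "z = (\<Sum>i<n. real (wt i * x i)) / real (total_weight I S)"
  have "real limit \<le> real num_constraints * exp z"
    using x v S False unfolding mw_invariant_def z_def by (meson of_nat_le_iff order.trans gr0I)
  also have "\<dots> \<le> real (4 * (2 ^ lg) ^ 2) * exp z"
    using num_constraints_le by (intro mult_right_mono) (auto simp only: of_nat_le_iff exp_ge_zero)
  finally have le: "real limit \<le> real (4 * (2 ^ lg) ^ 2) * exp z" .
  have "real limit = real (4 * (2 ^ lg) ^ 2) * (4 * 4 ^ lg)"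
  proof -
    have "(4::real) ^ lg = 2 ^ lg * 2 ^ lg" by (simp flip: power_mult_distrib)
    then show ?thesis by (simp add: limit_def power4_eq_xxxx power2_eq_square)
  qed
  with le have "real (4 * (2 ^ lg) ^ 2) * (4 * 4 ^ lg) \<le> real (4 * (2 ^ lg) ^ 2) * exp z"
    by (simp only:)
  then have "4 * 4 ^ lg \<le> exp z" by (rule mult_left_le_imp_le) simp
  moreover have "exp (real (lg + 1)) \<le> 4 * (4::real) ^ lg"
  proof -
    have "exp (1::real) \<le> 4" using exp_le by simp
    then have "exp (1::real) ^ (lg + 1) \<le> 4 ^ (lg + 1)" by (rule power_mono) simp
    then have "exp (real (lg + 1)) \<le> 4 ^ Suc lg"
      by (simp only: exp_of_nat_mult[symmetric] mult_1_right Suc_eq_plus1)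
    then show ?thesis by (simp only: power_Suc)
  qed
  ultimately have "exp (real (lg + 1)) \<le> exp z" by linarith
  then have "real (lg + 1) \<le> z" by (simp only: exp_le_cancel_iff)
  then show ?thesis using False by (simp add: z_def field_simps)
qed (auto intro!: sum_nonneg)

end

lemma sum_Un_le:
  fixes f :: "'a \<Rightarrow> nat"
  assumes "finite A" "finite B"
  shows "sum f (A \<union> B) \<le> sum f A + sum f B"
  using sum.union_inter[OF assms, of f] by linarith

section \<open>The potential of the rounding and its values before and after\<close>

context bagufp_instance
begin

definition gain :: "(nat \<Rightarrow> nat) \<Rightarrow> nat" where
  "gain P = (\<Sum>i<n. wt i * P i)"

definition clash :: "(nat \<Rightarrow> nat) \<Rightarrow> nat" where
  "clash P = (\<Sum>i<n. \<Sum>j | j < n \<and> blocks j i. wt i * P i * P j)"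

text \<open>Divided by \<open>denom ^ n\<close>, the product is the expectation of
  \<open>base\<close> to the number of sampled incident tasks: by independence it factors into the
  terms 1 + (base - 1) * P i / denom.\<close>

definition overload :: "(nat \<Rightarrow> nat) \<Rightarrow> nat" where
  "overload P = (\<Sum>c<num_constraints. \<Prod>i<n. denom + (if incident i c then (base - 1) * P i else 0))"

definition large_weight :: nat where
  "large_weight = (\<Sum>i | i < n \<and> large i. wt i)"

text \<open>
  If every task \<open>i\<close> is sampled independently with probability \<open>P i / denom\<close>, then \<open>credit P - debit P\<close>
  is, up to scaling, the expectation of the sampled weight, minus the weight lost to sampled
  blockers, minus an exponential penalty for the number of sampled tasks in each constraint.
\<close>

definition credit :: "(nat \<Rightarrow> nat) \<Rightarrow> nat" where
  "credit P = threshold * denom ^ n * denom * gain P"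

definition debit :: "(nat \<Rightarrow> nat) \<Rightarrow> nat" where
  "debit P = threshold * denom ^ n * clash P + large_weight * denom ^ 2 * overload P"

definition potential :: "(nat \<Rightarrow> nat) \<Rightarrow> real" where
  "potential P = real (credit P) - real (debit P)"

lemma blocks_irrefl: "\<not> blocks i i"
  by (simp add: blocks_def)

text \<open>No task blocks itself, so \<open>clash\<close> contains no square of a coordinate, and
  in each product of \<open>overload\<close> a coordinate occurs in only one factor.\<close>

lemma affine_in_potential: "affine_in k potential"
proof -
  have 1: "affine_in k (\<lambda>P. \<Sum>i<n. real (wt i) * real (P i))"
    by (intro affine_in_sum affine_in_cmult affine_in_coord)
  have 2: "affine_in k (\<lambda>P. \<Sum>i<n. \<Sum>j | j < n \<and> blocks j i. real (wt i) * (real (P i) * real (P j)))"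
  proof (intro affine_in_sum affine_in_cmult)
    fix i j assume "j \<in> {j. j < n \<and> blocks j i}"
    then have "i \<noteq> j" using blocks_irrefl by auto
    show "affine_in k (\<lambda>P. real (P i) * real (P j))"
    proof (cases "k = i")
      case True
      then have "affine_in k (\<lambda>P. real (P j) * real (P i))"
        using \<open>i \<noteq> j\<close> by (intro affine_in_mult constant_in_coord affine_in_coord) auto
      then show ?thesis by (simp add: mult.commute)
    next
      case False
      then show ?thesis by (intro affine_in_mult constant_in_coord affine_in_coord)
    qed
  qed
  have 3: "affine_in k (\<lambda>P. \<Sum>c<num_constraints. \<Prod>i<n. real denom +
      (if incident i c then real (base - 1) else 0) * real (P i))"
  proof (intro affine_in_sum affine_in_prod)
    fix c i assume "i \<noteq> k"
    then show "constant_in k (\<lambda>P. real denom + (if incident i c then real (base - 1) else 0) * real (P i))"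
      by (simp add: constant_in_def)
  qed (auto intro!: affine_in_add affine_in_const affine_in_cmult affine_in_coord)
  have eq: "potential = (\<lambda>P. (real threshold * real denom ^ n * real denom) * (\<Sum>i<n. real (wt i) * real (P i)) -
      ((real threshold * real denom ^ n) * (\<Sum>i<n. \<Sum>j | j < n \<and> blocks j i. real (wt i) * (real (P i) * real (P j))) +
       (real large_weight * real denom ^ 2) * (\<Sum>c<num_constraints. \<Prod>i<n. real denom +
      (if incident i c then real (base - 1) else 0) * real (P i))))"
  proof
    fix P
    have "real (overload P) = (\<Sum>c<num_constraints. \<Prod>i<n. real denom +
      (if incident i c then real (base - 1) else 0) * real (P i))"
      unfolding overload_def of_nat_sum of_nat_prod by (intro sum.cong prod.cong) auto
    moreover have "real (clash P) = (\<Sum>i<n. \<Sum>j | j < n \<and> blocks j i. real (wt i) * (real (P i) * real (P j)))"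
      unfolding clash_def by (simp add: mult.assoc)
    moreover have "real (gain P) = (\<Sum>i<n. real (wt i) * real (P i))"
      unfolding gain_def by simp
    ultimately show "potential P = (real threshold * real denom ^ n * real denom) * (\<Sum>i<n. real (wt i) * real (P i)) -
      ((real threshold * real denom ^ n) * (\<Sum>i<n. \<Sum>j | j < n \<and> blocks j i. real (wt i) * (real (P i) * real (P j))) +
       (real large_weight * real denom ^ 2) * (\<Sum>c<num_constraints. \<Prod>i<n. real denom +
      (if incident i c then real (base - 1) else 0) * real (P i)))"
      unfolding potential_def credit_def debit_def by (simp only: of_nat_mult of_nat_add of_nat_power)
  qed
  show ?thesis unfolding eq
    by (intro affine_in_diff affine_in_add affine_in_cmult 1 2 3)
qed

text \<open>Compares the potentials at the two ends of the segment, written without subtraction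
  because the machine computes with naturals.\<close>

definition round_step :: "nat \<Rightarrow> (nat \<Rightarrow> nat) \<Rightarrow> nat \<Rightarrow> nat" where
  "round_step i P =
     (if credit (P(i := 0)) + debit (P(i := denom)) \<le> credit (P(i := denom)) + debit (P(i := 0))
      then P(i := denom) else P(i := 0))"

text \<open>An affine function on the segment from 0 to \<open>denom\<close> is largest at an end,
  and \<open>round_step\<close> selects the better end.\<close>

lemma potential_round_step:
  assumes "P i \<le> denom"
  shows "potential P \<le> potential (round_step i P)"
proof -
  obtain a b where ab: "\<And>z. potential (P(i := z)) = a + b * real z"
    using affine_inD[OF affine_in_potential[of i], of P] by blast
  have "potential P = a + b * real (P i)" using ab[of "P i"] by simp
  also have "\<dots> \<le> max (a + b * real 0) (a + b * real denom)"
    using affine_on_segment[of "real (P i)" "real denom" a b] assms by simp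
  also have "\<dots> = max (potential (P(i := 0))) (potential (P(i := denom)))" by (simp only: ab)
  also have "\<dots> = potential (round_step i P)"
  proof (cases "credit (P(i := 0)) + debit (P(i := denom)) \<le> credit (P(i := denom)) + debit (P(i := 0))")
    case True
    then have "real (credit (P(i := 0))) + real (debit (P(i := denom))) \<le>
      real (credit (P(i := denom))) + real (debit (P(i := 0)))"
      by (simp only: of_nat_add[symmetric] of_nat_le_iff)
    then show ?thesis using True by (simp add: potential_def round_step_def)
  next
    case False
    then have "real (credit (P(i := denom))) + real (debit (P(i := 0))) \<le>
      real (credit (P(i := 0))) + real (debit (P(i := denom)))"
      by (simp only: of_nat_add[symmetric] of_nat_le_iff)
    then show ?thesis using False by (simp add: potential_def round_step_def)
  qed
  finally show ?thesis .
qed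

text \<open>The blockers of \<open>i\<close> are incident to its three own constraints, so their
  multiplicities sum to at most \<open>3 * depth\<close>, which is half of
  \<open>denom\<close>.\<close>

lemma clash_le:
  assumes u: "\<And>c. c < num_constraints \<Longrightarrow> usage x c < depth"
    and x0: "\<And>i. i < n \<Longrightarrow> \<not> large i \<Longrightarrow> x i = 0"
  shows "2 * clash x \<le> denom * gain x"
proof -
  have "2 * (\<Sum>j | j < n \<and> blocks j i. wt i * x i * x j) \<le> denom * (wt i * x i)" if i: "i < n" for i
  proof (cases "large i")
    case True
    note own = own_constraints[OF i True]
    have "(\<Sum>j | j < n \<and> blocks j i. x j) \<le>
      (\<Sum>j \<in> {j. j < n \<and> incident j (2 * n * n + i)} \<union>
        ({j. j < n \<and> incident j (i * n + i)} \<union> {j. j < n \<and> incident j ((n + i) * n + i)}). x j)"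
      by (intro sum_mono2) (auto simp: blocks_def own)
    also have "\<dots> \<le> usage x (2 * n * n + i) + (usage x (i * n + i) + usage x ((n + i) * n + i))"
      unfolding usage_def
      by (intro order.trans[OF sum_Un_le] add_left_mono) auto
    also have "\<dots> \<le> 3 * depth" using u[OF own(1)] u[OF own(3)] u[OF own(5)] by linarith
    finally have "2 * (\<Sum>j | j < n \<and> blocks j i. x j) \<le> denom" by (simp add: denom_def)
    then have "(wt i * x i) * (2 * (\<Sum>j | j < n \<and> blocks j i. x j)) \<le> (wt i * x i) * denom"
      by (rule mult_le_mono2)
    then show ?thesis by (simp add: sum_distrib_left mult.commute mult.left_commute)
  next
    case False
    then show ?thesis using x0[OF i] by simp
  qed
  then show ?thesis
    unfolding clash_def gain_def sum_distrib_left by (intro sum_mono) (auto simp: sum_distrib_left)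
qed

text \<open>With 1 + t \<le> exp t the product is governed by the exponent usage * (base - 1) /
  denom; \<open>depth\<close> cancels and leaves at most (lg + 1) / 6, and exp (1/6) is below
  2.\<close>

lemma overload_le:
  assumes u: "\<And>c. c < num_constraints \<Longrightarrow> usage x c < depth"
  shows "real (overload x) \<le> real (num_constraints * denom ^ n * 2 ^ (lg + 1))"
proof -
  have "(\<Prod>i<n. real denom + (if incident i c then real (base - 1) * real (x i) else 0)) \<le>
      real denom ^ n * 2 ^ (lg + 1)" if c: "c < num_constraints" for c
  proof -
    let ?e = "\<lambda>i. (if incident i c then real (x i) else 0) * (real (base - 1) / real denom)"
    have "(\<Prod>i<n. real denom + (if incident i c then real (base - 1) * real (x i) else 0)) \<le>
        (\<Prod>i<n. real denom * exp (?e i))"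
    proof (rule prod_mono, intro conjI)
      fix i
      have "real denom + (if incident i c then real (base - 1) * real (x i) else 0) = real denom * (1 + ?e i)"
        using denom_pos by (simp add: field_simps)
      also have "\<dots> \<le> real denom * exp (?e i)" by (intro mult_left_mono exp_ge_add_one_self) auto
      finally show "real denom + (if incident i c then real (base - 1) * real (x i) else 0) \<le>
        real denom * exp (?e i)" .
    qed auto
    also have "\<dots> = real denom ^ n * exp (\<Sum>i<n. ?e i)"
      by (simp add: prod.distrib exp_sum)
    also have "\<dots> \<le> real denom ^ n * 2 ^ (lg + 1)"
    proof (rule mult_left_mono)
    have "(\<Sum>i<n. ?e i) = real (usage x c) * (real (base - 1) / real denom)"
    proof -
      have "(\<Sum>i<n. if incident i c then real (x i) else 0) = real (usage x c)"
        by (simp add: usage_def sum.inter_filter[symmetric] lessThan_def)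
      then show ?thesis by (simp only: sum_distrib_right[symmetric])
    qed
    also have "\<dots> \<le> real depth * (real (base - 1) / real denom)"
      using u[OF c] by (intro mult_right_mono) auto
    also have "\<dots> = real (lg + 1) / 6" by (simp add: denom_def base_def depth_def field_simps)
    finally have "exp (\<Sum>i<n. ?e i) \<le> exp (real (lg + 1) / 6)" by (simp only: exp_le_cancel_iff)
    also have "\<dots> \<le> 2 ^ (lg + 1)"
    proof -
      have "exp (1 / 6 :: real) \<le> exp (1 / 2)" by simp
      also have "\<dots> \<le> 2"
      proof -
        have "exp (1 / 2 :: real) ^ 2 = exp 1" by (simp flip: exp_of_nat_mult)
        also have "\<dots> \<le> 2 ^ 2" using exp_le by simp
        finally show ?thesis by (rule power2_le_imp_le) simp
      qed
      finally have "exp (1 / 6 :: real) ^ (lg + 1) \<le> 2 ^ (lg + 1)" by (rule power_mono) simp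
      then show ?thesis by (simp only: exp_of_nat_mult[symmetric]) simp
    qed
    finally show "exp (\<Sum>i<n. ?e i) \<le> 2 ^ (lg + 1)" .
    qed simp
    finally show ?thesis .
  qed
  then have "(\<Sum>c<num_constraints. \<Prod>i<n. real denom + (if incident i c then real (base - 1) * real (x i) else 0)) \<le>
      (\<Sum>c<num_constraints. real denom ^ n * 2 ^ (lg + 1))"
    by (intro sum_mono) auto
  moreover have "real (overload x) = (\<Sum>c<num_constraints. \<Prod>i<n. real denom +
      (if incident i c then real (base - 1) * real (x i) else 0))"
    unfolding overload_def of_nat_sum of_nat_prod by (intro sum.cong prod.cong) auto
  ultimately show ?thesis by (simp add: mult.assoc)
qed

text \<open>Clashes cost at most half of the gain, and \<open>denom \<le> 30 * (lg + 1)\<close>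
  converts the gain into 1/60 of the scaled weight of \<open>S\<close>. The penalty is at most 8 *
  (2 ^ lg) ^ 4 in the same units, that is 1/128 after division by \<open>threshold\<close>; and 1/60
  - 1/128 is at least 1/120.\<close>

lemma potential_start:
  assumes x: "mw_invariant x" and v: "limit \<le> volume x" "volume x < 2 * limit"
    and S: "packed S" and max: "\<And>i. i < n \<Longrightarrow> large i \<Longrightarrow> wt i \<le> total_weight I S"
  shows "real denom ^ (n + 2) * real threshold * real (total_weight I S) / 120 \<le> potential x"
proof -
  let ?W = "total_weight I S"
  have u: "\<And>c. c < num_constraints \<Longrightarrow> usage x c < depth" using usage_less_depth v(2) by blast
  have x0: "\<And>i. i < n \<Longrightarrow> \<not> large i \<Longrightarrow> x i = 0" using x by (auto simp: mw_invariant_def)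
  have "real ((lg + 1) * ?W) \<le> real (gain x)"
    using mw_result[OF x v(1) S] by (simp add: gain_def)
  then have g: "real (lg + 1) * real ?W \<le> real (gain x)" by (simp only: of_nat_mult)
  have "2 * real (clash x) \<le> real denom * real (gain x)"
    using clash_le[OF u x0] by (metis of_nat_le_iff of_nat_mult of_nat_numeral)
  then have c: "real denom * real (gain x) - real (clash x) \<ge> real denom * real (gain x) / 2" by linarith
  have "real denom \<le> 30 * real (lg + 1)" by (simp add: denom_def depth_def)
  then have "real denom * real ?W \<le> 30 * (real (lg + 1) * real ?W)"
    by (simp add: mult_right_mono mult.assoc[symmetric])
  then have dW: "real denom * real ?W \<le> 30 * real (gain x)" using g by linarith
  have lw: "real large_weight \<le> real (2 ^ lg * ?W)"
  proof -
    have "large_weight \<le> (\<Sum>i | i < n \<and> large i. ?W)" unfolding large_weight_def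
      using max by (intro sum_mono) auto
    also have "\<dots> = card {i. i < n \<and> large i} * ?W" by simp
    also have "\<dots> \<le> n * ?W" using card_mono[of "{..<n}" "{i. i < n \<and> large i}"]
      by (intro mult_le_mono1) auto
    also have "\<dots> \<le> 2 ^ lg * ?W" using le_lg by (rule mult_le_mono1)
    finally show ?thesis by (simp only: of_nat_le_iff)
  qed
  have "real (large_weight * denom ^ 2 * overload x) \<le>
      real (2 ^ lg * ?W) * real (denom ^ 2) * real (num_constraints * denom ^ n * 2 ^ (lg + 1))"
    unfolding of_nat_mult[of _ "overload x"] of_nat_mult[of large_weight]
    by (intro mult_mono overload_le[OF u] lw) auto
  also have "\<dots> \<le> real (2 ^ lg * ?W) * real (denom ^ 2) * real (4 * (2 ^ lg) ^ 2 * denom ^ n * 2 ^ (lg + 1))"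
    using num_constraints_le by (intro mult_left_mono of_nat_mono mult_le_mono1) auto
  also have "\<dots> = real denom ^ (n + 2) * real threshold * real ?W / 128"
    by (simp add: threshold_def power_add power2_eq_square power4_eq_xxxx mult.commute mult.left_commute)
  finally have o: "real (large_weight * denom ^ 2 * overload x) \<le>
    real denom ^ (n + 2) * real threshold * real ?W / 128" .
  have nn: "0 \<le> real denom ^ (n + 2) * real threshold * real ?W" by simp
  have "real denom ^ (n + 2) * real threshold * real ?W / 60 =
    real threshold * real denom ^ n * (real denom * (real denom * real ?W) / 60)"
    by (simp add: power_add power2_eq_square)
  also have "\<dots> \<le> real threshold * real denom ^ n * (real denom * (30 * real (gain x)) / 60)"
    by (intro mult_left_mono divide_right_mono dW) auto
  also have "\<dots> = real threshold * real denom ^ n * (real denom * real (gain x) / 2)" by simp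
  also have "\<dots> \<le> real threshold * real denom ^ n * (real denom * real (gain x) - real (clash x))"
    by (intro mult_left_mono c) auto
  finally have "real denom ^ (n + 2) * real threshold * real ?W / 60 \<le>
      real threshold * real denom ^ n * (real denom * real (gain x) - real (clash x))" .
  moreover have "potential x = real threshold * real denom ^ n * (real denom * real (gain x) - real (clash x))
     - real (large_weight * denom ^ 2 * overload x)"
    by (simp add: potential_def credit_def debit_def algebra_simps)
  ultimately show ?thesis using o nn by linarith
qed

definition survivors :: "nat set \<Rightarrow> nat set" where
  "survivors S = {i \<in> S. \<forall>j\<in>S. \<not> blocks j i}"

text \<open>On a rounded vector a sampled task contributes its weight times 1 minus its number of
  sampled blockers. This is the full weight for a survivor and at most 0 otherwise.\<close>

lemma potential_end:
  assumes P: "\<And>i. i < n \<Longrightarrow> P i = 0 \<or> P i = denom"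
    and P0: "\<And>i. i < n \<Longrightarrow> \<not> large i \<Longrightarrow> P i = 0"
  defines "S \<equiv> {i. i < n \<and> P i \<noteq> 0}"
  shows "potential P \<le> real denom ^ (n + 2) * (real threshold * real (total_weight I (survivors S)) -
    real large_weight * (\<Sum>c<num_constraints. real base ^ card {i \<in> S. incident i c}))"
proof -
  have finS: "finite S" by (auto simp: S_def)
  have Peq: "P i = (if i \<in> S then denom else 0)" if "i < n" for i
    using P[OF that] that by (auto simp: S_def)
  have S_sub: "{i. i < n \<and> i \<in> S} = S" by (auto simp: S_def)
  have "real (gain P) = real denom * (\<Sum>i\<in>S. real (wt i))"
  proof -
    have "gain P = (\<Sum>i<n. if i \<in> S then wt i * denom else 0)"
      unfolding gain_def by (intro sum.cong) (auto simp: Peq)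
    also have "\<dots> = (\<Sum>i\<in>S. wt i * denom)"
      using S_sub by (simp add: sum.inter_filter[symmetric] lessThan_def)
    finally show ?thesis by (simp add: sum_distrib_left mult.commute)
  qed
  moreover have "real (clash P) = real denom ^ 2 * (\<Sum>i\<in>S. real (wt i) * real (card {j \<in> S. blocks j i}))"
  proof -
    have "clash P = (\<Sum>i<n. if i \<in> S then wt i * denom * (denom * card {j \<in> S. blocks j i}) else 0)"
      unfolding clash_def
    proof (rule sum.cong)
      fix i assume i: "i \<in> {..<n}"
      have "(\<Sum>j | j < n \<and> blocks j i. P j) = (\<Sum>j | j < n \<and> blocks j i. if j \<in> S then denom else 0)"
        by (intro sum.cong) (auto simp: Peq)
      also have "\<dots> = (\<Sum>j\<in>{j \<in> {j. j < n \<and> blocks j i}. j \<in> S}. denom)"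
        by (subst sum.inter_filter[symmetric]) auto
      also have "{j \<in> {j. j < n \<and> blocks j i}. j \<in> S} = {j \<in> S. blocks j i}" by (auto simp: S_def)
      finally have "(\<Sum>j | j < n \<and> blocks j i. P j) = denom * card {j \<in> S. blocks j i}" by simp
      then show "(\<Sum>j | j < n \<and> blocks j i. wt i * P i * P j) =
        (if i \<in> S then wt i * denom * (denom * card {j \<in> S. blocks j i}) else 0)"
        using i by (simp add: sum_distrib_left[symmetric] Peq)
    qed simp
    also have "\<dots> = (\<Sum>i\<in>S. wt i * denom * (denom * card {j \<in> S. blocks j i}))"
      using S_sub by (simp add: sum.inter_filter[symmetric] lessThan_def)
    finally show ?thesis
      by (simp add: sum_distrib_left power2_eq_square mult.commute mult.left_commute mult.assoc)
  qed
  moreover have "real (overload P) = real denom ^ n * (\<Sum>c<num_constraints. real base ^ card {i \<in> S. incident i c})"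
  proof -
    have "(\<Prod>i<n. denom + (if incident i c then (base - 1) * P i else 0)) =
        denom ^ n * base ^ card {i \<in> S. incident i c}" for c
    proof -
      have "(\<Prod>i<n. denom + (if incident i c then (base - 1) * P i else 0)) =
          (\<Prod>i<n. denom * (if i \<in> S \<and> incident i c then base else 1))"
        by (intro prod.cong) (auto simp: Peq base_def)
      also have "\<dots> = denom ^ n * (\<Prod>i<n. if i \<in> S \<and> incident i c then base else 1)"
        by (simp add: prod.distrib)
      also have "(\<Prod>i<n. if i \<in> S \<and> incident i c then base else 1) =
          (\<Prod>i\<in>{i \<in> {..<n}. i \<in> S \<and> incident i c}. base)"
        by (rule prod.inter_filter[symmetric]) simp
      also have "{i \<in> {..<n}. i \<in> S \<and> incident i c} = {i \<in> S. incident i c}" by (auto simp: S_def)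
      finally show ?thesis by simp
    qed
    then show ?thesis unfolding overload_def by (simp add: sum_distrib_left)
  qed
  ultimately have "potential P = real denom ^ (n + 2) * (real threshold *
      ((\<Sum>i\<in>S. real (wt i)) - (\<Sum>i\<in>S. real (wt i) * real (card {j \<in> S. blocks j i}))) -
    real large_weight * (\<Sum>c<num_constraints. real base ^ card {i \<in> S. incident i c}))"
    by (simp add: potential_def credit_def debit_def power_add power2_eq_square algebra_simps)
  also have "(\<Sum>i\<in>S. real (wt i)) - (\<Sum>i\<in>S. real (wt i) * real (card {j \<in> S. blocks j i})) =
      (\<Sum>i\<in>S. real (wt i) * (1 - real (card {j \<in> S. blocks j i})))"
    by (simp add: sum_subtractf algebra_simps)
  also have "\<dots> \<le> (\<Sum>i\<in>S. if i \<in> survivors S then real (wt i) else 0)"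
  proof (rule sum_mono)
    fix i assume i: "i \<in> S"
    show "real (wt i) * (1 - real (card {j \<in> S. blocks j i})) \<le> (if i \<in> survivors S then real (wt i) else 0)"
    proof (cases "i \<in> survivors S")
      case True
      then show ?thesis by (simp add: mult_left_le)
    next
      case False
      then have "{j \<in> S. blocks j i} \<noteq> {}" using i by (auto simp: survivors_def)
      then have "1 \<le> card {j \<in> S. blocks j i}" using finS by (simp add: Suc_le_eq card_gt_0_iff)
      then show ?thesis using False by (simp add: mult_nonneg_nonpos)
    qed
  qed
  also have "\<dots> = real (total_weight I (survivors S))"
  proof -
    have "{i \<in> S. i \<in> survivors S} = survivors S" by (auto simp: survivors_def)
    then show ?thesis using finS by (simp add: total_weight_eq sum.inter_filter[symmetric])
  qed
  finally show ?thesis by (simp add: mult_left_mono)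
qed

text \<open>Dropping the nonnegative penalty gives the first claim. For the second, strict
  positivity of the potential bounds the penalty strictly by \<open>threshold\<close> times the
  surviving weight, which is at most \<open>threshold * large_weight\<close>; the factor
  \<open>large_weight\<close> was put into the penalty in order to cancel here.\<close>

lemma rounding_result:
  assumes P: "\<And>i. i < n \<Longrightarrow> P i = 0 \<or> P i = denom"
    and P0: "\<And>i. i < n \<Longrightarrow> \<not> large i \<Longrightarrow> P i = 0"
    and pot: "real denom ^ (n + 2) * real threshold * real W / 120 \<le> potential P" and W: "0 < W"
  defines "S \<equiv> {i. i < n \<and> P i \<noteq> 0}"
  shows "W \<le> 120 * total_weight I (survivors S)"
    and "c < num_constraints \<Longrightarrow> base ^ card {i \<in> S. incident i c} < threshold"
proof -
  let ?Y = "\<Sum>c<num_constraints. real base ^ card {i \<in> S. incident i c}"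
  have "potential P \<le> real denom ^ (n + 2) *
      (real threshold * real (total_weight I (survivors S)) - real large_weight * ?Y)"
    unfolding S_def by (intro potential_end P P0)
  note order.trans[OF pot this]
  then have "real denom ^ (n + 2) * (real threshold * real W / 120) \<le> real denom ^ (n + 2) *
      (real threshold * real (total_weight I (survivors S)) - real large_weight * ?Y)"
    by (simp only: mult.assoc times_divide_eq_right)
  then have *: "real threshold * real W / 120 \<le>
      real threshold * real (total_weight I (survivors S)) - real large_weight * ?Y"
    using denom_pos by (subst (asm) mult_le_cancel_left_pos) auto
  have Y: "0 \<le> real large_weight * ?Y" by (intro mult_nonneg_nonneg sum_nonneg) auto
  have thr: "0 < real threshold" by (simp add: threshold_def)
  have "real threshold * (real W / 120) \<le> real threshold * real (total_weight I (survivors S))"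
    using * Y by simp
  then have "real W / 120 \<le> real (total_weight I (survivors S))"
    using thr by (subst (asm) mult_le_cancel_left_pos) auto
  then show "W \<le> 120 * total_weight I (survivors S)" by simp
  assume c: "c < num_constraints"
  have "x < n \<and> large x" if "x \<in> survivors S" for x
    using that P0[of x] by (auto simp: survivors_def S_def)
  then have le: "total_weight I (survivors S) \<le> large_weight"
    unfolding total_weight_eq large_weight_def by (intro sum_mono2) auto
  have "0 < real threshold * real W / 120" using thr W by simp
  then have "real large_weight * ?Y < real threshold * real (total_weight I (survivors S))" using * by linarith
  also have "\<dots> \<le> real threshold * real large_weight" using le by (intro mult_left_mono) auto
  finally have lt: "real large_weight * ?Y < real large_weight * real threshold" by (simp add: mult.commute)
  have "real base ^ card {i \<in> S. incident i c} \<le> ?Y" using c by (intro member_le_sum) auto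
  also have "?Y < real threshold" using lt by (rule mult_left_less_imp_less) simp
  finally have "real (base ^ card {i \<in> S. incident i c}) < real threshold" by simp
  then show "base ^ card {i \<in> S. incident i c} < threshold" by (simp only: of_nat_less_iff)
qed

end

section \<open>Layers of crossing rectangles\<close>

context bagufp_instance
begin

definition narrower :: "nat \<Rightarrow> nat \<Rightarrow> bool" where
  "narrower j i \<longleftrightarrow> snk j - src j < snk i - src i"

text \<open>The narrow rectangle \<open>j\<close> lies strictly inside the horizontal range of
  \<open>i\<close> and sticks out below its bottom.\<close>

definition pierces :: "nat \<Rightarrow> nat \<Rightarrow> bool" where
  "pierces j i \<longleftrightarrow> src i < src j \<and> snk j < snk i \<and> bot j < bot i"

text \<open>Let \<open>bot j \<le> bot i\<close>. At height \<open>bot i\<close> the rectangle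
  \<open>j\<close> is present, so if it contains neither lower corner of \<open>i\<close> it must
  lie strictly between the two ends. Equal bottoms are impossible, since then \<open>i\<close> would
  contain a lower corner of \<open>j\<close>.\<close>

lemma unblocked_conflict:
  assumes "i < n" "j < n" "large i" "large j" "i \<noteq> j" "conflict i j" "\<not> blocks i j" "\<not> blocks j i"
  shows "pierces i j \<or> pierces j i"
proof -
  have "pierces j i" if "i < n" "j < n" "large i" "large j" "i \<noteq> j" "conflict i j"
    "\<not> blocks i j" "\<not> blocks j i" "bot j \<le> bot i" for i j
    using that task_valid(3)[of i] task_valid(3)[of j]
    unfolding blocks_def covers_def conflict_def pierces_def by auto
  from this[of i j] this[of j i] assms show ?thesis
    by (cases "bot j \<le> bot i") (auto simp: conflict_def)
qed

lemma pierces_narrower: "j < n \<Longrightarrow> pierces j i \<Longrightarrow> narrower j i"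
  using task_valid(3)[of j] by (auto simp: pierces_def narrower_def)

text \<open>The path of \<open>j\<close> is contained in that of \<open>i\<close>, and a minimum
  over fewer edges is at least as large.\<close>

lemma pierces_bottleneck:
  assumes "i < n" "j < n" "pierces j i"
  shows "bottleneck i \<le> bottleneck j"
proof -
  obtain e where "src j \<le> e" "e < snk j" "cap e = bottleneck j"
    using bottleneck_attained[OF assms(2)] .
  then show ?thesis using bottleneck_le[of i e] assms(3) by (auto simp: pierces_def)
qed

text \<open>The greedy colouring by longest chains: larger than all narrower conflicting tasks, and
  positive only with a witness exactly one layer below. The witness is what yields a chain of length
  \<open>col i + 1\<close>.\<close>

definition layering :: "nat set \<Rightarrow> (nat \<Rightarrow> nat) \<Rightarrow> bool" where
  "layering S col \<longleftrightarrow> (\<forall>i\<in>S.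
     (\<forall>j\<in>S. narrower j i \<and> conflict i j \<longrightarrow> col j < col i) \<and>
     (col i = 0 \<or> (\<exists>j\<in>S. narrower j i \<and> conflict i j \<and> col i = Suc (col j))))"

context
  fixes S :: "nat set" and col :: "nat \<Rightarrow> nat"
  assumes S: "S \<subseteq> {i. i < n \<and> large i}" and col: "layering (survivors S) col"
begin

lemma survivorsD: "i \<in> survivors S \<Longrightarrow> i \<in> S \<and> i < n \<and> large i"
  using S by (auto simp: survivors_def)

lemma survivors_finite: "finite (survivors S)"
  by (rule finite_subset[of _ "{..<n}"]) (use survivorsD in auto)

lemma survivors_conflict:
  assumes "i \<in> survivors S" "j \<in> survivors S" "i \<noteq> j" "conflict i j"
  shows "pierces i j \<or> pierces j i"
  using assms survivorsD[of i] survivorsD[of j]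
  by (intro unblocked_conflict) (auto simp: survivors_def)

text \<open>Survivors in conflict pierce each other, hence are comparable by width and lie in
  different layers; members of one bag block each other, so two of them never survive.\<close>

lemma layer_packed: "packed {i \<in> survivors S. col i = k}"
  unfolding packed_def
proof (intro conjI ballI impI inj_onI)
  show "{i \<in> survivors S. col i = k} \<subseteq> {i. i < n \<and> large i}" using survivorsD by auto
next
  fix i j assume ij: "i \<in> {i \<in> survivors S. col i = k}" "j \<in> {i \<in> survivors S. col i = k}" "bg i = bg j"
  then have "\<not> blocks j i" "large j" using survivorsD[of j] by (auto simp: survivors_def)
  then show "i = j" using ij(3) by (auto simp: blocks_def)
next
  fix i j assume ij: "i \<in> {i \<in> survivors S. col i = k}" "j \<in> {i \<in> survivors S. col i = k}" "i \<noteq> j"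
  show "\<not> conflict i j"
  proof
    assume c: "conflict i j"
    then have c': "conflict j i" by (auto simp: conflict_def)
    have "narrower i j \<or> narrower j i"
      using survivors_conflict[OF _ _ ij(3) c] ij pierces_narrower survivorsD by blast
    then have "col i < col j \<or> col j < col i"
      using col c c' ij unfolding layering_def by blast
    then show False using ij by auto
  qed
qed

text \<open>
  A chain of piercing rectangles has a common point: the left end of the innermost one at the
  bottom of the outermost one.
\<close>

lemma layer_chain:
  assumes "i \<in> survivors S"
  shows "\<exists>X p. X \<subseteq> survivors S \<and> card X = Suc (col i) \<and> i \<in> X \<and> p \<in> X \<and>
    (\<forall>x\<in>X. src x \<le> src p \<and> src p < snk x \<and> bot x \<le> bot i \<and> bottleneck i \<le> bottleneck x)"
  using assms
proof (induction "col i" arbitrary: i)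
  case 0
  then show ?case using task_valid(3) survivorsD[of i]
    by (intro exI[of _ "{i}"] exI[of _ i]) auto
next
  case (Suc k)
  then obtain j where j: "j \<in> survivors S" "narrower j i" "conflict i j" "col i = Suc (col j)"
    using col unfolding layering_def by (metis nat.distinct(1))
  have n: "i < n" "j < n" using survivorsD Suc.prems j by auto
  have ne: "i \<noteq> j" using j(2) by (auto simp: narrower_def)
  \<comment> \<open>Of the two ways to cross, the one that would make \<open>i\<close> the narrower
    rectangle contradicts the choice of \<open>j\<close>.\<close>
  have "\<not> pierces i j" using pierces_narrower[OF n(1), of j] j(2) by (auto simp: narrower_def)
  then have p: "pierces j i" using survivors_conflict[OF Suc.prems j(1) ne j(3)] by blast
  have "k = col j" using Suc.hyps(2) j(4) by simp
  from Suc.hyps(1)[OF this j(1)] obtain X q where X: "X \<subseteq> survivors S" "card X = Suc (col j)" "j \<in> X" "q \<in> X"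
    "\<forall>x\<in>X. src x \<le> src q \<and> src q < snk x \<and> bot x \<le> bot j \<and> bottleneck j \<le> bottleneck x"
    by blast
  have "i \<notin> X" using X(5) p by (auto simp: pierces_def)
  then have "card (insert i X) = Suc (col i)"
    using X(1,2) j(4) survivors_finite finite_subset by (subst card_insert_disjoint) auto
  moreover have "src j \<le> src q" "src q < snk j" using X(3,5) by auto
  ultimately show ?case
    using X Suc.prems p pierces_bottleneck[OF n p]
    by (intro exI[of _ "insert i X"] exI[of _ q]) (auto simp: pierces_def)
qed

text \<open>All \<open>col i + 1\<close> members of the chain contain the point above
  \<open>src p\<close> at height \<open>bot i\<close>, which is the point of constraint
  \<open>p * n + i\<close>; so the depth bound of this constraint applies to the layer
  number.\<close>

lemma layer_bound:
  assumes deep: "\<And>c. c < num_constraints \<Longrightarrow> base ^ card {i \<in> S. incident i c} < threshold"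
    and i: "i \<in> survivors S"
  shows "base ^ Suc (col i) < threshold" "col i < n"
proof -
  obtain X p where X: "X \<subseteq> survivors S" "card X = Suc (col i)" "p \<in> X"
    "\<forall>x\<in>X. src x \<le> src p \<and> src p < snk x \<and> bot x \<le> bot i \<and> bottleneck i \<le> bottleneck x"
    using layer_chain[OF i] by blast
  have n: "i < n" "p < n" using survivorsD i X by auto
  let ?c = "p * n + i"
  have d: "?c div n = p" "?c mod n = i" using n by auto
  have "?c < (p + 1) * n" using n by simp
  also have "\<dots> \<le> num_constraints" unfolding num_constraints_def using n by (intro mult_le_mono1) simp
  finally have c: "?c < num_constraints" .
  have "X \<subseteq> {i \<in> S. incident i ?c}"
  proof
    fix x assume x: "x \<in> X"
    then have "x \<in> S" "large x" using survivorsD X(1) by auto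
    moreover have "covers x (xcoord p) (bot i)"
      using X(4) x n bot_less[OF n(1)] unfolding covers_def xcoord_def by (auto intro: order_less_le_trans)
    ultimately show "x \<in> {i \<in> S. incident i ?c}" using n unfolding incident_def d by auto
  qed
  moreover have "finite S" by (rule finite_subset[of _ "{..<n}"]) (use S in auto)
  ultimately have "Suc (col i) \<le> card {i \<in> S. incident i ?c}"
    using card_mono[of "{i \<in> S. incident i ?c}" X] X(2) by simp
  then have "base ^ Suc (col i) \<le> base ^ card {i \<in> S. incident i ?c}"
    by (intro power_increasing) (auto simp: base_def)
  then show "base ^ Suc (col i) < threshold" using deep[OF c] by linarith
  have "X \<subseteq> {..<n}" using X(1) survivorsD by auto
  then have "card X \<le> n" using card_mono[of "{..<n}" X] by simp
  then show "col i < n" using X(2) by simp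
qed

text \<open>\<open>K\<close> is the number of layers, one more than the largest colour, and each of
  them weighs at most \<open>V\<close>. Without survivors \<open>K = 0\<close> works because
  \<open>threshold\<close> exceeds 1.\<close>

lemma best_layer:
  assumes deep: "\<And>c. c < num_constraints \<Longrightarrow> base ^ card {i \<in> S. incident i c} < threshold"
    and best: "\<And>k. k < n \<Longrightarrow> total_weight I {i \<in> survivors S. col i = k} \<le> V"
  obtains K where "base ^ K < threshold" "total_weight I (survivors S) \<le> K * V"
proof (cases "survivors S = {}")
  case True
  then show ?thesis
    using that[of 0] one_less_power[of "2::nat" "4 * lg + 10"] by (simp add: total_weight_def threshold_eq)
next
  case False
  have "Max (col ` survivors S) \<in> col ` survivors S"
    using False survivors_finite by (intro Max_in) auto
  then obtain i where i: "i \<in> survivors S" "col i = Max (col ` survivors S)" by auto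
  have sub: "col ` survivors S \<subseteq> {..<Suc (col i)}"
    unfolding i(2) using survivors_finite by (auto simp: less_Suc_eq_le)
  have "total_weight I (survivors S) = (\<Sum>k<Suc (col i). total_weight I {i \<in> survivors S. col i = k})"
    unfolding total_weight_eq by (rule sum.group[OF survivors_finite finite_lessThan sub, symmetric])
  also have "\<dots> \<le> (\<Sum>k<Suc (col i). V)"
    using layer_bound(2)[OF deep i(1)] by (intro sum_mono best) auto
  finally show ?thesis using that[of "Suc (col i)"] layer_bound(1)[OF deep i(1)] by simp
qed

end

text \<open>An optimal solution is cut into its small tasks and the others. The latter are
  \<open>large\<close>, because being scheduled at all forces the demand below the
  bottleneck.\<close>

lemma optimum_split:
  assumes small: "\<And>Z. feasible I Z \<Longrightarrow> (\<And>i. i \<in> Z \<Longrightarrow> small i) \<Longrightarrow> total_weight I Z \<le> A"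
    and packed: "\<And>S. packed S \<Longrightarrow> total_weight I S \<le> B"
  shows "optimum I \<le> A + 47 * B"
proof -
  obtain Z where Z: "feasible I Z" "total_weight I Z = optimum I" using optimum_attained by blast
  have fin: "finite Z" using feasible_finite[OF Z(1)] .
  have sub: "feasible I Z'" if "Z' \<subseteq> Z" for Z'
  proof -
    have "(\<Sum>i \<in> {i \<in> Z'. src i \<le> e \<and> e < snk i}. dem i) \<le> cap e" if "e < m" for e
      using \<open>Z' \<subseteq> Z\<close> that by (intro feasible_sum_le[OF Z(1)]) auto
    then show ?thesis using that Z(1) by (auto simp: feasible_iff inj_on_subset)
  qed
  let ?s = "{i \<in> Z. small i}" and ?l = "{i \<in> Z. \<not> small i}"
  have large: "large i" if "i \<in> ?l" for i
  proof -
    have i: "i < n" using that Z(1) by (auto simp: feasible_iff)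
    have "(\<Sum>i\<in>{i}. dem i) \<le> cap (bneck_edge i)"
      using that bneck_edge[OF i] by (intro feasible_sum_le[OF Z(1)]) auto
    then show ?thesis using that bneck_edge(3)[OF i] by (auto simp: large_def small_def)
  qed
  have "feasible I ?l" by (rule sub) auto
  then obtain S where S: "packed S" "total_weight I ?l \<le> 47 * total_weight I S"
    using large_feasible_packed[of ?l] large by blast
  have "total_weight I Z = total_weight I ?s + total_weight I ?l"
    unfolding total_weight_eq using fin
    by (subst sum.union_disjoint[symmetric]) (auto intro!: sum.cong)
  moreover have "total_weight I ?s \<le> A" by (rule small) (use sub[of ?s] in auto)
  ultimately show ?thesis using S(2) packed[OF S(1)] Z(2) by linarith
qed

lemma max_packed:
  obtains S where "packed S" "\<And>S'. packed S' \<Longrightarrow> total_weight I S' \<le> total_weight I S"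
proof -
  have fin: "finite {S. packed S}"
    by (rule finite_subset[of _ "Pow {..<n}"]) (auto simp: packed_def)
  have "packed {}" by (simp add: packed_def)
  then have "Max (total_weight I ` {S. packed S}) \<in> total_weight I ` {S. packed S}"
    using fin by (intro Max_in) auto
  then obtain S where S: "packed S" "total_weight I S = Max (total_weight I ` {S. packed S})" by auto
  have "total_weight I S' \<le> total_weight I S" if "packed S'" for S'
    unfolding S(2) using fin that by (intro Max_ge) auto
  then show ?thesis using that S(1) by blast
qed

lemma packed_singleton: "i < n \<Longrightarrow> large i \<Longrightarrow> packed {i}"
  by (simp add: packed_def)

end

section \<open>Expressions of the program\<close>

text \<open>Truncated subtraction makes \<open>a - b\<close> vanish exactly for
  \<open>a \<le> b\<close>, so comparisons become values 0 and 1. The connectives below are meant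
  for such operands.\<close>

definition LE :: "aexp \<Rightarrow> aexp \<Rightarrow> aexp" where
  "LE a b = Sub (Const 1) (Sub a b)"
definition LT :: "aexp \<Rightarrow> aexp \<Rightarrow> aexp" where
  "LT a b = LE (Add a (Const 1)) b"
definition AND :: "aexp \<Rightarrow> aexp \<Rightarrow> aexp" where
  "AND a b = Mul a b"
definition EQ :: "aexp \<Rightarrow> aexp \<Rightarrow> aexp" where
  "EQ a b = AND (LE a b) (LE b a)"
definition NOT :: "aexp \<Rightarrow> aexp" where
  "NOT a = Sub (Const 1) a"
definition OR :: "aexp \<Rightarrow> aexp \<Rightarrow> aexp" where
  "OR a b = NOT (AND (NOT a) (NOT b))"
text \<open>Both branches are evaluated and the rejected one is multiplied by 0, so it may read
  cells that hold no task data.\<close>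

definition ITE :: "aexp \<Rightarrow> aexp \<Rightarrow> aexp \<Rightarrow> aexp" where
  "ITE c a b = Add (Mul c a) (Mul (NOT c) b)"
definition MOD :: "aexp \<Rightarrow> aexp \<Rightarrow> aexp" where
  "MOD a b = Sub a (Mul (Div a b) b)"

lemma aval_LE [simp]: "aval (LE a b) s = of_bool (aval a s \<le> aval b s)"
  by (auto simp: LE_def)
lemma aval_LT [simp]: "aval (LT a b) s = of_bool (aval a s < aval b s)"
  by (auto simp: LT_def)
lemma aval_AND [simp]:
  "aval a s = of_bool p \<Longrightarrow> aval b s = of_bool q \<Longrightarrow> aval (AND a b) s = of_bool (p \<and> q)"
  by (auto simp: AND_def)
lemma aval_EQ [simp]: "aval (EQ a b) s = of_bool (aval a s = aval b s)"
  by (auto simp: EQ_def AND_def)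
lemma aval_NOT [simp]: "aval a s = of_bool p \<Longrightarrow> aval (NOT a) s = of_bool (\<not> p)"
  by (auto simp: NOT_def)
lemma aval_OR [simp]:
  "aval a s = of_bool p \<Longrightarrow> aval b s = of_bool q \<Longrightarrow> aval (OR a b) s = of_bool (p \<or> q)"
  by (auto simp: OR_def AND_def NOT_def)
lemma aval_ITE [simp]:
  "aval c s = of_bool p \<Longrightarrow> aval (ITE c a b) s = (if p then aval a s else aval b s)"
  by (auto simp: ITE_def NOT_def)
lemma aval_MOD [simp]: "aval (MOD a b) s = aval a s mod aval b s"
  by (simp add: MOD_def minus_div_mult_eq_mod)

lemma esize_macros [simp]:
  "esize (LE a b) = esize a + esize b + 4"
  "esize (LT a b) = esize a + esize b + 7"
  "esize (AND a b) = esize a + esize b + 1"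
  "esize (EQ a b) = 2 * esize a + 2 * esize b + 9"
  "esize (NOT a) = esize a + 3"
  "esize (OR a b) = esize a + esize b + 10"
  "esize (ITE c a b) = 2 * esize c + esize a + esize b + 6"
  "esize (MOD a b) = 2 * esize b + 2 * esize a + 3"
  by (simp_all add: LE_def LT_def AND_def EQ_def NOT_def OR_def ITE_def MOD_def)

text \<open>
  Arrays 10 and 11 hold the bottlenecks and scales, 12 and 13 the residual weights and the accepted
  tasks of the local ratio algorithm, 14 the prices of the constraints, 15 the multiplicities and
  later the rounded vector, 16 the survivors, and 17 their layers.  Larger numbers are scalars,
  kept in cell 0.
\<close>

definition nE :: aexp where "nE = Get 0 (Const 1)"
definition mE :: aexp where "mE = Get 0 (Const 0)"

definition BotE :: "aexp \<Rightarrow> aexp" where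
  "BotE i = Sub (Get 10 i) (Get 3 i)"
definition SmallE :: "aexp \<Rightarrow> aexp" where
  "SmallE i = LE (Mul (Const 4) (Get 3 i)) (Get 11 i)"
definition LargeE :: "aexp \<Rightarrow> aexp" where
  "LargeE i = AND (LE (Get 3 i) (Get 10 i)) (LT (Get 11 i) (Mul (Const 4) (Get 3 i)))"
definition CoversE :: "aexp \<Rightarrow> aexp \<Rightarrow> aexp \<Rightarrow> aexp" where
  "CoversE j x y = AND (AND (LE (Get 4 j) x) (LT x (Get 5 j))) (AND (LE (BotE j) y) (LT y (Get 10 j)))"
definition XcoordE :: "aexp \<Rightarrow> aexp" where
  "XcoordE p = ITE (LT p nE) (Get 4 p) (Sub (Get 5 (Sub p nE)) (Const 1))"
definition IncidentE :: "aexp \<Rightarrow> aexp \<Rightarrow> aexp" where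
  "IncidentE i c = AND (LargeE i) (ITE (LT (Div c nE) (Mul (Const 2) nE))
     (CoversE i (XcoordE (Div c nE)) (BotE (MOD c nE))) (EQ (Get 6 i) (Get 6 (MOD c nE))))"
definition BlocksE :: "aexp \<Rightarrow> aexp \<Rightarrow> aexp" where
  "BlocksE j i = AND (NOT (EQ i j)) (AND (LargeE j) (OR (EQ (Get 6 i) (Get 6 j))
     (OR (CoversE j (Get 4 i) (BotE i)) (CoversE j (Sub (Get 5 i) (Const 1)) (BotE i)))))"
definition ConflictE :: "aexp \<Rightarrow> aexp \<Rightarrow> aexp" where
  "ConflictE i j = AND (AND (LT (Get 4 i) (Get 5 j)) (LT (Get 4 j) (Get 5 i)))
     (AND (LT (BotE i) (Get 10 j)) (LT (BotE j) (Get 10 i)))"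
definition WidthE :: "aexp \<Rightarrow> aexp" where
  "WidthE i = Sub (Get 5 i) (Get 4 i)"
definition ChargeE :: "aexp \<Rightarrow> aexp \<Rightarrow> aexp" where
  "ChargeE j i = ITE (EQ (Get 6 j) (Get 6 i)) (Get 12 j)
     (Mul (AND (EQ (Get 11 j) (Get 11 i)) (LT (Get 4 i) (Get 5 j)))
       (Div (Add (Mul (Mul (Get 12 j) (Const 4)) (Get 3 i)) (Sub (Get 11 i) (Const 1))) (Get 11 i)))"
definition NumE :: aexp where
  "NumE = Mul (Add (Mul (Const 2) nE) (Const 1)) nE"
definition SlotsE :: aexp where
  "SlotsE = Mul (Add mE (Const 1)) nE"
definition PowerE :: aexp where
  "PowerE = Mul (Mul (Var 30) (Var 30)) (Mul (Var 30) (Var 30))"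
definition LimitE :: aexp where
  "LimitE = Mul (Const 16) PowerE"
definition ThresholdE :: aexp where
  "ThresholdE = Mul (Const 1024) PowerE"
definition DenomE :: aexp where
  "DenomE = Mul (Const 6) (Add (Mul (Const 4) (Var 31)) (Const 5))"

lemma esize_exprs [simp]:
  "esize nE = 3" "esize mE = 2"
  "esize (BotE i) = 2 * esize i + 3"
  "esize (SmallE i) = 2 * esize i + 12"
  "esize (LargeE i) = 4 * esize i + 22"
  "esize (CoversE j x y) = 5 * esize j + 2 * esize x + 2 * esize y + 31"
  "esize (XcoordE p) = 4 * esize p + 35"
  "esize (IncidentE i c) = 11 * esize i + 22 * esize c + 271"
  "esize (BlocksE j i) = 16 * esize i + 18 * esize j + 153"
  "esize (ConflictE i j) = 5 * esize i + 5 * esize j + 43"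
  "esize (WidthE i) = 2 * esize i + 3"
  "esize (ChargeE j i) = 9 * esize j + 10 * esize i + 73"
  "esize NumE = 14" "esize SlotsE = 9" "esize PowerE = 11"
  "esize LimitE = 29" "esize ThresholdE = 1037" "esize DenomE = 23"
  by (simp_all add: nE_def mE_def BotE_def SmallE_def LargeE_def CoversE_def XcoordE_def IncidentE_def
      BlocksE_def ConflictE_def WidthE_def ChargeE_def NumE_def SlotsE_def PowerE_def LimitE_def
      ThresholdE_def DenomE_def)

context bagufp_instance
begin

definition inputs :: "memory \<Rightarrow> bool" where
  "inputs s \<longleftrightarrow> s 0 0 = m \<and> s 0 1 = n \<and> (\<forall>e<m. s 1 e = cap e) \<and>
     (\<forall>i<n. s 2 i = wt i \<and> s 3 i = dem i \<and> s 4 i = src i \<and> s 5 i = snk i \<and> s 6 i = bg i)"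

definition prepared :: "memory \<Rightarrow> bool" where
  "prepared s \<longleftrightarrow> inputs s \<and> (\<forall>i<n. s 10 i = bottleneck i \<and> s 11 i = scale i)"

lemma inputs_agree:
  assumes "agree A s s'" "inputs s" "A \<inter> {0, 1, 2, 3, 4, 5, 6} = {}"
  shows "inputs s'"
proof -
  have "s' a = s a" if "a \<in> {0, 1, 2, 3, 4, 5, 6}" for a
    using assms(1,3) that unfolding agree_def by blast
  then show ?thesis using assms(2) by (simp add: inputs_def)
qed

lemma prepared_agree:
  assumes "agree A s s'" "prepared s" "A \<inter> {0, 1, 2, 3, 4, 5, 6, 10, 11} = {}"
  shows "prepared s'"
proof -
  have "s' a = s a" if "a \<in> {0, 1, 2, 3, 4, 5, 6, 10, 11}" for a
    using assms(1,3) that unfolding agree_def by blast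
  then show ?thesis using assms(2) by (simp add: prepared_def inputs_def)
qed

lemma prepared_store: "prepared s \<Longrightarrow> a > 11 \<Longrightarrow> prepared (store a i x s)"
  by (simp add: prepared_def inputs_def store_other)

lemma inputs_aval:
  assumes "inputs s"
  shows "aval nE s = n" "aval mE s = m" "aval NumE s = num_constraints" "aval SlotsE s = (m + 1) * n"
  using assms by (simp_all add: inputs_def nE_def mE_def NumE_def SlotsE_def num_constraints_def)

lemma prepared_inputs: "prepared s \<Longrightarrow> inputs s"
  by (simp add: prepared_def)

lemma prepared_get:
  assumes "prepared s" "i < n"
  shows "s 2 i = wt i" "s 3 i = dem i" "s 4 i = src i" "s 5 i = snk i" "s 6 i = bg i"
    "s 10 i = bottleneck i" "s 11 i = scale i"
  using assms by (simp_all add: prepared_def inputs_def)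

lemma aval_BotE: "prepared s \<Longrightarrow> aval i s < n \<Longrightarrow> aval (BotE i) s = bot (aval i s)"
  by (simp add: BotE_def bot_def prepared_get)

lemma aval_SmallE: "prepared s \<Longrightarrow> aval i s < n \<Longrightarrow> aval (SmallE i) s = of_bool (small (aval i s))"
  by (simp add: SmallE_def small_def prepared_get)

lemma aval_LargeE: "prepared s \<Longrightarrow> aval i s < n \<Longrightarrow> aval (LargeE i) s = of_bool (large (aval i s))"
  by (simp add: LargeE_def large_def prepared_get)

lemma aval_CoversE: "prepared s \<Longrightarrow> aval j s < n \<Longrightarrow>
    aval (CoversE j x y) s = of_bool (covers (aval j s) (aval x s) (aval y s))"
  by (simp add: CoversE_def covers_def prepared_get aval_BotE)

lemma aval_IncidentE:
  assumes s: "prepared s" and i: "aval i s < n" and c: "aval c s < num_constraints"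
  shows "aval (IncidentE i c) s = of_bool (incident (aval i s) (aval c s))"
proof -
  note av = inputs_aval[OF prepared_inputs[OF s]]
  have q: "aval c s mod n < n" using i by (intro mod_less_divisor) auto
  have "aval c s div n < 2 * n + 1"
    using c i by (auto simp: num_constraints_def less_mult_imp_div_less)
  then have "aval c s div n < 2 * n \<Longrightarrow> \<not> aval c s div n < n \<Longrightarrow> aval c s div n - n < n" by linarith
  then have x: "aval (XcoordE (Div c nE)) s = xcoord (aval c s div n)" if "aval c s div n < 2 * n"
    using that s by (auto simp: XcoordE_def av xcoord_def prepared_get)
  have "aval (ITE (LT (Div c nE) (Mul (Const 2) nE))
     (CoversE i (XcoordE (Div c nE)) (BotE (MOD c nE))) (EQ (Get 6 i) (Get 6 (MOD c nE)))) s =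
     of_bool (if aval c s div n < 2 * n then covers (aval i s) (xcoord (aval c s div n)) (bot (aval c s mod n))
      else bg (aval i s) = bg (aval c s mod n))"
    using x s i q by (subst aval_ITE[of _ _ "aval c s div n < 2 * n"])
      (auto simp: av aval_CoversE aval_BotE prepared_get)
  then show ?thesis unfolding IncidentE_def incident_def
    by (rule aval_AND[OF aval_LargeE[OF s i]])
qed

lemma aval_BlocksE:
  assumes s: "prepared s" and ij: "aval i s < n" "aval j s < n"
  shows "aval (BlocksE j i) s = of_bool (blocks (aval j s) (aval i s))"
proof -
  have "aval (OR (EQ (Get 6 i) (Get 6 j))
     (OR (CoversE j (Get 4 i) (BotE i)) (CoversE j (Sub (Get 5 i) (Const 1)) (BotE i)))) s =
    of_bool (bg (aval i s) = bg (aval j s) \<or> (covers (aval j s) (src (aval i s)) (bot (aval i s)) \<or>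
      covers (aval j s) (snk (aval i s) - 1) (bot (aval i s))))"
    by (intro aval_OR) (use s ij in \<open>simp_all add: aval_CoversE aval_BotE prepared_get\<close>)
  then show ?thesis unfolding BlocksE_def blocks_def
    by (intro aval_AND aval_LargeE aval_NOT) (use s ij in auto)
qed

lemma aval_ConflictE: "prepared s \<Longrightarrow> aval i s < n \<Longrightarrow> aval j s < n \<Longrightarrow>
    aval (ConflictE i j) s = of_bool (conflict (aval i s) (aval j s))"
  by (simp add: ConflictE_def conflict_def prepared_get aval_BotE)

lemma aval_WidthE: "prepared s \<Longrightarrow> aval i s < n \<Longrightarrow> aval (WidthE i) s = snk (aval i s) - src (aval i s)"
  by (simp add: WidthE_def prepared_get)

lemma aval_ChargeE: "prepared s \<Longrightarrow> aval i s < n \<Longrightarrow> aval j s < n \<Longrightarrow>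
    aval (ChargeE j i) s = charge (s 12) (aval j s) (aval i s)"
  by (simp add: ChargeE_def charge_def prepared_get)

lemma aval_constants:
  assumes "s 30 0 = 2 ^ lg" "s 31 0 = lg"
  shows "aval LimitE s = limit" "aval ThresholdE s = threshold" "aval DenomE s = denom"
  using assms by (simp_all add: LimitE_def ThresholdE_def DenomE_def PowerE_def limit_def threshold_def
      denom_def depth_def power4_eq_xxxx)

section \<open>Bounds on the numbers that occur\<close>

definition size :: nat where "size = input_size I"
text \<open>Quadratic because \<open>denom ^ n\<close> and the products of \<open>overload\<close>
  have up to \<open>n\<close> factors of O(size) bits each; the linear term leaves room for the
  remaining factors.\<close>

definition mem_bits :: nat where "mem_bits = 10 * size ^ 2 + 50 * size"
text \<open>The fourth power is dictated by the weights phase, which may take \<open>limit\<close>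
  rounds.\<close>

definition loops :: nat where "loops = 16 * (2 * size + 1) ^ 4"

lemma sum_list_ge: "x \<in> set xs \<Longrightarrow> f x \<le> (\<Sum>x\<leftarrow>xs. f x :: nat)"
  by (induction xs) auto

lemma length_le_sum_list: "(\<And>x. x \<in> set xs \<Longrightarrow> 1 \<le> f x) \<Longrightarrow> length xs \<le> (\<Sum>x\<leftarrow>xs. f x :: nat)"
  by (induction xs) (force+)

lemma size_ge_3: "3 \<le> size"
  by (simp add: size_def input_size_def bits_def)

lemma n_m_le_size: "n + m \<le> size"
proof -
  have "length (capacities I) \<le> (\<Sum>u \<leftarrow> capacities I. bits u)"
    by (rule length_le_sum_list) (simp add: bits_def)
  moreover have "length (tasks I) \<le> (\<Sum>t \<leftarrow> tasks I. bits (weight t) + bits (demand t) +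
      bits (source t) + bits (sink t) + bits (bag t))"
    by (rule length_le_sum_list) (simp add: bits_def)
  ultimately show ?thesis
    by (simp add: size_def input_size_def num_tasks_def num_edges_def)
qed

lemma bits_le_size: "bits k \<le> size \<Longrightarrow> k \<le> 2 ^ size"
  by (meson less_power2_bits less_imp_le order.trans one_le_numeral power_increasing)

lemma cap_le: "e < m \<Longrightarrow> bits (cap e) \<le> size"
  using sum_list_ge[of "cap e" "capacities I" bits]
  by (simp add: size_def input_size_def cap_def num_edges_def)

lemma task_le:
  assumes "i < n"
  shows "wt i \<le> 2 ^ size" "dem i \<le> 2 ^ size" "src i \<le> 2 ^ size" "snk i \<le> 2 ^ size" "bg i \<le> 2 ^ size"
proof -
  have "bits (wt i) + bits (dem i) + bits (src i) + bits (snk i) + bits (bg i) \<le> size"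
    using sum_list_ge[of "tasks I ! i" "tasks I" "\<lambda>t. bits (weight t) + bits (demand t) +
      bits (source t) + bits (sink t) + bits (bag t)"] assms
    by (simp add: size_def input_size_def num_tasks_def task_defs)
  then show "wt i \<le> 2 ^ size" "dem i \<le> 2 ^ size" "src i \<le> 2 ^ size" "snk i \<le> 2 ^ size" "bg i \<le> 2 ^ size"
    by (intro bits_le_size; linarith)+
qed

lemma size_less: "size < 2 ^ size" by simp

lemma n_m_le: "n \<le> 2 ^ size" "m \<le> 2 ^ size"
  using n_m_le_size size_less by linarith+

lemma bottleneck_bits: "i < n \<Longrightarrow> bits (bottleneck i) \<le> size"
  using bneck_edge(3,4)[of i] cap_le[of "bneck_edge i"] by simp

lemma bottleneck_le_size: "i < n \<Longrightarrow> bottleneck i \<le> 2 ^ size" "i < n \<Longrightarrow> scale i \<le> 2 ^ size"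
  using bits_le_size[OF bottleneck_bits[of i]] scale_bounds(1)[of i] by auto

lemma level_le: "i < n \<Longrightarrow> level i \<le> size"
  using bottleneck_bits[of i] by (simp add: level_def bits_def)

lemma lg_le: "lg \<le> size" using lg_least n_m_le(1) by blast

lemma le_mem_bits: "x \<le> 2 ^ k \<Longrightarrow> k \<le> 10 * size ^ 2 + 50 * size \<Longrightarrow> x \<le> 2 ^ mem_bits" for x :: nat
  unfolding mem_bits_def by (meson order.trans one_le_numeral power_increasing)

lemma size_le_mem_bits: "x \<le> 2 ^ size \<Longrightarrow> x \<le> 2 ^ mem_bits" for x :: nat
  by (rule le_mem_bits) auto

lemma num_constraints_le_power: "num_constraints \<le> 2 ^ (3 * size)"
proof -
  have "num_constraints \<le> 2 ^ (2 * lg + 2)"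
    using num_constraints_le by (simp add: power_add power_mult power2_eq_square mult.commute power_mult_distrib[symmetric])
  also have "\<dots> \<le> 2 ^ (3 * size)" using lg_le size_ge_3 by (intro power_increasing) auto
  finally show ?thesis .
qed

lemma limit_le_power: "2 * limit \<le> 2 ^ (6 * size)"
proof -
  have "2 * limit = 2 ^ (4 * lg + 5)" by (simp add: limit_eq numeral_eq_Suc)
  also have "\<dots> \<le> 2 ^ (6 * size)" using lg_le size_ge_3 by (intro power_increasing) auto
  finally show ?thesis .
qed

lemma threshold_le_power: "threshold \<le> 2 ^ (8 * size)"
  unfolding threshold_eq using lg_le size_ge_3 by (intro power_increasing) auto

lemma denom_le_power: "denom \<le> 2 ^ (3 * size)"
proof -
  have "denom \<le> 2 ^ 6 * size"
    using lg_le size_ge_3 by (simp add: denom_def depth_def)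
  also have "\<dots> \<le> 2 ^ (2 * size) * 2 ^ size"
    using size_ge_3 size_less by (intro mult_le_mono power_increasing) auto
  also have "\<dots> = 2 ^ (3 * size)" by (simp add: power_add[symmetric])
  finally show ?thesis .
qed

lemma base_le_power: "base \<le> 2 ^ (2 * size)"
proof -
  have "base \<le> 2 ^ 1 * size" using lg_le size_ge_3 by (simp add: base_def)
  also have "\<dots> \<le> 2 ^ size * 2 ^ size"
    using size_ge_3 size_less by (intro mult_le_mono power_increasing) auto
  also have "\<dots> = 2 ^ (2 * size)" by (simp add: power_add[symmetric])
  finally show ?thesis .
qed

lemma sum_le_power: "N \<le> 2 ^ a \<Longrightarrow> (\<And>i. i < N \<Longrightarrow> f i \<le> 2 ^ b) \<Longrightarrow> (\<Sum>i<N. f i :: nat) \<le> 2 ^ (a + b)" for N :: nat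
proof -
  assume *: "N \<le> 2 ^ a" "\<And>i. i < N \<Longrightarrow> f i \<le> 2 ^ b"
  have "(\<Sum>i<N. f i) \<le> (\<Sum>i<N. 2 ^ b)" using * by (intro sum_mono) auto
  also have "\<dots> \<le> 2 ^ a * 2 ^ b" using * by simp
  finally show ?thesis by (simp add: power_add)
qed

lemma mult_le_power: "x \<le> 2 ^ a \<Longrightarrow> y \<le> 2 ^ b \<Longrightarrow> x * y \<le> 2 ^ (a + b)" for x y :: nat
  by (simp add: power_add mult_le_mono)

lemma loop_bounds: "n \<le> loops" "m \<le> loops" "num_constraints \<le> loops" "(m + 1) * n \<le> loops"
  "limit \<le> loops" "lg \<le> loops" "i < n \<Longrightarrow> level i \<le> loops" "1 \<le> loops"
proof -
  let ?z = "2 * size + 1"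
  have z: "n \<le> ?z" "m + 1 \<le> ?z" "lg \<le> ?z" "2 * n + 1 \<le> ?z" "1 \<le> ?z"
    using n_m_le_size lg_le size_ge_3 by linarith+
  have p: "?z ^ k \<le> loops" if "k \<le> 4" for k
    unfolding loops_def using power_increasing[OF that z(5)] by linarith
  show "n \<le> loops" "m \<le> loops" "lg \<le> loops" "1 \<le> loops" using p[of 1] z by simp_all
  show "i < n \<Longrightarrow> level i \<le> loops" using p[of 1] level_le[of i] by simp
  have "num_constraints \<le> ?z * ?z" unfolding num_constraints_def using z by (intro mult_le_mono) auto
  then show "num_constraints \<le> loops" using p[of 2] by (simp add: power2_eq_square)
  have "(m + 1) * n \<le> ?z * ?z" using z by (intro mult_le_mono) auto
  then show "(m + 1) * n \<le> loops" using p[of 2] by (simp add: power2_eq_square)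
  \<comment> \<open>The power \<open>2 ^ lg\<close> is less than twice as large as \<open>n\<close>
    for n > 1, hence linear in the input size; this makes \<open>limit\<close> a polynomial.\<close>
  have "2 ^ lg \<le> ?z" using power_lg_le z(4) by linarith
  then show "limit \<le> loops" unfolding limit_def loops_def by (intro mult_le_mono2 power_mono) auto
qed

lemma counter_bounds: "n \<le> 2 ^ mem_bits" "m \<le> 2 ^ mem_bits" "num_constraints \<le> 2 ^ mem_bits"
  "(m + 1) * n \<le> 2 ^ mem_bits"
proof -
  show "n \<le> 2 ^ mem_bits" "m \<le> 2 ^ mem_bits" using n_m_le size_le_mem_bits by auto
  show "num_constraints \<le> 2 ^ mem_bits"
    by (rule le_mem_bits[OF num_constraints_le_power]) simp
  have "m + 1 \<le> 2 ^ size" using n_m_le_size size_less by linarith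
  then show "(m + 1) * n \<le> 2 ^ mem_bits"
    by (intro le_mem_bits[OF mult_le_power[OF _ n_m_le(1)]]) auto
qed

text \<open>Replacing each trip count by the common bound \<open>loops\<close> turns all running
  times into polynomials in one quantity; the set-up cost is absorbed since \<open>loops\<close> is
  at least 1.\<close>

lemma wp_For_loops:
  assumes "esize e + 3 \<le> max_esize" "N \<le> 2 ^ v" "N \<le> loops" "J 0 s"
    "\<And>k s' z. J k s' \<Longrightarrow> J k (store x 0 z s')"
    "\<And>k s'. J k s' \<Longrightarrow> aval e s' = N"
    "\<And>k s'. k < N \<Longrightarrow> J k s' \<Longrightarrow> s' x 0 = k \<Longrightarrow> wp v c s' T (\<lambda>s''. J (Suc k) s'' \<and> s'' x 0 = k)"
  shows "wp v (For x e c) s (loops * (T + 4)) (J N)"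
proof (rule wp_mono[OF wp_For[OF assms(1,2,4-7)]])
  have "N * (T + 2) + 2 \<le> loops * (T + 2) + loops * 2"
    using assms(3) loop_bounds(8) by (intro add_mono mult_le_mono1) auto
  then show "N * (T + 2) + 2 \<le> loops * (T + 4)" by (simp add: algebra_simps)
qed

lemma wp_Fold_loops:
  assumes "esize e + 3 \<le> max_esize" "esize e0 \<le> max_esize" "esize step \<le> max_esize"
    "r \<noteq> x" "N \<le> 2 ^ v" "N \<le> loops"
    "\<And>s'. agree {r, x} s s' \<Longrightarrow> aval e s' = N" "aval e0 s = F 0"
    "\<And>k s'. k < N \<Longrightarrow> agree {r, x} s s' \<Longrightarrow> s' x 0 = k \<Longrightarrow> s' r 0 = F k \<Longrightarrow> aval step s' = F (Suc k)"
    "\<And>k. k \<le> N \<Longrightarrow> F k \<le> 2 ^ v"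
  shows "wp v (Fold r x e e0 step) s (6 * loops) (\<lambda>s'. s' r 0 = F N \<and> agree {r, x} s s')"
  by (rule wp_mono[OF wp_Fold[where F = F and N = N]]) (use assms loop_bounds(8) in auto)

end

section \<open>Bottlenecks and the logarithm\<close>

definition bottleneck_prog :: com where
  "bottleneck_prog = For 20 nE
     (Seq (Fold 23 21 mE (Get 1 (Get 4 (Var 20)))
       (ITE (AND (AND (LE (Get 4 (Var 20)) (Var 21)) (LT (Var 21) (Get 5 (Var 20))))
          (LT (Get 1 (Var 21)) (Var 23))) (Get 1 (Var 21)) (Var 23)))
     (Seq (Put 10 (Var 20) (Var 23))
     (Seq (Put 24 (Const 0) (Const 1))
     (Seq (While (LE (Mul (Const 2) (Var 24)) (Get 10 (Var 20)))
       (Put 24 (Const 0) (Mul (Const 2) (Var 24))))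
       (Put 11 (Var 20) (Var 24))))))"

definition log_prog :: com where
  "log_prog = Seq (Put 30 (Const 0) (Const 1)) (Seq (Put 31 (Const 0) (Const 0))
     (While (LT (Var 30) nE) (Seq (Put 30 (Const 0) (Mul (Const 2) (Var 30)))
       (Put 31 (Const 0) (Add (Var 31) (Const 1))))))"

context bagufp_instance
begin

lemma inputs_get:
  assumes "inputs s" "i < n"
  shows "s 2 i = wt i" "s 3 i = dem i" "s 4 i = src i" "s 5 i = snk i" "s 6 i = bg i"
  using assms by (simp_all add: inputs_def)

text \<open>All edges are scanned and those off the path skipped. The start value belongs to an edge
  of the path, so at every stage the value is the capacity of such an edge, which also bounds its
  size.\<close>

primrec running_min :: "nat \<Rightarrow> nat \<Rightarrow> nat" where
  "running_min i 0 = cap (src i)"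
| "running_min i (Suc k) = (if (src i \<le> k \<and> k < snk i) \<and> cap k < running_min i k then cap k else running_min i k)"

lemma running_min:
  assumes "i < n"
  shows "(\<exists>e. src i \<le> e \<and> e < snk i \<and> running_min i k = cap e) \<and>
    (\<forall>e. src i \<le> e \<and> e < snk i \<and> e < k \<longrightarrow> running_min i k \<le> cap e)"
proof (induction k)
  case 0
  then show ?case using task_valid(3)[OF assms] by auto
next
  case (Suc k)
  then show ?case by (auto simp: less_Suc_eq intro: order.trans less_imp_le)
qed

lemma running_min_final: "i < n \<Longrightarrow> running_min i m = bottleneck i"
  using running_min[of i m] bottleneck_eqI[of i] task_valid(4)[of i] by fastforce

lemma running_min_le: "i < n \<Longrightarrow> running_min i k \<le> 2 ^ mem_bits"
  using running_min[of i k] cap_le bits_le_size size_le_mem_bits task_valid(4)[of i]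
  by (metis order_less_le_trans)

lemma floorlog_power2: "floorlog 2 (2 ^ k) = Suc k"
  using bits_power2[of k] by (simp add: bits_def)

text \<open>Doubling preserves a power of two below the bottleneck. The exponent is not stored, so
  the variant recovers it with \<open>floorlog\<close>.\<close>

lemma wp_scale_loop:
  assumes i: "i < n" "s 20 0 = i" and s: "s 10 i = bottleneck i" "s 24 0 = 1"
  shows "wp mem_bits (While (LE (Mul (Const 2) (Var 24)) (Get 10 (Var 20)))
       (Put 24 (Const 0) (Mul (Const 2) (Var 24)))) s (2 * loops + 3)
     (\<lambda>s'. s' 24 0 = scale i \<and> agree {24} s s')"
proof -
  let ?J = "\<lambda>s'. (\<exists>k. s' 24 0 = 2 ^ k \<and> 2 ^ k \<le> bottleneck i) \<and> agree {24} s s'"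
  let ?m = "\<lambda>s'. Suc (level i) - floorlog 2 (s' 24 0)"
  have "wp mem_bits (While (LE (Mul (Const 2) (Var 24)) (Get 10 (Var 20)))
       (Put 24 (Const 0) (Mul (Const 2) (Var 24)))) s (?m s * (1 + 1) + 1)
     (\<lambda>s'. s' 24 0 = scale i \<and> agree {24} s s')"
  proof (rule wp_While[where I = ?J])
    show "?J s" using s bottleneck_pos[OF i(1)] by (auto simp: agree_refl intro!: exI[of _ 0])
  next
    fix s' assume s': "?J s'" "aval (LE (Mul (Const 2) (Var 24)) (Get 10 (Var 20))) s' \<noteq> 0"
    then obtain k where k: "s' 24 0 = 2 ^ k" "2 ^ k \<le> bottleneck i" by blast
    have ag: "agree {24} s s'" using s' by blast
    have "s' 10 = s 10" "s' 20 = s 20" using agreeD[OF ag] by simp_all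
    then have le: "2 * 2 ^ k \<le> bottleneck i" using s'(2) k i s by simp
    have "(2::nat) ^ Suc k < 2 ^ Suc (level i)"
      unfolding power_Suc using le scale_bounds(2)[OF i(1)] unfolding scale_def by linarith
    then have "k < level i" by (auto dest: power_less_imp_less_exp[of "2::nat", rotated] simp del: power_Suc)
    then have ms: "Suc (level i) - floorlog 2 (2 * 2 ^ k) < Suc (level i) - floorlog 2 (2 ^ k)"
      using floorlog_power2[of k] floorlog_power2[of "Suc k"] by simp
    show "wp mem_bits (Put 24 (Const 0) (Mul (Const 2) (Var 24))) s' 1 (\<lambda>s''. ?J s'' \<and> ?m s'' < ?m s')"
    proof (rule wp_Put)
      show "aval (Mul (Const 2) (Var 24)) s' \<le> 2 ^ mem_bits"
        using k le size_le_mem_bits[OF bottleneck_le_size(1)[OF i(1)]] by simp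
      show "?J (store 24 (aval (Const 0) s') (aval (Mul (Const 2) (Var 24)) s') s') \<and>
        ?m (store 24 (aval (Const 0) s') (aval (Mul (Const 2) (Var 24)) s') s') < ?m s'"
        using k le ms ag by (auto simp: store_same intro!: agree_store exI[of _ "Suc k"])
    qed (simp_all add: max_esize_def)
  next
    fix s' assume s': "?J s'" "aval (LE (Mul (Const 2) (Var 24)) (Get 10 (Var 20))) s' = 0"
    then obtain k where k: "s' 24 0 = 2 ^ k" "2 ^ k \<le> bottleneck i" by blast
    have ag: "agree {24} s s'" using s' by blast
    have "s' 10 = s 10" "s' 20 = s 20" using agreeD[OF ag] by simp_all
    then have "bottleneck i < 2 * 2 ^ k" using s'(2) k i s by simp
    then show "s' 24 0 = scale i \<and> agree {24} s s'" using scale_eqI[OF i(1) k(2)] k ag by simp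
  qed (simp add: max_esize_def)
  then show ?thesis
    by (rule wp_mono) (use loop_bounds(7)[OF i(1)] in auto)
qed

lemma wp_bottleneck_prog:
  assumes s: "inputs s"
  shows "wp mem_bits bottleneck_prog s (loops * (8 * loops + 10))
    (\<lambda>s'. prepared s' \<and> agree {10, 11, 20, 21, 23, 24} s s')"
proof -
  let ?J = "\<lambda>k s'. (\<forall>i<k. i < n \<longrightarrow> s' 10 i = bottleneck i \<and> s' 11 i = scale i) \<and> agree {10, 11, 20, 21, 23, 24} s s'"
  have inp: "inputs s'" if "agree {10, 11, 20, 21, 23, 24} s s'" for s'
    by (rule inputs_agree[OF that s]) simp
  have "wp mem_bits bottleneck_prog s (loops * ((6 * loops + (1 + (1 + ((2 * loops + 3) + 1)))) + 4)) (?J n)"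
    unfolding bottleneck_prog_def
  proof (rule wp_For_loops[where J = ?J and N = n])
    show "n \<le> 2 ^ mem_bits" "n \<le> loops" by (fact counter_bounds loop_bounds)+
    show "?J 0 s" by (simp add: agree_refl)
    fix k s' z assume "?J k s'"
    then show "?J k (store 20 0 z s')" by (auto simp: store_other intro: agree_store)
  next
    fix k s' assume "?J k s'"
    then show "aval nE s' = n" using inp inputs_aval(1) by blast
  next
    fix k s' assume k: "k < n" and J: "?J k s'" and s20: "s' 20 0 = k"
    have in': "inputs s'" using inp J by blast
    show "wp mem_bits (Seq (Fold 23 21 mE (Get 1 (Get 4 (Var 20)))
       (ITE (AND (AND (LE (Get 4 (Var 20)) (Var 21)) (LT (Var 21) (Get 5 (Var 20))))
          (LT (Get 1 (Var 21)) (Var 23))) (Get 1 (Var 21)) (Var 23)))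
     (Seq (Put 10 (Var 20) (Var 23))
     (Seq (Put 24 (Const 0) (Const 1))
     (Seq (While (LE (Mul (Const 2) (Var 24)) (Get 10 (Var 20)))
       (Put 24 (Const 0) (Mul (Const 2) (Var 24))))
       (Put 11 (Var 20) (Var 24)))))) s'
      (6 * loops + (1 + (1 + ((2 * loops + 3) + 1)))) (\<lambda>s''. ?J (Suc k) s'' \<and> s'' 20 0 = k)"
    proof (intro wp_Seq)
      show "wp mem_bits (Fold 23 21 mE (Get 1 (Get 4 (Var 20)))
       (ITE (AND (AND (LE (Get 4 (Var 20)) (Var 21)) (LT (Var 21) (Get 5 (Var 20))))
          (LT (Get 1 (Var 21)) (Var 23))) (Get 1 (Var 21)) (Var 23))) s' (6 * loops)
        (\<lambda>s''. s'' 23 0 = running_min k m \<and> agree {23, 21} s' s'')"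
      proof (rule wp_Fold_loops[where F = "running_min k" and N = m])
        show "m \<le> 2 ^ mem_bits" "m \<le> loops" by (fact counter_bounds loop_bounds)+
        fix s'' assume "agree {23, 21} s' s''"
        then show "aval mE s'' = m" using inputs_aval(2) inputs_agree[OF _ in'] by simp
      next
        have "src k < m" using task_valid[OF k] by simp
        then show "aval (Get 1 (Get 4 (Var 20))) s' = running_min k 0"
          using in' k s20 by (simp add: inputs_get) (simp add: inputs_def)
      next
        fix e s'' assume e: "e < m" and ag: "agree {23, 21} s' s''" and v: "s'' 21 0 = e" "s'' 23 0 = running_min k e"
        have "inputs s''" using inputs_agree[OF ag in'] by simp
        moreover have "s'' 20 0 = k" using agreeD[OF ag, of 20] s20 by simp
        ultimately show "aval (ITE (AND (AND (LE (Get 4 (Var 20)) (Var 21)) (LT (Var 21) (Get 5 (Var 20))))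
          (LT (Get 1 (Var 21)) (Var 23))) (Get 1 (Var 21)) (Var 23)) s'' = running_min k (Suc e)"
          using v e k by (simp add: inputs_get) (simp add: inputs_def)
      qed (use running_min_le[OF k] in \<open>auto simp: max_esize_def\<close>)
    next
      fix s1 assume s1: "s1 23 0 = running_min k m \<and> agree {23, 21} s' s1"
      then have s1_20: "s1 20 0 = k" using agreeD[of "{23, 21}" s' s1 20] s20 by simp
      have s1_ag: "agree {10, 11, 20, 21, 23, 24} s s1"
        by (rule agree_trans[of _ s s']) (use J s1 in auto)
      have s1_arr: "s1 10 = s' 10" "s1 11 = s' 11" using agreeD[of "{23, 21}" s' s1] s1 by auto
      show "wp mem_bits (Put 10 (Var 20) (Var 23)) s1 1
        (\<lambda>s2. s2 10 = (s' 10)(k := bottleneck k) \<and> s2 11 = s' 11 \<and> s2 20 0 = k \<and> agree {10, 11, 20, 21, 23, 24} s s2)"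
        using s1 s1_20 s1_ag s1_arr running_min_le[OF k, of m]
        by (intro wp_Put) (auto simp: max_esize_def running_min_final[OF k] store_other store_same intro: agree_store)
    next
      fix s2 assume s2: "s2 10 = (s' 10)(k := bottleneck k) \<and> s2 11 = s' 11 \<and> s2 20 0 = k \<and> agree {10, 11, 20, 21, 23, 24} s s2"
      then show "wp mem_bits (Put 24 (Const 0) (Const 1)) s2 1
        (\<lambda>s3. s3 10 = (s' 10)(k := bottleneck k) \<and> s3 11 = s' 11 \<and> s3 20 0 = k \<and> s3 24 0 = 1 \<and> agree {10, 11, 20, 21, 23, 24} s s3)"
        by (intro wp_Put) (auto simp: max_esize_def store_other store_same intro: agree_store)
    next
      fix s3 assume s3: "s3 10 = (s' 10)(k := bottleneck k) \<and> s3 11 = s' 11 \<and> s3 20 0 = k \<and> s3 24 0 = 1 \<and> agree {10, 11, 20, 21, 23, 24} s s3"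
      then show "wp mem_bits (While (LE (Mul (Const 2) (Var 24)) (Get 10 (Var 20)))
       (Put 24 (Const 0) (Mul (Const 2) (Var 24)))) s3 (2 * loops + 3)
       (\<lambda>s'. s' 24 0 = scale k \<and> agree {24} s3 s')"
        by (intro wp_scale_loop k) auto
      fix s4 assume s4: "s4 24 0 = scale k \<and> agree {24} s3 s4"
      then have "s4 10 = (s' 10)(k := bottleneck k)" "s4 11 = s' 11" "s4 20 0 = k"
        using agreeD[of "{24}" s3 s4] s3 by auto
      moreover have "agree {10, 11, 20, 21, 23, 24} s s4"
        by (rule agree_trans[of _ s s3]) (use s3 s4 in auto)
      ultimately show "wp mem_bits (Put 11 (Var 20) (Var 24)) s4 1 (\<lambda>s''. ?J (Suc k) s'' \<and> s'' 20 0 = k)"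
        using s4 J size_le_mem_bits[OF bottleneck_le_size(2)[OF k]]
        by (intro wp_Put) (auto simp: max_esize_def store_other store_same less_Suc_eq intro: agree_store)
    qed
  qed (simp add: max_esize_def)
  then show ?thesis
  proof (rule wp_mono)
    fix s' assume "?J n s'"
    then show "prepared s' \<and> agree {10, 11, 20, 21, 23, 24} s s'"
      using inp by (auto simp: prepared_def)
  qed (simp add: algebra_simps)
qed

lemma wp_log_prog:
  assumes s: "inputs s"
  shows "wp mem_bits log_prog s (3 * loops + 3)
    (\<lambda>s'. s' 30 0 = 2 ^ lg \<and> s' 31 0 = lg \<and> agree {30, 31} s s')"
proof -
  let ?J = "\<lambda>s'. s' 30 0 = 2 ^ (s' 31 0) \<and> s' 31 0 \<le> lg \<and> agree {30, 31} s s'"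
  have "wp mem_bits log_prog s (1 + (1 + (lg * ((1 + 1) + 1) + 1)))
    (\<lambda>s'. s' 30 0 = 2 ^ lg \<and> s' 31 0 = lg \<and> agree {30, 31} s s')"
    unfolding log_prog_def
  proof (rule wp_Seq[where P = "\<lambda>s'. s' 30 0 = 1 \<and> agree {30, 31} s s'"], goal_cases)
    case 1
    show ?case by (rule wp_Put) (auto simp: max_esize_def store_same intro: agree_store agree_refl)
  next
    case (2 s1)
    show ?case
    proof (rule wp_Seq[where P = "\<lambda>s'. ?J s' \<and> s' 31 0 = 0"], goal_cases)
      case 1
      show ?case by (rule wp_Put) (use 2 in \<open>auto simp: max_esize_def store_same store_other intro: agree_store\<close>)
    next
      case (2 s2)
      have inp: "inputs s'" if "?J s'" for s'
        using inputs_agree[of "{30, 31}" s s'] that s by simp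
      have "wp mem_bits (While (LT (Var 30) nE) (Seq (Put 30 (Const 0) (Mul (Const 2) (Var 30)))
         (Put 31 (Const 0) (Add (Var 31) (Const 1))))) s2 ((lg - s2 31 0) * ((1 + 1) + 1) + 1)
         (\<lambda>s'. s' 30 0 = 2 ^ lg \<and> s' 31 0 = lg \<and> agree {30, 31} s s')"
      proof (rule wp_While[where I = ?J and measure = "\<lambda>s'. lg - s' 31 0"])
        show "?J s2" using 2 by blast
      next
        fix s' assume s': "?J s'" "aval (LT (Var 30) nE) s' \<noteq> 0"
        then have lt: "2 ^ (s' 31 0) < n" using inputs_aval(1)[OF inp[OF s'(1)]] by simp
        then have "(2::nat) ^ (s' 31 0) < 2 ^ lg" using le_lg by linarith
        then have l: "s' 31 0 < lg" by simp
        have b: "(2::nat) ^ lg \<le> 2 ^ mem_bits" using lg_le size_le_mem_bits[of "2 ^ lg"] by simp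
        have c: "lg \<le> 2 ^ mem_bits" using size_le_mem_bits[of lg] lg_le size_less by linarith
        have "(2::nat) ^ Suc (s' 31 0) \<le> 2 ^ lg" using l by (intro power_increasing) auto
        from order.trans[OF this b] have d: "2 * 2 ^ (s' 31 0) \<le> (2::nat) ^ mem_bits" by (simp only: power_Suc)
        show "wp mem_bits (Seq (Put 30 (Const 0) (Mul (Const 2) (Var 30)))
         (Put 31 (Const 0) (Add (Var 31) (Const 1)))) s' (1 + 1) (\<lambda>s''. ?J s'' \<and> lg - s'' 31 0 < lg - s' 31 0)"
        proof (rule wp_Seq[where P = "\<lambda>s''. s'' 30 0 = 2 * 2 ^ (s' 31 0) \<and> s'' 31 0 = s' 31 0 \<and> agree {30, 31} s s''"], goal_cases)
          case 1
          show ?case by (rule wp_Put) (use s' d in \<open>auto simp: max_esize_def store_same store_other intro: agree_store\<close>)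
        next
          case (2 s'')
          then show ?case using l c
            by (intro wp_Put) (auto simp: max_esize_def store_same store_other intro: agree_store)
        qed
      next
        fix s' assume s': "?J s'" "aval (LT (Var 30) nE) s' = 0"
        then have "n \<le> 2 ^ (s' 31 0)" using inputs_aval(1)[OF inp[OF s'(1)]] by simp
        then have "s' 31 0 = lg" using lg_least s'(1) by (intro antisym) auto
        then show "s' 30 0 = 2 ^ lg \<and> s' 31 0 = lg \<and> agree {30, 31} s s'" using s'(1) by simp
      qed (simp add: max_esize_def)
      then show ?case by (rule wp_mono) (use 2 in auto)
    qed
  qed
  then show ?thesis by (rule wp_mono) (use loop_bounds(6) in auto)
qed

end

section \<open>The local ratio program\<close>

lemma wp_PutI:
  assumes "aval e1 s = i" "aval e2 s = x" "x \<le> 2 ^ v" "Q (store a i x s)"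
    "esize e1 \<le> max_esize" "esize e2 \<le> max_esize"
  shows "wp v (Put a e1 e2) s 1 Q"
  by (rule wp_Put) (use assms in auto)

lemma wp_SeqPut:
  assumes "aval e1 s = i" "aval e2 s = x" "x \<le> 2 ^ v" "wp v c (store a i x s) T Q"
    "esize e1 \<le> max_esize" "esize e2 \<le> max_esize"
  shows "wp v (Seq (Put a e1 e2) c) s (1 + T) Q"
proof (rule wp_Seq[where P = "\<lambda>s'. s' = store a i x s"])
  show "wp v (Put a e1 e2) s 1 (\<lambda>s'. s' = store a i x s)"
    by (rule wp_PutI[OF assms(1-3)]) (use assms in auto)
qed (use assms in auto)

text \<open>The loop runs through all possible values of \<open>time\<close>. Slot \<open>q\<close>
  can only belong to task \<open>q mod n\<close>, and it does so if the right end of this task is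
  \<open>q div n\<close>; other slots are skipped.\<close>

definition residual_prog :: com where
  "residual_prog = For 22 SlotsE (Seq (Put 20 (Const 0) (MOD (Var 22) nE))
     (If (AND (EQ (Get 5 (Var 20)) (Div (Var 22) nE)) (SmallE (Var 20)))
       (Seq (Fold 23 21 nE (Const 0) (Add (Var 23) (ChargeE (Var 21) (Var 20))))
         (Put 12 (Var 20) (Sub (Mul (Mul (Const 2) nE) (Get 2 (Var 20))) (Var 23))))
       Skip))"

text \<open>The same enumeration backwards, because acceptance depends on the later tasks.\<close>

definition accept_prog :: com where
  "accept_prog = For 22 SlotsE (Seq (Put 24 (Const 0) (Sub (Sub SlotsE (Const 1)) (Var 22)))
     (Seq (Put 20 (Const 0) (MOD (Var 24) nE))
     (If (EQ (Get 5 (Var 20)) (Div (Var 24) nE))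
       (Seq (Fold 23 21 nE (Const 0) (Add (Var 23) (Mul (Mul (Get 13 (Var 21))
           (AND (EQ (Get 11 (Var 21)) (Get 11 (Var 20))) (LT (Get 4 (Var 21)) (Get 5 (Var 20)))))
           (Get 3 (Var 21)))))
       (Seq (Fold 25 21 nE (Const 0) (Add (Var 25) (Mul (Get 13 (Var 21))
           (EQ (Get 6 (Var 21)) (Get 6 (Var 20))))))
         (Put 13 (Var 20) (AND (LT (Const 0) (Get 12 (Var 20))) (AND (EQ (Var 25) (Const 0))
           (LE (Mul (Const 2) (Add (Var 23) (Get 3 (Var 20)))) (Get 11 (Var 20))))))))
       Skip)))"

context bagufp_instance
begin

lemma slot_task:
  assumes "q < (m + 1) * n"
  shows "q mod n < n" "snk (q mod n) = q div n \<longleftrightarrow> time (q mod n) = q"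
    "j < n \<Longrightarrow> time j = q \<Longrightarrow> j = q mod n"
proof -
  have n: "0 < n" using assms by (cases n) auto
  then show "q mod n < n" by simp
  show "snk (q mod n) = q div n \<longleftrightarrow> time (q mod n) = q"
  proof
    assume "snk (q mod n) = q div n"
    then show "time (q mod n) = q" by (simp add: time_def)
  next
    assume "time (q mod n) = q"
    then have "time (q mod n) div n = q div n" by simp
    moreover have "time (q mod n) div n = snk (q mod n)" using n by (simp add: time_def)
    ultimately show "snk (q mod n) = q div n" by simp
  qed
  show "j = q mod n" if "j < n" "time j = q"
    using that by (auto simp: time_def)
qed

lemma time_less: "i < n \<Longrightarrow> time i < (m + 1) * n"
proof -
  assume i: "i < n"
  have "time i < (snk i + 1) * n" using i by (simp add: time_def)
  also have "\<dots> \<le> (m + 1) * n" using task_valid(4)[OF i] by (intro mult_le_mono1) simp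
  finally show ?thesis .
qed

lemma charge_cong: "r j = r' j \<Longrightarrow> charge r j i = charge r' j i"
  by (simp add: charge_def)

text \<open>A zero residual charges nothing in spite of rounding up, as the added
  \<open>scale i - 1\<close> is below the divisor. Tasks that have not been reached can therefore be
  left in the sums.\<close>

lemma charge_zero: "i < n \<Longrightarrow> r j = 0 \<Longrightarrow> charge r j i = 0"
  using scale_bounds(3)[of i] by (simp add: charge_def)

lemma charge_le:
  assumes "i < n" "r j \<le> 2 ^ (3 * size)"
  shows "charge r j i \<le> 2 ^ (6 * size)"
proof -
  have "(r j * 4 * dem i + (scale i - 1)) div scale i \<le> r j * 4 * dem i + (scale i - 1)"
    by (rule div_le_dividend)
  also have "\<dots> \<le> 2 ^ (5 * size) + 2 ^ (5 * size)"
  proof (rule add_mono)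
    have "r j * 4 * dem i \<le> 2 ^ ((3 * size + 2) + size)"
      using assms task_le(2) by (intro mult_le_power) (auto simp: power_add)
    also have "\<dots> \<le> 2 ^ (5 * size)" using size_ge_3 by (intro power_increasing) auto
    finally show "r j * 4 * dem i \<le> 2 ^ (5 * size)" .
    have "scale i - 1 \<le> 2 ^ size" using bottleneck_le_size(2)[OF assms(1)] by simp
    also have "\<dots> \<le> 2 ^ (5 * size)" by (intro power_increasing) auto
    finally show "scale i - 1 \<le> 2 ^ (5 * size)" .
  qed
  also have "\<dots> = 2 ^ (5 * size + 1)" by simp
  also have "\<dots> \<le> 2 ^ (6 * size)" using size_ge_3 by (intro power_increasing) auto
  finally have 1: "(r j * 4 * dem i + (scale i - 1)) div scale i \<le> 2 ^ (6 * size)" .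
  have "r j \<le> 2 ^ (6 * size)"
    by (rule order.trans[OF assms(2)]) (intro power_increasing; simp)
  then show ?thesis using 1 by (simp add: charge_def)
qed

lemma scaled_weight_le: "i < n \<Longrightarrow> 2 * n * wt i \<le> 2 ^ (3 * size)"
proof -
  assume i: "i < n"
  have "2 * n * wt i \<le> 2 ^ ((1 + size) + size)"
    using n_m_le(1) task_le(1)[OF i] by (intro mult_le_power) auto
  also have "\<dots> \<le> 2 ^ (3 * size)" using size_ge_3 by (intro power_increasing) auto
  finally show ?thesis .
qed

text \<open>Entries of tasks with a slot not yet reached are 0, so that the program may sum charges
  over all tasks without comparing times.\<close>

definition residual_upto :: "nat \<Rightarrow> (nat \<Rightarrow> nat) \<Rightarrow> bool" where
  "residual_upto q r \<longleftrightarrow> (\<forall>i<n. r i = (if small i \<and> time i < q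
     then 2 * n * wt i - (\<Sum>j | j < n \<and> time j < time i. charge r j i) else 0))"

lemma residual_upto_zero: "residual_upto q r \<Longrightarrow> j < n \<Longrightarrow> q \<le> time j \<Longrightarrow> r j = 0"
  unfolding residual_upto_def by (metis leD)

lemma residual_upto_le:
  assumes "residual_upto q r" "j < n"
  shows "r j \<le> 2 ^ (3 * size)"
proof -
  have "r j \<le> 2 * n * wt j" using assms unfolding residual_upto_def by (metis diff_le_self le0)
  then show ?thesis using scaled_weight_le[OF assms(2)] by linarith
qed

lemma residual_upto_skip:
  assumes "residual_upto q r" "\<And>i. i < n \<Longrightarrow> small i \<Longrightarrow> time i \<noteq> q"
  shows "residual_upto (Suc q) r"
  unfolding residual_upto_def
proof (intro allI impI)
  fix i assume i: "i < n"
  have "(small i \<and> time i < Suc q) = (small i \<and> time i < q)" using assms(2)[OF i] by (auto simp: less_Suc_eq)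
  then show "r i = (if small i \<and> time i < Suc q
     then 2 * n * wt i - (\<Sum>j | j < n \<and> time j < time i. charge r j i) else 0)"
    using assms(1) i unfolding residual_upto_def by presburger
qed

lemma residual_upto_step:
  assumes r: "residual_upto q r" and i: "i < n" "small i" "time i = q"
  shows "residual_upto (Suc q) (r(i := 2 * n * wt i - (\<Sum>j<n. charge r j i)))"
proof -
  let ?r = "r(i := 2 * n * wt i - (\<Sum>j<n. charge r j i))"
  have same: "(\<Sum>j | j < n \<and> time j < time k. charge ?r j k) = (\<Sum>j | j < n \<and> time j < time k. charge r j k)"
    if "time k \<le> q" for k
    using that i(3) by (intro sum.cong charge_cong) auto
  have all: "(\<Sum>j<n. charge r j i) = (\<Sum>j | j < n \<and> time j < time i. charge r j i)"
  proof (rule sum.mono_neutral_right)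
    show "\<forall>j\<in>{..<n} - {j. j < n \<and> time j < time i}. charge r j i = 0"
    proof
      fix j assume "j \<in> {..<n} - {j. j < n \<and> time j < time i}"
      then have "j < n" "q \<le> time j" using i(3) by auto
      then show "charge r j i = 0" by (intro charge_zero[OF i(1)] residual_upto_zero[OF r])
    qed
  qed auto
  show ?thesis unfolding residual_upto_def
  proof (intro allI impI)
    fix k assume k: "k < n"
    show "?r k = (if small k \<and> time k < Suc q
      then 2 * n * wt k - (\<Sum>j | j < n \<and> time j < time k. charge ?r j k) else 0)"
    proof (cases "k = i")
      case True
      then show ?thesis using i same[of i] all by simp
    next
      case False
      then have "time k \<noteq> q" using time_inj[OF k i(1)] i(3) by auto
      then have "(small k \<and> time k < Suc q) = (small k \<and> time k < q)" by auto
      moreover have "r k = (if small k \<and> time k < q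
        then 2 * n * wt k - (\<Sum>j | j < n \<and> time j < time k. charge r j k) else 0)"
        using r k unfolding residual_upto_def by blast
      ultimately show ?thesis using False same[of k] by auto
    qed
  qed
qed

lemma wp_residual_prog:
  assumes s: "prepared s" and z: "s 12 = (\<lambda>_. 0)"
  shows "wp mem_bits residual_prog s (loops * (6 * loops + 7))
    (\<lambda>s'. residual (s' 12) \<and> agree {12, 20, 21, 22, 23} s s')"
proof -
  let ?c = "AND (EQ (Get 5 (Var 20)) (Div (Var 22) nE)) (SmallE (Var 20))"
  let ?step = "Add (Var 23) (ChargeE (Var 21) (Var 20))"
  let ?fold = "Fold 23 21 nE (Const 0) ?step"
  let ?e = "Sub (Mul (Mul (Const 2) nE) (Get 2 (Var 20))) (Var 23)"
  let ?then = "Seq ?fold (Put 12 (Var 20) ?e)"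
  let ?J = "\<lambda>q s'. residual_upto q (s' 12) \<and> agree {12, 20, 21, 22, 23} s s'"
  have prep: "prepared s'" if "agree {12, 20, 21, 22, 23} s s'" for s'
    by (rule prepared_agree[OF that s]) simp
  have "wp mem_bits residual_prog s (loops * ((1 + ((6 * loops + 1) + 1)) + 4)) (?J ((m + 1) * n))"
    unfolding residual_prog_def
  proof (rule wp_For_loops[where J = ?J and N = "(m + 1) * n"])
    show "(m + 1) * n \<le> 2 ^ mem_bits" "(m + 1) * n \<le> loops" by (fact counter_bounds loop_bounds)+
    show "?J 0 s" using z by (simp add: agree_refl residual_upto_def)
    fix q s' z assume "?J q s'"
    then show "?J q (store 22 0 z s')" by (auto simp: store_other intro: agree_store)
  next
    fix q s' assume "?J q s'"
    then show "aval SlotsE s' = (m + 1) * n" using inputs_aval(4)[OF prepared_inputs] prep by blast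
  next
    fix q s' assume q: "q < (m + 1) * n" and J: "?J q s'" and s22: "s' 22 0 = q"
    note st = slot_task[OF q]
    let ?i = "q mod n"
    have p': "prepared s'" using prep J by blast
    let ?s = "store 20 0 ?i s'"
    have ag1: "agree {12, 20, 21, 22, 23} s ?s" using J by (auto intro: agree_store)
    have p1: "prepared ?s" by (rule prep[OF ag1])
    have v1: "?s 20 0 = ?i" "?s 22 0 = q" "?s 12 = s' 12" using s22 by (simp_all add: store_same store_other)
    have n0: "aval nE s' = n" "aval nE ?s = n" using inputs_aval(1) prepared_inputs p' p1 by blast+
    have cond: "aval ?c ?s =
        of_bool (time ?i = q \<and> small ?i)"
      using v1 p1 st(1,2) by (simp add: n0 aval_SmallE prepared_get)
    show "wp mem_bits (Seq (Put 20 (Const 0) (MOD (Var 22) nE))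
     (If ?c
       ?then
       Skip)) s' (1 + ((6 * loops + 1) + 1)) (\<lambda>s''. ?J (Suc q) s'' \<and> s'' 22 0 = q)"
    proof (rule wp_SeqPut)
      show "?i \<le> 2 ^ mem_bits" using st(1) counter_bounds(1) by linarith
      show "aval (Const 0) s' = 0" "aval (MOD (Var 22) nE) s' = ?i" using s22 n0 by simp_all
      show "wp mem_bits (If ?c
       ?then
       Skip) ?s ((6 * loops + 1) + 1) (\<lambda>s''. ?J (Suc q) s'' \<and> s'' 22 0 = q)"
      proof (rule wp_If)
        assume "aval ?c ?s \<noteq> 0"
        then have i: "time ?i = q" "small ?i" using cond by auto
        show "wp mem_bits ?then ?s
         (6 * loops + 1) (\<lambda>s''. ?J (Suc q) s'' \<and> s'' 22 0 = q)"
        proof (rule wp_Seq)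
          show "wp mem_bits ?fold ?s (6 * loops)
            (\<lambda>s''. s'' 23 0 = (\<Sum>j<n. charge (s' 12) j ?i) \<and> agree {23, 21} ?s s'')"
          proof (rule wp_Fold_loops[where F = "\<lambda>k. \<Sum>j<k. charge (s' 12) j ?i" and N = n])
            show "n \<le> 2 ^ mem_bits" "n \<le> loops" by (fact counter_bounds loop_bounds)+
          next
            fix s'' assume "agree {23, 21} ?s s''"
            then show "aval nE s'' = n" using inputs_aval(1)[OF prepared_inputs[OF prepared_agree]] p1 by simp
          next
            fix k s'' assume k: "k < n" "agree {23, 21} ?s s''" "s'' 21 0 = k"
              "s'' 23 0 = (\<Sum>j<k. charge (s' 12) j ?i)"
            have "prepared s''" using prepared_agree[OF k(2) p1] by simp
            moreover have "s'' 20 0 = ?i" "s'' 12 = s' 12" using agreeD[OF k(2)] v1 by simp_all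
            ultimately show "aval ?step s'' = (\<Sum>j<Suc k. charge (s' 12) j ?i)"
              using k st(1) by (simp add: aval_ChargeE)
          next
            fix k assume k: "k \<le> n"
            have "(\<Sum>j<k. charge (s' 12) j ?i) \<le> 2 ^ (size + 6 * size)"
              using k n_m_le(1) J st(1) by (intro sum_le_power charge_le) (auto intro: residual_upto_le)
            then show "(\<Sum>j<k. charge (s' 12) j ?i) \<le> 2 ^ mem_bits" by (rule le_mem_bits) simp
          qed (auto simp: max_esize_def)
        next
          fix s1 assume s1: "s1 23 0 = (\<Sum>j<n. charge (s' 12) j ?i) \<and> agree {23, 21} ?s s1"
          then have ag: "agree {23, 21} ?s s1" by blast
          have p: "prepared s1" using prepared_agree[OF ag p1] by simp
          have v: "s1 20 0 = ?i" "s1 22 0 = q" "s1 12 = s' 12" using agreeD[OF ag] v1 by simp_all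
          have ag2: "agree {12, 20, 21, 22, 23} s s1" by (rule agree_trans[OF ag1 ag]) auto
          have val: "aval ?e s1 =
              2 * n * wt ?i - (\<Sum>j<n. charge (s' 12) j ?i)"
            using s1 v st(1) p inputs_aval(1)[OF prepared_inputs[OF p]] by (simp add: prepared_get)
          let ?x = "2 * n * wt ?i - (\<Sum>j<n. charge (s' 12) j ?i)"
          have "2 * n * wt ?i \<le> 2 ^ mem_bits"
            by (rule le_mem_bits[OF scaled_weight_le[OF st(1)]]) simp
          then have x: "?x \<le> 2 ^ mem_bits" by linarith
          have eq: "store 12 ?i ?x s1 12 = (s' 12)(?i := ?x)" using v by (simp add: store_def)
          have "residual_upto (Suc q) (store 12 ?i ?x s1 12)"
            unfolding eq using residual_upto_step[OF _ st(1) i(2,1)] J by blast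
          moreover have "aval (Var 20) s1 = ?i" using v by simp
          ultimately show "wp mem_bits (Put 12 (Var 20) ?e) s1 1
            (\<lambda>s''. ?J (Suc q) s'' \<and> s'' 22 0 = q)"
            using v ag2 by (intro wp_PutI[OF _ val x]) (simp_all add: max_esize_def store_other agree_store)
        qed
      next
        assume "aval ?c ?s = 0"
        then have "\<not> (time ?i = q \<and> small ?i)" using cond by auto
        then have "residual_upto (Suc q) (s' 12)"
          using J st(3) by (intro residual_upto_skip) auto
        then have "wp mem_bits Skip ?s 1 (\<lambda>s''. ?J (Suc q) s'' \<and> s'' 22 0 = q)"
          using v1 ag1 by (intro wp_Skip) auto
        then show "wp mem_bits Skip ?s (6 * loops + 1) (\<lambda>s''. ?J (Suc q) s'' \<and> s'' 22 0 = q)"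
          by (rule wp_mono) auto
      qed (simp add: max_esize_def)
    qed (simp_all add: max_esize_def)
  qed (simp add: max_esize_def)
  then show ?thesis
  proof (rule wp_mono)
    fix s' assume s': "?J ((m + 1) * n) s'"
    then have "residual (s' 12)" using time_less unfolding residual_def residual_upto_def by simp
    then show "residual (s' 12) \<and> agree {12, 20, 21, 22, 23} s s'" using s' by blast
  qed simp
qed

definition acceptable :: "(nat \<Rightarrow> nat) \<Rightarrow> (nat \<Rightarrow> nat) \<Rightarrow> nat \<Rightarrow> bool" where
  "acceptable r acc i \<longleftrightarrow> r i > 0 \<and> (\<forall>j<n. time i < time j \<and> acc j \<noteq> 0 \<longrightarrow> bg j \<noteq> bg i) \<and>
     2 * ((\<Sum>j | j < n \<and> time i < time j \<and> acc j \<noteq> 0 \<and> scale j = scale i \<and> src j < snk i. dem j) + dem i)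
       \<le> scale i"

text \<open>Invariant of the backward scan: tasks with \<open>time\<close> at least \<open>q\<close>
  are decided, all others still have the entry 0.\<close>

definition accepted_from :: "nat \<Rightarrow> (nat \<Rightarrow> nat) \<Rightarrow> (nat \<Rightarrow> nat) \<Rightarrow> bool" where
  "accepted_from q r acc \<longleftrightarrow> (\<forall>i<n. acc i = (if q \<le> time i then of_bool (acceptable r acc i) else 0))"

lemma acceptable_cong:
  assumes "\<And>j. j < n \<Longrightarrow> time i < time j \<Longrightarrow> acc j = acc' j"
  shows "acceptable r acc i = acceptable r acc' i"
proof -
  have 1: "{j. j < n \<and> time i < time j \<and> acc j \<noteq> 0 \<and> scale j = scale i \<and> src j < snk i} =
    {j. j < n \<and> time i < time j \<and> acc' j \<noteq> 0 \<and> scale j = scale i \<and> src j < snk i}"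
    using assms by (intro Collect_cong) metis
  have 2: "(\<forall>j<n. time i < time j \<and> acc j \<noteq> 0 \<longrightarrow> bg j \<noteq> bg i) =
    (\<forall>j<n. time i < time j \<and> acc' j \<noteq> 0 \<longrightarrow> bg j \<noteq> bg i)"
    using assms by metis
  show ?thesis unfolding acceptable_def 1 2 ..
qed

lemma accepted_from_zero: "accepted_from q r acc \<Longrightarrow> j < n \<Longrightarrow> time j < q \<Longrightarrow> acc j = 0"
  unfolding accepted_from_def by (metis leD)

lemma accepted_from_le: "accepted_from q r acc \<Longrightarrow> j < n \<Longrightarrow> acc j \<le> 1"
  unfolding accepted_from_def by (metis le0 of_bool_eq(1) of_bool_eq(2) order.refl)

lemma accepted_from_skip:
  assumes "accepted_from (Suc q) r acc" "\<And>i. i < n \<Longrightarrow> time i \<noteq> q"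
  shows "accepted_from q r acc"
  unfolding accepted_from_def
proof (intro allI impI)
  fix i assume i: "i < n"
  have "q \<le> time i \<longleftrightarrow> Suc q \<le> time i" using assms(2)[OF i] by linarith
  then show "acc i = (if q \<le> time i then of_bool (acceptable r acc i) else 0)"
    using assms(1) i unfolding accepted_from_def by presburger
qed

text \<open>The program sums over all tasks without a time condition. Nonzero entries belong to
  decided and hence later tasks, and entries are 0 or 1, so these sums are the ones in
  \<open>acceptable\<close>.\<close>

lemma accepted_from_step:
  assumes acc: "accepted_from (Suc q) r acc" and i: "i < n" "time i = q"
  shows "accepted_from q r (acc(i := of_bool (r i > 0 \<and> (\<Sum>j<n. acc j * of_bool (bg j = bg i)) = 0 \<and>
    2 * ((\<Sum>j<n. acc j * of_bool (scale j = scale i \<and> src j < snk i) * dem j) + dem i) \<le> scale i)))"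
    (is "accepted_from q r ?acc")
proof -
  have a01: "acc j = 0 \<or> acc j = 1" if "j < n" for j
    using accepted_from_le[OF acc that] by linarith
  have later: "time i < time j" if "j < n" "acc j \<noteq> 0" for j
    using accepted_from_zero[OF acc that(1)] that(2) i(2) by (cases "time j < Suc q") auto
  have b1: "(\<Sum>j<n. acc j * of_bool (bg j = bg i)) = 0 \<longleftrightarrow> (\<forall>j\<in>{..<n}. acc j * of_bool (bg j = bg i) = 0)"
    by (rule sum_eq_0_iff) simp
  have b2: "(\<forall>j\<in>{..<n}. acc j * of_bool (bg j = bg i) = 0) \<longleftrightarrow> (\<forall>j<n. time i < time j \<and> acc j \<noteq> 0 \<longrightarrow> bg j \<noteq> bg i)"
  proof
    assume *: "\<forall>j\<in>{..<n}. acc j * of_bool (bg j = bg i) = 0"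
    show "\<forall>j<n. time i < time j \<and> acc j \<noteq> 0 \<longrightarrow> bg j \<noteq> bg i"
    proof (intro allI impI)
      fix j assume "j < n" "time i < time j \<and> acc j \<noteq> 0"
      then show "bg j \<noteq> bg i" using bspec[OF *, of j] by simp
    qed
  next
    assume *: "\<forall>j<n. time i < time j \<and> acc j \<noteq> 0 \<longrightarrow> bg j \<noteq> bg i"
    show "\<forall>j\<in>{..<n}. acc j * of_bool (bg j = bg i) = 0"
    proof
      fix j assume "j \<in> {..<n}"
      then show "acc j * of_bool (bg j = bg i) = 0" using *[rule_format, of j] later[of j] by auto
    qed
  qed
  have bags: "(\<Sum>j<n. acc j * of_bool (bg j = bg i)) = 0 \<longleftrightarrow>
      (\<forall>j<n. time i < time j \<and> acc j \<noteq> 0 \<longrightarrow> bg j \<noteq> bg i)"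
    unfolding b1 b2 ..
  have l1: "(\<Sum>j<n. acc j * of_bool (scale j = scale i \<and> src j < snk i) * dem j) =
      (\<Sum>j<n. if acc j \<noteq> 0 \<and> scale j = scale i \<and> src j < snk i then dem j else 0)"
  proof (rule sum.cong[OF refl])
    fix j assume "j \<in> {..<n}"
    then have "acc j = 0 \<or> acc j = 1" by (intro a01) simp
    then show "acc j * of_bool (scale j = scale i \<and> src j < snk i) * dem j =
      (if acc j \<noteq> 0 \<and> scale j = scale i \<and> src j < snk i then dem j else 0)"
      by (cases "scale j = scale i \<and> src j < snk i") auto
  qed
  have l2: "(\<Sum>j<n. if acc j \<noteq> 0 \<and> scale j = scale i \<and> src j < snk i then dem j else 0) =
      (\<Sum>j\<in>{j \<in> {..<n}. acc j \<noteq> 0 \<and> scale j = scale i \<and> src j < snk i}. dem j)"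
    by (rule sum.inter_filter[symmetric]) simp
  have l3: "{j \<in> {..<n}. acc j \<noteq> 0 \<and> scale j = scale i \<and> src j < snk i} =
      {j. j < n \<and> time i < time j \<and> acc j \<noteq> 0 \<and> scale j = scale i \<and> src j < snk i}"
    using later by auto
  have eq: "?acc = acc(i := of_bool (acceptable r acc i))"
    unfolding acceptable_def bags l1 l2 l3 ..
  show ?thesis unfolding eq accepted_from_def
  proof (intro allI impI)
    fix k assume k: "k < n"
    have same: "acceptable r (acc(i := of_bool (acceptable r acc i))) k = acceptable r acc k" if "q \<le> time k"
      using that i(2) by (intro acceptable_cong) auto
    show "(acc(i := of_bool (acceptable r acc i))) k =
      (if q \<le> time k then of_bool (acceptable r (acc(i := of_bool (acceptable r acc i))) k) else 0)"
    proof (cases "k = i")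
      case True
      then show ?thesis using i same by simp
    next
      case False
      then have "time k \<noteq> q" using time_inj[OF k i(1)] i(2) by auto
      then have "q \<le> time k \<longleftrightarrow> Suc q \<le> time k" by linarith
      moreover have "acc k = (if Suc q \<le> time k then of_bool (acceptable r acc k) else 0)"
        using acc k unfolding accepted_from_def by blast
      ultimately show ?thesis using False same by auto
    qed
  qed
qed

lemma wp_accept_prog:
  assumes s: "prepared s" and z: "s 13 = (\<lambda>_. 0)"
  shows "wp mem_bits accept_prog s (loops * (12 * loops + 8))
    (\<lambda>s'. accepted (s 12) (\<lambda>i. s' 13 i \<noteq> 0) \<and> (\<forall>i<n. s' 13 i \<le> 1) \<and>
       agree {13, 20, 21, 22, 23, 24, 25} s s')"
proof -
  let ?step = "Add (Var 23) (Mul (Mul (Get 13 (Var 21)) (AND (EQ (Get 11 (Var 21)) (Get 11 (Var 20))) (LT (Get 4 (Var 21)) (Get 5 (Var 20))))) (Get 3 (Var 21)))"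
  let ?load = "Fold 23 21 nE (Const 0) ?step"
  let ?step2 = "Add (Var 25) (Mul (Get 13 (Var 21)) (EQ (Get 6 (Var 21)) (Get 6 (Var 20))))"
  let ?mates = "Fold 25 21 nE (Const 0) ?step2"
  let ?e = "AND (LT (Const 0) (Get 12 (Var 20))) (AND (EQ (Var 25) (Const 0)) (LE (Mul (Const 2) (Add (Var 23) (Get 3 (Var 20)))) (Get 11 (Var 20))))"
  let ?put = "Put 13 (Var 20) ?e"
  let ?c = "EQ (Get 5 (Var 20)) (Div (Var 24) nE)"
  let ?N = "(m + 1) * n"
  let ?A = "{13, 20, 21, 22, 23, 24, 25} :: nat set"
  let ?J = "\<lambda>q s'. accepted_from (?N - q) (s 12) (s' 13) \<and> agree ?A s s'"
  have prep: "prepared s'" if "agree ?A s s'" for s'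
    by (rule prepared_agree[OF that s]) simp
  have "wp mem_bits accept_prog s (loops * ((1 + (1 + ((6 * loops + (6 * loops + 1)) + 1))) + 4)) (?J ?N)"
    unfolding accept_prog_def
  proof (rule wp_For_loops[where J = ?J and N = ?N])
    show "?N \<le> 2 ^ mem_bits" "?N \<le> loops" by (fact counter_bounds loop_bounds)+
    have "accepted_from ?N (s 12) (s 13)"
      unfolding accepted_from_def z using time_less by (metis leD)
    then show "?J 0 s" by (simp add: agree_refl)
    fix q s' z assume "?J q s'"
    then show "?J q (store 22 0 z s')" by (auto simp: store_other intro: agree_store)
  next
    fix q s' assume "?J q s'"
    then show "aval SlotsE s' = ?N" using inputs_aval(4)[OF prepared_inputs] prep by blast
  next
    fix q0 s0 assume q0: "q0 < ?N" and J: "?J q0 s0" and s22: "s0 22 0 = q0"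
    \<comment> \<open>The counter \<open>q0\<close> ascends while the slot \<open>q\<close> descends
      from the last one.\<close>
    define q where "q = ?N - 1 - q0"
    have q: "q < ?N" "?N - q0 = Suc q" "?N - Suc q0 = q" using q0 by (auto simp: q_def)
    note st = slot_task[OF q(1)]
    let ?i = "q mod n"
    let ?s = "store 20 0 ?i (store 24 0 q s0)"
    have ag0: "agree ?A s (store 24 0 q s0)" using J by (auto intro: agree_store)
    have ag1: "agree ?A s ?s" using J by (auto intro: agree_store)
    have p0: "prepared s0" "prepared (store 24 0 q s0)" using prep J ag0 by blast+
    have p1: "prepared ?s" by (rule prep[OF ag1])
    have v1: "?s 20 0 = ?i" "?s 24 0 = q" "?s 22 0 = q0" "?s 13 = s0 13" "?s 12 = s 12"
      using s22 agreeD[OF ag1] by (simp_all add: store_same store_other)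
    have n0: "aval nE s0 = n" "aval nE ?s = n" "aval SlotsE s0 = ?N" "aval nE (store 24 0 q s0) = n"
      using inputs_aval prepared_inputs p0 p1 by blast+
    have acc: "accepted_from (Suc q) (s 12) (s0 13)" using J q by simp
    have cond: "aval ?c ?s = of_bool (time ?i = q)"
      using v1 p1 st(1,2) by (simp add: n0 prepared_get)
    have le1: "s0 13 j \<le> 1" if "j < n" for j using accepted_from_le[OF acc that] .
    define L where "L = (\<lambda>k. \<Sum>j<k. s0 13 j * of_bool (scale j = scale ?i \<and> src j < snk ?i) * dem j)"
    define Bg where "Bg = (\<lambda>k. \<Sum>j<k. s0 13 j * of_bool (bg j = bg ?i))"
    have L_le: "L k \<le> 2 ^ (2 * size)" if "k \<le> n" for k
    proof -
      have "L k \<le> 2 ^ (size + size)" unfolding L_def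
      proof (rule sum_le_power)
        show "k \<le> 2 ^ size" using that n_m_le(1) by linarith
        fix j assume j: "j < k"
        have "s0 13 j * of_bool (scale j = scale ?i \<and> src j < snk ?i) * dem j \<le> 1 * 1 * dem j"
          using le1[of j] j that by (intro mult_le_mono) auto
        also have "1 * 1 * dem j \<le> 2 ^ size" using task_le(2)[of j] j that by simp
        finally show "s0 13 j * of_bool (scale j = scale ?i \<and> src j < snk ?i) * dem j \<le> 2 ^ size" .
      qed
      then show ?thesis by (simp add: mult_2)
    qed
    have Suc: "L (Suc k) = L k + s0 13 k * of_bool (scale k = scale ?i \<and> src k < snk ?i) * dem k"
      "Bg (Suc k) = Bg k + s0 13 k * of_bool (bg k = bg ?i)" for k
      by (simp_all only: L_def Bg_def sum.lessThan_Suc)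
    have Bg_le: "Bg k \<le> 2 ^ (size + 0)" if "k \<le> n" for k
      unfolding Bg_def
    proof (rule sum_le_power)
      show "k \<le> 2 ^ size" using that n_m_le(1) by linarith
      fix j assume j: "j < k"
      have "s0 13 j * of_bool (bg j = bg ?i) \<le> 1 * 1" using le1[of j] j that by (intro mult_le_mono) auto
      then show "s0 13 j * of_bool (bg j = bg ?i) \<le> 2 ^ 0" by simp
    qed
    show "wp mem_bits (Seq (Put 24 (Const 0) (Sub (Sub SlotsE (Const 1)) (Var 22)))
     (Seq (Put 20 (Const 0) (MOD (Var 24) nE))
     (If ?c
       (Seq ?load
       (Seq ?mates
         ?put))
       Skip))) s0 (1 + (1 + ((6 * loops + (6 * loops + 1)) + 1))) (\<lambda>s''. ?J (Suc q0) s'' \<and> s'' 22 0 = q0)"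
      (is "wp _ (Seq _ (Seq _ ?If)) _ _ ?Q")
    proof (rule wp_SeqPut)
      show "aval (Const 0) s0 = 0" "aval (Sub (Sub SlotsE (Const 1)) (Var 22)) s0 = q"
        using s22 n0 by (simp_all add: q_def)
      show "q \<le> 2 ^ mem_bits" using q(1) counter_bounds(4) by linarith
      show "wp mem_bits (Seq (Put 20 (Const 0) (MOD (Var 24) nE)) ?If) (store 24 0 q s0)
        (1 + ((6 * loops + (6 * loops + 1)) + 1)) ?Q"
      proof (rule wp_SeqPut)
        show "aval (Const 0) (store 24 0 q s0) = 0" "aval (MOD (Var 24) nE) (store 24 0 q s0) = ?i"
          using n0 by (simp_all add: store_same)
        show "?i \<le> 2 ^ mem_bits" using st(1) counter_bounds(1) by linarith
        show "wp mem_bits ?If ?s ((6 * loops + (6 * loops + 1)) + 1) ?Q"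
        proof (rule wp_If)
          assume "aval ?c ?s \<noteq> 0"
          then have i: "time ?i = q" unfolding cond by simp
          show "wp mem_bits (Seq ?load
           (Seq ?mates
           ?put)) ?s
             (6 * loops + (6 * loops + 1)) ?Q"
          proof (intro wp_Seq)
            show "wp mem_bits ?load ?s (6 * loops) (\<lambda>s''. s'' 23 0 = L n \<and> agree {23, 21} ?s s'')"
            proof (rule wp_Fold_loops[where F = L and N = n])
              show "n \<le> 2 ^ mem_bits" "n \<le> loops" by (fact counter_bounds loop_bounds)+
            next
              fix s'' assume "agree {23, 21} ?s s''"
              then show "aval nE s'' = n" using inputs_aval(1)[OF prepared_inputs[OF prepared_agree]] p1 by simp
            next
              fix k s'' assume k: "k < n" "agree {23, 21} ?s s''" "s'' 21 0 = k" "s'' 23 0 = L k"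
              have "prepared s''" using prepared_agree[OF k(2) p1] by simp
              moreover have "s'' 20 0 = ?i" "s'' 13 = s0 13" using agreeD[OF k(2)] v1 by simp_all
              ultimately show "aval ?step s'' = L (Suc k)"
                using k st(1) by (simp add: prepared_get Suc)
            next
              fix k assume "k \<le> n"
              then show "L k \<le> 2 ^ mem_bits" by (rule le_mem_bits[OF L_le]) simp
            qed (auto simp: max_esize_def L_def)
          next
            fix s1 assume s1: "s1 23 0 = L n \<and> agree {23, 21} ?s s1"
            then have ag: "agree {23, 21} ?s s1" by blast
            have p: "prepared s1" using prepared_agree[OF ag p1] by simp
            have v: "s1 20 0 = ?i" "s1 22 0 = q0" "s1 13 = s0 13" "s1 12 = s 12" using agreeD[OF ag] v1 by simp_all
            show "wp mem_bits ?mates s1 (6 * loops) (\<lambda>s''. s'' 25 0 = Bg n \<and> agree {25, 21} s1 s'')"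
            proof (rule wp_Fold_loops[where F = Bg and N = n])
              show "n \<le> 2 ^ mem_bits" "n \<le> loops" by (fact counter_bounds loop_bounds)+
            next
              fix s'' assume "agree {25, 21} s1 s''"
              then show "aval nE s'' = n" using inputs_aval(1)[OF prepared_inputs[OF prepared_agree]] p by simp
            next
              fix k s'' assume k: "k < n" "agree {25, 21} s1 s''" "s'' 21 0 = k" "s'' 25 0 = Bg k"
              have "prepared s''" using prepared_agree[OF k(2) p] by simp
              moreover have "s'' 20 0 = ?i" "s'' 13 = s0 13" using agreeD[OF k(2)] v by simp_all
              ultimately show "aval ?step2 s'' = Bg (Suc k)"
                using k st(1) by (simp add: prepared_get Suc)
            next
              fix k assume "k \<le> n"
              then show "Bg k \<le> 2 ^ mem_bits" by (rule le_mem_bits[OF Bg_le]) simp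
            qed (auto simp: max_esize_def Bg_def)
            fix s2 assume s2: "s2 25 0 = Bg n \<and> agree {25, 21} s1 s2"
            then have ag': "agree {25, 21} s1 s2" by blast
            have p2: "prepared s2" using prepared_agree[OF ag' p] by simp
            have v2: "s2 20 0 = ?i" "s2 22 0 = q0" "s2 13 = s0 13" "s2 12 = s 12" "s2 23 0 = L n" "s2 25 0 = Bg n"
              using agreeD[OF ag'] v s1 s2 by simp_all
            have ag2: "agree ?A s s2"
              by (rule agree_trans[OF agree_trans[OF ag1 ag, of ?A] ag']) auto
            let ?b = "of_bool (s 12 ?i > 0 \<and> Bg n = 0 \<and> 2 * (L n + dem ?i) \<le> scale ?i) :: nat"
            have val: "aval ?e s2 = ?b"
              using v2 st(1) p2 by (simp add: prepared_get)
            have "store 13 ?i ?b s2 13 = (s0 13)(?i := ?b)" using v2 by (simp add: store_def)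
            then have "accepted_from (?N - Suc q0) (s 12) (store 13 ?i ?b s2 13)"
              using accepted_from_step[OF acc st(1) i] q(3) by (simp add: L_def Bg_def)
            then show "wp mem_bits ?put s2 1 ?Q"
              using v2 ag2 by (intro wp_PutI[OF _ val, where i = "q mod n"]) (simp_all add: max_esize_def store_other agree_store)
          qed
        next
          assume "aval ?c ?s = 0"
          then have "time ?i \<noteq> q" unfolding cond by simp
          then have "accepted_from (?N - Suc q0) (s 12) (s0 13)"
            unfolding q(3) using st(3) by (intro accepted_from_skip[OF acc]) metis
          then have "wp mem_bits Skip ?s 1 ?Q"
            using v1 ag1 by (intro wp_Skip) simp
          then show "wp mem_bits Skip ?s (6 * loops + (6 * loops + 1)) ?Q"
            by (rule wp_mono) auto
        qed (simp add: max_esize_def)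
      qed (simp_all add: max_esize_def)
    qed (simp_all add: max_esize_def)
  qed (simp add: max_esize_def)
  then show ?thesis
  proof (rule wp_mono)
    fix s' assume s': "?J ?N s'"
    then have acc: "accepted_from 0 (s 12) (s' 13)" by simp
    have "accepted (s 12) (\<lambda>i. s' 13 i \<noteq> 0)"
      unfolding accepted_def
    proof (intro allI impI)
      fix i assume "i < n"
      then have "s' 13 i = of_bool (acceptable (s 12) (s' 13) i)"
        using acc unfolding accepted_from_def by (metis le0)
      then have "s' 13 i \<noteq> 0 \<longleftrightarrow> acceptable (s 12) (s' 13) i" by (metis of_bool_eq_0_iff)
      then show "s' 13 i \<noteq> 0 \<longleftrightarrow> s 12 i > 0 \<and>
         (\<forall>j < n. time i < time j \<and> s' 13 j \<noteq> 0 \<longrightarrow> bg j \<noteq> bg i) \<and>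
         2 * ((\<Sum>j | j < n \<and> time i < time j \<and> s' 13 j \<noteq> 0 \<and> scale j = scale i \<and> src j < snk i. dem j) + dem i)
           \<le> scale i"
        unfolding acceptable_def .
    qed
    then show "accepted (s 12) (\<lambda>i. s' 13 i \<noteq> 0) \<and> (\<forall>i<n. s' 13 i \<le> 1) \<and>
       agree {13, 20, 21, 22, 23, 24, 25} s s'"
      using s' accepted_from_le[OF acc] by blast
  qed simp
qed

end

section \<open>The multiplicative weights program\<close>

definition scan_body :: com where
  "scan_body = If (LargeE (Var 20))
     (Seq (Fold 23 22 NumE (Const 0) (Add (Var 23) (Mul (IncidentE (Var 20) (Var 22)) (Get 14 (Var 22)))))
       (If (OR (EQ (Var 34) nE) (LT (Mul (Var 23) (Get 2 (Var 34))) (Mul (Var 35) (Get 2 (Var 20)))))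
         (Seq (Put 34 (Const 0) (Var 20)) (Put 35 (Const 0) (Var 23))) Skip)) Skip"

definition mw_body :: com where
  "mw_body = Seq (Put 34 (Const 0) nE) (Seq (Put 35 (Const 0) (Const 0)) (Seq (For 20 nE scan_body)
     (Seq (Put 15 (Var 34) (Add (Get 15 (Var 34)) (Const 1)))
     (Seq (For 22 NumE (Put 14 (Var 22) (Mul (Get 14 (Var 22)) (Add (Const 1) (IncidentE (Var 34) (Var 22))))))
       (Put 32 (Const 0) (Add (Var 32) (Var 35)))))))"

text \<open>Cell 33 counts the large tasks. As a factor of the loop condition it prevents entering
  the loop when there are none, where the volume could never grow.\<close>

definition mw_prog :: com where
  "mw_prog = Seq (For 22 NumE (Put 14 (Var 22) (Const 1))) (Seq (Put 32 (Const 0) NumE)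
     (Seq (Fold 33 20 nE (Const 0) (Add (Var 33) (LargeE (Var 20))))
       (While (Mul (Var 33) (Sub LimitE (Var 32))) mw_body)))"

context bagufp_instance
begin

lemma aval_nE_prepared: "prepared s \<Longrightarrow> aval nE s = n"
  using inputs_aval(1)[OF prepared_inputs] .

lemma aval_NumE_prepared: "prepared s \<Longrightarrow> aval NumE s = num_constraints"
  using inputs_aval(3)[OF prepared_inputs] .

definition length_upto :: "(nat \<Rightarrow> nat) \<Rightarrow> nat \<Rightarrow> nat \<Rightarrow> nat" where
  "length_upto x i k = (\<Sum>c<k. of_bool (incident i c) * price x c)"

lemma length_upto_final: "length_upto x i num_constraints = length_of x i"
proof -
  have "length_upto x i num_constraints = (\<Sum>c<num_constraints. if incident i c then price x c else 0)"
    unfolding length_upto_def by (intro sum.cong) auto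
  also have "\<dots> = (\<Sum>c\<in>{c \<in> {..<num_constraints}. incident i c}. price x c)"
    by (rule sum.inter_filter[symmetric]) simp
  also have "{c \<in> {..<num_constraints}. incident i c} = {c. c < num_constraints \<and> incident i c}" by auto
  finally show ?thesis by (simp add: length_of_def)
qed

lemma length_upto_le: "k \<le> num_constraints \<Longrightarrow> length_upto x i k \<le> volume x"
  unfolding length_upto_def volume_def
  by (rule order.trans[OF sum_mono[where g = "price x"] sum_mono2]) auto

lemma volume_le_mem: "volume x < 2 * limit \<Longrightarrow> z \<le> volume x \<Longrightarrow> z \<le> 2 ^ mem_bits"
  using limit_le_power by (intro le_mem_bits[where k = "6 * size"]) auto

lemma price_le_volume: "c < num_constraints \<Longrightarrow> price x c \<le> volume x"
  unfolding volume_def by (intro member_le_sum) auto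

text \<open>\<open>best = n\<close> is a sentinel for no large task seen so far. Ratios of length to
  weight are compared by cross multiplication.\<close>

definition scanned :: "(nat \<Rightarrow> nat) \<Rightarrow> nat \<Rightarrow> nat \<Rightarrow> nat \<Rightarrow> bool" where
  "scanned x k best len \<longleftrightarrow> (best = n \<and> (\<forall>i<k. i < n \<longrightarrow> \<not> large i)) \<or>
     (best < n \<and> large best \<and> len = length_of x best \<and>
      (\<forall>i<k. i < n \<and> large i \<longrightarrow> length_of x best * wt i \<le> length_of x i * wt best))"

lemma scanned_skip: "scanned x k best len \<Longrightarrow> \<not> large k \<Longrightarrow> scanned x (Suc k) best len"
  unfolding scanned_def by (auto simp: less_Suc_eq)

lemma scanned_keep:
  assumes "scanned x k best len" "best \<noteq> n" "\<not> length_of x k * wt best < len * wt k"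
  shows "scanned x (Suc k) best len"
  using assms unfolding scanned_def by (auto simp: less_Suc_eq)

text \<open>Transitivity of the ratio comparison: the inequalities against \<open>best\<close> are
  multiplied and the positive weight \<open>wt best\<close> is cancelled.\<close>

lemma scanned_update:
  assumes sc: "scanned x k best len" and k: "k < n" "large k"
    and lt: "best = n \<or> length_of x k * wt best < len * wt k"
  shows "scanned x (Suc k) k (length_of x k)"
proof -
  have "length_of x k * wt i \<le> length_of x i * wt k" if i: "i < k" "i < n" "large i" for i
  proof -
    have b: "best \<noteq> n" using sc i unfolding scanned_def by auto
    then have best: "best < n" "len = length_of x best" "length_of x best * wt i \<le> length_of x i * wt best"
      using sc i unfolding scanned_def by auto
    have "wt best * (length_of x k * wt i) = (length_of x k * wt best) * wt i" by simp
    also have "\<dots> \<le> (len * wt k) * wt i" using lt b by (intro mult_le_mono1) auto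
    also have "\<dots> = (length_of x best * wt i) * wt k" using best(2) by simp
    also have "\<dots> \<le> (length_of x i * wt best) * wt k" using best(3) by (rule mult_le_mono1)
    also have "\<dots> = wt best * (length_of x i * wt k)" by simp
    finally show ?thesis using task_valid(1)[OF best(1)] by simp
  qed
  then show ?thesis using k unfolding scanned_def by (auto simp: less_Suc_eq)
qed

lemma wp_scan:
  assumes s: "prepared s" and y: "\<And>c. c < num_constraints \<Longrightarrow> s 14 c = price x c"
    and vol: "volume x < 2 * limit" and s34: "s 34 0 = n"
  shows "wp mem_bits (For 20 nE scan_body) s (loops * (6 * loops + 8))
    (\<lambda>s'. scanned x n (s' 34 0) (s' 35 0) \<and> agree {20, 22, 23, 34, 35} s s')"
proof -
  let ?step = "Add (Var 23) (Mul (IncidentE (Var 20) (Var 22)) (Get 14 (Var 22)))"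
  let ?fold = "Fold 23 22 NumE (Const 0) ?step"
  let ?better = "OR (EQ (Var 34) nE) (LT (Mul (Var 23) (Get 2 (Var 34))) (Mul (Var 35) (Get 2 (Var 20))))"
  let ?take = "Seq (Put 34 (Const 0) (Var 20)) (Put 35 (Const 0) (Var 23))"
  let ?A = "{20, 22, 23, 34, 35} :: nat set"
  let ?J = "\<lambda>k s'. scanned x k (s' 34 0) (s' 35 0) \<and> agree ?A s s'"
  have prep: "prepared s'" if "agree ?A s s'" for s'
    by (rule prepared_agree[OF that s]) simp
  have "wp mem_bits (For 20 nE scan_body) s (loops * ((6 * loops + (1 + 1 + 1) + 1) + 4)) (?J n)"
  proof (rule wp_For_loops[where J = ?J and N = n])
    show "n \<le> 2 ^ mem_bits" "n \<le> loops" by (fact counter_bounds loop_bounds)+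
    show "?J 0 s" using s34 by (simp add: agree_refl scanned_def)
    fix q s' z assume "?J q s'"
    then show "?J q (store 20 0 z s')" by (auto simp: store_other intro: agree_store)
  next
    fix q s' assume "?J q s'"
    then show "aval nE s' = n" using aval_nE_prepared prep by blast
  next
    fix k s' assume k: "k < n" and J: "?J k s'" and s20: "s' 20 0 = k"
    have p': "prepared s'" using prep J by blast
    have cond: "aval (LargeE (Var 20)) s' = of_bool (large k)"
      using s20 k p' by (simp add: aval_LargeE)
    show "wp mem_bits scan_body s' (6 * loops + (1 + 1 + 1) + 1) (\<lambda>s''. ?J (Suc k) s'' \<and> s'' 20 0 = k)"
      unfolding scan_body_def
    proof (rule wp_If)
      assume "aval (LargeE (Var 20)) s' \<noteq> 0"
      then have lk: "large k" unfolding cond by simp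
      show "wp mem_bits (Seq ?fold
       (If ?better
         ?take Skip)) s' (6 * loops + (1 + 1 + 1))
         (\<lambda>s''. ?J (Suc k) s'' \<and> s'' 20 0 = k)"
      proof (rule wp_Seq)
        show "wp mem_bits ?fold s'
          (6 * loops) (\<lambda>s''. s'' 23 0 = length_upto x k num_constraints \<and> agree {23, 22} s' s'')"
        proof (rule wp_Fold_loops[where F = "length_upto x k" and N = num_constraints])
          show "num_constraints \<le> 2 ^ mem_bits" "num_constraints \<le> loops" by (fact counter_bounds loop_bounds)+
        next
          fix s'' assume "agree {23, 22} s' s''"
          then show "aval NumE s'' = num_constraints" using aval_NumE_prepared[OF prepared_agree[OF _ p']] by simp
        next
          fix c s'' assume c: "c < num_constraints" "agree {23, 22} s' s''" "s'' 22 0 = c" "s'' 23 0 = length_upto x k c"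
          have p: "prepared s''" using prepared_agree[OF c(2) p'] by simp
          have "s'' 14 = s 14" using agreeD[OF c(2), of 14] J agreeD[of ?A s s' 14] by simp
          then have y'': "s'' 14 c = price x c" using y c(1) by simp
          have "s'' 20 0 = k" using agreeD[OF c(2), of 20] s20 by simp
          then have "aval (IncidentE (Var 20) (Var 22)) s'' = of_bool (incident k c)"
            using aval_IncidentE[OF p, of "Var 20" "Var 22"] k c by simp
          then show "aval ?step s'' = length_upto x k (Suc c)"
            using c y'' by (simp only: aval.simps length_upto_def sum.lessThan_Suc)
        next
          fix c assume "c \<le> num_constraints"
          then show "length_upto x k c \<le> 2 ^ mem_bits" by (rule volume_le_mem[OF vol length_upto_le])
        qed (simp_all add: max_esize_def length_upto_def)
      next
        fix s1 assume s1: "s1 23 0 = length_upto x k num_constraints \<and> agree {23, 22} s' s1"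
        then have ag: "agree {23, 22} s' s1" and len: "s1 23 0 = length_of x k"
          by (simp_all add: length_upto_final)
        have p1: "prepared s1" using prepared_agree[OF ag p'] by simp
        have v: "s1 20 0 = k" "s1 34 0 = s' 34 0" "s1 35 0 = s' 35 0" using agreeD[OF ag] s20 by simp_all
        have ag1: "agree ?A s s1" by (rule agree_trans[OF _ ag]) (use J in auto)
        have sc: "scanned x k (s1 34 0) (s1 35 0)" using J v by simp
        let ?up = "s1 34 0 = n \<or> length_of x k * s1 2 (s1 34 0) < s1 35 0 * wt k"
        \<comment> \<open>For the sentinel, the weight is read from a cell outside the task range;
          the first disjunct settles this case whatever that cell contains.\<close>
        have up: "?up \<longleftrightarrow> s1 34 0 = n \<or> length_of x k * wt (s1 34 0) < s1 35 0 * wt k"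
        proof (cases "s1 34 0 = n")
          case False
          then have "s1 34 0 < n" using sc by (auto simp: scanned_def)
          then show ?thesis using p1 by (simp add: prepared_get)
        qed simp
        have cond2: "aval ?better s1 = of_bool ?up"
          using v len k p1 aval_nE_prepared[OF p1] by (intro aval_OR) (simp_all add: prepared_get)
        show "wp mem_bits (If ?better
         ?take Skip) s1 (1 + 1 + 1)
         (\<lambda>s''. ?J (Suc k) s'' \<and> s'' 20 0 = k)"
        proof (rule wp_If)
          assume "aval ?better s1 \<noteq> 0"
          then have ?up unfolding cond2 of_bool_eq_0_iff by blast
          then have sc': "scanned x (Suc k) k (length_of x k)"
            using up by (intro scanned_update[OF sc k lk]) blast
          show "wp mem_bits ?take s1 (1 + 1)
            (\<lambda>s''. ?J (Suc k) s'' \<and> s'' 20 0 = k)"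
          proof (rule wp_SeqPut)
            show "aval (Const 0) s1 = 0" "aval (Var 20) s1 = k" using v by simp_all
            show "k \<le> 2 ^ mem_bits" using k counter_bounds(1) by linarith
            show "wp mem_bits (Put 35 (Const 0) (Var 23)) (store 34 0 k s1) 1 (\<lambda>s''. ?J (Suc k) s'' \<and> s'' 20 0 = k)"
            proof (rule wp_PutI)
              show "aval (Const 0) (store 34 0 k s1) = 0" "aval (Var 23) (store 34 0 k s1) = length_of x k"
                using len by (simp_all add: store_other)
              show "length_of x k \<le> 2 ^ mem_bits" by (rule volume_le_mem[OF vol length_of_le_volume])
              show "?J (Suc k) (store 35 0 (length_of x k) (store 34 0 k s1)) \<and>
                store 35 0 (length_of x k) (store 34 0 k s1) 20 0 = k"
                using sc' v ag1 by (simp add: store_same store_other agree_store)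
            qed (simp_all add: max_esize_def)
          qed (simp_all add: max_esize_def)
        next
          assume "aval ?better s1 = 0"
          then have "\<not> ?up" unfolding cond2 of_bool_eq_0_iff by blast
          then have "scanned x (Suc k) (s1 34 0) (s1 35 0)"
            using up by (intro scanned_keep[OF sc]) blast+
          then have "wp mem_bits Skip s1 1 (\<lambda>s''. ?J (Suc k) s'' \<and> s'' 20 0 = k)"
            using ag1 v by (intro wp_Skip) blast
          then show "wp mem_bits Skip s1 (1 + 1) (\<lambda>s''. ?J (Suc k) s'' \<and> s'' 20 0 = k)"
            by (rule wp_mono) auto
        qed (simp add: max_esize_def)
      qed
    next
      assume "aval (LargeE (Var 20)) s' = 0"
      then have "\<not> large k" unfolding cond by simp
      then have "scanned x (Suc k) (s' 34 0) (s' 35 0)" using J by (intro scanned_skip) blast+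
      then have "wp mem_bits Skip s' 1 (\<lambda>s''. ?J (Suc k) s'' \<and> s'' 20 0 = k)"
        using J s20 by (intro wp_Skip) blast
      then show "wp mem_bits Skip s' (6 * loops + (1 + 1 + 1)) (\<lambda>s''. ?J (Suc k) s'' \<and> s'' 20 0 = k)"
        by (rule wp_mono) auto
    qed (simp add: max_esize_def)
  qed (simp add: max_esize_def)
  then show ?thesis by (rule wp_mono) auto
qed

definition mw_state :: "memory \<Rightarrow> bool" where
  "mw_state s \<longleftrightarrow> prepared s \<and> s 30 0 = 2 ^ lg \<and> s 31 0 = lg \<and> mw_invariant (s 15) \<and>
     (\<forall>c<num_constraints. s 14 c = price (s 15) c) \<and> s 32 0 = volume (s 15) \<and> volume (s 15) < 2 * limit"

lemma mw_stateI:
  assumes "prepared s" "s 30 0 = 2 ^ lg" "s 31 0 = lg" "s 15 = x" "mw_invariant x"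
    "\<And>c. c < num_constraints \<Longrightarrow> s 14 c = price x c" "s 32 0 = volume x" "volume x < 2 * limit"
  shows "mw_state s"
  using assms unfolding mw_state_def by metis

text \<open>The multiplicity of a large task is part of the usage of its own bag constraint.\<close>

lemma multiplicity_le:
  assumes "volume x < 2 * limit" "i < n" "large i"
  shows "x i < depth"
proof -
  have "x i \<le> usage x (2 * n * n + i)"
    unfolding usage_def using assms own_constraints(2)[OF assms(2,3)] by (intro member_le_sum) auto
  then show ?thesis using usage_less_depth[OF assms(1) own_constraints(1)[OF assms(2,3)]] by linarith
qed

lemma depth_le_mem: "z \<le> denom \<Longrightarrow> z \<le> 2 ^ mem_bits"
  using denom_le_power by (intro le_mem_bits[where k = "3 * size"]) auto

lemma wp_price_update:
  assumes s: "prepared s" and k: "k < n" "s 34 0 = k"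
    and y: "\<And>c. c < num_constraints \<Longrightarrow> s 14 c = price x c"
    and vol: "volume (x(k := x k + 1)) < 2 * limit"
  shows "wp mem_bits (For 22 NumE (Put 14 (Var 22) (Mul (Get 14 (Var 22)) (Add (Const 1) (IncidentE (Var 34) (Var 22)))))) s
    (loops * 5) (\<lambda>s'. (\<forall>c<num_constraints. s' 14 c = price (x(k := x k + 1)) c) \<and> agree {14, 22} s s')"
proof -
  let ?e = "Mul (Get 14 (Var 22)) (Add (Const 1) (IncidentE (Var 34) (Var 22)))"
  let ?x = "x(k := x k + 1)"
  let ?J = "\<lambda>q s'. (\<forall>c<num_constraints. s' 14 c = (if c < q then price ?x c else price x c)) \<and> agree {14, 22} s s'"
  have prep: "prepared s'" if "agree {14, 22} s s'" for s'
    by (rule prepared_agree[OF that s]) simp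
  have "wp mem_bits (For 22 NumE (Put 14 (Var 22) ?e)) s
    (loops * (1 + 4)) (?J num_constraints)"
  proof (rule wp_For_loops[where J = ?J and N = num_constraints])
    show "num_constraints \<le> 2 ^ mem_bits" "num_constraints \<le> loops" by (fact counter_bounds loop_bounds)+
    show "?J 0 s" using y by (simp add: agree_refl)
    fix q s' z assume "?J q s'"
    then show "?J q (store 22 0 z s')" by (auto simp: store_other intro: agree_store)
  next
    fix q s' assume "?J q s'"
    then show "aval NumE s' = num_constraints" using aval_NumE_prepared prep by blast
  next
    fix q s' assume q: "q < num_constraints" and J: "?J q s'" and s22: "s' 22 0 = q"
    have p': "prepared s'" using prep J by blast
    have s34: "s' 34 0 = k" using J agreeD[of "{14, 22}" s s' 34] k by simp
    have inc: "aval (IncidentE (Var 34) (Var 22)) s' = of_bool (incident k q)"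
      using aval_IncidentE[OF p', of "Var 34" "Var 22"] k q s34 s22 by simp
    have "s' 14 q = price x q" using J q by simp
    then have val: "aval ?e s' = price ?x q"
      unfolding price_bump[OF k(1)] using inc s22 by simp
    show "wp mem_bits (Put 14 (Var 22) ?e) s' 1
      (\<lambda>s''. ?J (Suc q) s'' \<and> s'' 22 0 = q)"
    proof (rule wp_PutI[OF _ val])
      show "aval (Var 22) s' = q" using s22 by simp
      show "price ?x q \<le> 2 ^ mem_bits" by (rule volume_le_mem[OF vol price_le_volume[OF q]])
      show "?J (Suc q) (store 14 q (price ?x q) s') \<and> store 14 q (price ?x q) s' 22 0 = q"
        using J s22 by (auto simp: store_same store_other agree_store less_Suc_eq)
    qed (simp_all add: max_esize_def)
  qed (simp add: max_esize_def)
  then show ?thesis by (rule wp_mono) auto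
qed

text \<open>The volume strictly increases because a large task has positive length, and it at most
  doubles because a length never exceeds the volume; so starting below \<open>limit\<close> it stays
  below \<open>2 * limit\<close>.\<close>

lemma wp_mw_body:
  assumes s: "mw_state s" and large: "i < n" "large i" and vol: "volume (s 15) < limit"
  shows "wp mem_bits mw_body s (loops * (6 * loops + 17))
    (\<lambda>s'. mw_state s' \<and> volume (s 15) < volume (s' 15) \<and> agree {14, 15, 20, 22, 23, 32, 34, 35} s s')"
proof -
  let ?upd = "For 22 NumE (Put 14 (Var 22) (Mul (Get 14 (Var 22)) (Add (Const 1) (IncidentE (Var 34) (Var 22)))))"
  let ?vol = "Put 32 (Const 0) (Add (Var 32) (Var 35))"
  let ?bump = "Put 15 (Var 34) (Add (Get 15 (Var 34)) (Const 1))"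
  let ?tail = "Seq ?bump (Seq ?upd ?vol)"
  let ?A = "{14, 15, 20, 22, 23, 32, 34, 35} :: nat set"
  let ?x = "s 15"
  let ?Q = "\<lambda>s'. mw_state s' \<and> volume ?x < volume (s' 15) \<and> agree ?A s s'"
  have p: "prepared s" and vol2: "volume ?x < 2 * limit" using s by (auto simp: mw_state_def)
  let ?s1 = "store 34 0 n s" and ?s2 = "store 35 0 0 (store 34 0 n s)"
  have p1: "prepared ?s1" "prepared ?s2" using p by (simp_all add: prepared_store)
  have "wp mem_bits mw_body s (1 + (1 + (loops * (6 * loops + 8) + (1 + (loops * 5 + 1))))) ?Q"
    unfolding mw_body_def
  proof (rule wp_SeqPut)
    show "aval (Const 0) s = 0" "aval nE s = n" using aval_nE_prepared[OF p] by simp_all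
    show "n \<le> 2 ^ mem_bits" by (fact counter_bounds)
    show "wp mem_bits (Seq (Put 35 (Const 0) (Const 0)) (Seq (For 20 nE scan_body)
     ?tail)) ?s1 (1 + (loops * (6 * loops + 8) + (1 + (loops * 5 + 1)))) ?Q"
    proof (rule wp_SeqPut)
      show "wp mem_bits (Seq (For 20 nE scan_body)
       ?tail) ?s2 (loops * (6 * loops + 8) + (1 + (loops * 5 + 1))) ?Q"
      proof (rule wp_Seq)
        show "wp mem_bits (For 20 nE scan_body) ?s2 (loops * (6 * loops + 8))
          (\<lambda>s'. scanned ?x n (s' 34 0) (s' 35 0) \<and> agree {20, 22, 23, 34, 35} ?s2 s')"
          using s by (intro wp_scan p1 vol2) (auto simp: mw_state_def store_same store_other)
      next
        fix s3 assume s3: "scanned ?x n (s3 34 0) (s3 35 0) \<and> agree {20, 22, 23, 34, 35} ?s2 s3"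
        define k where "k = s3 34 0"
        have ag3: "agree {20, 22, 23, 34, 35} s s3"
        proof (rule agree_trans[of "{34, 35}" s ?s2])
          show "agree {34, 35} s ?s2" by (intro agree_store agree_refl) auto
        qed (use s3 in auto)
        have k: "k < n" "large k" "s3 35 0 = length_of ?x k"
          "\<And>i. i < n \<Longrightarrow> large i \<Longrightarrow> length_of ?x k * wt i \<le> length_of ?x i * wt k"
          using s3 large unfolding scanned_def k_def by auto
        define x' where "x' = (s 15)(k := s 15 k + 1)"
        have vb: "volume x' = volume ?x + length_of ?x k" unfolding x'_def by (rule volume_bump[OF k(1)])
        have vol': "volume x' < 2 * limit" using vb vol length_of_le_volume[of ?x k] by linarith
        have p3: "prepared s3" using prepared_agree[OF ag3 p] by simp
        have v3: "s3 15 = ?x" "s3 14 = s 14" "s3 32 = s 32" "s3 30 = s 30" "s3 31 = s 31"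
          using agreeD[OF ag3] by simp_all
        let ?s4 = "store 15 k (?x k + 1) s3"
        have ag4: "agree ?A s ?s4"
          by (intro agree_store agree_trans[OF ag3 agree_refl[of "{}"]]) auto
        have p4: "prepared ?s4" using p3 by (simp add: prepared_store)
        have v4: "?s4 15 = x'" "?s4 14 = s 14" "?s4 34 0 = k" using v3 by (auto simp: store_def k_def x'_def)
        show "wp mem_bits ?tail s3 (1 + (loops * 5 + 1)) ?Q"
        proof (rule wp_SeqPut)
          show "aval (Var 34) s3 = k" "aval (Add (Get 15 (Var 34)) (Const 1)) s3 = ?x k + 1"
            using v3 by (simp_all add: k_def)
          show "?x k + 1 \<le> 2 ^ mem_bits"
            using multiplicity_le[OF vol2 k(1,2)] by (intro depth_le_mem) (simp add: denom_def)
          show "wp mem_bits (Seq ?upd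
           ?vol) ?s4 (loops * 5 + 1) ?Q"
          proof (rule wp_Seq)
            show "wp mem_bits ?upd ?s4
              (loops * 5) (\<lambda>s'. (\<forall>c<num_constraints. s' 14 c = price x' c) \<and> agree {14, 22} ?s4 s')"
              unfolding x'_def
              using s v4 vol' by (intro wp_price_update[where x = ?x] p4 k(1)) (auto simp: mw_state_def x'_def)
          next
            fix s5 assume s5: "(\<forall>c<num_constraints. s5 14 c = price x' c) \<and> agree {14, 22} ?s4 s5"
            then have ag5: "agree {14, 22} ?s4 s5" by blast
            have v5: "s5 15 = x'" "s5 32 = s 32" "s5 30 = s 30" "s5 31 = s 31" "s5 35 0 = length_of ?x k"
              using agreeD[OF ag5] v4 v3 k(3) by (simp_all add: store_other)
            have p5: "prepared s5" using prepared_agree[OF ag5 p4] by simp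
            have agf: "agree ?A s (store 32 0 (volume x') s5)"
              by (intro agree_store agree_trans[OF ag4 ag5]) auto
            show "wp mem_bits ?vol s5 1 ?Q"
            proof (rule wp_PutI)
              show "aval (Const 0) s5 = 0" "aval (Add (Var 32) (Var 35)) s5 = volume x'"
                using v5 s vb by (simp_all add: mw_state_def)
              show "volume x' \<le> 2 ^ mem_bits" by (rule volume_le_mem[OF vol' order.refl])
              have "mw_invariant x'" unfolding x'_def using s by (intro mw_invariant_step k) (auto simp: mw_state_def)
              then have "mw_state (store 32 0 (volume x') s5)"
                using s s5 v5 p5 vol' by (intro mw_stateI[where x = x'])
                  (simp_all add: store_same store_other prepared_store mw_state_def)
              moreover have "store 32 0 (volume x') s5 15 = x'" using v5 by (simp add: store_other)
              moreover have "volume ?x < volume x'" using vb length_of_pos[OF k(1,2), of ?x] by linarith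
              ultimately show "?Q (store 32 0 (volume x') s5)" using agf by simp
            qed (simp_all add: max_esize_def)
          qed
        qed (simp_all add: max_esize_def)
      qed
    qed (simp_all add: max_esize_def)
  qed (simp_all add: max_esize_def)
  then show ?thesis
    by (rule wp_mono) (use loop_bounds(8) in \<open>auto simp: algebra_simps\<close>)
qed

lemma num_constraints_less_limit: "num_constraints < 2 * limit"
proof -
  have "(2 ^ lg) ^ 2 \<le> ((2 ^ lg) ^ 4 :: nat)" by (intro power_increasing) auto
  moreover have "0 < ((2 ^ lg) ^ 4 :: nat)" by simp
  ultimately show ?thesis using num_constraints_le unfolding limit_def by linarith
qed

text \<open>The variant is the distance of the volume from \<open>limit\<close>, which gives at most
  \<open>limit\<close> rounds. Initially all prices are 1, and the volume is the number of
  constraints.\<close>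

lemma wp_mw_prog:
  assumes s: "prepared s" "s 30 0 = 2 ^ lg" "s 31 0 = lg" and z: "s 15 = (\<lambda>_. 0)"
  shows "wp mem_bits mw_prog s (loops * (loops * (6 * loops + 17) + 14))
    (\<lambda>s'. mw_invariant (s' 15) \<and> volume (s' 15) < 2 * limit \<and>
       ((\<forall>i<n. \<not> large i) \<or> limit \<le> volume (s' 15)) \<and>
       agree {14, 15, 20, 22, 23, 32, 33, 34, 35} s s')"
proof -
  let ?fold = "Fold 33 20 nE (Const 0) (Add (Var 33) (LargeE (Var 20)))"
  let ?c = "Mul (Var 33) (Sub LimitE (Var 32))"
  let ?A = "{14, 15, 20, 22, 23, 32, 33, 34, 35} :: nat set"
  let ?Q = "\<lambda>s'. mw_invariant (s' 15) \<and> volume (s' 15) < 2 * limit \<and>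
       ((\<forall>i<n. \<not> large i) \<or> limit \<le> volume (s' 15)) \<and> agree ?A s s'"
  let ?T = "loops * (6 * loops + 17)"
  have vol0: "volume (\<lambda>_. 0) = num_constraints" by (simp add: volume_def price_def usage_def)
  have "wp mem_bits mw_prog s (loops * (1 + 4) + (1 + (6 * loops + (limit * (?T + 1) + 1)))) ?Q"
    unfolding mw_prog_def
  proof (rule wp_Seq)
    let ?J = "\<lambda>k s'. (\<forall>c<k. s' 14 c = 1) \<and> agree {14, 22} s s'"
    show "wp mem_bits (For 22 NumE (Put 14 (Var 22) (Const 1))) s (loops * (1 + 4)) (?J num_constraints)"
    proof (rule wp_For_loops[where J = ?J and N = num_constraints])
      show "num_constraints \<le> 2 ^ mem_bits" "num_constraints \<le> loops" by (fact counter_bounds loop_bounds)+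
      show "?J 0 s" by (simp add: agree_refl)
      fix q s' z assume "?J q s'"
      then show "?J q (store 22 0 z s')" by (auto simp: store_other intro: agree_store)
    next
      fix q s' assume "?J q s'"
      then show "aval NumE s' = num_constraints"
        using aval_NumE_prepared[OF prepared_agree[of "{14, 22}", OF _ s(1)]] by simp
    next
      fix q s' assume J: "?J q s'" "s' 22 0 = q"
      show "wp mem_bits (Put 14 (Var 22) (Const 1)) s' 1 (\<lambda>s''. ?J (Suc q) s'' \<and> s'' 22 0 = q)"
      proof (rule wp_PutI[where i = q and x = 1])
        show "?J (Suc q) (store 14 q 1 s') \<and> store 14 q 1 s' 22 0 = q"
          using J by (auto simp: store_same store_other agree_store less_Suc_eq)
      qed (use J in \<open>simp_all add: max_esize_def\<close>)
    qed (simp add: max_esize_def)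
  next
    fix s1 assume s1: "(\<forall>c<num_constraints. s1 14 c = 1) \<and> agree {14, 22} s s1"
    then have ag1: "agree {14, 22} s s1" by blast
    have p1: "prepared s1" using prepared_agree[OF ag1 s(1)] by simp
    let ?s2 = "store 32 0 num_constraints s1"
    have p2: "prepared ?s2" using p1 by (simp add: prepared_store)
    show "wp mem_bits (Seq (Put 32 (Const 0) NumE)
     (Seq ?fold
       (While ?c mw_body))) s1 (1 + (6 * loops + (limit * (?T + 1) + 1))) ?Q"
    proof (rule wp_SeqPut)
      show "aval (Const 0) s1 = 0" "aval NumE s1 = num_constraints" using aval_NumE_prepared[OF p1] by simp_all
      show "num_constraints \<le> 2 ^ mem_bits" by (fact counter_bounds)
      show "wp mem_bits (Seq ?fold
       (While ?c mw_body)) ?s2 (6 * loops + (limit * (?T + 1) + 1)) ?Q"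
      proof (rule wp_Seq)
        show "wp mem_bits ?fold ?s2 (6 * loops)
          (\<lambda>s''. s'' 33 0 = (\<Sum>i<n. of_bool (large i)) \<and> agree {33, 20} ?s2 s'')"
        proof (rule wp_Fold_loops[where F = "\<lambda>k. \<Sum>i<k. of_bool (large i)" and N = n])
          show "n \<le> 2 ^ mem_bits" "n \<le> loops" by (fact counter_bounds loop_bounds)+
        next
          fix s'' assume "agree {33, 20} ?s2 s''"
          then show "aval nE s'' = n" using aval_nE_prepared[OF prepared_agree[OF _ p2]] by simp
        next
          fix k s'' assume k: "k < n" "agree {33, 20} ?s2 s''" "s'' 20 0 = k" "s'' 33 0 = (\<Sum>i<k. of_bool (large i))"
          have "prepared s''" using prepared_agree[OF k(2) p2] by simp
          then have "aval (LargeE (Var 20)) s'' = of_bool (large k)" using k by (simp add: aval_LargeE)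
          then show "aval (Add (Var 33) (LargeE (Var 20))) s'' = (\<Sum>i<Suc k. of_bool (large i))"
            using k(4) by (simp only: aval.simps sum.lessThan_Suc)
        next
          fix k assume "k \<le> n"
          then have "(\<Sum>i<k. of_bool (large i)) \<le> (2::nat) ^ (size + 0)"
            using n_m_le(1) by (intro sum_le_power) auto
          then show "(\<Sum>i<k. of_bool (large i)) \<le> (2::nat) ^ mem_bits" by (rule le_mem_bits) simp
        qed (simp_all add: max_esize_def)
      next
        fix s3 assume s3: "s3 33 0 = (\<Sum>i<n. of_bool (large i)) \<and> agree {33, 20} ?s2 s3"
        then have ag3: "agree {33, 20} ?s2 s3" by blast
        have v3: "s3 15 = (\<lambda>_. 0)" "s3 14 = s1 14" "s3 32 0 = num_constraints" "s3 30 = s 30" "s3 31 = s 31"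
          using agreeD[OF ag3] agreeD[OF ag1] z by (simp_all add: store_other store_same)
        have p3: "prepared s3" using prepared_agree[OF ag3 p2] by simp
        have ags: "agree ?A s s3"
        proof (rule agree_trans[of ?A s ?s2])
          show "agree ?A s ?s2" by (intro agree_store agree_trans[OF ag1 agree_refl[of "{}"]]) auto
        qed (use ag3 in auto)
        let ?I = "\<lambda>s'. mw_state s' \<and> agree ?A s s' \<and> s' 33 0 = (\<Sum>i<n. of_bool (large i))"
        let ?m = "\<lambda>s'. limit - volume (s' 15)"
        have "wp mem_bits (While ?c mw_body) s3 (?m s3 * (?T + 1) + 1) ?Q"
        proof (rule wp_While[where I = ?I])
          have "mw_state s3"
            using v3 p3 s1 s mw_invariant_init num_constraints_less_limit
            by (simp add: mw_state_def vol0 price_def usage_def)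
          then show "?I s3" using ags s3 by blast
        next
          fix s' assume I: "?I s'" "aval ?c s' \<noteq> 0"
          then have st: "mw_state s'" by blast
          have lim: "aval LimitE s' = limit" using st aval_constants(1)[of s'] by (auto simp: mw_state_def)
          have vol: "volume (s' 15) < limit" using I(2) st lim by (simp add: mw_state_def)
          have "s' 33 0 \<noteq> 0" using I(2) by simp
          then have "(\<Sum>i<n. of_bool (large i)) \<noteq> (0::nat)" using I by simp
          then obtain i where i: "i < n" "large i" by (auto simp: sum_eq_0_iff)
          show "wp mem_bits mw_body s' ?T (\<lambda>s''. ?I s'' \<and> ?m s'' < ?m s')"
          proof (rule wp_mono[OF wp_mw_body[OF st i vol] order.refl])
            fix s'' assume s'': "mw_state s'' \<and> volume (s' 15) < volume (s'' 15) \<and>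
              agree {14, 15, 20, 22, 23, 32, 34, 35} s' s''"
            then have ag: "agree {14, 15, 20, 22, 23, 32, 34, 35} s' s''" by blast
            have "s'' 33 = s' 33" using agreeD[OF ag] by simp
            moreover have "agree ?A s s''" by (rule agree_trans[of ?A s s', OF _ ag]) (use I in auto)
            ultimately show "?I s'' \<and> ?m s'' < ?m s'" using s'' I vol by auto
          qed
        next
          fix s' assume I: "?I s'" "aval ?c s' = 0"
          then have st: "mw_state s'" by blast
          have lim: "aval LimitE s' = limit" using st aval_constants(1)[of s'] by (auto simp: mw_state_def)
          have "s' 33 0 = 0 \<or> limit \<le> volume (s' 15)" using I(2) st lim by (auto simp: mw_state_def)
          moreover have "\<forall>i<n. \<not> large i" if "s' 33 0 = 0"
          proof -
            have "(\<Sum>i<n. of_bool (large i)) = (0::nat)" using that I by simp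
            then show ?thesis by (auto simp: sum_eq_0_iff)
          qed
          moreover have "mw_invariant (s' 15)" "volume (s' 15) < 2 * limit"
            using st unfolding mw_state_def by blast+
          ultimately show "?Q s'" using I by blast
        qed (simp add: max_esize_def)
        then show "wp mem_bits (While ?c mw_body) s3 (limit * (?T + 1) + 1) ?Q"
          by (rule wp_mono) (intro add_right_mono mult_le_mono1 diff_le_self, assumption)
      qed
    qed (simp_all add: max_esize_def)
  qed
  then show ?thesis
  proof (rule wp_mono)
    have "limit * (?T + 1) \<le> loops * (?T + 1)" using loop_bounds(5) by (rule mult_le_mono1)
    then show "loops * (1 + 4) + (1 + (6 * loops + (limit * (?T + 1) + 1))) \<le> loops * (?T + 14)"
      using loop_bounds(8) by (simp add: algebra_simps)
  qed blast
qed

end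

section \<open>The rounding program\<close>

lemma agree_mono: "agree A s s' \<Longrightarrow> A \<subseteq> C \<Longrightarrow> agree C s s'"
  by (auto simp: agree_def)

definition gain_prog :: com where
  "gain_prog = Fold 38 21 nE (Const 0) (Add (Var 38) (Mul (Get 2 (Var 21)) (Get 15 (Var 21))))"

definition clash_prog :: com where
  "clash_prog = For 21 nE (Seq (Fold 23 22 nE (Const 0) (Add (Var 23)
       (Mul (BlocksE (Var 22) (Var 21)) (Mul (Mul (Get 2 (Var 21)) (Get 15 (Var 21))) (Get 15 (Var 22))))))
     (Put 39 (Const 0) (Add (Var 39) (Var 23))))"

text \<open>\<open>Var 31 + 1\<close> is \<open>lg + 1\<close>, that is
  \<open>base - 1\<close>.\<close>

definition overload_prog :: com where
  "overload_prog = For 22 NumE (Seq (Fold 23 21 nE (Const 1) (Mul (Var 23)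
       (Add DenomE (Mul (IncidentE (Var 21) (Var 22)) (Mul (Add (Var 31) (Const 1)) (Get 15 (Var 21)))))))
     (Put 24 (Const 0) (Add (Var 24) (Var 23))))"

definition eval_prog :: com where
  "eval_prog = Seq gain_prog
     (Seq (Put 38 (Const 0) (Mul (Mul (Mul ThresholdE (Var 37)) DenomE) (Var 38)))
     (Seq (Put 39 (Const 0) (Const 0)) (Seq clash_prog
     (Seq (Put 24 (Const 0) (Const 0)) (Seq overload_prog
     (Put 39 (Const 0) (Add (Mul (Mul ThresholdE (Var 37)) (Var 39))
       (Mul (Mul (Var 36) (Mul DenomE DenomE)) (Var 24)))))))))"

text \<open>Credit and debit at the end 0 are saved in cells 40 and 41 before the end
  \<open>denom\<close> is evaluated. Entries of other than large tasks are left alone; they are 0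
  already.\<close>

definition round_body :: com where
  "round_body = If (LargeE (Var 20))
     (Seq (Put 15 (Var 20) (Const 0)) (Seq eval_prog
     (Seq (Put 40 (Const 0) (Var 38)) (Seq (Put 41 (Const 0) (Var 39))
     (Seq (Put 15 (Var 20) DenomE) (Seq eval_prog
     (If (LE (Add (Var 40) (Var 39)) (Add (Var 38) (Var 41))) Skip (Put 15 (Var 20) (Const 0)))))))))
     Skip"

definition round_prog :: com where
  "round_prog = Seq (Fold 37 20 nE (Const 1) (Mul (Var 37) DenomE))
     (Seq (Fold 36 20 nE (Const 0) (Add (Var 36) (Mul (LargeE (Var 20)) (Get 2 (Var 20)))))
       (For 20 nE round_body))"

context bagufp_instance
begin

definition round_state :: "memory \<Rightarrow> bool" where
  "round_state s \<longleftrightarrow> prepared s \<and> s 30 0 = 2 ^ lg \<and> s 31 0 = lg \<and> s 36 0 = large_weight \<and>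
     s 37 0 = denom ^ n \<and> (\<forall>i<n. s 15 i \<le> denom)"

lemma round_state_agree:
  assumes "agree A s s'" "round_state s" "A \<inter> {0, 1, 2, 3, 4, 5, 6, 10, 11, 15, 30, 31, 36, 37} = {}"
  shows "round_state s'"
proof -
  have "s' a = s a" if "a \<in> {0, 1, 2, 3, 4, 5, 6, 10, 11, 15, 30, 31, 36, 37}" for a
    using assms(1,3) that unfolding agree_def by blast
  then show ?thesis using assms(2) by (simp add: round_state_def prepared_def inputs_def)
qed

lemma round_stateD:
  assumes "round_state s"
  shows "prepared s" "s 30 0 = 2 ^ lg" "s 31 0 = lg" "s 36 0 = large_weight" "s 37 0 = denom ^ n"
    "aval DenomE s = denom" "aval ThresholdE s = threshold" "\<And>i. i < n \<Longrightarrow> s 15 i \<le> denom"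
  using assms aval_constants[of s] by (auto simp: round_state_def)

lemma coord_le: "round_state s \<Longrightarrow> i < n \<Longrightarrow> s 15 i \<le> 2 ^ (3 * size)"
  using round_stateD(8) denom_le_power by (meson order.trans)

definition gain_upto :: "(nat \<Rightarrow> nat) \<Rightarrow> nat \<Rightarrow> nat" where
  "gain_upto P k = (\<Sum>i<k. wt i * P i)"

lemma gain_upto_le:
  assumes "round_state s" "k \<le> n"
  shows "gain_upto (s 15) k \<le> 2 ^ (5 * size)"
proof -
  have "gain_upto (s 15) k \<le> 2 ^ (size + (size + 3 * size))" unfolding gain_upto_def
  proof (rule sum_le_power)
    show "k \<le> 2 ^ size" using assms(2) n_m_le(1) by linarith
    fix i assume "i < k"
    then show "wt i * s 15 i \<le> 2 ^ (size + 3 * size)"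
      using assms by (intro mult_le_power task_le(1) coord_le) auto
  qed
  then show ?thesis by simp
qed

lemma wp_gain_prog:
  assumes s: "round_state s"
  shows "wp mem_bits gain_prog s (6 * loops) (\<lambda>s'. s' 38 0 = gain (s 15) \<and> agree {38, 21} s s')"
proof -
  have "wp mem_bits gain_prog s (6 * loops) (\<lambda>s'. s' 38 0 = gain_upto (s 15) n \<and> agree {38, 21} s s')"
    unfolding gain_prog_def
  proof (rule wp_Fold_loops[where F = "gain_upto (s 15)" and N = n])
    show "n \<le> 2 ^ mem_bits" "n \<le> loops" by (fact counter_bounds loop_bounds)+
  next
    fix s' assume "agree {38, 21} s s'"
    then show "aval nE s' = n" using aval_nE_prepared[OF prepared_agree[OF _ round_stateD(1)[OF s]]] by simp
  next
    fix k s' assume k: "k < n" "agree {38, 21} s s'" "s' 21 0 = k" "s' 38 0 = gain_upto (s 15) k"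
    have "prepared s'" using prepared_agree[OF k(2) round_stateD(1)[OF s]] by simp
    moreover have "s' 15 = s 15" using agreeD[OF k(2)] by simp
    ultimately show "aval (Add (Var 38) (Mul (Get 2 (Var 21)) (Get 15 (Var 21)))) s' = gain_upto (s 15) (Suc k)"
      using k by (simp add: prepared_get gain_upto_def)
  next
    fix k assume "k \<le> n"
    then show "gain_upto (s 15) k \<le> 2 ^ mem_bits" by (rule le_mem_bits[OF gain_upto_le[OF s]]) simp
  qed (simp_all add: max_esize_def gain_upto_def)
  then show ?thesis by (simp add: gain_upto_def gain_def)
qed

definition clash_row :: "(nat \<Rightarrow> nat) \<Rightarrow> nat \<Rightarrow> nat \<Rightarrow> nat" where
  "clash_row P i k = (\<Sum>j<k. of_bool (blocks j i) * (wt i * P i * P j))"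

lemma clash_rows: "clash P = (\<Sum>i<n. clash_row P i n)"
proof -
  have "(\<Sum>j | j < n \<and> blocks j i. wt i * P i * P j) = clash_row P i n" for i
  proof -
    have "clash_row P i n = (\<Sum>j<n. if blocks j i then wt i * P i * P j else 0)"
      unfolding clash_row_def by (intro sum.cong) auto
    also have "\<dots> = (\<Sum>j\<in>{j \<in> {..<n}. blocks j i}. wt i * P i * P j)"
      by (rule sum.inter_filter[symmetric]) simp
    also have "{j \<in> {..<n}. blocks j i} = {j. j < n \<and> blocks j i}" by auto
    finally show ?thesis by simp
  qed
  then show ?thesis by (simp add: clash_def)
qed

lemma clash_row_le:
  assumes "round_state s" "i < n" "k \<le> n"
  shows "clash_row (s 15) i k \<le> 2 ^ (8 * size)"
proof -
  have "clash_row (s 15) i k \<le> 2 ^ (size + ((size + 3 * size) + 3 * size))" unfolding clash_row_def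
  proof (rule sum_le_power)
    show "k \<le> 2 ^ size" using assms(3) n_m_le(1) by linarith
    fix j assume "j < k"
    then have "wt i * s 15 i * s 15 j \<le> 2 ^ ((size + 3 * size) + 3 * size)"
      using assms by (intro mult_le_power task_le(1) coord_le) auto
    then show "of_bool (blocks j i) * (wt i * s 15 i * s 15 j) \<le> 2 ^ ((size + 3 * size) + 3 * size)" by auto
  qed
  then show ?thesis by simp
qed

lemma clash_rows_le:
  assumes "round_state s" "k \<le> n"
  shows "(\<Sum>i<k. clash_row (s 15) i n) \<le> 2 ^ (9 * size)"
proof -
  have "(\<Sum>i<k. clash_row (s 15) i n) \<le> 2 ^ (size + 8 * size)"
    using assms n_m_le(1) by (intro sum_le_power clash_row_le) auto
  then show ?thesis by simp
qed

lemma wp_clash_prog: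
  assumes s: "round_state s" and z: "s 39 0 = 0"
  shows "wp mem_bits clash_prog s (loops * (6 * loops + 5))
    (\<lambda>s'. s' 39 0 = clash (s 15) \<and> agree {21, 22, 23, 39} s s')"
proof -
  let ?step = "Add (Var 23) (Mul (BlocksE (Var 22) (Var 21)) (Mul (Mul (Get 2 (Var 21)) (Get 15 (Var 21))) (Get 15 (Var 22))))"
  let ?fold = "Fold 23 22 nE (Const 0) ?step"
  let ?J = "\<lambda>k s'. s' 39 0 = (\<Sum>i<k. clash_row (s 15) i n) \<and> agree {21, 22, 23, 39} s s'"
  have rs: "round_state s'" if "agree {21, 22, 23, 39} s s'" for s'
    by (rule round_state_agree[OF that s]) simp
  have "wp mem_bits clash_prog s (loops * ((6 * loops + 1) + 4)) (?J n)"
    unfolding clash_prog_def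
  proof (rule wp_For_loops[where J = ?J and N = n])
    show "n \<le> 2 ^ mem_bits" "n \<le> loops" by (fact counter_bounds loop_bounds)+
    show "?J 0 s" using z by (simp add: agree_refl)
    fix q s' z assume "?J q s'"
    then show "?J q (store 21 0 z s')" by (auto simp: store_other intro: agree_store)
  next
    fix q s' assume "?J q s'"
    then show "aval nE s' = n" using aval_nE_prepared rs round_stateD(1) by blast
  next
    fix k s' assume k: "k < n" and J: "?J k s'" and s21: "s' 21 0 = k"
    have p': "prepared s'" using rs round_stateD(1) J by blast
    have P': "s' 15 = s 15" using J agreeD[of "{21, 22, 23, 39}" s s' 15] by simp
    show "wp mem_bits (Seq ?fold
     (Put 39 (Const 0) (Add (Var 39) (Var 23)))) s' (6 * loops + 1) (\<lambda>s''. ?J (Suc k) s'' \<and> s'' 21 0 = k)"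
    proof (rule wp_Seq)
      show "wp mem_bits ?fold s'
       (6 * loops) (\<lambda>s''. s'' 23 0 = clash_row (s 15) k n \<and> agree {23, 22} s' s'')"
      proof (rule wp_Fold_loops[where F = "clash_row (s 15) k" and N = n])
        show "n \<le> 2 ^ mem_bits" "n \<le> loops" by (fact counter_bounds loop_bounds)+
      next
        fix s'' assume "agree {23, 22} s' s''"
        then show "aval nE s'' = n" using aval_nE_prepared[OF prepared_agree[OF _ p']] by simp
      next
        fix j s'' assume j: "j < n" "agree {23, 22} s' s''" "s'' 22 0 = j" "s'' 23 0 = clash_row (s 15) k j"
        have p: "prepared s''" using prepared_agree[OF j(2) p'] by simp
        have v: "s'' 15 = s 15" "s'' 21 0 = k" using agreeD[OF j(2)] P' s21 by simp_all
        have "aval (BlocksE (Var 22) (Var 21)) s'' = of_bool (blocks j k)"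
          using aval_BlocksE[OF p, of "Var 21" "Var 22"] v j k by simp
        moreover have "aval (Mul (Mul (Get 2 (Var 21)) (Get 15 (Var 21))) (Get 15 (Var 22))) s'' = wt k * s 15 k * s 15 j"
          using v j k p by (simp add: prepared_get)
        ultimately show "aval ?step s'' =
          clash_row (s 15) k (Suc j)"
          unfolding aval.simps(3)[of "Var 23"] aval.simps(5)[of "BlocksE (Var 22) (Var 21)"]
          using j(4) by (simp only: aval.simps clash_row_def sum.lessThan_Suc)
      next
        fix j assume "j \<le> n"
        then show "clash_row (s 15) k j \<le> 2 ^ mem_bits" by (rule le_mem_bits[OF clash_row_le[OF s k]]) simp
      qed (simp_all add: max_esize_def clash_row_def)
    next
      fix s1 assume s1: "s1 23 0 = clash_row (s 15) k n \<and> agree {23, 22} s' s1"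
      then have ag: "agree {23, 22} s' s1" by blast
      have v: "s1 39 0 = (\<Sum>i<k. clash_row (s 15) i n)" "s1 21 0 = k" using agreeD[OF ag] J s21 by simp_all
      have ag1: "agree {21, 22, 23, 39} s s1"
        by (rule agree_trans[of "{21, 22, 23, 39}" s s', OF _ ag]) (use J in auto)
      show "wp mem_bits (Put 39 (Const 0) (Add (Var 39) (Var 23))) s1 1 (\<lambda>s''. ?J (Suc k) s'' \<and> s'' 21 0 = k)"
      proof (rule wp_PutI)
        show "aval (Const 0) s1 = 0" by simp
        show "aval (Add (Var 39) (Var 23)) s1 = (\<Sum>i<Suc k. clash_row (s 15) i n)" using s1 v by simp
        show "(\<Sum>i<Suc k. clash_row (s 15) i n) \<le> 2 ^ mem_bits"
          by (rule le_mem_bits[OF clash_rows_le[OF s]]) (use k in auto)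
        show "?J (Suc k) (store 39 0 (\<Sum>i<Suc k. clash_row (s 15) i n) s1) \<and>
          store 39 0 (\<Sum>i<Suc k. clash_row (s 15) i n) s1 21 0 = k"
          using v ag1 by (simp add: store_same store_other agree_store)
      qed (simp_all add: max_esize_def)
    qed
  qed (simp add: max_esize_def)
  then show ?thesis by (rule wp_mono) (simp_all add: clash_rows)
qed

definition cover_prod :: "(nat \<Rightarrow> nat) \<Rightarrow> nat \<Rightarrow> nat \<Rightarrow> nat" where
  "cover_prod P c k = (\<Prod>i<k. denom + (if incident i c then (base - 1) * P i else 0))"

lemma overload_prods: "overload P = (\<Sum>c<num_constraints. cover_prod P c n)"
  by (simp add: overload_def cover_prod_def)

text \<open>Each factor is at most \<open>denom * base\<close>, a number of at most
  \<open>5 * size\<close> bits, and there are at most \<open>size\<close> factors. This is the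
  largest quadratic contribution to \<open>mem_bits\<close>.\<close>

lemma cover_prod_le:
  assumes "round_state s" "k \<le> n"
  shows "cover_prod (s 15) c k \<le> 2 ^ (5 * size ^ 2)"
proof -
  have "cover_prod (s 15) c k \<le> (\<Prod>i<k. denom * base)" unfolding cover_prod_def
  proof (rule prod_mono, intro conjI)
    fix i assume i: "i \<in> {..<k}"
    have "(if incident i c then (base - 1) * s 15 i else 0) \<le> (base - 1) * denom"
      using round_stateD(8)[OF assms(1), of i] i assms(2) by auto
    then have "denom + (if incident i c then (base - 1) * s 15 i else 0) \<le> denom + (base - 1) * denom" by simp
    also have "\<dots> = denom * base" by (simp add: base_def algebra_simps)
    finally show "denom + (if incident i c then (base - 1) * s 15 i else 0) \<le> denom * base" .
  qed simp
  also have "\<dots> = (denom * base) ^ k" by simp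
  also have "\<dots> \<le> (2 ^ (3 * size + 2 * size)) ^ k"
    by (intro power_mono mult_le_power denom_le_power base_le_power) auto
  also have "\<dots> = 2 ^ (5 * size * k)" by (simp add: power_mult[symmetric])
  also have "\<dots> \<le> 2 ^ (5 * size ^ 2)"
    using assms(2) n_m_le_size by (intro power_increasing) (auto simp: power2_eq_square)
  finally show ?thesis .
qed

lemma cover_prods_le:
  assumes "round_state s" "k \<le> num_constraints"
  shows "(\<Sum>c<k. cover_prod (s 15) c n) \<le> 2 ^ (3 * size + 5 * size ^ 2)"
  using assms num_constraints_le_power by (intro sum_le_power cover_prod_le) auto

lemma wp_overload_prog:
  assumes s: "round_state s" and z: "s 24 0 = 0"
  shows "wp mem_bits overload_prog s (loops * (6 * loops + 5))
    (\<lambda>s'. s' 24 0 = overload (s 15) \<and> agree {21, 22, 23, 24} s s')"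
proof -
  let ?fac = "Add DenomE (Mul (IncidentE (Var 21) (Var 22)) (Mul (Add (Var 31) (Const 1)) (Get 15 (Var 21))))"
  let ?fold = "Fold 23 21 nE (Const 1) (Mul (Var 23) ?fac)"
  let ?J = "\<lambda>k s'. s' 24 0 = (\<Sum>c<k. cover_prod (s 15) c n) \<and> agree {21, 22, 23, 24} s s'"
  have rs: "round_state s'" if "agree {21, 22, 23, 24} s s'" for s'
    by (rule round_state_agree[OF that s]) simp
  have "wp mem_bits overload_prog s (loops * ((6 * loops + 1) + 4)) (?J num_constraints)"
    unfolding overload_prog_def
  proof (rule wp_For_loops[where J = ?J and N = num_constraints])
    show "num_constraints \<le> 2 ^ mem_bits" "num_constraints \<le> loops" by (fact counter_bounds loop_bounds)+
    show "?J 0 s" using z by (simp add: agree_refl)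
    fix q s' z assume "?J q s'"
    then show "?J q (store 22 0 z s')" by (auto simp: store_other intro: agree_store)
  next
    fix q s' assume "?J q s'"
    then show "aval NumE s' = num_constraints" using aval_NumE_prepared rs round_stateD(1) by blast
  next
    fix k s' assume k: "k < num_constraints" and J: "?J k s'" and s22: "s' 22 0 = k"
    have r': "round_state s'" using rs J by blast
    have P': "s' 15 = s 15" using J agreeD[of "{21, 22, 23, 24}" s s' 15] by simp
    show "wp mem_bits (Seq ?fold
     (Put 24 (Const 0) (Add (Var 24) (Var 23)))) s' (6 * loops + 1) (\<lambda>s''. ?J (Suc k) s'' \<and> s'' 22 0 = k)"
    proof (rule wp_Seq)
      show "wp mem_bits ?fold s'
       (6 * loops) (\<lambda>s''. s'' 23 0 = cover_prod (s 15) k n \<and> agree {23, 21} s' s'')"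
      proof (rule wp_Fold_loops[where F = "cover_prod (s 15) k" and N = n])
        show "n \<le> 2 ^ mem_bits" "n \<le> loops" by (fact counter_bounds loop_bounds)+
      next
        fix s'' assume "agree {23, 21} s' s''"
        then show "aval nE s'' = n" using aval_nE_prepared[OF round_stateD(1)[OF round_state_agree[OF _ r']]] by simp
      next
        fix i s'' assume i: "i < n" "agree {23, 21} s' s''" "s'' 21 0 = i" "s'' 23 0 = cover_prod (s 15) k i"
        have r: "round_state s''" using round_state_agree[OF i(2) r'] by simp
        have v: "s'' 15 = s 15" "s'' 22 0 = k" using agreeD[OF i(2)] P' s22 by simp_all
        have "aval (IncidentE (Var 21) (Var 22)) s'' = of_bool (incident i k)"
          using aval_IncidentE[OF round_stateD(1)[OF r], of "Var 21" "Var 22"] v i k by simp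
        moreover have "aval (Mul (Add (Var 31) (Const 1)) (Get 15 (Var 21))) s'' = (base - 1) * s 15 i"
          using v i round_stateD(3)[OF r] by (simp add: base_def)
        ultimately have "aval ?fac s'' =
          denom + (if incident i k then (base - 1) * s 15 i else 0)"
          unfolding aval.simps(3)[of DenomE] aval.simps(5)[of "IncidentE (Var 21) (Var 22)"]
          using round_stateD(6)[OF r] by simp
        then show "aval (Mul (Var 23)
          ?fac) s'' =
          cover_prod (s 15) k (Suc i)"
          unfolding aval.simps(5)[of "Var 23"] using i(4) by (simp only: aval.simps cover_prod_def prod.lessThan_Suc)
      next
        fix i assume "i \<le> n"
        then show "cover_prod (s 15) k i \<le> 2 ^ mem_bits" by (rule le_mem_bits[OF cover_prod_le[OF s]]) simp
      qed (simp_all add: max_esize_def cover_prod_def)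
    next
      fix s1 assume s1: "s1 23 0 = cover_prod (s 15) k n \<and> agree {23, 21} s' s1"
      then have ag: "agree {23, 21} s' s1" by blast
      have v: "s1 24 0 = (\<Sum>c<k. cover_prod (s 15) c n)" "s1 22 0 = k" using agreeD[OF ag] J s22 by simp_all
      have ag1: "agree {21, 22, 23, 24} s s1"
        by (rule agree_trans[of "{21, 22, 23, 24}" s s', OF _ ag]) (use J in auto)
      show "wp mem_bits (Put 24 (Const 0) (Add (Var 24) (Var 23))) s1 1 (\<lambda>s''. ?J (Suc k) s'' \<and> s'' 22 0 = k)"
      proof (rule wp_PutI)
        show "aval (Const 0) s1 = 0" by simp
        show "aval (Add (Var 24) (Var 23)) s1 = (\<Sum>c<Suc k. cover_prod (s 15) c n)" using s1 v by simp
        show "(\<Sum>c<Suc k. cover_prod (s 15) c n) \<le> 2 ^ mem_bits"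
          by (rule le_mem_bits[OF cover_prods_le[OF s]]) (use k in auto)
        show "?J (Suc k) (store 24 0 (\<Sum>c<Suc k. cover_prod (s 15) c n) s1) \<and>
          store 24 0 (\<Sum>c<Suc k. cover_prod (s 15) c n) s1 22 0 = k"
          using v ag1 by (simp add: store_same store_other agree_store)
      qed (simp_all add: max_esize_def)
    qed
  qed (simp add: max_esize_def)
  then show ?thesis by (rule wp_mono) (simp_all add: overload_prods)
qed

lemma denom_power_le: "k \<le> n \<Longrightarrow> denom ^ k \<le> 2 ^ (3 * size ^ 2)"
proof -
  assume k: "k \<le> n"
  have "denom ^ k \<le> (2 ^ (3 * size)) ^ k" by (intro power_mono denom_le_power) simp
  also have "\<dots> = 2 ^ (3 * size * k)" by (simp add: power_mult)
  also have "\<dots> \<le> 2 ^ (3 * size ^ 2)"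
    using k n_m_le_size by (intro power_increasing) (auto simp: power2_eq_square)
  finally show ?thesis .
qed

lemma large_weight_le: "large_weight \<le> 2 ^ (2 * size)"
proof -
  have "large_weight \<le> (\<Sum>i<n. wt i)" unfolding large_weight_def by (intro sum_mono2) auto
  also have "\<dots> \<le> 2 ^ (size + size)" using n_m_le(1) by (intro sum_le_power task_le(1)) auto
  finally show ?thesis by (simp add: mult_2)
qed

lemma credit_le:
  assumes "round_state s"
  shows "credit (s 15) \<le> 2 ^ mem_bits"
proof -
  have "gain (s 15) \<le> 2 ^ (5 * size)"
    using gain_upto_le[OF assms order.refl] by (simp add: gain_upto_def gain_def)
  then have "credit (s 15) \<le> 2 ^ (((8 * size + 3 * size ^ 2) + 3 * size) + 5 * size)"
    unfolding credit_def
    by (intro mult_le_power threshold_le_power denom_power_le denom_le_power) auto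
  then show ?thesis by (rule le_mem_bits) simp
qed

lemma debit_le:
  assumes "round_state s"
  shows "debit (s 15) \<le> 2 ^ mem_bits"
proof -
  have 1: "threshold * denom ^ n * clash (s 15) \<le> 2 ^ ((8 * size + 3 * size ^ 2) + 9 * size)"
    using clash_rows_le[OF assms order.refl]
    by (intro mult_le_power threshold_le_power denom_power_le) (auto simp: clash_rows)
  have "denom ^ 2 \<le> 2 ^ (3 * size + 3 * size)"
    unfolding power2_eq_square by (intro mult_le_power denom_le_power)
  then have 2: "large_weight * denom ^ 2 * overload (s 15) \<le>
      2 ^ ((2 * size + (3 * size + 3 * size)) + (3 * size + 5 * size ^ 2))"
    using cover_prods_le[OF assms order.refl]
    by (intro mult_le_power large_weight_le) (auto simp: overload_prods)
  have "debit (s 15) \<le> 2 ^ (17 * size + 5 * size ^ 2) + 2 ^ (17 * size + 5 * size ^ 2)"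
    unfolding debit_def
    by (rule add_mono; rule order.trans[OF 1] order.trans[OF 2]; intro power_increasing) auto
  also have "\<dots> = 2 ^ (17 * size + 5 * size ^ 2 + 1)" by simp
  finally show ?thesis by (rule le_mem_bits) (use size_ge_3 in simp)
qed

lemma wp_eval_prog:
  assumes s: "round_state s"
  shows "wp mem_bits eval_prog s (loops * (12 * loops + 20))
    (\<lambda>s'. s' 38 0 = credit (s 15) \<and> s' 39 0 = debit (s 15) \<and> agree {21, 22, 23, 24, 38, 39} s s')"
proof -
  let ?e = "Add (Mul (Mul ThresholdE (Var 37)) (Var 39)) (Mul (Mul (Var 36) (Mul DenomE DenomE)) (Var 24))"
  let ?c5 = "Seq overload_prog (Put 39 (Const 0) ?e)"
  let ?c4 = "Seq (Put 24 (Const 0) (Const 0)) ?c5"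
  let ?c3 = "Seq clash_prog ?c4"
  let ?c2 = "Seq (Put 39 (Const 0) (Const 0)) ?c3"
  let ?A = "{21, 22, 23, 24, 38, 39} :: nat set"
  let ?Q = "\<lambda>s'. s' 38 0 = credit (s 15) \<and> s' 39 0 = debit (s 15) \<and> agree ?A s s'"
  have rs: "round_state s'" if "agree ?A s s'" for s'
    by (rule round_state_agree[OF that s]) simp
  have P: "s' 15 = s 15" if "agree ?A s s'" for s' using agreeD[OF that] by simp
  have "wp mem_bits eval_prog s (6 * loops + (1 + (1 + (loops * (6 * loops + 5) + (1 +
      (loops * (6 * loops + 5) + 1)))))) ?Q"
    unfolding eval_prog_def
  proof (rule wp_Seq[OF wp_gain_prog[OF s]])
    fix s1 assume s1: "s1 38 0 = gain (s 15) \<and> agree {38, 21} s s1"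
    have ag1: "agree ?A s s1" by (rule agree_mono[of "{38, 21}" s s1]) (use s1 in auto)
    note r1 = rs[OF ag1]
    let ?s2 = "store 38 0 (credit (s 15)) s1"
    have ag2: "agree ?A s ?s2" by (rule agree_store[OF ag1]) simp
    let ?s3 = "store 39 0 0 ?s2"
    have ag3: "agree ?A s ?s3" by (rule agree_store[OF ag2]) simp
    show "wp mem_bits (Seq (Put 38 (Const 0) (Mul (Mul (Mul ThresholdE (Var 37)) DenomE) (Var 38)))
     ?c2) s1
       (1 + (1 + (loops * (6 * loops + 5) + (1 + (loops * (6 * loops + 5) + 1))))) ?Q"
    proof (rule wp_SeqPut)
      show "aval (Const 0) s1 = 0" by simp
      show "aval (Mul (Mul (Mul ThresholdE (Var 37)) DenomE) (Var 38)) s1 = credit (s 15)"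
        using round_stateD[OF r1] s1 by (simp add: credit_def)
      show "credit (s 15) \<le> 2 ^ mem_bits" by (rule credit_le[OF s])
      show "wp mem_bits ?c2 ?s2
         (1 + (loops * (6 * loops + 5) + (1 + (loops * (6 * loops + 5) + 1)))) ?Q"
      proof (rule wp_SeqPut)
        show "wp mem_bits ?c3 ?s3
           (loops * (6 * loops + 5) + (1 + (loops * (6 * loops + 5) + 1))) ?Q"
        proof (rule wp_Seq[OF wp_clash_prog[OF rs[OF ag3]]])
          show "?s3 39 0 = 0" by (simp add: store_same)
        next
          fix s4 assume s4: "s4 39 0 = clash (?s3 15) \<and> agree {21, 22, 23, 39} ?s3 s4"
          then have ag43: "agree {21, 22, 23, 39} ?s3 s4" by blast
          have ag4: "agree ?A s s4" by (rule agree_trans[OF ag3 ag43]) auto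
          have v4: "s4 39 0 = clash (s 15)" "s4 38 0 = credit (s 15)"
            using s4 P[OF ag3] agreeD[OF ag43] by (simp_all add: store_same store_other)
          let ?s5 = "store 24 0 0 s4"
          have ag5: "agree ?A s ?s5" using ag4 by (intro agree_store) auto
          show "wp mem_bits ?c4 s4 (1 + (loops * (6 * loops + 5) + 1)) ?Q"
          proof (rule wp_SeqPut)
            show "wp mem_bits ?c5 ?s5 (loops * (6 * loops + 5) + 1) ?Q"
            proof (rule wp_Seq[OF wp_overload_prog[OF rs[OF ag5]]])
              show "?s5 24 0 = 0" by (simp add: store_same)
            next
              fix s6 assume s6: "s6 24 0 = overload (?s5 15) \<and> agree {21, 22, 23, 24} ?s5 s6"
              then have ag65: "agree {21, 22, 23, 24} ?s5 s6" by blast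
              have ag6: "agree ?A s s6" by (rule agree_trans[OF ag5 ag65]) auto
              have v6: "s6 39 0 = clash (s 15)" "s6 38 0 = credit (s 15)" "s6 24 0 = overload (s 15)"
                using s6 P[OF ag5] agreeD[OF ag65] v4 by (simp_all add: store_same store_other)
              note r6 = round_stateD[OF rs[OF ag6]]
              show "wp mem_bits (Put 39 (Const 0) ?e) s6 1 ?Q"
              proof (rule wp_PutI)
                show "aval (Const 0) s6 = 0" by simp
                show "aval ?e s6 = debit (s 15)"
                  using r6 v6 by (simp add: debit_def power2_eq_square)
                show "debit (s 15) \<le> 2 ^ mem_bits" by (rule debit_le[OF s])
                show "?Q (store 39 0 (debit (s 15)) s6)"
                  using v6 ag6 by (simp add: store_same store_other agree_store)
              qed (simp_all add: max_esize_def)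
            qed
          qed (simp_all add: max_esize_def)
        qed
      qed (simp_all add: max_esize_def)
    qed (simp_all add: max_esize_def)
  qed
  then show ?thesis
    by (rule wp_mono) (use loop_bounds(8) in \<open>simp_all add: algebra_simps\<close>)
qed

text \<open>Besides the rounded prefix it records that the potential has not dropped below its start
  value \<open>x\<close>, the only fact about the process that the analysis needs.\<close>

definition rounded_upto :: "(nat \<Rightarrow> nat) \<Rightarrow> nat \<Rightarrow> (nat \<Rightarrow> nat) \<Rightarrow> bool" where
  "rounded_upto x k P \<longleftrightarrow> (\<forall>i<n. P i \<le> denom \<and> (\<not> large i \<longrightarrow> P i = 0) \<and>
     (i < k \<longrightarrow> P i = 0 \<or> P i = denom)) \<and> potential x \<le> potential P"

lemma rounded_upto_skip: "rounded_upto x k P \<Longrightarrow> \<not> large k \<Longrightarrow> rounded_upto x (Suc k) P"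
  unfolding rounded_upto_def by (metis less_Suc_eq)

lemma rounded_upto_step:
  assumes P: "rounded_upto x k P" and k: "k < n" "large k"
  shows "rounded_upto x (Suc k) (round_step k P)"
proof -
  have "potential x \<le> potential (round_step k P)"
    using P potential_round_step[of P k] k unfolding rounded_upto_def by (meson order.trans)
  moreover have "round_step k P i \<le> denom \<and> (\<not> large i \<longrightarrow> round_step k P i = 0) \<and>
     (i < Suc k \<longrightarrow> round_step k P i = 0 \<or> round_step k P i = denom)" if "i < n" for i
    using P that k unfolding rounded_upto_def round_step_def by (cases "i = k") auto
  ultimately show ?thesis unfolding rounded_upto_def by blast
qed

lemma wp_round_body:
  assumes s: "round_state s" and k: "k < n" "s 20 0 = k" and P: "rounded_upto x k (s 15)"
  shows "wp mem_bits round_body s (2 * (loops * (12 * loops + 20)) + 7)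
    (\<lambda>s'. rounded_upto x (Suc k) (s' 15) \<and> agree {15, 21, 22, 23, 24, 38, 39, 40, 41} s s')"
proof -
  let ?c = "LE (Add (Var 40) (Var 39)) (Add (Var 38) (Var 41))"
  let ?c5 = "If ?c Skip (Put 15 (Var 20) (Const 0))"
  let ?c4 = "Seq eval_prog ?c5"
  let ?c3 = "Seq (Put 15 (Var 20) DenomE) ?c4"
  let ?c2 = "Seq (Put 41 (Const 0) (Var 39)) ?c3"
  let ?c1 = "Seq (Put 40 (Const 0) (Var 38)) ?c2"
  let ?A = "{15, 21, 22, 23, 24, 38, 39, 40, 41} :: nat set"
  let ?Q = "\<lambda>s'. rounded_upto x (Suc k) (s' 15) \<and> agree ?A s s'"
  let ?T = "loops * (12 * loops + 20)"
  define P0 where "P0 = (s 15)(k := 0)"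
  define P1 where "P1 = (s 15)(k := denom)"
  have ple: "\<forall>i<n. P0 i \<le> denom" "\<forall>i<n. P1 i \<le> denom"
    using round_stateD(8)[OF s] by (auto simp: P0_def P1_def)
  have cond: "aval (LargeE (Var 20)) s = of_bool (large k)"
    using k round_stateD(1)[OF s] by (simp add: aval_LargeE)
  have "wp mem_bits round_body s ((1 + (?T + (1 + (1 + (1 + (?T + (1 + 1))))))) + 1) ?Q"
    unfolding round_body_def
  proof (rule wp_If)
    assume "aval (LargeE (Var 20)) s \<noteq> 0"
    then have lk: "large k" unfolding cond by simp
    let ?s1 = "store 15 k 0 s"
    have r1: "round_state ?s1" using s ple(1)
      by (auto simp: round_state_def prepared_store store_other store_same P0_def)
    have v1: "?s1 15 = P0" by (auto simp: store_def P0_def)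
    show "wp mem_bits (Seq (Put 15 (Var 20) (Const 0)) (Seq eval_prog
     ?c1)) s
     (1 + (?T + (1 + (1 + (1 + (?T + (1 + 1))))))) ?Q"
    proof (rule wp_SeqPut[where i = k and x = 0])
      show "wp mem_bits (Seq eval_prog ?c1) ?s1
       (?T + (1 + (1 + (1 + (?T + (1 + 1)))))) ?Q"
      proof (rule wp_Seq[OF wp_eval_prog[OF r1]])
        fix s2 assume "s2 38 0 = credit (?s1 15) \<and> s2 39 0 = debit (?s1 15) \<and> agree {21, 22, 23, 24, 38, 39} ?s1 s2"
        then have s2: "s2 38 0 = credit P0" "s2 39 0 = debit P0" and ag2: "agree {21, 22, 23, 24, 38, 39} ?s1 s2"
          unfolding v1 by blast+
        have r2: "round_state s2" by (rule round_state_agree[OF ag2 r1]) simp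
        have v2: "s2 20 0 = k" "s2 15 = P0" using agreeD[OF ag2] k v1 by (simp_all add: store_other)
        let ?s3 = "store 40 0 (credit P0) s2"
        let ?s4 = "store 41 0 (debit P0) ?s3"
        let ?s5 = "store 15 k denom ?s4"
        have "?s5 15 = P0(k := denom)" using v2 by (simp add: store_def)
        then have v5: "?s5 15 = P1" "?s5 20 0 = k" "?s5 40 0 = credit P0" "?s5 41 0 = debit P0"
          using v2 by (simp_all add: P0_def P1_def store_other store_same)
        have "\<forall>i<n. ?s5 15 i \<le> denom" unfolding v5(1) by (rule ple(2))
        then have r5: "round_state ?s5" using r2
          unfolding round_state_def by (simp add: prepared_store store_other)
        have ag5: "agree ?A s ?s5"
        proof (intro agree_store)
          show "agree ?A s s2"
            by (rule agree_trans[OF agree_store[OF agree_refl[of "{15}"]] ag2]) auto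
        qed auto
        have b: "credit P0 \<le> 2 ^ mem_bits" "debit P0 \<le> 2 ^ mem_bits"
          using credit_le[OF r1] debit_le[OF r1] unfolding v1 by blast+
        show "wp mem_bits ?c1 s2
         (1 + (1 + (1 + (?T + (1 + 1))))) ?Q"
        proof (rule wp_SeqPut)
          show "aval (Const 0) s2 = 0" "aval (Var 38) s2 = credit P0" using s2 by simp_all
          show "credit P0 \<le> 2 ^ mem_bits" by (rule b)
          show "wp mem_bits ?c2 ?s3
           (1 + (1 + (?T + (1 + 1)))) ?Q"
          proof (rule wp_SeqPut)
            show "aval (Const 0) ?s3 = 0" "aval (Var 39) ?s3 = debit P0" using s2 by (simp_all add: store_other)
            show "debit P0 \<le> 2 ^ mem_bits" by (rule b)
            show "wp mem_bits ?c3 ?s4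
             (1 + (?T + (1 + 1))) ?Q"
            proof (rule wp_SeqPut)
              show "aval (Var 20) ?s4 = k" using v2 by (simp add: store_other)
              have "?s4 30 0 = 2 ^ lg" "?s4 31 0 = lg" using round_stateD(2,3)[OF r2] by (simp_all add: store_other)
              then show "aval DenomE ?s4 = denom" by (rule aval_constants)
              show "denom \<le> 2 ^ mem_bits" by (rule depth_le_mem) simp
              show "wp mem_bits ?c4 ?s5
                (?T + (1 + 1)) ?Q"
              proof (rule wp_Seq[OF wp_eval_prog[OF r5]])
                fix s6 assume "s6 38 0 = credit (?s5 15) \<and> s6 39 0 = debit (?s5 15) \<and> agree {21, 22, 23, 24, 38, 39} ?s5 s6"
                then have s6: "s6 38 0 = credit P1" "s6 39 0 = debit P1" and ag6: "agree {21, 22, 23, 24, 38, 39} ?s5 s6"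
                  unfolding v5 by blast+
                have v6: "s6 15 = P1" "s6 20 0 = k" "s6 40 0 = credit P0" "s6 41 0 = debit P0"
                  using agreeD[OF ag6] v5 by simp_all
                have ag6': "agree ?A s s6" by (rule agree_trans[OF ag5 ag6]) auto
                have c: "aval ?c s6 =
                  of_bool (credit P0 + debit P1 \<le> credit P1 + debit P0)"
                  using s6 v6 by simp
                have step: "round_step k (s 15) = (if credit P0 + debit P1 \<le> credit P1 + debit P0 then P1 else P0)"
                  unfolding round_step_def P0_def P1_def ..
                note rd = rounded_upto_step[OF P k(1) lk]
                \<comment> \<open>The end \<open>denom\<close> is in memory at this moment, so
                  keeping it requires no action and only the other outcome resets the cell.\<close>
                show "wp mem_bits ?c5 s6
                  (1 + 1) ?Q"
                proof (rule wp_If)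
                  assume "aval ?c s6 \<noteq> 0"
                  then have "credit P0 + debit P1 \<le> credit P1 + debit P0" unfolding c of_bool_eq_0_iff by blast
                  then have "rounded_upto x (Suc k) (s6 15)" using rd unfolding step v6 by simp
                  then show "wp mem_bits Skip s6 1 ?Q" using ag6' by (intro wp_Skip) blast
                next
                  assume "aval ?c s6 = 0"
                  then have "\<not> credit P0 + debit P1 \<le> credit P1 + debit P0" unfolding c of_bool_eq_0_iff by blast
                  then have rd0: "rounded_upto x (Suc k) P0" using rd unfolding step by simp
                  have "store 15 k 0 s6 15 = P1(k := 0)" using v6 by (simp add: store_def)
                  also have "\<dots> = P0" by (simp add: P0_def P1_def)
                  finally have "store 15 k 0 s6 15 = P0" .
                  then have "?Q (store 15 k 0 s6)" using rd0 ag6' by (simp add: agree_store)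
                  then show "wp mem_bits (Put 15 (Var 20) (Const 0)) s6 1 ?Q"
                    using v6 by (intro wp_PutI[where i = k and x = 0]) (simp_all add: max_esize_def)
                qed (simp add: max_esize_def)
              qed
            qed (simp_all add: max_esize_def)
          qed (simp_all add: max_esize_def)
        qed (simp_all add: max_esize_def)
      qed
    qed (use k in \<open>simp_all add: max_esize_def\<close>)
  next
    assume "aval (LargeE (Var 20)) s = 0"
    then have "\<not> large k" unfolding cond by simp
    then have "wp mem_bits Skip s 1 ?Q"
      using rounded_upto_skip[OF P] by (intro wp_Skip) (simp add: agree_refl)
    then show "wp mem_bits Skip s (1 + (?T + (1 + (1 + (1 + (?T + (1 + 1))))))) ?Q" by (rule wp_mono) auto
  qed (simp add: max_esize_def)
  then show ?thesis by (rule wp_mono) auto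
qed

lemma wp_round_prog:
  assumes s: "prepared s" "s 30 0 = 2 ^ lg" "s 31 0 = lg"
    and x: "\<And>i. i < n \<Longrightarrow> s 15 i \<le> denom" "\<And>i. i < n \<Longrightarrow> \<not> large i \<Longrightarrow> s 15 i = 0"
  shows "wp mem_bits round_prog s (loops * (2 * (loops * (12 * loops + 20)) + 23))
    (\<lambda>s'. rounded_upto (s 15) n (s' 15) \<and> agree {15, 20, 21, 22, 23, 24, 36, 37, 38, 39, 40, 41} s s')"
proof -
  let ?step = "Add (Var 36) (Mul (LargeE (Var 20)) (Get 2 (Var 20)))"
  let ?fold = "Fold 36 20 nE (Const 0) ?step"
  let ?A = "{15, 20, 21, 22, 23, 24, 36, 37, 38, 39, 40, 41} :: nat set"
  let ?T = "2 * (loops * (12 * loops + 20)) + 7"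
  let ?Q = "\<lambda>s'. rounded_upto (s 15) n (s' 15) \<and> agree ?A s s'"
  have "wp mem_bits round_prog s (6 * loops + (6 * loops + (loops * (?T + 4)))) ?Q"
    unfolding round_prog_def
  proof (rule wp_Seq)
    show "wp mem_bits (Fold 37 20 nE (Const 1) (Mul (Var 37) DenomE)) s (6 * loops)
      (\<lambda>s'. s' 37 0 = denom ^ n \<and> agree {37, 20} s s')"
    proof (rule wp_Fold_loops[where F = "\<lambda>k. denom ^ k" and N = n])
      show "n \<le> 2 ^ mem_bits" "n \<le> loops" by (fact counter_bounds loop_bounds)+
    next
      fix s' assume "agree {37, 20} s s'"
      then show "aval nE s' = n" using aval_nE_prepared[OF prepared_agree[OF _ s(1)]] by simp
    next
      fix k s' assume k: "k < n" "agree {37, 20} s s'" "s' 20 0 = k" "s' 37 0 = denom ^ k"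
      have "aval DenomE s' = denom" using agreeD[OF k(2)] s by (intro aval_constants) simp_all
      then show "aval (Mul (Var 37) DenomE) s' = denom ^ Suc k" using k(4) by simp
    next
      fix k assume "k \<le> n"
      then show "denom ^ k \<le> 2 ^ mem_bits" by (rule le_mem_bits[OF denom_power_le]) simp
    qed (simp_all add: max_esize_def)
  next
    fix s1 assume s1: "s1 37 0 = denom ^ n \<and> agree {37, 20} s s1"
    then have ag1: "agree {37, 20} s s1" by blast
    have p1: "prepared s1" by (rule prepared_agree[OF ag1 s(1)]) simp
    let ?L = "\<lambda>k. \<Sum>i<k. of_bool (large i) * wt i"
    have lw: "?L n = large_weight"
    proof -
      have "?L n = (\<Sum>i<n. if large i then wt i else 0)" by (intro sum.cong) auto
      also have "\<dots> = (\<Sum>i\<in>{i \<in> {..<n}. large i}. wt i)" by (rule sum.inter_filter[symmetric]) simp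
      also have "{i \<in> {..<n}. large i} = {i. i < n \<and> large i}" by auto
      finally show ?thesis by (simp add: large_weight_def)
    qed
    show "wp mem_bits (Seq ?fold
       (For 20 nE round_body)) s1 (6 * loops + (loops * (?T + 4))) ?Q"
    proof (rule wp_Seq)
      show "wp mem_bits ?fold s1 (6 * loops)
        (\<lambda>s'. s' 36 0 = ?L n \<and> agree {36, 20} s1 s')"
      proof (rule wp_Fold_loops[where F = ?L and N = n])
        show "n \<le> 2 ^ mem_bits" "n \<le> loops" by (fact counter_bounds loop_bounds)+
      next
        fix s' assume "agree {36, 20} s1 s'"
        then show "aval nE s' = n" using aval_nE_prepared[OF prepared_agree[OF _ p1]] by simp
      next
        fix k s' assume k: "k < n" "agree {36, 20} s1 s'" "s' 20 0 = k" "s' 36 0 = ?L k"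
        have p: "prepared s'" by (rule prepared_agree[OF k(2) p1]) simp
        then have "aval (LargeE (Var 20)) s' = of_bool (large k)" using k by (simp add: aval_LargeE)
        moreover have "aval (Get 2 (Var 20)) s' = wt k" using p k by (simp add: prepared_get)
        ultimately show "aval ?step s' = ?L (Suc k)"
          unfolding aval.simps(3)[of "Var 36"] aval.simps(5)[of "LargeE (Var 20)"]
          using k(4) by (simp only: aval.simps sum.lessThan_Suc)
      next
        fix k assume k: "k \<le> n"
        have "?L k \<le> 2 ^ (size + size)"
        proof (rule sum_le_power)
          show "k \<le> 2 ^ size" using k n_m_le(1) by linarith
          fix i assume "i < k"
          then show "of_bool (large i) * wt i \<le> 2 ^ size" using task_le(1)[of i] k by auto
        qed
        then show "?L k \<le> 2 ^ mem_bits" by (rule le_mem_bits) simp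
      qed (simp_all add: max_esize_def)
    next
      fix s2 assume s2: "s2 36 0 = ?L n \<and> agree {36, 20} s1 s2"
      then have ag2: "agree {36, 20} s1 s2" by blast
      have v2: "s2 15 = s 15" "s2 30 = s 30" "s2 31 = s 31" "s2 37 0 = denom ^ n" "s2 36 0 = large_weight"
        using agreeD[OF ag2] agreeD[OF ag1] s1 s2 lw by simp_all
      have p2: "prepared s2" by (rule prepared_agree[OF ag2 p1]) simp
      have r2: "round_state s2" using p2 v2 s x(1) by (simp add: round_state_def)
      have ags: "agree ?A s s2" by (rule agree_trans[OF ag1 ag2]) auto
      let ?J = "\<lambda>k s'. rounded_upto (s 15) k (s' 15) \<and> agree ?A s s' \<and> round_state s'"
      have "wp mem_bits (For 20 nE round_body) s2 (loops * (?T + 4)) (?J n)"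
      proof (rule wp_For_loops[where J = ?J and N = n])
        show "n \<le> 2 ^ mem_bits" "n \<le> loops" by (fact counter_bounds loop_bounds)+
        have "rounded_upto (s 15) 0 (s 15)" using x unfolding rounded_upto_def by simp
        then show "?J 0 s2" using v2 ags r2 by simp
        fix q s' z assume "?J q s'"
        then show "?J q (store 20 0 z s')"
          by (auto simp: store_other round_state_def prepared_store intro: agree_store)
      next
        fix q s' assume "?J q s'"
        then show "aval nE s' = n" using aval_nE_prepared round_stateD(1) by blast
      next
        fix k s' assume k: "k < n" and J: "?J k s'" and s20: "s' 20 0 = k"
        have r': "round_state s'" and P': "rounded_upto (s 15) k (s' 15)" using J by blast+
        show "wp mem_bits round_body s' ?T (\<lambda>s''. ?J (Suc k) s'' \<and> s'' 20 0 = k)"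
        proof (rule wp_mono[OF wp_round_body[OF r' k s20 P'] order.refl])
          fix s'' assume s'': "rounded_upto (s 15) (Suc k) (s'' 15) \<and> agree {15, 21, 22, 23, 24, 38, 39, 40, 41} s' s''"
          then have ag: "agree {15, 21, 22, 23, 24, 38, 39, 40, 41} s' s''" by blast
          have "agree ?A s s''" by (rule agree_trans[of ?A s s', OF _ ag]) (use J in auto)
          moreover have "prepared s''" by (rule prepared_agree[OF ag round_stateD(1)[OF r']]) simp
          moreover have "s'' 30 = s' 30" "s'' 31 = s' 31" "s'' 36 = s' 36" "s'' 37 = s' 37" "s'' 20 = s' 20"
            using agreeD[OF ag] by simp_all
          moreover have "\<forall>i<n. s'' 15 i \<le> denom" using s'' unfolding rounded_upto_def by blast
          ultimately show "?J (Suc k) s'' \<and> s'' 20 0 = k"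
            using s'' s20 round_stateD(2-5)[OF r'] by (simp add: round_state_def)
        qed
      qed (simp add: max_esize_def)
      then show "wp mem_bits (For 20 nE round_body) s2 (loops * (?T + 4)) ?Q"
        by (rule wp_mono) auto
    qed
  qed
  then show ?thesis by (rule wp_mono) (simp_all add: algebra_simps)
qed

end

section \<open>Selecting a layer\<close>

definition survivors_prog :: com where
  "survivors_prog = For 20 nE (Seq (Fold 23 21 nE (Const 0)
       (Add (Var 23) (Mul (BlocksE (Var 21) (Var 20)) (LT (Const 0) (Get 15 (Var 21))))))
     (Put 16 (Var 20) (AND (LT (Const 0) (Get 15 (Var 20))) (EQ (Var 23) (Const 0)))))"

text \<open>The layer plus one if the task is a narrower conflicting survivor, else 0; the maximum
  over all tasks then yields layer 0 without a special case.\<close>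

definition CandE :: aexp where
  "CandE = Mul (AND (LT (Const 0) (Get 16 (Var 21))) (AND (LT (WidthE (Var 21)) (WidthE (Var 20)))
     (ConflictE (Var 20) (Var 21)))) (Add (Get 17 (Var 21)) (Const 1))"

definition layer_prog :: com where
  "layer_prog = For 22 SlotsE (Seq (Put 20 (Const 0) (MOD (Var 22) nE))
     (If (AND (LT (Const 0) (Get 16 (Var 20))) (EQ (WidthE (Var 20)) (Div (Var 22) nE)))
       (Seq (Fold 23 21 nE (Const 0) (ITE (LT (Var 23) CandE) CandE (Var 23)))
         (Put 17 (Var 20) (Var 23)))
       Skip))"

definition best_prog :: com where
  "best_prog = Seq (Put 42 (Const 0) (Const 0)) (Seq (Put 43 (Const 0) (Const 0))
     (For 21 nE (Seq (Fold 23 20 nE (Const 0) (Add (Var 23)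
         (Mul (AND (LT (Const 0) (Get 16 (Var 20))) (EQ (Get 17 (Var 20)) (Var 21))) (Get 2 (Var 20)))))
       (If (LT (Var 43) (Var 23)) (Seq (Put 42 (Const 0) (Var 21)) (Put 43 (Const 0) (Var 23))) Skip))))"

definition output_prog :: com where
  "output_prog = Seq (Fold 44 20 nE (Const 0) (Add (Var 44) (Mul (Get 13 (Var 20)) (Get 2 (Var 20)))))
     (If (LE (Var 43) (Var 44)) (For 20 nE (Put 7 (Var 20) (Get 13 (Var 20))))
       (For 20 nE (Put 7 (Var 20) (AND (LT (Const 0) (Get 16 (Var 20))) (EQ (Get 17 (Var 20)) (Var 42))))))"

context bagufp_instance
begin

lemma sum_of_bool_le: "k \<le> n \<Longrightarrow> (\<Sum>i<k. of_bool (p i)) \<le> (2::nat) ^ mem_bits"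
proof -
  assume "k \<le> n"
  then have "(\<Sum>i<k. of_bool (p i)) \<le> (2::nat) ^ (size + 0)"
    using n_m_le(1) by (intro sum_le_power) auto
  then show ?thesis by (rule le_mem_bits) simp
qed

lemma sum_weights_le: "k \<le> n \<Longrightarrow> (\<Sum>i<k. of_bool (p i) * wt i) \<le> (2::nat) ^ mem_bits"
proof -
  assume k: "k \<le> n"
  have "(\<Sum>i<k. of_bool (p i) * wt i) \<le> (2::nat) ^ (size + size)"
  proof (rule sum_le_power)
    show "k \<le> 2 ^ size" using k n_m_le(1) by linarith
    fix i assume "i < k"
    then show "of_bool (p i) * wt i \<le> 2 ^ size" using task_le(1)[of i] k by auto
  qed
  then show ?thesis by (rule le_mem_bits) simp
qed

lemma sum_weights_eq: "(\<Sum>i<n. of_bool (p i) * wt i) = total_weight I {i. i < n \<and> p i}"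
proof -
  have "(\<Sum>i<n. of_bool (p i) * wt i) = (\<Sum>i<n. if p i then wt i else 0)" by (intro sum.cong) auto
  also have "\<dots> = (\<Sum>i\<in>{i \<in> {..<n}. p i}. wt i)" by (rule sum.inter_filter[symmetric]) simp
  also have "{i \<in> {..<n}. p i} = {i. i < n \<and> p i}" by auto
  finally show ?thesis by (simp add: total_weight_eq)
qed

lemma wp_survivors_prog:
  assumes s: "prepared s"
  shows "wp mem_bits survivors_prog s (loops * (6 * loops + 5))
    (\<lambda>s'. (\<forall>i<n. s' 16 i = of_bool (i \<in> survivors {i. i < n \<and> s 15 i \<noteq> 0})) \<and> agree {16, 20, 21, 23} s s')"
proof -
  let ?fac = "Mul (BlocksE (Var 21) (Var 20)) (LT (Const 0) (Get 15 (Var 21)))"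
  let ?fold = "Fold 23 21 nE (Const 0) (Add (Var 23) ?fac)"
  let ?e = "AND (LT (Const 0) (Get 15 (Var 20))) (EQ (Var 23) (Const 0))"
  let ?A = "{16, 20, 21, 23} :: nat set"
  let ?S = "{i. i < n \<and> s 15 i \<noteq> 0}"
  let ?J = "\<lambda>k s'. (\<forall>i<k. s' 16 i = of_bool (i \<in> survivors ?S)) \<and> agree ?A s s'"
  have prep: "prepared s'" if "agree ?A s s'" for s'
    by (rule prepared_agree[OF that s]) simp
  have "wp mem_bits survivors_prog s (loops * ((6 * loops + 1) + 4)) (?J n)"
    unfolding survivors_prog_def
  proof (rule wp_For_loops[where J = ?J and N = n])
    show "n \<le> 2 ^ mem_bits" "n \<le> loops" by (fact counter_bounds loop_bounds)+
    show "?J 0 s" by (simp add: agree_refl)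
    fix q s' z assume "?J q s'"
    then show "?J q (store 20 0 z s')" by (auto simp: store_other intro: agree_store)
  next
    fix q s' assume "?J q s'"
    then show "aval nE s' = n" using aval_nE_prepared prep by blast
  next
    fix k s' assume k: "k < n" and J: "?J k s'" and s20: "s' 20 0 = k"
    have p': "prepared s'" using prep J by blast
    have P': "s' 15 = s 15" using J agreeD[of ?A s s' 15] by simp
    let ?F = "\<lambda>q. \<Sum>j<q. of_bool (blocks j k \<and> 0 < s 15 j) :: nat"
    show "wp mem_bits (Seq ?fold
     (Put 16 (Var 20) ?e)) s' (6 * loops + 1)
     (\<lambda>s''. ?J (Suc k) s'' \<and> s'' 20 0 = k)"
    proof (rule wp_Seq)
      show "wp mem_bits ?fold s' (6 * loops)
       (\<lambda>s''. s'' 23 0 = ?F n \<and> agree {23, 21} s' s'')"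
      proof (rule wp_Fold_loops[where F = ?F and N = n])
        show "n \<le> 2 ^ mem_bits" "n \<le> loops" by (fact counter_bounds loop_bounds)+
      next
        fix s'' assume "agree {23, 21} s' s''"
        then show "aval nE s'' = n" using aval_nE_prepared[OF prepared_agree[OF _ p']] by simp
      next
        fix j s'' assume j: "j < n" "agree {23, 21} s' s''" "s'' 21 0 = j" "s'' 23 0 = ?F j"
        have p: "prepared s''" by (rule prepared_agree[OF j(2) p']) simp
        have v: "s'' 15 = s 15" "s'' 20 0 = k" using agreeD[OF j(2)] P' s20 by simp_all
        have "aval (BlocksE (Var 21) (Var 20)) s'' = of_bool (blocks j k)"
          using aval_BlocksE[OF p, of "Var 20" "Var 21"] v j k by simp
        moreover have "aval (LT (Const 0) (Get 15 (Var 21))) s'' = of_bool (0 < s 15 j)" using v j by simp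
        ultimately have "aval ?fac s'' =
            of_bool (blocks j k \<and> 0 < s 15 j)"
          unfolding aval.simps(5)[of "BlocksE (Var 21) (Var 20)"] by (simp only: of_bool_conj)
        then show "aval (Add (Var 23) ?fac) s'' = ?F (Suc j)"
          unfolding aval.simps(3)[of "Var 23"] using j(4) by (simp only: aval.simps sum.lessThan_Suc)
      next
        fix j assume "j \<le> n"
        then show "?F j \<le> 2 ^ mem_bits" by (rule sum_of_bool_le)
      qed (simp_all add: max_esize_def)
    next
      fix s1 assume s1: "s1 23 0 = ?F n \<and> agree {23, 21} s' s1"
      then have ag: "agree {23, 21} s' s1" by blast
      have v: "s1 15 = s 15" "s1 20 0 = k" "s1 16 = s' 16" using agreeD[OF ag] P' s20 by simp_all
      have ag1: "agree ?A s s1" by (rule agree_trans[of ?A s s', OF _ ag]) (use J in auto)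
      have F0: "?F n = 0 \<longleftrightarrow> (\<forall>j\<in>?S. \<not> blocks j k)" by (auto simp: sum_eq_0_iff)
      have val: "aval ?e s1 = of_bool (k \<in> survivors ?S)"
      proof -
        have "aval ?e s1 =
          of_bool (0 < s 15 k \<and> ?F n = 0)"
          using v s1 by (intro aval_AND) simp_all
        also have "(0 < s 15 k \<and> ?F n = 0) = (k \<in> survivors ?S)"
          unfolding F0 using k by (auto simp: survivors_def)
        finally show ?thesis .
      qed
      show "wp mem_bits (Put 16 (Var 20) ?e) s1 1
        (\<lambda>s''. ?J (Suc k) s'' \<and> s'' 20 0 = k)"
      proof (rule wp_PutI[OF _ val])
        show "aval (Var 20) s1 = k" using v by simp
        show "?J (Suc k) (store 16 k (of_bool (k \<in> survivors ?S)) s1) \<and>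
          store 16 k (of_bool (k \<in> survivors ?S)) s1 20 0 = k"
          using J v ag1 by (auto simp: store_same store_other agree_store less_Suc_eq)
      qed (simp_all add: max_esize_def)
    qed
  qed (simp add: max_esize_def)
  then show ?thesis by (rule wp_mono) simp_all
qed

text \<open>Analogue of \<open>time\<close> with the width as leading key, so narrower rectangles
  receive their layers first.\<close>

definition width_time :: "nat \<Rightarrow> nat" where
  "width_time i = (snk i - src i) * n + i"

lemma width_slot:
  assumes "q < (m + 1) * n"
  shows "q mod n < n" "snk (q mod n) - src (q mod n) = q div n \<longleftrightarrow> width_time (q mod n) = q"
    "j < n \<Longrightarrow> width_time j = q \<Longrightarrow> j = q mod n"
proof -
  have n: "0 < n" using assms by (cases n) auto
  then show i: "q mod n < n" by simp
  show "snk (q mod n) - src (q mod n) = q div n \<longleftrightarrow> width_time (q mod n) = q"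
  proof
    assume "snk (q mod n) - src (q mod n) = q div n"
    then show "width_time (q mod n) = q" by (simp add: width_time_def)
  next
    assume "width_time (q mod n) = q"
    then have "width_time (q mod n) div n = q div n" by simp
    moreover have "width_time (q mod n) div n = snk (q mod n) - src (q mod n)"
      unfolding width_time_def using i by simp
    ultimately show "snk (q mod n) - src (q mod n) = q div n" by simp
  qed
  show "j = q mod n" if "j < n" "width_time j = q"
    using that by (auto simp: width_time_def)
qed

lemma width_time_less: "i < n \<Longrightarrow> width_time i < (m + 1) * n"
proof -
  assume i: "i < n"
  have "width_time i < (snk i - src i + 1) * n" using i by (simp add: width_time_def)
  also have "\<dots> \<le> (m + 1) * n" using task_valid(4)[OF i] by (intro mult_le_mono1) simp
  finally show ?thesis .
qed

lemma narrower_time: "i < n \<Longrightarrow> j < n \<Longrightarrow> narrower j i \<Longrightarrow> width_time j < width_time i"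
proof -
  assume ij: "i < n" "j < n" "narrower j i"
  have "width_time j < (snk j - src j + 1) * n" using ij by (simp add: width_time_def)
  also have "\<dots> \<le> (snk i - src i) * n" using ij(3) by (intro mult_le_mono1) (simp add: narrower_def)
  also have "\<dots> \<le> width_time i" by (simp add: width_time_def)
  finally show ?thesis .
qed

definition layer_ok :: "nat set \<Rightarrow> (nat \<Rightarrow> nat) \<Rightarrow> nat \<Rightarrow> bool" where
  "layer_ok S col i \<longleftrightarrow> (\<forall>j\<in>S. narrower j i \<and> conflict i j \<longrightarrow> col j < col i) \<and>
     (col i = 0 \<or> (\<exists>j\<in>S. narrower j i \<and> conflict i j \<and> col i = Suc (col j)))"

text \<open>The bound \<open>col i \<le> q\<close> grows by at most one per slot and keeps the layer
  numbers small enough to be stored.\<close>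

definition layered_upto :: "nat set \<Rightarrow> nat \<Rightarrow> (nat \<Rightarrow> nat) \<Rightarrow> bool" where
  "layered_upto S q col \<longleftrightarrow> (\<forall>i<n. col i \<le> q) \<and> (\<forall>i\<in>S. width_time i < q \<longrightarrow> layer_ok S col i)"

lemma layered_upto_final:
  "S \<subseteq> {..<n} \<Longrightarrow> layered_upto S ((m + 1) * n) col \<Longrightarrow> layering S col"
  unfolding layered_upto_def layering_def layer_ok_def using width_time_less by blast

definition candidate :: "nat set \<Rightarrow> (nat \<Rightarrow> nat) \<Rightarrow> nat \<Rightarrow> nat \<Rightarrow> nat" where
  "candidate S col i j = of_bool (j \<in> S \<and> narrower j i \<and> conflict i j) * (col j + 1)"

primrec running_max :: "nat set \<Rightarrow> (nat \<Rightarrow> nat) \<Rightarrow> nat \<Rightarrow> nat \<Rightarrow> nat" where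
  "running_max S col i 0 = 0"
| "running_max S col i (Suc k) = (if running_max S col i k < candidate S col i k then candidate S col i k
     else running_max S col i k)"

lemma running_max:
  "(\<forall>j<k. candidate S col i j \<le> running_max S col i k) \<and>
   (running_max S col i k = 0 \<or> (\<exists>j<k. running_max S col i k = candidate S col i j))"
proof (induction k)
  case (Suc k)
  show ?case
  proof (cases "running_max S col i k < candidate S col i k")
    case True
    then have "candidate S col i j \<le> candidate S col i k" if "j < k" for j
      using Suc that by (meson less_imp_le order.trans)
    then show ?thesis using True by (auto simp: less_Suc_eq)
  next
    case False
    then show ?thesis using Suc by (auto simp: less_Suc_eq)
  qed
qed simp

lemma running_max_le: "k \<le> n \<Longrightarrow> (\<And>j. j < n \<Longrightarrow> col j \<le> q) \<Longrightarrow> running_max S col i k \<le> Suc q"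
proof -
  assume *: "k \<le> n" "\<And>j. j < n \<Longrightarrow> col j \<le> q"
  consider "running_max S col i k = 0" | j where "j < k" "running_max S col i k = candidate S col i j"
    using running_max[of k S col i] by metis
  then show ?thesis
  proof cases
    case (2 j)
    then show ?thesis using *(2)[of j] *(1) by (auto simp: candidate_def)
  qed simp
qed

text \<open>The layer of a task depends only on narrower ones, which have smaller slots; setting the
  layer of \<open>i\<close> changes nothing for tasks treated before.\<close>

lemma layered_upto_step:
  assumes S: "S \<subseteq> {..<n}" and col: "layered_upto S q col" and i: "i \<in> S" "width_time i = q"
  shows "layered_upto S (Suc q) (col(i := running_max S col i n))"
proof -
  define c where "c = running_max S col i n"
  have iS: "i < n" using S i by auto
  have c_le: "c \<le> Suc q" unfolding c_def
    using col by (intro running_max_le) (auto simp: layered_upto_def)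
  have same: "layer_ok S (col(i := c)) k" if "k \<in> S" "width_time k < q" for k
  proof -
    have k: "k < n" "k \<noteq> i" using S that i by auto
    \<comment> \<open>A narrower task has an earlier slot than \<open>k\<close>, hence earlier than
      that of \<open>i\<close>.\<close>
    have ne: "j \<noteq> i" if "j \<in> S" "narrower j k" for j
      using narrower_time[OF k(1), of j] S that \<open>width_time k < q\<close> i by auto
    have "layer_ok S col k" using col that by (auto simp: layered_upto_def)
    then show ?thesis using k ne unfolding layer_ok_def by (simp) metis
  qed
  have "layer_ok S (col(i := c)) i"
    unfolding layer_ok_def
  proof (intro conjI ballI impI)
    fix j assume j: "j \<in> S" "narrower j i \<and> conflict i j"
    then have "j \<noteq> i" by (auto simp: narrower_def)
    moreover have "candidate S col i j \<le> c" unfolding c_def using running_max[of n S col i] S j(1) by blast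
    ultimately show "(col(i := c)) j < (col(i := c)) i" using j by (simp add: candidate_def)
  next
    consider "c = 0" | j where "c \<noteq> 0" "c = candidate S col i j"
      unfolding c_def using running_max[of n S col i] by metis
    then show "(col(i := c)) i = 0 \<or>
      (\<exists>j\<in>S. narrower j i \<and> conflict i j \<and> (col(i := c)) i = Suc ((col(i := c)) j))"
    proof cases
      case (2 j)
      then have "j \<in> S" "narrower j i" "conflict i j" "c = Suc (col j)"
        by (auto simp: candidate_def split: if_splits)
      moreover from this have "j \<noteq> i" by (auto simp: narrower_def)
      ultimately show ?thesis by auto
    qed simp
  qed
  moreover have "k = i" if "k \<in> S" "width_time k = q" for k
  proof -
    have "i < n" "k < n" using S i(1) that(1) by auto
    then have "width_time i mod n = i" "width_time k mod n = k"
      by (simp_all add: width_time_def)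
    then show ?thesis using that(2) i(2) by metis
  qed
  ultimately have "layer_ok S (col(i := c)) k" if "k \<in> S" "width_time k < Suc q" for k
    using same[of k] that by (metis less_Suc_eq)
  then show ?thesis
    using c_le col unfolding layered_upto_def c_def[symmetric] by (auto simp: le_SucI)
qed

lemma layered_upto_skip:
  assumes "layered_upto S q col" "\<And>i. i \<in> S \<Longrightarrow> width_time i \<noteq> q"
  shows "layered_upto S (Suc q) col"
  using assms unfolding layered_upto_def by (metis le_SucI less_Suc_eq)

lemma esize_CandE [simp]: "esize CandE = 104"
  by (simp add: CandE_def)

lemma wp_layer_prog:
  assumes s: "prepared s" and z: "s 17 = (\<lambda>_. 0)"
    and S: "S \<subseteq> {..<n}" "\<And>i. i < n \<Longrightarrow> s 16 i = of_bool (i \<in> S)"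
  shows "wp mem_bits layer_prog s (loops * (6 * loops + 7))
    (\<lambda>s'. layering S (s' 17) \<and> agree {17, 20, 21, 22, 23} s s')"
proof -
  let ?c = "AND (LT (Const 0) (Get 16 (Var 20))) (EQ (WidthE (Var 20)) (Div (Var 22) nE))"
  let ?step = "ITE (LT (Var 23) CandE) CandE (Var 23)"
  let ?fold = "Fold 23 21 nE (Const 0) ?step"
  let ?then = "Seq ?fold (Put 17 (Var 20) (Var 23))"
  let ?A = "{17, 20, 21, 22, 23} :: nat set"
  let ?J = "\<lambda>q s'. layered_upto S q (s' 17) \<and> agree ?A s s'"
  let ?N = "(m + 1) * n"
  have prep: "prepared s'" if "agree ?A s s'" for s'
    by (rule prepared_agree[OF that s]) simp
  have "wp mem_bits layer_prog s (loops * ((1 + ((6 * loops + 1) + 1)) + 4)) (?J ?N)"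
    unfolding layer_prog_def
  proof (rule wp_For_loops[where J = ?J and N = ?N])
    show "?N \<le> 2 ^ mem_bits" "?N \<le> loops" by (fact counter_bounds loop_bounds)+
    show "?J 0 s" using z by (simp add: agree_refl layered_upto_def)
    fix q s' z assume "?J q s'"
    then show "?J q (store 22 0 z s')" by (auto simp: store_other intro: agree_store)
  next
    fix q s' assume "?J q s'"
    then show "aval SlotsE s' = ?N" using inputs_aval(4)[OF prepared_inputs] prep by blast
  next
    fix q s' assume q: "q < ?N" and J: "?J q s'" and s22: "s' 22 0 = q"
    note st = width_slot[OF q]
    define i where "i = q mod n"
    have i: "i < n" using st(1) by (simp add: i_def)
    let ?s = "store 20 0 i s'"
    have ag1: "agree ?A s ?s" using J by (auto intro: agree_store)
    have p': "prepared s'" "prepared ?s" using prep J ag1 by blast+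
    have v1: "?s 20 0 = i" "?s 22 0 = q" "?s 17 = s' 17" "?s 16 = s 16"
      using s22 agreeD[OF ag1] by (simp_all add: store_same store_other)
    have n0: "aval nE s' = n" "aval nE ?s = n" using aval_nE_prepared p' by blast+
    have cond: "aval ?c ?s =
        of_bool (i \<in> S \<and> width_time i = q)"
    proof (rule aval_AND)
      show "aval (LT (Const 0) (Get 16 (Var 20))) ?s = of_bool (i \<in> S)" using v1 S(2)[OF i] by simp
      show "aval (EQ (WidthE (Var 20)) (Div (Var 22) nE)) ?s = of_bool (width_time i = q)"
        using v1 p' i n0 st(2) by (simp add: aval_WidthE i_def)
    qed
    have colq: "\<And>j. j < n \<Longrightarrow> s' 17 j \<le> q" using J by (auto simp: layered_upto_def)
    show "wp mem_bits (Seq (Put 20 (Const 0) (MOD (Var 22) nE))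
     (If ?c
       ?then
       Skip)) s' (1 + ((6 * loops + 1) + 1)) (\<lambda>s''. ?J (Suc q) s'' \<and> s'' 22 0 = q)"
    proof (rule wp_SeqPut)
      show "i \<le> 2 ^ mem_bits" using i counter_bounds(1) by linarith
      show "aval (Const 0) s' = 0" "aval (MOD (Var 22) nE) s' = i" using s22 n0 by (simp_all add: i_def)
      show "wp mem_bits (If ?c
       ?then
       Skip) ?s ((6 * loops + 1) + 1) (\<lambda>s''. ?J (Suc q) s'' \<and> s'' 22 0 = q)"
      proof (rule wp_If)
        assume "aval ?c ?s \<noteq> 0"
        then have iS: "i \<in> S" "width_time i = q" unfolding cond of_bool_eq_0_iff by blast+
        define F where "F = running_max S (s' 17) i"
        have F_le: "F k \<le> 2 ^ mem_bits" if "k \<le> n" for k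
        proof -
          have "F k \<le> Suc q" unfolding F_def using that colq by (rule running_max_le)
          then show ?thesis using q counter_bounds(4) by linarith
        qed
        show "wp mem_bits ?then ?s (6 * loops + 1) (\<lambda>s''. ?J (Suc q) s'' \<and> s'' 22 0 = q)"
        proof (rule wp_Seq)
          show "wp mem_bits ?fold ?s (6 * loops)
            (\<lambda>s''. s'' 23 0 = F n \<and> agree {23, 21} ?s s'')"
          proof (rule wp_Fold_loops[where F = F and N = n])
            show "n \<le> 2 ^ mem_bits" "n \<le> loops" by (fact counter_bounds loop_bounds)+
          next
            fix s'' assume "agree {23, 21} ?s s''"
            then show "aval nE s'' = n" using aval_nE_prepared[OF prepared_agree[OF _ p'(2)]] by simp
          next
            fix j s'' assume j: "j < n" "agree {23, 21} ?s s''" "s'' 21 0 = j" "s'' 23 0 = F j"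
            have p: "prepared s''" by (rule prepared_agree[OF j(2) p'(2)]) simp
            have v: "s'' 20 0 = i" "s'' 17 = s' 17" "s'' 16 = s 16" using agreeD[OF j(2)] v1 by simp_all
            have "aval (AND (LT (Const 0) (Get 16 (Var 21))) (AND (LT (WidthE (Var 21)) (WidthE (Var 20)))
              (ConflictE (Var 20) (Var 21)))) s'' = of_bool (j \<in> S \<and> narrower j i \<and> conflict i j)"
            proof (intro aval_AND)
              show "aval (LT (Const 0) (Get 16 (Var 21))) s'' = of_bool (j \<in> S)" using v j S(2)[OF j(1)] by simp
              show "aval (LT (WidthE (Var 21)) (WidthE (Var 20))) s'' = of_bool (narrower j i)"
                using v j i p by (simp add: aval_WidthE narrower_def)
              show "aval (ConflictE (Var 20) (Var 21)) s'' = of_bool (conflict i j)"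
                using aval_ConflictE[OF p, of "Var 20" "Var 21"] v j i by simp
            qed
            then have cand: "aval CandE s'' = candidate S (s' 17) i j"
              unfolding CandE_def aval.simps(5) using v j by (simp add: candidate_def)
            show "aval ?step s'' = F (Suc j)"
              using cand j(4) by (simp add: F_def)
          next
            fix k assume "k \<le> n" then show "F k \<le> 2 ^ mem_bits" by (rule F_le)
          qed (simp_all add: max_esize_def F_def)
        next
          fix s1 assume s1: "s1 23 0 = F n \<and> agree {23, 21} ?s s1"
          then have ag: "agree {23, 21} ?s s1" by blast
          have v: "s1 20 0 = i" "s1 22 0 = q" "s1 17 = s' 17" using agreeD[OF ag] v1 by simp_all
          have ag2: "agree ?A s s1" by (rule agree_trans[OF ag1 ag]) auto
          have eq: "store 17 i (F n) s1 17 = (s' 17)(i := F n)" using v by (simp add: store_def)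
          have "layered_upto S q (s' 17)" using J by (rule conjunct1)
          then have lu: "layered_upto S (Suc q) (store 17 i (F n) s1 17)"
            unfolding eq unfolding F_def by (rule layered_upto_step[OF S(1) _ iS])
          show "wp mem_bits (Put 17 (Var 20) (Var 23)) s1 1 (\<lambda>s''. ?J (Suc q) s'' \<and> s'' 22 0 = q)"
          proof (rule wp_PutI)
            show "aval (Var 20) s1 = i" "aval (Var 23) s1 = F n" using v s1 by simp_all
            show "F n \<le> 2 ^ mem_bits" by (rule F_le) simp
            show "?J (Suc q) (store 17 i (F n) s1) \<and> store 17 i (F n) s1 22 0 = q"
              using lu v ag2 by (simp add: store_other agree_store)
          qed (simp_all add: max_esize_def)
        qed
      next
        assume "aval ?c ?s = 0"
        then have no: "\<not> (i \<in> S \<and> width_time i = q)" unfolding cond of_bool_eq_0_iff by blast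
        have "width_time k \<noteq> q" if k: "k \<in> S" for k
        proof
          assume wt: "width_time k = q"
          then have "k = i" unfolding i_def using st(3)[of k] k S(1) by blast
          then show False using no k wt by blast
        qed
        then have "layered_upto S (Suc q) (s' 17)"
          using J by (intro layered_upto_skip[of S q "s' 17"]) blast+
        then have "wp mem_bits Skip ?s 1 (\<lambda>s''. ?J (Suc q) s'' \<and> s'' 22 0 = q)"
          using v1 ag1 by (intro wp_Skip) simp
        then show "wp mem_bits Skip ?s (6 * loops + 1) (\<lambda>s''. ?J (Suc q) s'' \<and> s'' 22 0 = q)"
          by (rule wp_mono) auto
      qed (simp add: max_esize_def)
    qed (simp_all add: max_esize_def)
  qed (simp add: max_esize_def)
  then show ?thesis
  proof (rule wp_mono)
    fix s' assume "?J ?N s'"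
    then show "layering S (s' 17) \<and> agree ?A s s'" using layered_upto_final[OF S(1)] by blast
  qed simp
qed

text \<open>Only the layers below \<open>n\<close> are tried; by \<open>layer_bound\<close> there
  are no others. The initial values 0 for layer and weight satisfy the invariant, as a weight is
  never negative.\<close>

lemma wp_best_prog:
  assumes s: "prepared s" and S: "S \<subseteq> {..<n}" "\<And>i. i < n \<Longrightarrow> s 16 i = of_bool (i \<in> S)"
  shows "wp mem_bits best_prog s (loops * (6 * loops + 9))
    (\<lambda>s'. (\<forall>k<n. total_weight I {i \<in> S. s 17 i = k} \<le> s' 43 0) \<and>
       s' 43 0 \<le> total_weight I {i \<in> S. s 17 i = s' 42 0} \<and> agree {20, 21, 23, 42, 43} s s')"
proof -
  let ?sel = "AND (LT (Const 0) (Get 16 (Var 20))) (EQ (Get 17 (Var 20)) (Var 21))"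
  let ?step = "Add (Var 23) (Mul ?sel (Get 2 (Var 20)))"
  let ?fold = "Fold 23 20 nE (Const 0) ?step"
  let ?take = "Seq (Put 42 (Const 0) (Var 21)) (Put 43 (Const 0) (Var 23))"
  let ?if = "If (LT (Var 43) (Var 23)) ?take Skip"
  let ?body = "Seq ?fold ?if"
  let ?A = "{20, 21, 23, 42, 43} :: nat set"
  let ?W = "\<lambda>k. total_weight I {i \<in> S. s 17 i = k}"
  let ?J = "\<lambda>k s'. (\<forall>k'<k. ?W k' \<le> s' 43 0) \<and> s' 43 0 \<le> ?W (s' 42 0) \<and> agree ?A s s'"
  have prep: "prepared s'" if "agree ?A s s'" for s'
    by (rule prepared_agree[OF that s]) simp
  let ?s1 = "store 42 0 0 s"
  let ?s2 = "store 43 0 0 ?s1"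
  have ag2: "agree ?A s ?s2" by (intro agree_store agree_refl) auto
  have Seq: "{i. i < n \<and> (i \<in> S \<and> s 17 i = k)} = {i \<in> S. s 17 i = k}" for k using S(1) by auto
  have "wp mem_bits best_prog s (1 + (1 + loops * ((6 * loops + (1 + 1 + 1)) + 4))) (?J n)"
    unfolding best_prog_def
  proof (rule wp_SeqPut[where i = 0 and x = 0])
    show "wp mem_bits (Seq (Put 43 (Const 0) (Const 0))
     (For 21 nE ?body)) ?s1
       (1 + loops * ((6 * loops + (1 + 1 + 1)) + 4)) (?J n)"
    proof (rule wp_SeqPut[where i = 0 and x = 0])
      show "wp mem_bits (For 21 nE ?body) ?s2
       (loops * ((6 * loops + (1 + 1 + 1)) + 4)) (?J n)"
      proof (rule wp_For_loops[where J = ?J and N = n])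
        show "n \<le> 2 ^ mem_bits" "n \<le> loops" by (fact counter_bounds loop_bounds)+
        show "?J 0 ?s2" using ag2 by (simp add: store_same)
        fix q s' z assume "?J q s'"
        then show "?J q (store 21 0 z s')" by (auto simp: store_other intro: agree_store)
      next
        fix q s' assume "?J q s'"
        then show "aval nE s' = n" using aval_nE_prepared prep by blast
      next
        fix k s' assume k: "k < n" and J: "?J k s'" and s21: "s' 21 0 = k"
        have ag': "agree ?A s s'" using J by blast
        have p': "prepared s'" by (rule prep[OF ag'])
        have v': "s' 16 = s 16" "s' 17 = s 17" using agreeD[OF ag'] by simp_all
        let ?F = "\<lambda>q. \<Sum>i<q. of_bool (i \<in> S \<and> s 17 i = k) * wt i"
        have Fn: "?F n = ?W k" unfolding sum_weights_eq Seq ..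
        show "wp mem_bits ?body s'
         (6 * loops + (1 + 1 + 1)) (\<lambda>s''. ?J (Suc k) s'' \<and> s'' 21 0 = k)"
        proof (rule wp_Seq)
          show "wp mem_bits ?fold s' (6 * loops)
           (\<lambda>s''. s'' 23 0 = ?F n \<and> agree {23, 20} s' s'')"
          proof (rule wp_Fold_loops[where F = ?F and N = n])
            show "n \<le> 2 ^ mem_bits" "n \<le> loops" by (fact counter_bounds loop_bounds)+
          next
            fix s'' assume "agree {23, 20} s' s''"
            then show "aval nE s'' = n" using aval_nE_prepared[OF prepared_agree[OF _ p']] by simp
          next
            fix i s'' assume i: "i < n" "agree {23, 20} s' s''" "s'' 20 0 = i" "s'' 23 0 = ?F i"
            have p: "prepared s''" by (rule prepared_agree[OF i(2) p']) simp
            have v: "s'' 16 = s 16" "s'' 17 = s 17" "s'' 21 0 = k" using agreeD[OF i(2)] v' s21 by simp_all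
            have "aval ?sel s'' =
              of_bool (i \<in> S \<and> s 17 i = k)"
              using v i S(2)[OF i(1)] by (intro aval_AND) simp_all
            moreover have "aval (Get 2 (Var 20)) s'' = wt i" using i p by (simp add: prepared_get)
            ultimately show "aval ?step s'' = ?F (Suc i)"
              unfolding aval.simps(3)[of "Var 23"] aval.simps(5)
              using i(4) by (simp only: aval.simps sum.lessThan_Suc)
          next
            fix i assume "i \<le> n" then show "?F i \<le> 2 ^ mem_bits" by (rule sum_weights_le)
          qed (simp_all add: max_esize_def)
        next
          fix s1 assume s1: "s1 23 0 = ?F n \<and> agree {23, 20} s' s1"
          then have ag: "agree {23, 20} s' s1" by blast
          have v: "s1 21 0 = k" "s1 42 0 = s' 42 0" "s1 43 0 = s' 43 0" "s1 23 0 = ?W k"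
            using agreeD[OF ag] s21 s1 Fn by simp_all
          have ag1: "agree ?A s s1" by (rule agree_trans[OF ag' ag]) auto
          have Wb: "?W k \<le> 2 ^ mem_bits" using sum_weights_le[of n "\<lambda>i. i \<in> S \<and> s 17 i = k"] Fn by simp
          show "wp mem_bits ?if s1
            (1 + 1 + 1) (\<lambda>s''. ?J (Suc k) s'' \<and> s'' 21 0 = k)"
          proof (rule wp_If)
            assume "aval (LT (Var 43) (Var 23)) s1 \<noteq> 0"
            then have lt: "s' 43 0 < ?W k" using v by simp
            show "wp mem_bits ?take s1 (1 + 1)
              (\<lambda>s''. ?J (Suc k) s'' \<and> s'' 21 0 = k)"
            proof (rule wp_SeqPut)
              show "aval (Const 0) s1 = 0" "aval (Var 21) s1 = k" using v by simp_all
              show "k \<le> 2 ^ mem_bits" using k counter_bounds(1) by linarith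
              show "wp mem_bits (Put 43 (Const 0) (Var 23)) (store 42 0 k s1) 1 (\<lambda>s''. ?J (Suc k) s'' \<and> s'' 21 0 = k)"
              proof (rule wp_PutI)
                show "aval (Const 0) (store 42 0 k s1) = 0" "aval (Var 23) (store 42 0 k s1) = ?W k"
                  using v by (simp_all add: store_other)
                show "?W k \<le> 2 ^ mem_bits" by (rule Wb)
                have "\<forall>k'<Suc k. ?W k' \<le> ?W k" using J lt by (auto simp: less_Suc_eq)
                moreover have "agree ?A s (store 43 0 (?W k) (store 42 0 k s1))"
                  by (intro agree_store ag1) auto
                ultimately show "?J (Suc k) (store 43 0 (?W k) (store 42 0 k s1)) \<and>
                  store 43 0 (?W k) (store 42 0 k s1) 21 0 = k"
                  using v(1) by (simp only: store_same store_other) (simp add: store_same store_other)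
              qed (simp_all add: max_esize_def)
            qed (simp_all add: max_esize_def)
          next
            assume "aval (LT (Var 43) (Var 23)) s1 = 0"
            then have "\<not> s' 43 0 < ?W k" using v by simp
            then have "?J (Suc k) s1" using J v ag1 by (auto simp: less_Suc_eq)
            then have "wp mem_bits Skip s1 1 (\<lambda>s''. ?J (Suc k) s'' \<and> s'' 21 0 = k)"
              using v by (intro wp_Skip) simp
            then show "wp mem_bits Skip s1 (1 + 1) (\<lambda>s''. ?J (Suc k) s'' \<and> s'' 21 0 = k)" by (rule wp_mono) auto
          qed (simp add: max_esize_def)
        qed
      qed (simp add: max_esize_def)
    qed (simp_all add: max_esize_def)
  qed (simp_all add: max_esize_def)
  then show ?thesis by (rule wp_mono) (use loop_bounds(8) in \<open>simp_all add: algebra_simps\<close>)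
qed

lemma wp_output_loop:
  assumes s: "prepared s" and sz: "esize e \<le> max_esize"
    and e: "\<And>i s'. i < n \<Longrightarrow> agree {7, 20} s s' \<Longrightarrow> s' 20 0 = i \<Longrightarrow> aval e s' = of_bool (i \<in> X)"
    and X: "X \<subseteq> {..<n}"
  shows "wp mem_bits (For 20 nE (Put 7 (Var 20) e)) s (loops * 5) (\<lambda>s'. output_set I s' = X)"
proof -
  let ?J = "\<lambda>k s'. (\<forall>i<k. s' 7 i = of_bool (i \<in> X)) \<and> agree {7, 20} s s'"
  have "wp mem_bits (For 20 nE (Put 7 (Var 20) e)) s (loops * (1 + 4)) (?J n)"
  proof (rule wp_For_loops[where J = ?J and N = n])
    show "n \<le> 2 ^ mem_bits" "n \<le> loops" by (fact counter_bounds loop_bounds)+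
    show "?J 0 s" by (simp add: agree_refl)
    fix q s' z assume "?J q s'"
    then show "?J q (store 20 0 z s')" by (auto simp: store_other intro: agree_store)
  next
    fix q s' assume "?J q s'"
    then have "agree {7, 20} s s'" by blast
    then have "s' 0 = s 0" by (simp add: agree_def)
    then show "aval nE s' = n" using aval_nE_prepared[OF s] by (simp add: nE_def)
  next
    fix k s' assume k: "k < n" and J: "?J k s'" and s20: "s' 20 0 = k"
    show "wp mem_bits (Put 7 (Var 20) e) s' 1 (\<lambda>s''. ?J (Suc k) s'' \<and> s'' 20 0 = k)"
    proof (rule wp_PutI)
      show "aval (Var 20) s' = k" using s20 by simp
      show "aval e s' = of_bool (k \<in> X)" using e[of k s'] k s20 J by blast
      show "?J (Suc k) (store 7 k (of_bool (k \<in> X)) s') \<and> store 7 k (of_bool (k \<in> X)) s' 20 0 = k"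
        using J s20 by (auto simp: store_same store_other agree_store less_Suc_eq)
    qed (use sz in \<open>simp_all add: max_esize_def\<close>)
  qed (simp add: max_esize_def)
  then show ?thesis
  proof (rule wp_mono)
    fix s' assume "?J n s'"
    then show "output_set I s' = X" using X by (auto simp: output_set_def)
  qed simp
qed

text \<open>The choice is made with the stored weight \<open>s 43 0\<close> instead of that of the
  layer itself; a lower bound on the output by this number is what the analysis uses.\<close>

lemma wp_output_prog:
  assumes s: "prepared s" and S: "S \<subseteq> {..<n}" "\<And>i. i < n \<Longrightarrow> s 16 i = of_bool (i \<in> S)"
    and acc: "\<And>i. i < n \<Longrightarrow> s 13 i \<le> 1"
  defines "A \<equiv> {i. i < n \<and> s 13 i \<noteq> 0}" and "L \<equiv> {i \<in> S. s 17 i = s 42 0}"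
  assumes best: "s 43 0 \<le> total_weight I L"
  shows "wp mem_bits output_prog s (loops * 12)
    (\<lambda>s'. (output_set I s' = A \<or> output_set I s' = L) \<and>
       total_weight I A \<le> total_weight I (output_set I s') \<and> s 43 0 \<le> total_weight I (output_set I s'))"
proof -
  let ?e = "AND (LT (Const 0) (Get 16 (Var 20))) (EQ (Get 17 (Var 20)) (Var 42))"
  let ?small = "For 20 nE (Put 7 (Var 20) (Get 13 (Var 20)))"
  let ?layer = "For 20 nE (Put 7 (Var 20) ?e)"
  let ?Q = "\<lambda>s'. (output_set I s' = A \<or> output_set I s' = L) \<and>
       total_weight I A \<le> total_weight I (output_set I s') \<and> s 43 0 \<le> total_weight I (output_set I s')"
  have acc01: "s 13 i = of_bool (s 13 i \<noteq> 0)" if "i < n" for i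
  proof -
    have "s 13 i = 0 \<or> s 13 i = 1" using acc[OF that] by linarith
    then show ?thesis by auto
  qed
  let ?F = "\<lambda>k. \<Sum>i<k. of_bool (s 13 i \<noteq> 0) * wt i"
  have Fn: "?F n = total_weight I A" unfolding sum_weights_eq A_def ..
  have "wp mem_bits output_prog s (6 * loops + (loops * 5 + 1)) ?Q"
    unfolding output_prog_def
  proof (rule wp_Seq)
    show "wp mem_bits (Fold 44 20 nE (Const 0) (Add (Var 44) (Mul (Get 13 (Var 20)) (Get 2 (Var 20))))) s (6 * loops)
      (\<lambda>s'. s' 44 0 = ?F n \<and> agree {44, 20} s s')"
    proof (rule wp_Fold_loops[where F = ?F and N = n])
      show "n \<le> 2 ^ mem_bits" "n \<le> loops" by (fact counter_bounds loop_bounds)+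
    next
      fix s' assume "agree {44, 20} s s'"
      then show "aval nE s' = n" using aval_nE_prepared[OF prepared_agree[OF _ s]] by simp
    next
      fix i s' assume i: "i < n" "agree {44, 20} s s'" "s' 20 0 = i" "s' 44 0 = ?F i"
      have p: "prepared s'" by (rule prepared_agree[OF i(2) s]) simp
      have "s' 13 = s 13" using agreeD[OF i(2)] by simp
      then have "aval (Get 13 (Var 20)) s' = of_bool (s 13 i \<noteq> 0)" using i(3) acc01[OF i(1)] by simp
      moreover have "aval (Get 2 (Var 20)) s' = wt i" using i p by (simp add: prepared_get)
      ultimately show "aval (Add (Var 44) (Mul (Get 13 (Var 20)) (Get 2 (Var 20)))) s' = ?F (Suc i)"
        unfolding aval.simps(3)[of "Var 44"] aval.simps(5)
        using i(4) by (simp only: aval.simps sum.lessThan_Suc)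
    next
      fix i assume "i \<le> n" then show "?F i \<le> 2 ^ mem_bits" by (rule sum_weights_le)
    qed (simp_all add: max_esize_def)
  next
    fix s1 assume s1: "s1 44 0 = ?F n \<and> agree {44, 20} s s1"
    then have ag: "agree {44, 20} s s1" by blast
    have v: "s1 13 = s 13" "s1 16 = s 16" "s1 17 = s 17" "s1 42 = s 42" "s1 43 = s 43" "s1 44 0 = total_weight I A"
      using agreeD[OF ag] s1 Fn by simp_all
    have p1: "prepared s1" by (rule prepared_agree[OF ag s]) simp
    show "wp mem_bits (If (LE (Var 43) (Var 44)) ?small
       ?layer) s1
       (loops * 5 + 1) ?Q"
    proof (rule wp_If)
      assume "aval (LE (Var 43) (Var 44)) s1 \<noteq> 0"
      then have le: "s 43 0 \<le> total_weight I A" using v by simp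
      have "wp mem_bits ?small s1 (loops * 5) (\<lambda>s'. output_set I s' = A)"
      proof (rule wp_output_loop[OF p1])
        fix i s' assume i: "i < n" "agree {7, 20} s1 s'" "s' 20 0 = i"
        have "s' 13 = s 13" using agreeD[OF i(2)] v by simp
        then show "aval (Get 13 (Var 20)) s' = of_bool (i \<in> A)" using i acc01[OF i(1)] by (simp add: A_def)
      qed (auto simp: max_esize_def A_def)
      then show "wp mem_bits ?small s1 (loops * 5) ?Q"
        by (rule wp_mono) (use le in auto)
    next
      assume "aval (LE (Var 43) (Var 44)) s1 = 0"
      then have lt: "total_weight I A < s 43 0" using v by simp
      have "wp mem_bits ?layer s1
        (loops * 5) (\<lambda>s'. output_set I s' = L)"
      proof (rule wp_output_loop[OF p1])
        fix i s' assume i: "i < n" "agree {7, 20} s1 s'" "s' 20 0 = i"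
        have "s' 16 = s 16" "s' 17 = s 17" "s' 42 = s 42" using agreeD[OF i(2)] v by simp_all
        then have "aval ?e s' =
          of_bool (i \<in> S \<and> s 17 i = s 42 0)"
          using i S(2)[OF i(1)] by (intro aval_AND) simp_all
        then show "aval ?e s' = of_bool (i \<in> L)"
          by (simp add: L_def)
      qed (use S(1) in \<open>auto simp: max_esize_def L_def\<close>)
      then show "wp mem_bits ?layer s1
        (loops * 5) ?Q"
        by (rule wp_mono) (use lt best in auto)
    qed (simp add: max_esize_def)
  qed
  then show ?thesis by (rule wp_mono) (use loop_bounds(8) in simp_all)
qed

end

section \<open>The algorithm\<close>

definition bagufp_prog :: com where
  "bagufp_prog = Seq bottleneck_prog (Seq log_prog (Seq residual_prog (Seq accept_prog (Seq mw_prog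
     (Seq round_prog (Seq survivors_prog (Seq layer_prog (Seq best_prog output_prog))))))))"

text \<open>5640 = 47 * 120. The quotient bounds the number of layers; the summand 2 inside the
  logarithm keeps the denominator positive for every \<open>n\<close>.\<close>

definition approx_factor :: "nat \<Rightarrow> real" where
  "approx_factor n = 36 + 5640 * ((4 * log 2 (real n) + 14) * ln 2 / ln (log 2 (real n) + 2))"

text \<open>For \<open>n = 0\<close> the convention \<open>ln 0 = 0\<close> yields the value
  0.\<close>

lemma log2_nonneg: "0 \<le> log 2 (real n)"
  by (cases "n = 0") (auto simp: log_def)

lemma approx_factor_ge: "36 \<le> approx_factor n"
  unfolding approx_factor_def using log2_nonneg[of n] by (auto intro!: divide_nonneg_nonneg mult_nonneg_nonneg)

context bagufp_instance
begin

lemma lg_bounds: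
  assumes "0 < n"
  shows "log 2 (real n) \<le> real lg" "real lg \<le> log 2 (real n) + 1"
proof -
  have "real n \<le> 2 ^ lg" using le_lg by (metis of_nat_le_iff of_nat_numeral of_nat_power)
  then show "log 2 (real n) \<le> real lg" using assms by (simp add: log_le_iff powr_realpow)
  show "real lg \<le> log 2 (real n) + 1"
  proof (cases lg)
    case 0
    then show ?thesis using log2_nonneg[of n] by simp
  next
    case (Suc l)
    then have "\<not> n \<le> 2 ^ l" using lg_least[of l] by auto
    then have "2 ^ l \<le> real n" by (metis less_imp_le not_le of_nat_le_iff of_nat_numeral of_nat_power)
    then have "real l \<le> log 2 (real n)" using assms by (simp add: le_log_iff powr_realpow)
    then show ?thesis using Suc by simp
  qed
qed

text \<open>Taking logarithms in \<open>base ^ K < threshold\<close> gives K * ln (lg + 2) \<le> (4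
  * lg + 10) * ln 2. Replacing \<open>lg\<close> by log n + 1 on the right accounts for the 14, and
  by log n on the left for the denominator.\<close>

lemma layers_le:
  assumes "0 < n" "base ^ K < threshold"
  shows "36 + 5640 * real K \<le> approx_factor n"
proof -
  let ?l = "log 2 (real n)"
  have l: "0 \<le> ?l" "?l \<le> real lg" "real lg \<le> ?l + 1" using log2_nonneg lg_bounds[OF assms(1)] by auto
  have "real base ^ K \<le> 2 ^ (4 * lg + 10)"
    using assms(2) unfolding threshold_eq
    by (metis less_imp_le of_nat_le_iff of_nat_numeral of_nat_power)
  then have "ln (real base ^ K) \<le> ln (2 ^ (4 * lg + 10) :: real)"
    by (subst ln_le_cancel_iff) (auto simp: base_def)
  then have "real K * ln (real lg + 2) \<le> real (4 * lg + 10) * ln 2"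
    by (simp add: ln_realpow base_def add.commute)
  also have "\<dots> \<le> (4 * ?l + 14) * ln 2" using l by (intro mult_right_mono) auto
  finally have *: "real K * ln (real lg + 2) \<le> (4 * ?l + 14) * ln 2" .
  have "real K * ln (?l + 2) \<le> real K * ln (real lg + 2)"
    using l by (intro mult_left_mono) auto
  then have "real K * ln (?l + 2) \<le> (4 * ?l + 14) * ln 2" using * by linarith
  then have "real K \<le> (4 * ?l + 14) * ln 2 / ln (?l + 2)" using l by (simp add: pos_le_divide_eq)
  then show ?thesis unfolding approx_factor_def by simp
qed

text \<open>The output \<open>W\<close> dominates both candidates: small tasks contribute at most
  \<open>36 * W\<close>, while a best packing weighs at most 120 times the survivors and these at
  most \<open>K * W\<close>, multiplied by 47 for the split of large tasks.\<close>

lemma approximation: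
  assumes r: "residual r" and acc: "accepted r acc"
    and x: "mw_invariant x" "volume x < 2 * limit" "(\<forall>i<n. \<not> large i) \<or> limit \<le> volume x"
    and P: "rounded_upto x n P"
    and col: "layering (survivors {i. i < n \<and> P i \<noteq> 0}) col"
    and best: "\<And>k. k < n \<Longrightarrow> total_weight I {i \<in> survivors {i. i < n \<and> P i \<noteq> 0}. col i = k} \<le> V"
    and out: "total_weight I {i. i < n \<and> acc i} \<le> W" "V \<le> W"
  shows "real (optimum I) \<le> approx_factor n * real W"
proof -
  let ?S = "{i. i < n \<and> P i \<noteq> 0}"
  have small: "total_weight I Z \<le> 36 * W" if "feasible I Z" "\<And>i. i \<in> Z \<Longrightarrow> small i" for Z
    using small_ratio[OF r acc that] out(1) by simp
  obtain Sm where Sm: "packed Sm" "\<And>S'. packed S' \<Longrightarrow> total_weight I S' \<le> total_weight I Sm"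
    using max_packed by blast
  show ?thesis
  proof (cases "total_weight I Sm = 0")
    case True
    then have "optimum I \<le> 36 * W + 47 * 0" using Sm(2) by (intro optimum_split[OF small]) simp_all
    then have "real (optimum I) \<le> 36 * real W" by simp
    also have "\<dots> \<le> approx_factor n * real W" by (intro mult_right_mono approx_factor_ge) simp
    finally show ?thesis .
  next
    case False
    \<comment> \<open>A packing of positive weight supplies a large task, which rules out that the
      weights phase was skipped.\<close>
    then have "Sm \<noteq> {}" by (auto simp: total_weight_def)
    then obtain i where i: "i < n" "large i" using Sm(1) by (auto simp: packed_def)
    then have vol: "limit \<le> volume x" using x(3) by blast
    have max: "wt j \<le> total_weight I Sm" if "j < n" "large j" for j
      using Sm(2)[OF packed_singleton[OF that]] by (simp add: total_weight_eq)
    have Pd: "\<And>i. i < n \<Longrightarrow> P i = 0 \<or> P i = denom" "\<And>i. i < n \<Longrightarrow> \<not> large i \<Longrightarrow> P i = 0"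
      "potential x \<le> potential P"
      using P unfolding rounded_upto_def by blast+
    have pot: "real denom ^ (n + 2) * real threshold * real (total_weight I Sm) / 120 \<le> potential P"
      using potential_start[OF x(1) vol x(2) Sm(1) max] Pd(3) by linarith
    have S_large: "?S \<subseteq> {i. i < n \<and> large i}"
    proof
      fix i assume "i \<in> ?S"
      then show "i \<in> {i. i < n \<and> large i}" using Pd(2)[of i] by auto
    qed
    have W1: "total_weight I Sm \<le> 120 * total_weight I (survivors ?S)"
      by (rule rounding_result(1)[OF _ _ pot]) (use Pd False in auto)
    have deep: "base ^ card {i \<in> ?S. incident i c} < threshold" if "c < num_constraints" for c
      by (rule rounding_result(2)[OF _ _ pot]) (use Pd False that in auto)
    obtain K where K: "base ^ K < threshold" "total_weight I (survivors ?S) \<le> K * V"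
      by (rule best_layer[OF S_large col deep best])
    have KW: "total_weight I Sm \<le> 120 * (K * W)"
    proof -
      have "K * V \<le> K * W" using out(2) by simp
      then show ?thesis using W1 K(2) by linarith
    qed
    have "optimum I \<le> 36 * W + 47 * (120 * (K * W))"
    proof (rule optimum_split[OF small])
      fix S' assume "packed S'"
      then show "total_weight I S' \<le> 120 * (K * W)" using Sm(2)[of S'] KW by linarith
    qed
    then have "real (optimum I) \<le> real (36 * W + 47 * (120 * (K * W)))" by (simp only: of_nat_le_iff)
    also have "\<dots> = (36 + 5640 * real K) * real W" by (simp add: algebra_simps)
    also have "\<dots> \<le> approx_factor n * real W"
      using i(1) K(1) by (intro mult_right_mono layers_le) auto
    finally show ?thesis .
  qed
qed

lemma array_of_le: "(\<And>x. x \<in> set xs \<Longrightarrow> x \<le> b) \<Longrightarrow> array_of xs i \<le> b"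
  by (simp add: array_of_def)

lemma inputs_input_memory: "inputs (input_memory I)"
  by (simp add: inputs_def input_memory_def array_of_def num_edges_def num_tasks_def cap_def task_defs)

lemma set_tasks: "t \<in> set (tasks I) \<Longrightarrow> \<exists>i<n. t = tasks I ! i"
  by (metis in_set_conv_nth num_tasks_def)

lemma bounded_input_memory: "bounded_memory mem_bits (input_memory I)"
proof -
  have nb: "num_bags I \<le> 2 ^ size"
    by (rule bits_le_size) (simp add: size_def input_size_def)
  have caps: "u \<le> 2 ^ size" if "u \<in> set (capacities I)" for u
    using that cap_le bits_le_size by (metis cap_def in_set_conv_nth num_edges_def)
  have "input_memory I a i \<le> 2 ^ size" for a i
    unfolding input_memory_def
    using n_m_le nb caps task_le by (auto intro!: array_of_le dest!: set_tasks simp: task_defs)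
  then show ?thesis using size_le_mem_bits by (simp add: bounded_memory_def)
qed

lemma wp_bagufp_prog:
  "wp mem_bits bagufp_prog (input_memory I) (232 * loops ^ 3) (\<lambda>s. feasible I (output_set I s) \<and>
     real (optimum I) \<le> approx_factor n * real (total_weight I (output_set I s)))"
proof -
  let ?T8 = "loops * (6 * loops + 9) + loops * 12"
  let ?T7 = "loops * (6 * loops + 7) + ?T8"
  let ?T6 = "loops * (6 * loops + 5) + ?T7"
  let ?T5 = "loops * (2 * (loops * (12 * loops + 20)) + 23) + ?T6"
  let ?T4 = "loops * (loops * (6 * loops + 17) + 14) + ?T5"
  let ?T3 = "loops * (12 * loops + 8) + ?T4"
  let ?T2 = "loops * (6 * loops + 7) + ?T3"
  let ?T1 = "loops * (8 * loops + 10) + ((3 * loops + 3) + ?T2)"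
  let ?c8 = "Seq best_prog output_prog"
  let ?c7 = "Seq layer_prog ?c8"
  let ?c6 = "Seq survivors_prog ?c7"
  let ?c5 = "Seq round_prog ?c6"
  let ?c4 = "Seq mw_prog ?c5"
  let ?c3 = "Seq accept_prog ?c4"
  let ?c2 = "Seq residual_prog ?c3"
  let ?Q = "\<lambda>s. feasible I (output_set I s) \<and>
     real (optimum I) \<le> approx_factor n * real (total_weight I (output_set I s))"
  let ?s0 = "input_memory I"
  have zero: "?s0 12 = (\<lambda>_. 0)" "?s0 13 = (\<lambda>_. 0)" "?s0 15 = (\<lambda>_. 0)" "?s0 17 = (\<lambda>_. 0)"
    by (simp_all add: input_memory_def)
  have "wp mem_bits bagufp_prog ?s0 ?T1 ?Q"
    unfolding bagufp_prog_def
  proof (rule wp_Seq[OF wp_bottleneck_prog[OF inputs_input_memory]], elim conjE,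
      rule wp_Seq[OF wp_log_prog[OF prepared_inputs]], assumption, elim conjE)
    fix s1 s2
    assume p1: "prepared s1" and ag1: "agree {10, 11, 20, 21, 23, 24} ?s0 s1"
      and l2: "s2 30 0 = 2 ^ lg" "s2 31 0 = lg" and ag2: "agree {30, 31} s1 s2"
    have p2: "prepared s2" by (rule prepared_agree[OF ag2 p1]) simp
    have z2: "s2 12 = (\<lambda>_. 0)" "s2 13 = (\<lambda>_. 0)" "s2 15 = (\<lambda>_. 0)" "s2 17 = (\<lambda>_. 0)"
      using agreeD[OF ag2] agreeD[OF ag1] zero by simp_all
    show "wp mem_bits ?c2 s2
       ?T2 ?Q"
    proof (rule wp_Seq[OF wp_residual_prog[OF p2 z2(1)]], elim conjE)
      fix s3 assume r3: "residual (s3 12)" and ag3: "agree {12, 20, 21, 22, 23} s2 s3"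
      have p3: "prepared s3" by (rule prepared_agree[OF ag3 p2]) simp
      have z3: "s3 13 = (\<lambda>_. 0)" "s3 15 = (\<lambda>_. 0)" "s3 17 = (\<lambda>_. 0)" "s3 30 = s2 30" "s3 31 = s2 31"
        using agreeD[OF ag3] z2 by simp_all
      show "wp mem_bits ?c3 s3
         ?T3 ?Q"
      proof (rule wp_Seq[OF wp_accept_prog[OF p3 z3(1)]], elim conjE)
        fix s4 assume a4: "accepted (s3 12) (\<lambda>i. s4 13 i \<noteq> 0)" "\<forall>i<n. s4 13 i \<le> 1"
          and ag4: "agree {13, 20, 21, 22, 23, 24, 25} s3 s4"
        have p4: "prepared s4" by (rule prepared_agree[OF ag4 p3]) simp
        have z4: "s4 15 = (\<lambda>_. 0)" "s4 17 = (\<lambda>_. 0)" "s4 30 0 = 2 ^ lg" "s4 31 0 = lg"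
          using agreeD[OF ag4] z3 l2 by simp_all
        show "wp mem_bits ?c4 s4
           ?T4 ?Q"
        proof (rule wp_Seq[OF wp_mw_prog[OF p4 z4(3,4,1)]], elim conjE)
          fix s5 assume x5: "mw_invariant (s5 15)" "volume (s5 15) < 2 * limit"
            "(\<forall>i<n. \<not> large i) \<or> limit \<le> volume (s5 15)"
            and ag5: "agree {14, 15, 20, 22, 23, 32, 33, 34, 35} s4 s5"
          have p5: "prepared s5" by (rule prepared_agree[OF ag5 p4]) simp
          have z5: "s5 17 = (\<lambda>_. 0)" "s5 30 0 = 2 ^ lg" "s5 31 0 = lg" "s5 13 = s4 13"
            using agreeD[OF ag5] z4 by simp_all
          have x0: "s5 15 i = 0" if "i < n" "\<not> large i" for i
            using x5(1) that by (simp add: mw_invariant_def)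
          have xd: "s5 15 i \<le> denom" if "i < n" for i
            using multiplicity_le[OF x5(2) that] x0[OF that] by (cases "large i") (auto simp: denom_def)
          show "wp mem_bits ?c5 s5
             ?T5 ?Q"
          proof (rule wp_Seq[OF wp_round_prog[OF p5 z5(2,3) xd x0]], assumption, assumption, assumption, elim conjE)
            fix s6 assume P6: "rounded_upto (s5 15) n (s6 15)"
              and ag6: "agree {15, 20, 21, 22, 23, 24, 36, 37, 38, 39, 40, 41} s5 s6"
            have p6: "prepared s6" by (rule prepared_agree[OF ag6 p5]) simp
            have z6: "s6 17 = (\<lambda>_. 0)" "s6 13 = s4 13" using agreeD[OF ag6] z5 by simp_all
            define S where "S = survivors {i. i < n \<and> s6 15 i \<noteq> 0}"
            have Sn: "S \<subseteq> {..<n}" by (auto simp: S_def survivors_def)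
            show "wp mem_bits ?c6 s6
               ?T6 ?Q"
            proof (rule wp_Seq[OF wp_survivors_prog[OF p6]], fold S_def, elim conjE)
              fix s7 assume S7: "\<forall>i<n. s7 16 i = of_bool (i \<in> S)" and ag7: "agree {16, 20, 21, 23} s6 s7"
              have p7: "prepared s7" by (rule prepared_agree[OF ag7 p6]) simp
              have z7: "s7 17 = (\<lambda>_. 0)" "s7 13 = s4 13" using agreeD[OF ag7] z6 by simp_all
              show "wp mem_bits ?c7 s7
                 ?T7 ?Q"
              proof (rule wp_Seq[OF wp_layer_prog[OF p7 z7(1) Sn]])
                show "\<And>i. i < n \<Longrightarrow> s7 16 i = of_bool (i \<in> S)" using S7 by blast
                fix s8 assume s8: "layering S (s8 17) \<and> agree {17, 20, 21, 22, 23} s7 s8"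
                then have L8: "layering S (s8 17)" and ag8: "agree {17, 20, 21, 22, 23} s7 s8" by blast+
                have p8: "prepared s8" by (rule prepared_agree[OF ag8 p7]) simp
                have z8: "s8 16 = s7 16" "s8 13 = s4 13" using agreeD[OF ag8] z7 by simp_all
                have S8: "\<And>i. i < n \<Longrightarrow> s8 16 i = of_bool (i \<in> S)" using S7 z8 by simp
                show "wp mem_bits ?c8 s8 ?T8 ?Q"
                proof (rule wp_Seq[OF wp_best_prog[OF p8 Sn S8]], assumption, elim conjE)
                  fix s9 assume b9: "\<forall>k<n. total_weight I {i \<in> S. s8 17 i = k} \<le> s9 43 0"
                    "s9 43 0 \<le> total_weight I {i \<in> S. s8 17 i = s9 42 0}"
                    and ag9: "agree {20, 21, 23, 42, 43} s8 s9"
                  have p9: "prepared s9" by (rule prepared_agree[OF ag9 p8]) simp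
                  have z9: "s9 16 = s8 16" "s9 13 = s4 13" "s9 17 = s8 17" using agreeD[OF ag9] z8 by simp_all
                  have S9: "\<And>i. i < n \<Longrightarrow> s9 16 i = of_bool (i \<in> S)" using S8 z9 by simp
                  have a9: "\<And>i. i < n \<Longrightarrow> s9 13 i \<le> 1" using a4(2) z9 by simp
                  have best9: "s9 43 0 \<le> total_weight I {i \<in> S. s9 17 i = s9 42 0}" using b9(2) z9 by simp
                  have "wp mem_bits output_prog s9 (loops * 12)
                    (\<lambda>s'. (output_set I s' = {i. i < n \<and> s9 13 i \<noteq> 0} \<or> output_set I s' = {i \<in> S. s9 17 i = s9 42 0}) \<and>
                      total_weight I {i. i < n \<and> s9 13 i \<noteq> 0} \<le> total_weight I (output_set I s') \<and>
                      s9 43 0 \<le> total_weight I (output_set I s'))"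
                    by (rule wp_output_prog[OF p9 Sn S9 a9 best9])
                  then show "wp mem_bits output_prog s9 (loops * 12) ?Q"
                  proof (rule wp_mono[OF _ order.refl])
                    fix s' assume s': "(output_set I s' = {i. i < n \<and> s9 13 i \<noteq> 0} \<or> output_set I s' = {i \<in> S. s9 17 i = s9 42 0}) \<and>
                      total_weight I {i. i < n \<and> s9 13 i \<noteq> 0} \<le> total_weight I (output_set I s') \<and>
                      s9 43 0 \<le> total_weight I (output_set I s')"
                    have Slarge: "{i. i < n \<and> s6 15 i \<noteq> 0} \<subseteq> {i. i < n \<and> large i}"
                    proof
                      fix i assume "i \<in> {i. i < n \<and> s6 15 i \<noteq> 0}"
                      then show "i \<in> {i. i < n \<and> large i}" using P6 unfolding rounded_upto_def by auto
                    qed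
                    have "packed {i \<in> S. s8 17 i = s9 42 0}"
                      unfolding S_def by (rule layer_packed[OF Slarge]) (use L8 S_def in simp)
                    then have f1: "feasible I {i \<in> S. s9 17 i = s9 42 0}" unfolding z9 by (rule packed_feasible)
                    have f2: "feasible I {i. i < n \<and> s9 13 i \<noteq> 0}"
                      unfolding z9 by (rule accepted_feasible[OF r3 a4(1)])
                    from conjunct1[OF s'] have "feasible I (output_set I s')"
                      by (rule disjE) (simp_all only: f1 f2)
                    moreover have "real (optimum I) \<le> approx_factor n * real (total_weight I (output_set I s'))"
                    proof (rule approximation[OF r3 a4(1) x5 P6])
                      show "layering (survivors {i. i < n \<and> s6 15 i \<noteq> 0}) (s8 17)" using L8 by (simp add: S_def)
                      show "\<And>k. k < n \<Longrightarrow> total_weight I {i \<in> survivors {i. i < n \<and> s6 15 i \<noteq> 0}. s8 17 i = k} \<le> s9 43 0"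
                        using b9(1) by (simp add: S_def)
                      show "total_weight I {i. i < n \<and> s4 13 i \<noteq> 0} \<le> total_weight I (output_set I s')"
                        using conjunct1[OF conjunct2[OF s']] unfolding z9 .
                      show "s9 43 0 \<le> total_weight I (output_set I s')" by (rule conjunct2[OF conjunct2[OF s']])
                    qed
                    ultimately show "?Q s'" by blast
                  qed
                qed
              qed
            qed
          qed
        qed
      qed
    qed
  qed
  then show ?thesis
  proof (rule wp_mono)
    \<comment> \<open>All lower powers are raised to the cube, and the coefficients add up to 30 +
      101 + 98 + 3 = 232.\<close>
    have "loops \<le> loops ^ 3" "loops ^ 2 \<le> loops ^ 3" "1 \<le> loops ^ 3"
      using power_increasing[of 1 3 loops] power_increasing[of 2 3 loops] loop_bounds(8) by auto
    moreover have "?T1 =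
      30 * loops ^ 3 + 101 * loops ^ 2 + 98 * loops + 3"
      by (simp add: algebra_simps power2_eq_square power3_eq_cube)
    ultimately show "?T1
      \<le> 232 * loops ^ 3" by linarith
  qed
qed

lemma exec_bagufp_prog:
  obtains s k where "exec bagufp_prog (input_memory I) (return_pmf (s, k))"
    "k \<le> 232 * loops ^ 3 * step_cost mem_bits" "feasible I (output_set I s)"
    "real (optimum I) \<le> approx_factor n * real (total_weight I (output_set I s))"
proof -
  have "1 \<le> mem_bits" using size_ge_3 by (simp add: mem_bits_def)
  then show ?thesis
    using wp_bagufp_prog bounded_input_memory that unfolding wp_def run_def by (elim impE exE conjE) simp_all
qed

end

definition time_bound :: "nat poly" where
  "time_bound = [:232:] * ([:16:] * [:1, 2:] ^ 4) ^ 3 *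
     ([:1:] + [:2:] * ([:max_esize:] * ([:0, 50, 10:] * [:max_esize:] + [:2:])))"

lemma poly_time_bound:
  "bagufp_instance I \<Longrightarrow> poly time_bound (input_size I) =
     232 * bagufp_instance.loops I ^ 3 * step_cost (bagufp_instance.mem_bits I)"
proof -
  assume I: "bagufp_instance I"
  have 1: "poly [:1, 2:] z = 2 * z + 1" for z :: nat by (simp add: mult_2)
  have 2: "poly [:0, 50, 10:] z = 10 * z ^ 2 + 50 * z" for z :: nat
    by (simp add: power2_eq_square algebra_simps)
  have 3: "poly [:c:] z = c" for c z :: nat by simp
  show ?thesis
    unfolding time_bound_def bagufp_instance.loops_def[OF I] bagufp_instance.mem_bits_def[OF I]
      bagufp_instance.size_def[OF I] step_cost_def poly_mult poly_power poly_add 1 2 3 ..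
qed

lemma approx_factor_bigo: "approx_factor \<in> O(\<lambda>n. ln (real n) / ln (ln (real n)))"
  unfolding approx_factor_def by real_asymp

lemma approx_factor_bigomega: "(\<lambda>n. 1 / approx_factor n) \<in> \<Omega>(\<lambda>n. ln (ln (real n)) / ln (real n))"
  unfolding approx_factor_def by real_asymp

text \<open>The witness tosses no coins, so its output distribution is a point mass and the expected
  weight is the weight of that single output. The reciprocal of \<open>approx_factor\<close> serves
  as the ratio; it is positive since the factor is at least 36.\<close>

theorem theorem6p12:
  shows "\<exists>alg :: com.
    poly_time_on_bagufp alg \<and>
    (\<forall>I. valid_bagufp I \<longrightarrow> (\<forall>S \<in> set_pmf (output_dist alg I). feasible I S)) \<and>
    (\<exists>\<rho> \<in> \<Omega>(\<lambda>n. ln (ln (real n)) / ln (real n)).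
       (\<forall>n. \<rho> n \<ge> 0) \<and>
       (\<forall>I. valid_bagufp I \<longrightarrow>
         expected_weight alg I \<ge> \<rho> (num_tasks I) * real (optimum I))) \<and>
    (\<exists>\<alpha> \<in> O(\<lambda>n. ln (real n) / ln (ln (real n))).
       \<forall>I. valid_bagufp I \<longrightarrow>
         real (optimum I) \<le> \<alpha> (num_tasks I) * expected_weight alg I)"
proof -
  have run: "\<exists>s k. exec bagufp_prog (input_memory I) (return_pmf (s, k)) \<and>
      k \<le> poly time_bound (input_size I) \<and> feasible I (output_set I s) \<and>
      output_dist bagufp_prog I = return_pmf (output_set I s) \<and>
      real (optimum I) \<le> approx_factor (num_tasks I) * expected_weight bagufp_prog I"
    if "valid_bagufp I" for I
  proof -
    interpret bagufp_instance I using that by unfold_locales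
    obtain s k where sk: "exec bagufp_prog (input_memory I) (return_pmf (s, k))"
      "k \<le> 232 * loops ^ 3 * step_cost mem_bits" "feasible I (output_set I s)"
      "real (optimum I) \<le> approx_factor n * real (total_weight I (output_set I s))"
      by (rule exec_bagufp_prog)
    have d: "output_dist bagufp_prog I = return_pmf (output_set I s)"
      using output_dist_eq[OF sk(1)] by simp
    then have "expected_weight bagufp_prog I = real (total_weight I (output_set I s))"
      by (simp add: expected_weight_def)
    then show ?thesis
      using sk d poly_time_bound[OF bagufp_instance_axioms] by auto
  qed
  have "poly_time_on_bagufp bagufp_prog"
    unfolding poly_time_on_bagufp_def
  proof (intro exI[of _ time_bound] allI impI)
    fix I assume "valid_bagufp I"
    from run[OF this] obtain s k where "exec bagufp_prog (input_memory I) (return_pmf (s, k))"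
      "k \<le> poly time_bound (input_size I)" by blast
    then show "\<exists>D. exec bagufp_prog (input_memory I) D \<and>
        (\<forall>(s, k)\<in>set_pmf D. k \<le> poly time_bound (input_size I))"
      by (intro exI[of _ "return_pmf (s, k)"]) auto
  qed
  moreover have "\<forall>I. valid_bagufp I \<longrightarrow> (\<forall>S \<in> set_pmf (output_dist bagufp_prog I). feasible I S)"
    using run by fastforce
  moreover have "\<exists>\<rho> \<in> \<Omega>(\<lambda>n. ln (ln (real n)) / ln (real n)). (\<forall>n. \<rho> n \<ge> 0) \<and>
       (\<forall>I. valid_bagufp I \<longrightarrow> expected_weight bagufp_prog I \<ge> \<rho> (num_tasks I) * real (optimum I))"
  proof (intro bexI[of _ "\<lambda>n. 1 / approx_factor n"] conjI allI impI approx_factor_bigomega)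
    fix n show "0 \<le> 1 / approx_factor n" using approx_factor_ge[of n] by simp
  next
    fix I assume "valid_bagufp I"
    then have "real (optimum I) \<le> approx_factor (num_tasks I) * expected_weight bagufp_prog I"
      using run by blast
    then show "1 / approx_factor (num_tasks I) * real (optimum I) \<le> expected_weight bagufp_prog I"
      using approx_factor_ge[of "num_tasks I"] by (simp add: divide_le_eq mult.commute)
  qed
  moreover have "\<exists>\<alpha> \<in> O(\<lambda>n. ln (real n) / ln (ln (real n))).
       \<forall>I. valid_bagufp I \<longrightarrow> real (optimum I) \<le> \<alpha> (num_tasks I) * expected_weight bagufp_prog I"
    using run by (intro bexI[of _ approx_factor] approx_factor_bigo) blast
  ultimately show ?thesis by blast
qed

end
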